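(* Let $k\ge 2$ be an integer. Assume: (1) $\inf_{t\in[0,1]}\psi(t)=\psi(1)=0$ and $\psi'(1)<0$, and $2k<\kappa<\infty$; (2) there exists $\delta_1>0$ such that $\psi(t)<\infty$ for all $t\in[1-\delta_1,\lceil\kappa+\delta_1\rceil]$ and, for all $1\le j\le\lceil\kappa+\delta_1\rceil$ and all $\beta=(\beta_1,\dots,\beta_j)\in(\mathbb N^* )^j$ with $\sum_{i=1}^j\beta_i\le\lceil\kappa+\delta_1\rceil$, $c_j(\beta):=\mathbf E\big[\sum_{\mathbf x\in\Delta^j_1}e^{-\sum_{i=1}^j\beta_iV(x^{(i)})}\big]<\infty$; (3) there exists $\mathfrak h>0$ such that $\mathbf P\big(\inf_{x\in\mathbb T,x\ne e}(V(x)-V(x^* ))\ge-\mathfrak h\big)=1$; (4) $(\ell_n)$ and $(\mathfrak L_n)$ are sequences of positive integers with $\delta_0^{-1}\log n\le\ell_n\le\mathfrak L_n$ and, for some $l_0\in\mathbb N$, $\lim_{n\to\infty}\frac{\mathfrak L_n}{n^{1/2}}\Lambda_{l_0}(\mathfrak L_n)=0$. Let $L_n:=\mathfrak L_n-\ell_n+1$, let $\lambda=(\lambda_2,\dots,\lambda_k)\in(\mathbb N^* )^{k-1}$ and, for $\mathbf x\in\Delta^k$, $f_\lambda(\mathbf x):=\prod_{i=2}^k\mathbf 1_{\{|x^{(i-1)}\wedge x^{(i)}|<\lambda_i\}}$. Then, in $\mathbb P^*$-probability, $$\frac1{(n^{1/2}L_n)^k}\mathcal A^k(\mathcal D_n,f_\lambda)\underset{n\to\infty}{\longrightarrow}(c_\infty)^k\mathcal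 A^k_\infty(f_\lambda),$$ where $\mathcal A^k_\infty(f_\lambda)=\lim_{l\to\infty}\sum_{\mathbf x\in\Delta^k_l}e^{-V(x^{(1)})}\prod_{i=2}^ke^{-V(x^{(i)})}\mathbf 1_{\{|x^{(i-1)}\wedge x^{(i)}|<\lambda_i\}}$, the limit holding in $L^2(\mathbf P^* )$.
   Context: $\mathbb N=\{0,1,\dots\}$, $\mathbb N^*=\{1,2,\dots\}$. Environment. Under a probability $\mathbf P$ (expectation $\mathbf E$), $\mathcal P$ is a random finite sequence of reals of length $N$, with $\mathbf E[N]>1$. $(\mathbb T,(A_x)_{x\in\mathbb T})$ is the marked Galton–Watson tree with root $e$, $A_e=0$, where each vertex, independently of the others in its generation, has $N$-many marked children whose marks are distributed as $\mathcal P$. $|x|$ is the generation of $x$, $x^*$ its parent; $x\le y$ means $x$ is an ancestor of $y$ or $x=y$; $x\wedge y$ is the most recent common ancestor; $\mathbb T_l=\{x:|x|=l\}$. $V(e)=0$, $V(x)=\sum_{e<z\le x}A_z$, $\mathcal E=(\mathbb T,(V(x))_{x\in\mathbb T})$. $\mathbf P^*=\mathbf P(\cdot\mid\text{non-extinction of }\mathbb T)$, with expectation $\mathbf E^*$. $\psi(t)=\log\mathbf E[\sum_{|x|=1}e^{-tV(x)}]$ and $\kappa=\inf\{t>1:\psi(t)=0\}$. Walk. Add a parent $e^*$ to $e$. Given $\mathcal E$, under $\mathbb P^{\mathcal E}$, $(X_j)_{j\ge0}$ is the Markov chain on $\mathbb T\cup\{e^*\}$ with $X_0=e$, which from $x\in\mathbb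 T$ with children $x^1,\dots,x^{N_x}$ jumps to $x^*$ with probability $e^{-V(x)}/(e^{-V(x)}+\sum_ie^{-V(x^i)})$ and to $x^j$ with probability $e^{-V(x^j)}/(e^{-V(x)}+\sum_ie^{-V(x^i)})$, and from $e^*$ jumps to $e$ with probability 1. $\mathbb P^*=\mathbf E^*[\mathbb P^{\mathcal E}(\cdot)]$. $T^0=0$, $T^j=\inf\{i>T^{j-1}:X_i=e^*\}$. $\mathcal R_T=\{u\in\mathbb T:\exists\,1\le j\le T,\ X_j=u\}$. When used as an index, $n^{1/2}$ means its integer part. $\delta_0>0$ is a constant fixed once and for all such that, for some $\rho_1>1/2$ and every positive integer $\zeta$, $\mathbf P(\min_{|z|=\lceil\delta_0^{-1}\zeta\rceil}V(z)\ge3\zeta)\ge1-e^{-\rho_1\zeta}$ (such a constant exists under (1)). $\Lambda_0(t)=t$ and $\Lambda_{i-1}(t)=e^{\Lambda_i(t)}$ for $i\ge1$ (iterated logarithms). Tuples. $\Delta^k$ is the set of $\mathbf x=(x^{(1)},\dots,x^{(k)})\in\mathbb T^k$ such that for all $i\ne j$ neither $x^{(i)}\le x^{(j)}$ nor $x^{(j)}\le x^{(i)}$. For $\mathfrak D\subset\mathbb T$, $\Delta^k(\mathfrak D)=\Delta^k\cap\mathfrak D^k$; $\Delta^k_l=\Delta^k(\mathbb T_l)$. $\mathcal A^k(\mathfrak D,f)=\sum_{\mathbf x\in\Delta^k(\mathfrak D)}f(\mathbf x)$ ($0$ if $\Delta^k(\mathfrak D)=\emptyset$). $\mathcal D_n=\{x\in\mathcal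 R_{T^{n^{1/2}}}:\ell_n\le|x|\le\mathfrak L_n\}$. $(S_j)_{j\ge0}$ is a random walk with i.i.d. increments, $S_0=0$, $\mathbf E[\mathfrak t(S_1)]=\mathbf E[\sum_{|x|=1}\mathfrak t(V(x))e^{-V(x)}]$ for bounded measurable $\mathfrak t$; $c_\infty=\mathbf E[(\sum_{j\ge0}e^{-S_j})^{-1}]$. *)

theory Defs
  imports "HOL-Probability.Probability" "HOL-Library.Sublist"
begin

(* Finite sequences of reals carry the sigma-algebra of the disjoint union of the spaces R^n. *)

definition seq_space :: "real list measure" where
  "seq_space = sigma UNIV
     {{s. length s = n \<and> (\<forall>i<n. s ! i \<in> B i)} | n B. \<forall>i. B i \<in> sets borel}"

(* Ulam-Harris coding.  An individual is a list of natural numbers, the root e is [], the children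
   of u are u @ [i] (i = 0, 1, ...), so the generation of u is length u, its parent is butlast u
   and ancestry is prefix.  An environment attaches to every label u the finite sequence of the
   marks of the children of u; the length of this sequence is the number of children N_u. *)

type_synonym env = "nat list \<Rightarrow> real list"

inductive_set tree :: "env \<Rightarrow> nat list set" for \<omega> :: env where
  root: "[] \<in> tree \<omega>"
| child: "u \<in> tree \<omega> \<Longrightarrow> i < length (\<omega> u) \<Longrightarrow> u @ [i] \<in> tree \<omega>"

definition generation :: "env \<Rightarrow> nat \<Rightarrow> nat list set" where
  "generation \<omega> l = {u \<in> tree \<omega>. length u = l}"

definition mark :: "env \<Rightarrow> nat list \<Rightarrow> real" where
  "mark \<omega> z = (if z = [] then 0 else \<omega> (butlast z) ! last z)"

definition V :: "env \<Rightarrow> nat list \<Rightarrow> real" where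
  "V \<omega> x = (\<Sum>z | strict_prefix [] z \<and> prefix z x. mark \<omega> z)"

(* In the following, \<nu> is the law of the random finite sequence of reals. *)

definition env_measure :: "real list measure \<Rightarrow> env measure" where
  "env_measure \<nu> = PiM UNIV (\<lambda>_. \<nu>)"

definition survival :: "env set" where
  "survival = {\<omega>. \<forall>l. generation \<omega> l \<noteq> {}}"

definition env_measure_star :: "real list measure \<Rightarrow> env measure" where
  "env_measure_star \<nu> = uniform_measure (env_measure \<nu>) survival"

definition log_ennreal :: "ennreal \<Rightarrow> ereal" where
  "log_ennreal a = (if a = 0 then - \<infinity> else if a = \<infinity> then \<infinity> else ereal (ln (enn2real a)))"

definition psi :: "real list measure \<Rightarrow> real \<Rightarrow> ereal" where
  "psi \<nu> t = log_ennreal (\<integral>\<^sup>+\<omega>. (\<Sum>x\<in>generation \<omega> 1. ennreal (exp (- t * V \<omega> x))) \<partial>env_measure \<nu>)"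

definition kappa :: "real list measure \<Rightarrow> ereal" where
  "kappa \<nu> = Inf {ereal t | t. 1 < t \<and> psi \<nu> t = 0}"

(* k-tuples (x 1, ..., x k) are extensional functions on {1..k}. *)

definition Delta :: "nat \<Rightarrow> nat list set \<Rightarrow> (nat \<Rightarrow> nat list) set" where
  "Delta k D = {x \<in> {1..k} \<rightarrow>\<^sub>E D. \<forall>i\<in>{1..k}. \<forall>j\<in>{1..k}. i \<noteq> j \<longrightarrow>
                  \<not> prefix (x i) (x j) \<and> \<not> prefix (x j) (x i)}"

definition tuple_sum :: "nat \<Rightarrow> nat list set \<Rightarrow> ((nat \<Rightarrow> nat list) \<Rightarrow> real) \<Rightarrow> real" where
  "tuple_sum k D f = (\<Sum>x\<in>Delta k D. f x)"

definition c_moment :: "real list measure \<Rightarrow> nat \<Rightarrow> (nat \<Rightarrow> nat) \<Rightarrow> ennreal" where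
  "c_moment \<nu> j \<beta> =
     (\<integral>\<^sup>+\<omega>. (\<Sum>x\<in>Delta j (generation \<omega> 1). ennreal (exp (- (\<Sum>i=1..j. real (\<beta> i) * V \<omega> (x i)))))
        \<partial>env_measure \<nu>)"

definition f_lambda :: "nat \<Rightarrow> (nat \<Rightarrow> nat) \<Rightarrow> (nat \<Rightarrow> nat list) \<Rightarrow> real" where
  "f_lambda k lam x = (\<Prod>i=2..k. of_bool (length (longest_common_prefix (x (i - 1)) (x i)) < lam i))"

definition level_sum :: "nat \<Rightarrow> (nat \<Rightarrow> nat) \<Rightarrow> nat \<Rightarrow> env \<Rightarrow> real" where
  "level_sum k lam l \<omega> =
     tuple_sum k (generation \<omega> l)
       (\<lambda>x. exp (- V \<omega> (x 1)) *
            (\<Prod>i=2..k. exp (- V \<omega> (x i)) *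
               of_bool (length (longest_common_prefix (x (i - 1)) (x i)) < lam i)))"

(* The walk lives on the vertices together with the artificial parent of the root, which is None. *)

type_synonym vertex = "nat list option"

definition parent :: "nat list \<Rightarrow> vertex" where
  "parent u = (if u = [] then None else Some (butlast u))"

fun trans_prob :: "env \<Rightarrow> vertex \<Rightarrow> vertex \<Rightarrow> real" where
  "trans_prob \<omega> None y = (if y = Some [] then 1 else 0)"
| "trans_prob \<omega> (Some u) y =
     (if y = parent u then exp (- V \<omega> u)
      else if \<exists>i<length (\<omega> u). y = Some (u @ [i]) then exp (- V \<omega> (the y))
      else 0) / (exp (- V \<omega> u) + (\<Sum>i<length (\<omega> u). exp (- V \<omega> (u @ [i]))))"

(* Q is the law, on the path space, of the Markov chain with transition probabilities
   trans_prob \<omega> started at the root; it is determined by its finite-dimensional distributions. *)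

definition quenched_law :: "env \<Rightarrow> (nat \<Rightarrow> vertex) measure \<Rightarrow> bool" where
  "quenched_law \<omega> Q \<longleftrightarrow>
     prob_space Q \<and> sets Q = sets (PiM UNIV (\<lambda>_. count_space UNIV)) \<and>
     (\<forall>n x. measure Q {X. \<forall>i\<le>n. X i = x i} =
              of_bool (x 0 = Some []) * (\<Prod>i<n. trans_prob \<omega> (x i) (x (Suc i))))"

(* Times are extended naturals: the infimum of the empty set is infinity. *)

primrec T_ret :: "nat \<Rightarrow> (nat \<Rightarrow> vertex) \<Rightarrow> enat" where
  "T_ret 0 X = 0"
| "T_ret (Suc j) X = Inf {enat i | i. T_ret j X < enat i \<and> X i = None}"

definition range_walk :: "env \<Rightarrow> enat \<Rightarrow> (nat \<Rightarrow> vertex) \<Rightarrow> nat list set" where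
  "range_walk \<omega> T X = {u \<in> tree \<omega>. \<exists>j\<ge>1. enat j \<le> T \<and> X j = Some u}"

definition D_set ::
  "(nat \<Rightarrow> nat) \<Rightarrow> (nat \<Rightarrow> nat) \<Rightarrow> nat \<Rightarrow> env \<Rightarrow> (nat \<Rightarrow> vertex) \<Rightarrow> nat list set" where
  "D_set low high n \<omega> X =
     {x \<in> range_walk \<omega> (T_ret (nat \<lfloor>sqrt (real n)\<rfloor>) X) X. low n \<le> length x \<and> length x \<le> high n}"

(* The annealed probability of an event: quenched probability averaged over surviving trees. *)

definition annealed_star ::
  "real list measure \<Rightarrow> (env \<Rightarrow> (nat \<Rightarrow> vertex) measure) \<Rightarrow>
   (env \<Rightarrow> (nat \<Rightarrow> vertex) \<Rightarrow> bool) \<Rightarrow> ennreal" where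
  "annealed_star \<nu> Q E = (\<integral>\<^sup>+\<omega>. emeasure (Q \<omega>) {X. E \<omega> X} \<partial>env_measure_star \<nu>)"

definition tendsto_in_annealed_prob ::
  "real list measure \<Rightarrow> (env \<Rightarrow> (nat \<Rightarrow> vertex) measure) \<Rightarrow>
   (nat \<Rightarrow> env \<Rightarrow> (nat \<Rightarrow> vertex) \<Rightarrow> real) \<Rightarrow> (env \<Rightarrow> real) \<Rightarrow> bool" where
  "tendsto_in_annealed_prob \<nu> Q Y Z \<longleftrightarrow>
     (\<forall>\<epsilon>>0. (\<lambda>n. annealed_star \<nu> Q (\<lambda>\<omega> X. \<bar>Y n \<omega> X - Z \<omega>\<bar> > \<epsilon>)) \<longlonglongrightarrow> 0)"

definition in_L2 :: "'a measure \<Rightarrow> ('a \<Rightarrow> real) \<Rightarrow> bool" where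
  "in_L2 M f \<longleftrightarrow> f \<in> borel_measurable M \<and> integrable M (\<lambda>x. (f x)\<^sup>2)"

definition tendsto_in_L2 :: "'a measure \<Rightarrow> (nat \<Rightarrow> 'a \<Rightarrow> real) \<Rightarrow> ('a \<Rightarrow> real) \<Rightarrow> bool" where
  "tendsto_in_L2 M Y Z \<longleftrightarrow>
     (\<forall>n. in_L2 M (Y n)) \<and> in_L2 M Z \<and> (\<lambda>n. \<integral>x. (Y n x - Z x)\<^sup>2 \<partial>M) \<longlonglongrightarrow> 0"

definition many_to_one_walk :: "real list measure \<Rightarrow> 's measure \<Rightarrow> (nat \<Rightarrow> 's \<Rightarrow> real) \<Rightarrow> bool" where
  "many_to_one_walk \<nu> M S \<longleftrightarrow>
     prob_space M \<and> (\<forall>j. S j \<in> borel_measurable M) \<and> (\<forall>s\<in>space M. S 0 s = 0) \<and>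
     prob_space.indep_vars M (\<lambda>_. borel) (\<lambda>j s. S (Suc j) s - S j s) UNIV \<and>
     (\<forall>j. distr M borel (\<lambda>s. S (Suc j) s - S j s) = distr M borel (S 1)) \<and>
     (\<forall>t::real \<Rightarrow> real. t \<in> borel_measurable borel \<longrightarrow> bounded (range t) \<longrightarrow>
        (\<integral>s. t (S 1 s) \<partial>M) =
        (\<integral>\<omega>. (\<Sum>x\<in>generation \<omega> 1. t (V \<omega> x) * exp (- V \<omega> x)) \<partial>env_measure \<nu>))"

(* The series and its inverse are taken in [0, infinity], with inverse infinity = 0. *)

definition c_infty :: "'s measure \<Rightarrow> (nat \<Rightarrow> 's \<Rightarrow> real) \<Rightarrow> real" where
  "c_infty M S = enn2real (\<integral>\<^sup>+s. inverse (\<Sum>j. ennreal (exp (- S j s))) \<partial>M)"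

(* Lambda_i is the i-fold iterated logarithm; as ln is total this is the intended function only
   at arguments large enough, and it is only used in a limit at infinity. *)

definition iter_log :: "nat \<Rightarrow> real \<Rightarrow> real" where
  "iter_log i t = (ln ^^ i) t"

definition delta0_condition :: "real list measure \<Rightarrow> real \<Rightarrow> bool" where
  "delta0_condition \<nu> \<delta>0 \<longleftrightarrow> \<delta>0 > 0 \<and>
     (\<exists>\<rho>>1/2. \<forall>\<zeta>::nat. \<zeta> \<ge> 1 \<longrightarrow>
        measure (env_measure \<nu>)
          {\<omega> \<in> space (env_measure \<nu>).
             (INF z\<in>generation \<omega> (nat \<lceil>real \<zeta> / \<delta>0\<rceil>). ereal (V \<omega> z)) \<ge> ereal (3 * real \<zeta>)}
        \<ge> 1 - exp (- \<rho> * real \<zeta>))"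

end

theory Submission
  imports Defs
begin

text \<open>
The proof is a second moment computation for the walk in a fixed environment; the environment itself
is only controlled through first and second moments. Write \<open>weight x\<close> for \<open>exp (- V x)\<close> on the tree,
\<open>mass m\<close> for the sum of the weights of generation \<open>m\<close> (the additive martingale), and cut the tree
at a generation \<open>m\<close> that is not less than any \<open>lam i\<close>.

Two remarks on tuples carry the combinatorics. Whether a tuple of vertices beyond generation \<open>m\<close>
is counted by \<open>f_lambda\<close> depends only on the ancestors of its entries in generation \<open>m\<close>, and
vertices with different such ancestors are incomparable. Hence a \<open>k\<close>-fold sum of products of weights
is the same sum over tuples of distinct vertices \<open>u\<close> of generation \<open>m\<close>, where \<open>u\<close> carries the total
weight \<open>G u\<close> of its descendants, up to the tuples with two entries above the same \<open>u\<close>; those cost at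
most \<open>k\<^sup>2 (\<Sum>u. (G u)\<^sup>2) (\<Sum>u. G u) ^ (k - 2)\<close> (\<open>tuple_sum_block_approximation\<close>).

For the weights \<open>exp (- V x)\<close> on a late generation, \<open>G u\<close> converges to the limit measure
\<open>limit_measure u\<close>, the weight of \<open>u\<close> times the limit of the additive martingale of the subtree of
\<open>u\<close>. As \<open>\<psi>\<close> is negative between \<open>1\<close> and \<open>\<kappa>\<close>, \<open>\<Sum>u. (limit_measure u)\<^sup>2\<close> tends to \<open>0\<close> with
\<open>m \<rightarrow> \<infinity>\<close>, so the level sums converge almost surely (\<open>tuple_limit_regular\<close>). They are at most
\<open>mass l ^ k\<close>, and \<open>mass l ^ (2 * k)\<close> converges in \<open>L\<^sup>1\<close> because \<open>2 * k < \<kappa>\<close>; this gives convergence in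
\<open>L\<^sup>2\<close> (\<open>level_sum_tendsto_in_L2\<close>).

For the visited vertices, with weight \<open>1 / (sqrt n * L)\<close> each, it remains to compare the number of
visited vertices above \<open>u\<close> with \<open>sqrt n * L * c_infty * limit_measure u\<close>. One excursion from the
parent of the root hits \<open>x\<close> with probability \<open>hit x = 1 / (\<Sum>y\<le>x. exp (V y))\<close>.

\<^item> The sum of \<open>hit\<close> over the vertices of one generation above \<open>u\<close> is close to
  \<open>c_infty * limit_measure u\<close> in mean (\<open>block_error_bound\<close>): \<open>hit x\<close> is \<open>weight x\<close> divided by a sum
  along the ancestral line that mostly depends on the last few steps before \<open>x\<close>. Keeping only \<open>b\<close> of them
  gives a sum over independent subtrees, which averages out to \<open>hit_mean b\<close>, and by the many-to-one
  formula \<open>hit_mean b\<close> is the mean of \<open>1 / (\<Sum>j\<le>b. exp (- S j))\<close>, which tends to \<open>c_infty\<close>.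

\<^item> The walk is recurrent (\<open>AE_escape_tendsto_0\<close>), and over \<open>t\<close> excursions the number of visited
  vertices concentrates (\<open>second_moment\<close>). Explicit supermartingales bound the probability that \<open>x\<close>
  and \<open>y\<close> are both visited by \<open>2 * t * hit x * hit y / hit z + t\<^sup>2 * hit x * hit y\<close> with \<open>z\<close> the last
  common ancestor, and the probability of missing \<open>x\<close> by \<open>(1 - hit x) ^ t\<close>. On average over the
  environment the first term sums to at most a constant times \<open>t * high * L\<^sup>2\<close>, which is small against
  \<open>(t * L)\<^sup>2\<close> exactly because \<open>high / sqrt n \<rightarrow> 0\<close>. The error terms from vertices visited in several
  excursions are negligible as \<open>hit x\<close> is at most of order \<open>n ^ -3\<close> on the generations in question
  (\<open>hits_small_of_delta0\<close>).
\<close>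

section \<open>Weights on the tree\<close>

definition subtree :: "nat list \<Rightarrow> env \<Rightarrow> env" where
  "subtree v \<xi> = (\<lambda>u. \<xi> (v @ u))"

definition edge_weight :: "real list \<Rightarrow> nat \<Rightarrow> real" where
  "edge_weight s i = (if i < length s then exp (- (s ! i)) else 0)"

text \<open>The product form makes the weight vanish off the tree, so sums over a random generation become
  sums over all labels of a given length.\<close>

definition weight :: "env \<Rightarrow> nat list \<Rightarrow> real" where
  "weight \<xi> v = (\<Prod>j<length v. edge_weight (\<xi> (take j v)) (v ! j))"

lemma edge_weight_nonneg [simp]: "0 \<le> edge_weight s i"
  by (simp add: edge_weight_def)

lemma weight_nonneg [simp]: "0 \<le> weight \<xi> v"
  by (simp add: weight_def prod_nonneg)

lemma weight_Nil [simp]: "weight \<xi> [] = 1"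
  by (simp add: weight_def)

lemma weight_snoc: "weight \<xi> (v @ [i]) = weight \<xi> v * edge_weight (\<xi> v) i"
  by (simp add: weight_def nth_append)

lemma subtree_Nil [simp]: "subtree [] \<xi> = \<xi>"
  by (simp add: subtree_def)

lemma subtree_subtree: "subtree v (subtree u \<xi>) = subtree (u @ v) \<xi>"
  by (simp add: subtree_def)

lemma subtree_apply: "subtree v \<xi> u = \<xi> (v @ u)"
  by (simp add: subtree_def)

lemma weight_append: "weight \<xi> (v @ w) = weight \<xi> v * weight (subtree v \<xi>) w"
proof (induction w rule: rev_induct)
  case (snoc i w)
  have "weight \<xi> (v @ w @ [i]) = weight \<xi> (v @ w) * edge_weight (\<xi> (v @ w)) i"
    using weight_snoc[of \<xi> "v @ w" i] by simp
  then show ?case using snoc by (simp add: weight_snoc subtree_apply)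
qed simp

lemma weight_take_pos: "weight \<xi> v > 0 \<Longrightarrow> weight \<xi> (take j v) > 0"
  using weight_append[of \<xi> "take j v" "drop j v"] weight_nonneg[of \<xi> "take j v"]
  by (metis append_take_drop_id less_eq_real_def mult_zero_left)

lemma tree_snoc: "u @ [i] \<in> tree \<xi> \<longleftrightarrow> u \<in> tree \<xi> \<and> i < length (\<xi> u)"
  by (subst tree.simps) auto

lemma tree_iff_weight: "u \<in> tree \<xi> \<longleftrightarrow> weight \<xi> u > 0"
proof (induction u rule: rev_induct)
  case Nil then show ?case by (simp add: tree.root)
next
  case (snoc i u)
  then show ?case
    by (simp add: tree_snoc weight_snoc edge_weight_def zero_less_mult_iff less_eq_real_def)
qed

lemma V_Nil [simp]: "V \<xi> [] = 0"
proof -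
  have "{z::nat list. strict_prefix [] z \<and> prefix z []} = {}" by (auto simp: strict_prefix_def)
  then show ?thesis unfolding V_def by (simp only: sum.empty)
qed

lemma V_snoc: "V \<xi> (u @ [i]) = V \<xi> u + \<xi> u ! i"
proof -
  have "{z. strict_prefix [] z \<and> prefix z (u @ [i])}
      = insert (u @ [i]) {z. strict_prefix [] z \<and> prefix z u}"
    by (auto simp: prefix_snoc strict_prefix_def)
  moreover have "finite {z. strict_prefix [] z \<and> prefix z u}"
    by (rule finite_subset[of _ "set (prefixes u)"]) auto
  moreover have "u @ [i] \<notin> {z. strict_prefix [] z \<and> prefix z u}"
    by (auto dest: prefix_length_le)
  ultimately show ?thesis
    unfolding V_def by (simp add: mark_def)
qed

lemma weight_eq_exp_V: "u \<in> tree \<xi> \<Longrightarrow> weight \<xi> u = exp (- V \<xi> u)"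
proof (induction u rule: rev_induct)
  case (snoc i u)
  then show ?case by (simp add: tree_snoc weight_snoc edge_weight_def V_snoc exp_diff exp_minus field_simps)
qed simp

lemma weight_eq_0: "u \<notin> tree \<xi> \<Longrightarrow> weight \<xi> u = 0"
  using tree_iff_weight[of u \<xi>] weight_nonneg[of \<xi> u] by linarith

lemma generation_0: "generation \<xi> 0 = {[]}"
  by (auto simp: generation_def tree.root)

lemma generation_Suc:
  "generation \<xi> (Suc m) = (\<Union>u\<in>generation \<xi> m. (\<lambda>i. u @ [i]) ` {..<length (\<xi> u)})"
proof -
  have "x \<in> (\<Union>u\<in>generation \<xi> m. (\<lambda>i. u @ [i]) ` {..<length (\<xi> u)})"
    if "x \<in> tree \<xi>" "length x = Suc m" for x
    using that by (cases x rule: rev_cases) (auto simp: generation_def tree_snoc)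
  then show ?thesis by (auto simp: generation_def tree_snoc)
qed

lemma finite_generation [simp]: "finite (generation \<xi> m)"
  by (induction m) (auto simp: generation_0 generation_Suc)

section \<open>Sums over the labels of a generation\<close>

text \<open>Sums over all labels, not only over the tree: the index set is deterministic, which makes
  measurability and exchanges with integrals immediate.\<close>

definition level_sum_nn :: "nat \<Rightarrow> (nat list \<Rightarrow> ennreal) \<Rightarrow> ennreal" where
  "level_sum_nn m f = (\<integral>\<^sup>+v. f v \<partial>count_space {v. length v = m})"

lemma level_sum_nn_0 [simp]: "level_sum_nn 0 f = f []"
  by (simp add: level_sum_nn_def nn_integral_count_space_finite)

lemma level_sum_nn_cong: "(\<And>v. length v = m \<Longrightarrow> f v = g v) \<Longrightarrow> level_sum_nn m f = level_sum_nn m g"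
  unfolding level_sum_nn_def by (auto intro!: nn_integral_cong)

lemma level_sum_nn_mono: "(\<And>v. length v = m \<Longrightarrow> f v \<le> g v) \<Longrightarrow> level_sum_nn m f \<le> level_sum_nn m g"
  unfolding level_sum_nn_def by (auto intro!: nn_integral_mono)

lemma level_sum_nn_zero [simp]: "level_sum_nn m (\<lambda>_. 0) = 0"
  by (simp add: level_sum_nn_def)

lemma level_sum_nn_cmult: "level_sum_nn m (\<lambda>v. c * f v) = c * level_sum_nn m f"
  unfolding level_sum_nn_def by (simp add: nn_integral_cmult)

lemma level_sum_nn_multc: "level_sum_nn m (\<lambda>v. f v * c) = level_sum_nn m f * c"
  unfolding level_sum_nn_def by (simp add: nn_integral_multc)

lemma level_sum_nn_add: "level_sum_nn m (\<lambda>v. f v + g v) = level_sum_nn m f + level_sum_nn m g"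
  unfolding level_sum_nn_def by (simp add: nn_integral_add)

lemma level_sum_nn_append:
  "level_sum_nn (m + j) f = level_sum_nn m (\<lambda>v. level_sum_nn j (\<lambda>w. f (v @ w)))"
proof -
  let ?A = "{v::nat list. length v = m}" and ?B = "{v::nat list. length v = j}"
  have bij: "bij_betw (\<lambda>(v, w). v @ w) (?A \<times> ?B) {v. length v = m + j}"
    by (rule bij_betwI[where g="\<lambda>v. (take m v, drop m v)"]) auto
  have "level_sum_nn (m + j) f = (\<integral>\<^sup>+p. f (case p of (v, w) \<Rightarrow> v @ w) \<partial>count_space (?A \<times> ?B))"
    unfolding level_sum_nn_def by (rule nn_integral_bij_count_space[OF bij, symmetric])
  also have "\<dots> = (\<integral>\<^sup>+p. f (fst p @ snd p) \<partial>(count_space ?A \<Otimes>\<^sub>M count_space ?B))"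
    by (simp add: pair_measure_countable case_prod_beta)
  also have "\<dots> = level_sum_nn m (\<lambda>v. level_sum_nn j (\<lambda>w. f (v @ w)))"
  proof -
    interpret B: sigma_finite_measure "count_space ?B"
      by (rule sigma_finite_measure_count_space_countable) simp
    show ?thesis unfolding level_sum_nn_def
      by (subst B.nn_integral_fst[symmetric]) (auto simp: pair_measure_countable)
  qed
  finally show ?thesis .
qed

lemma nn_integral_level_sum_nn:
  assumes [measurable]: "\<And>v. f v \<in> borel_measurable M"
  shows "(\<integral>\<^sup>+x. level_sum_nn m (\<lambda>v. f v x) \<partial>M) = level_sum_nn m (\<lambda>v. \<integral>\<^sup>+x. f v x \<partial>M)"
  unfolding level_sum_nn_def by (rule nn_integral_count_space_nn_integral) auto

lemma borel_measurable_level_sum_nn [measurable]: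
  assumes "\<And>v. f v \<in> borel_measurable M"
  shows "(\<lambda>x. level_sum_nn m (\<lambda>v. f v x)) \<in> borel_measurable M"
proof -
  interpret sigma_finite_measure "count_space {v::nat list. length v = m}"
    by (rule sigma_finite_measure_count_space_countable) simp
  have "(\<lambda>(v, x). f v x) \<in> borel_measurable (count_space {v. length v = m} \<Otimes>\<^sub>M M)"
    using assms by (intro measurable_pair_measure_countable1) auto
  then have "(\<lambda>(x, v). f v x) \<in> borel_measurable (M \<Otimes>\<^sub>M count_space {v. length v = m})"
    by (subst measurable_pair_swap_iff) (simp add: case_prod_beta)
  from borel_measurable_nn_integral[OF this] show ?thesis
    unfolding level_sum_nn_def by simp
qed

lemma level_sum_nn_generation:
  assumes "\<And>v. length v = m \<Longrightarrow> v \<notin> tree \<xi> \<Longrightarrow> f v = 0"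
  shows "level_sum_nn m f = (\<Sum>v\<in>generation \<xi> m. f v)"
  unfolding level_sum_nn_def
proof (rule nn_integral_count_space')
  show "f v = 0" if "v \<in> {v. length v = m}" "v \<notin> generation \<xi> m" for v
    using that assms by (auto simp: generation_def)
  show "generation \<xi> m \<subseteq> {v. length v = m}"
    by (auto simp: generation_def)
qed (rule finite_generation)

lemma level_sum_nn_weight:
  assumes "\<And>v. 0 \<le> g v" "a \<ge> 1"
  shows "level_sum_nn m (\<lambda>v. ennreal (weight \<xi> v ^ a * g v))
       = ennreal (\<Sum>v\<in>generation \<xi> m. weight \<xi> v ^ a * g v)"
  using assms
  by (subst level_sum_nn_generation[where \<xi>=\<xi>]) (auto simp: weight_eq_0 sum_ennreal power_0_left)

section \<open>The branching property\<close>

text \<open>Replaces the subtree at \<open>v\<close> by an independent environment; the branching property is the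
  invariance of the law under this operation.\<close>

definition graft :: "nat list \<Rightarrow> env \<Rightarrow> env \<Rightarrow> env" where
  "graft v \<xi>' \<xi> = (\<lambda>u. if prefix v u then \<xi>' (drop (length v) u) else \<xi> u)"

lemma subtree_graft [simp]: "subtree v (graft v \<xi>' \<xi>) = \<xi>'"
  by (simp add: graft_def subtree_def)

lemma subtree_graft_incomparable:
  assumes "\<not> prefix v w" "\<not> prefix w v"
  shows "subtree w (graft v \<xi>' \<xi>) = subtree w \<xi>"
  using assms prefix_same_cases[of v _ w] by (fastforce simp: graft_def subtree_def prefix_append)

lemma weight_cong:
  assumes "\<And>j. j < length w \<Longrightarrow> \<xi> (take j w) = \<xi>' (take j w)"
  shows "weight \<xi> w = weight \<xi>' w"
  using assms by (simp add: weight_def)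

lemma weight_graft: "length w \<le> length v \<Longrightarrow> weight (graft v \<xi>' \<xi>) w = weight \<xi> w"
  by (rule weight_cong) (auto simp: graft_def dest: prefix_length_le)

lemma space_seq_space: "space seq_space = UNIV"
  by (simp add: seq_space_def)

lemma seq_space_box:
  assumes "\<And>i. B i \<in> sets borel"
  shows "{s. length s = n \<and> (\<forall>i<n. s ! i \<in> B i)} \<in> sets seq_space"
  unfolding seq_space_def using assms
  by (subst sets_measure_of) (auto intro!: sigma_sets.Basic)

lemma seq_space_length: "{s. length s = n} \<in> sets seq_space"
  using seq_space_box[of "\<lambda>_. UNIV" n] by simp

text \<open>The generating sets fix the length of the sequence; a condition on one coordinate is a
  countable union of such sets.\<close>

lemma seq_space_nth:
  assumes "B \<in> sets borel"
  shows "{s. i < length s \<and> s ! i \<in> B} \<in> sets seq_space"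
proof -
  have "{s. i < length s \<and> s ! i \<in> B}
      = (\<Union>n\<in>{i<..}. {s. length s = n \<and> (\<forall>j<n. s ! j \<in> (if j = i then B else UNIV))})"
    by auto
  also have "\<dots> \<in> sets seq_space"
  proof (intro sets.countable_UN' subsetI)
    fix X assume "X \<in> (\<lambda>n. {s. length s = n \<and> (\<forall>j<n. s ! j \<in> (if j = i then B else UNIV))}) ` {i<..}"
    then obtain n where "X = {s. length s = n \<and> (\<forall>j<n. s ! j \<in> (if j = i then B else UNIV))}"
      by blast
    then show "X \<in> sets seq_space"
      using seq_space_box[of "\<lambda>j. if j = i then B else UNIV" n] assms by simp
  qed simp
  finally show ?thesis .
qed

lemma measurable_edge_weight_seq: "(\<lambda>s. edge_weight s i) \<in> borel_measurable seq_space"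
proof (rule measurableI)
  fix A :: "real set" assume A: "A \<in> sets borel"
  have "{s::real list. i < length s \<and> s ! i \<in> (\<lambda>x. exp (- x)) -` A} \<in> sets seq_space"
    by (rule seq_space_nth) (use A measurable_sets[of "\<lambda>x::real. exp (- x)" borel borel A] in simp)
  moreover have "{s::real list. \<not> i < length s} \<in> sets seq_space"
  proof -
    have "{s::real list. \<not> i < length s} = (\<Union>n\<in>{..i}. {s. length s = n})" by auto
    also have "\<dots> \<in> sets seq_space" by (intro sets.finite_UN) (auto intro: seq_space_length)
    finally show ?thesis .
  qed
  moreover have "(\<lambda>s. edge_weight s i) -` A \<inter> space seq_space =
      {s. i < length s \<and> s ! i \<in> (\<lambda>x. exp (- x)) -` A} \<union> (if 0 \<in> A then {s. \<not> i < length s} else {})"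
    by (auto simp: edge_weight_def space_seq_space split: if_splits)
  ultimately show "(\<lambda>s. edge_weight s i) -` A \<inter> space seq_space \<in> sets seq_space"
    by auto
qed (simp add: space_seq_space)

locale marked_tree_law = prob_space \<nu> for \<nu> :: "real list measure" +
  assumes sets_law: "sets \<nu> = sets seq_space"
begin

abbreviation Env :: "env measure" where "Env \<equiv> env_measure \<nu>"

lemma space_law: "space \<nu> = UNIV"
  using sets_eq_imp_space_eq[OF sets_law] by (simp add: space_seq_space)

lemma space_env [simp]: "space Env = UNIV"
  by (simp add: env_measure_def space_PiM space_law)

sublocale env: prob_space Env
  unfolding env_measure_def by (intro prob_space_PiM prob_space_axioms)

lemma emeasure_env_UNIV [simp]: "emeasure Env UNIV = 1"
  using env.emeasure_space_1 by simp

lemma measurable_coordinate [measurable]: "(\<lambda>\<xi>. \<xi> u) \<in> measurable Env \<nu>"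
  unfolding env_measure_def by (rule measurable_component_singleton) simp

lemma measurable_edge_weight [measurable]: "(\<lambda>s. edge_weight s i) \<in> borel_measurable \<nu>"
  using measurable_edge_weight_seq by (simp add: measurable_cong_sets[OF sets_law refl])

lemma measurable_weight [measurable]: "(\<lambda>\<xi>. weight \<xi> v) \<in> borel_measurable Env"
  unfolding weight_def by measurable

lemma measurable_envI:
  assumes "\<And>u. (\<lambda>x. f x u) \<in> measurable M \<nu>"
  shows "f \<in> measurable M Env"
  unfolding env_measure_def using assms
  by (intro measurable_PiM_single') (auto simp: space_law)

lemma measurable_subtree [measurable]: "subtree v \<in> measurable Env Env"
  unfolding subtree_def by (rule measurable_envI) simp

lemma measurable_graft [measurable]:
  "(\<lambda>(\<xi>, \<xi>'). graft v \<xi>' \<xi>) \<in> measurable (Env \<Otimes>\<^sub>M Env) Env"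
proof (rule measurable_envI)
  fix u
  have 1: "(\<lambda>x. fst x u) \<in> measurable (Env \<Otimes>\<^sub>M Env) \<nu>"
    by (rule measurable_compose[OF measurable_fst measurable_coordinate])
  have 2: "(\<lambda>x. snd x (drop (length v) u)) \<in> measurable (Env \<Otimes>\<^sub>M Env) \<nu>"
    by (rule measurable_compose[OF measurable_snd measurable_coordinate])
  show "(\<lambda>x. (case x of (\<xi>, \<xi>') \<Rightarrow> graft v \<xi>' \<xi>) u) \<in> measurable (Env \<Otimes>\<^sub>M Env) \<nu>"
    using 1 2 by (cases "prefix v u") (simp_all add: graft_def case_prod_beta)
qed

text \<open>Both sides are product measures, so it suffices to compare finite cylinders, and those split
  into the coordinates inside and outside the subtree at \<open>v\<close>.\<close>

lemma distr_graft: "distr (Env \<Otimes>\<^sub>M Env) Env (\<lambda>(\<xi>, \<xi>'). graft v \<xi>' \<xi>) = Env"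
proof -
  interpret P: product_prob_space "\<lambda>_::nat list. \<nu>" UNIV ..
  interpret EE: pair_prob_space Env Env ..
  let ?g = "\<lambda>(\<xi>, \<xi>'). graft v \<xi>' \<xi>"
  have "distr (Env \<Otimes>\<^sub>M Env) (PiM UNIV (\<lambda>_. \<nu>)) ?g = PiM UNIV (\<lambda>_. \<nu>)"
  proof (rule P.PiM_eq)
    fix J :: "nat list set" and F assume J: "finite J" "\<And>j. j \<in> J \<Longrightarrow> F j \<in> sets \<nu>"
    let ?X = "prod_emb UNIV (\<lambda>_. \<nu>) J (Pi\<^sub>E J F)"
    define J1 where "J1 = {j\<in>J. \<not> prefix v j}"
    define J2 where "J2 = {j\<in>J. prefix v j}"
    define K where "K = drop (length v) ` J2"
    have fin: "finite J1" "finite J2" "finite K" using J by (auto simp: J1_def J2_def K_def)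
    have inj: "inj_on (drop (length v)) J2"
      by (auto simp: J2_def prefix_def inj_on_def)
    have K: "v @ u \<in> J" if "u \<in> K" for u
      using that by (auto simp: K_def J2_def prefix_def)
    let ?X1 = "prod_emb UNIV (\<lambda>_. \<nu>) J1 (Pi\<^sub>E J1 F)"
    let ?X2 = "prod_emb UNIV (\<lambda>_. \<nu>) K (\<Pi>\<^sub>E u\<in>K. F (v @ u))"
    have emb: "prod_emb UNIV (\<lambda>_. \<nu>) I (Pi\<^sub>E I G) = {\<xi>. \<forall>u\<in>I. \<xi> u \<in> G u}"
      for I and G :: "nat list \<Rightarrow> real list set"
      by (auto simp: prod_emb_def space_law PiE_iff)
    have "?g -` ?X \<inter> space (Env \<Otimes>\<^sub>M Env) = ?X1 \<times> ?X2"
    proof -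
      have "(\<forall>u\<in>J. graft v \<xi>' \<xi> u \<in> F u) \<longleftrightarrow>
          (\<forall>u\<in>J1. \<xi> u \<in> F u) \<and> (\<forall>u\<in>K. \<xi>' u \<in> F (v @ u))" for \<xi> \<xi>'
        unfolding J1_def J2_def K_def graft_def by (auto simp: prefix_def)
      then show ?thesis by (simp add: emb space_pair_measure set_eq_iff)
    qed
    moreover have X: "?X1 \<in> sets Env" "?X2 \<in> sets Env" "?X \<in> sets Env"
      unfolding env_measure_def using J K fin
      by (auto intro!: sets_PiM_I simp: J1_def)
    ultimately have "emeasure (distr (Env \<Otimes>\<^sub>M Env) (PiM UNIV (\<lambda>_. \<nu>)) ?g) ?X
        = emeasure (Env \<Otimes>\<^sub>M Env) (?X1 \<times> ?X2)"
      by (subst emeasure_distr) (auto simp flip: env_measure_def)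
    also have "\<dots> = emeasure Env ?X1 * emeasure Env ?X2"
      using X by (intro env.emeasure_pair_measure_Times)
    also have "emeasure Env ?X1 = (\<Prod>j\<in>J1. emeasure \<nu> (F j))"
      unfolding env_measure_def using J fin by (intro P.emeasure_PiM_emb) (auto simp: J1_def)
    also have "emeasure Env ?X2 = (\<Prod>j\<in>K. emeasure \<nu> (F (v @ j)))"
      unfolding env_measure_def using J fin K by (intro P.emeasure_PiM_emb) auto
    also have "\<dots> = (\<Prod>j\<in>J2. emeasure \<nu> (F j))"
      unfolding K_def using inj
      by (subst prod.reindex) (auto simp: J2_def prefix_def intro!: prod.cong)
    also have "(\<Prod>j\<in>J1. emeasure \<nu> (F j)) * \<dots> = (\<Prod>j\<in>J. emeasure \<nu> (F j))"
      using fin by (subst prod.union_disjoint[symmetric]) (auto simp: J1_def J2_def intro!: prod.cong)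
    finally show "emeasure (distr (Env \<Otimes>\<^sub>M Env) (PiM UNIV (\<lambda>_. \<nu>)) ?g) ?X
        = (\<Prod>j\<in>J. emeasure \<nu> (F j))" .
  qed simp
  then show ?thesis by (simp flip: env_measure_def)
qed

lemma nn_integral_graft:
  assumes [measurable]: "f \<in> borel_measurable Env"
  shows "(\<integral>\<^sup>+\<xi>. f \<xi> \<partial>Env) = (\<integral>\<^sup>+\<xi>. \<integral>\<^sup>+\<xi>'. f (graft v \<xi>' \<xi>) \<partial>Env \<partial>Env)"
proof -
  have "(\<integral>\<^sup>+\<xi>. f \<xi> \<partial>Env) = (\<integral>\<^sup>+p. f (case p of (\<xi>, \<xi>') \<Rightarrow> graft v \<xi>' \<xi>) \<partial>(Env \<Otimes>\<^sub>M Env))"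
    by (subst distr_graft[of v, symmetric], subst nn_integral_distr) (auto simp: distr_graft)
  also have "\<dots> = (\<integral>\<^sup>+\<xi>. \<integral>\<^sup>+\<xi>'. f (graft v \<xi>' \<xi>) \<partial>Env \<partial>Env)"
    by (subst env.nn_integral_fst[symmetric]) auto
  finally show ?thesis .
qed

text \<open>The branching property in the form used throughout: what happens outside the subtree of \<open>v\<close> is
  independent of the subtree.\<close>

lemma nn_integral_subtree:
  assumes [measurable]: "G \<in> borel_measurable Env" "\<Phi> \<in> borel_measurable Env"
    and inv: "\<And>\<xi> \<xi>'. G (graft v \<xi>' \<xi>) = G \<xi>"
  shows "(\<integral>\<^sup>+\<xi>. G \<xi> * \<Phi> (subtree v \<xi>) \<partial>Env) = (\<integral>\<^sup>+\<xi>. G \<xi> \<partial>Env) * (\<integral>\<^sup>+\<xi>. \<Phi> \<xi> \<partial>Env)"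
  by (subst nn_integral_graft[of _ v]) (simp_all add: inv nn_integral_cmult nn_integral_multc)

lemma distr_subtree: "distr Env Env (subtree v) = Env"
proof (rule measure_eqI)
  fix A assume "A \<in> sets (distr Env Env (subtree v))"
  then have [measurable]: "A \<in> sets Env" by simp
  have "emeasure (distr Env Env (subtree v)) A = (\<integral>\<^sup>+\<xi>. 1 * indicator A (subtree v \<xi>) \<partial>Env)"
    by (subst nn_integral_indicator[symmetric], simp, subst nn_integral_distr) simp_all
  also have "\<dots> = emeasure Env A"
    by (subst nn_integral_subtree) (simp_all add: env.emeasure_space_1)
  finally show "emeasure (distr Env Env (subtree v)) A = emeasure Env A" .
qed simp

lemma AE_subtree:
  assumes "AE \<xi> in Env. P \<xi>"
  shows "AE \<xi> in Env. \<forall>v. P (subtree v \<xi>)"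
proof -
  have "AE \<xi> in Env. P (subtree v \<xi>)" for v
    by (rule AE_distrD[OF measurable_subtree]) (subst distr_subtree, rule assms)
  then show ?thesis by (simp add: AE_all_countable)
qed

lemma nn_integral_two_subtrees:
  assumes [measurable]: "G \<in> borel_measurable Env" "\<Phi> \<in> borel_measurable Env" "\<Psi> \<in> borel_measurable Env"
    and "\<And>\<xi> \<xi>'. G (graft v \<xi>' \<xi>) = G \<xi>" "\<And>\<xi> \<xi>'. G (graft w \<xi>' \<xi>) = G \<xi>"
    and "\<not> prefix v w" "\<not> prefix w v"
  shows "(\<integral>\<^sup>+\<xi>. G \<xi> * \<Phi> (subtree v \<xi>) * \<Psi> (subtree w \<xi>) \<partial>Env)
       = (\<integral>\<^sup>+\<xi>. G \<xi> \<partial>Env) * (\<integral>\<^sup>+\<xi>. \<Phi> \<xi> \<partial>Env) * (\<integral>\<^sup>+\<xi>. \<Psi> \<xi> \<partial>Env)"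
  using assms
  by (subst nn_integral_subtree) (auto simp: subtree_graft_incomparable nn_integral_subtree)

text \<open>Sums over a generation of a weight times a functional of the subtree factorise, as every label
  of the generation separates its subtree from its weight.\<close>

lemma many_to_one_subtree:
  assumes [measurable]: "\<And>v. G v \<in> borel_measurable Env" "\<Phi> \<in> borel_measurable Env"
    and inv: "\<And>v \<xi> \<xi>'. length v = m \<Longrightarrow> G v (graft v \<xi>' \<xi>) = G v \<xi>"
  shows "(\<integral>\<^sup>+\<xi>. level_sum_nn m (\<lambda>v. G v \<xi> * \<Phi> (subtree v \<xi>)) \<partial>Env)
       = (\<integral>\<^sup>+\<xi>. level_sum_nn m (\<lambda>v. G v \<xi>) \<partial>Env) * (\<integral>\<^sup>+\<xi>. \<Phi> \<xi> \<partial>Env)"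
proof -
  have "level_sum_nn m (\<lambda>v. \<integral>\<^sup>+\<xi>. G v \<xi> * \<Phi> (subtree v \<xi>) \<partial>Env)
      = level_sum_nn m (\<lambda>v. (\<integral>\<^sup>+\<xi>. G v \<xi> \<partial>Env) * (\<integral>\<^sup>+\<xi>. \<Phi> \<xi> \<partial>Env))"
    by (rule level_sum_nn_cong, rule nn_integral_subtree) (auto simp: inv)
  then show ?thesis
    by (simp add: nn_integral_level_sum_nn level_sum_nn_multc)
qed

end

section \<open>Moments of the additive martingale\<close>

definition mass :: "env \<Rightarrow> nat \<Rightarrow> real" where
  "mass \<xi> m = (\<Sum>v\<in>generation \<xi> m. weight \<xi> v)"

lemma mass_nonneg [simp]: "0 \<le> mass \<xi> m"
  by (simp add: mass_def sum_nonneg)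

lemma mass_0 [simp]: "mass \<xi> 0 = 1"
  by (simp add: mass_def generation_0)

lemma ennreal_mass: "ennreal (mass \<xi> m) = level_sum_nn m (\<lambda>v. ennreal (weight \<xi> v))"
  using level_sum_nn_weight[of "\<lambda>_. 1" 1 m \<xi>] by (simp add: mass_def)

lemma in_tree_append: "v @ w \<in> tree \<xi> \<longleftrightarrow> v \<in> tree \<xi> \<and> w \<in> tree (subtree v \<xi>)"
  using weight_nonneg[of \<xi> v] weight_nonneg[of "subtree v \<xi>" w]
  unfolding tree_iff_weight weight_append zero_less_mult_iff by linarith

lemma generation_append:
  "generation \<xi> (m + j) = (\<Union>v\<in>generation \<xi> m. (@) v ` generation (subtree v \<xi>) j)"
proof (intro equalityI subsetI)
  fix x assume x: "x \<in> generation \<xi> (m + j)"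
  then have "take m x @ drop m x \<in> tree \<xi>" "length x = m + j" by (auto simp: generation_def)
  then have "take m x \<in> generation \<xi> m" "drop m x \<in> generation (subtree (take m x) \<xi>) j"
    unfolding in_tree_append by (auto simp: generation_def)
  then show "x \<in> (\<Union>v\<in>generation \<xi> m. (@) v ` generation (subtree v \<xi>) j)"
    by (intro UN_I[of "take m x"] image_eqI[of _ _ "drop m x"]) simp_all
qed (auto simp: generation_def in_tree_append)

lemma sum_generation_append:
  fixes f :: "nat list \<Rightarrow> 'b::comm_monoid_add"
  shows "(\<Sum>x\<in>generation \<xi> (m + j). f x)
       = (\<Sum>v\<in>generation \<xi> m. \<Sum>w\<in>generation (subtree v \<xi>) j. f (v @ w))"
proof -
  have "(@) u ` generation (subtree u \<xi>) j \<inter> (@) v ` generation (subtree v \<xi>) j = {}"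
    if "u \<in> generation \<xi> m" "v \<in> generation \<xi> m" "u \<noteq> v" for u v
    using that by (auto simp: generation_def)
  then have "(\<Sum>x\<in>generation \<xi> (m + j). f x)
       = (\<Sum>v\<in>generation \<xi> m. \<Sum>x\<in>(@) v ` generation (subtree v \<xi>) j. f x)"
    unfolding generation_append by (intro sum.UNION_disjoint ballI impI finite_imageI finite_generation)
  also have "\<dots> = (\<Sum>v\<in>generation \<xi> m. \<Sum>w\<in>generation (subtree v \<xi>) j. f (v @ w))"
    by (rule sum.cong[OF refl], subst sum.reindex) (auto simp: inj_on_def)
  finally show ?thesis .
qed

lemma mass_append:
  "mass \<xi> (m + j) = (\<Sum>v\<in>generation \<xi> m. weight \<xi> v * mass (subtree v \<xi>) j)"
  by (simp add: mass_def sum_generation_append weight_append sum_distrib_left)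

text \<open>Jensen's inequality for the convex function \<open>x ^ Suc q\<close> and the weights \<open>a\<close>, without
  normalisation. The induction step is Chebyshev's sum inequality for the similarly ordered families
  \<open>b\<close> and \<open>b ^ Suc q\<close>.\<close>

lemma power_weighted_sum_le:
  fixes a b :: "'i \<Rightarrow> real"
  assumes "finite I" "\<And>i. i \<in> I \<Longrightarrow> 0 \<le> a i" "\<And>i. i \<in> I \<Longrightarrow> 0 \<le> b i"
  shows "(\<Sum>i\<in>I. a i * b i) ^ Suc q \<le> (\<Sum>i\<in>I. a i) ^ q * (\<Sum>i\<in>I. a i * b i ^ Suc q)"
proof (induction q)
  case (Suc q)
  have cheb: "(\<Sum>i\<in>I. a i * b i) * (\<Sum>i\<in>I. a i * b i ^ Suc q) \<le> (\<Sum>i\<in>I. a i) * (\<Sum>i\<in>I. a i * b i ^ Suc (Suc q))"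
  proof -
    have "0 \<le> (\<Sum>i\<in>I. \<Sum>j\<in>I. a i * a j * ((b i - b j) * (b i ^ Suc q - b j ^ Suc q)))"
    proof (intro sum_nonneg)
      fix i j assume ij: "i \<in> I" "j \<in> I"
      then have "0 \<le> (b i - b j) * (b i ^ Suc q - b j ^ Suc q)"
        using assms(3) power_mono[of "b i" "b j" "Suc q"] power_mono[of "b j" "b i" "Suc q"]
        by (cases "b i \<le> b j") (auto intro: mult_nonneg_nonneg mult_nonpos_nonpos)
      then show "0 \<le> a i * a j * ((b i - b j) * (b i ^ Suc q - b j ^ Suc q))"
        using assms(2)[OF ij(1)] assms(2)[OF ij(2)] by (simp only: mult_nonneg_nonneg)
    qed
    also have "\<dots> = 2 * ((\<Sum>i\<in>I. a i) * (\<Sum>i\<in>I. a i * b i ^ Suc (Suc q)))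
        - 2 * ((\<Sum>i\<in>I. a i * b i) * (\<Sum>i\<in>I. a i * b i ^ Suc q))"
    proof -
      have "(\<Sum>i\<in>I. \<Sum>j\<in>I. a i * a j * ((b i - b j) * (b i ^ Suc q - b j ^ Suc q)))
        = (\<Sum>i\<in>I. \<Sum>j\<in>I. a i * (a j * b j ^ Suc (Suc q))) + (\<Sum>i\<in>I. \<Sum>j\<in>I. (a i * b i ^ Suc (Suc q)) * a j)
        - (\<Sum>i\<in>I. \<Sum>j\<in>I. (a i * b i) * (a j * b j ^ Suc q)) - (\<Sum>i\<in>I. \<Sum>j\<in>I. (a i * b i ^ Suc q) * (a j * b j))"
        unfolding sum.distrib[symmetric] sum_subtractf[symmetric]
        by (intro sum.cong refl) (simp add: algebra_simps)
      then show ?thesis by (simp only: sum_product[symmetric]) (simp add: algebra_simps)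
    qed
    finally show ?thesis by simp
  qed
  have "(\<Sum>i\<in>I. a i * b i) ^ Suc (Suc q) = (\<Sum>i\<in>I. a i * b i) * (\<Sum>i\<in>I. a i * b i) ^ Suc q" by simp
  also have "\<dots> \<le> (\<Sum>i\<in>I. a i * b i) * ((\<Sum>i\<in>I. a i) ^ q * (\<Sum>i\<in>I. a i * b i ^ Suc q))"
    using assms by (intro mult_left_mono[OF Suc.IH] sum_nonneg) auto
  also have "\<dots> = (\<Sum>i\<in>I. a i) ^ q * ((\<Sum>i\<in>I. a i * b i) * (\<Sum>i\<in>I. a i * b i ^ Suc q))"
    by (simp add: mult_ac)
  also have "\<dots> \<le> (\<Sum>i\<in>I. a i) ^ q * ((\<Sum>i\<in>I. a i) * (\<Sum>i\<in>I. a i * b i ^ Suc (Suc q)))"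
    using assms by (intro mult_left_mono[OF cheb] zero_le_power sum_nonneg)
  finally show ?case by (simp add: mult_ac)
qed simp

text \<open>Only the leading term \<open>s ^ Suc q\<close> keeps the constant \<open>1\<close>; every other binomial term contains a
  factor \<open>r\<close> and is at most the sum of the two extreme ones.\<close>

lemma power_add_le_split:
  fixes s r :: real
  assumes "0 \<le> s" "0 \<le> r"
  shows "(s + r) ^ Suc q \<le> s ^ Suc q + 2 ^ Suc q * (s ^ q * r + r ^ Suc q)"
proof -
  have m: "(s + r) ^ Suc q = s ^ Suc q + (\<Sum>j\<le>q. of_nat (Suc q choose j) * s ^ j * r ^ (Suc q - j))"
    by (subst binomial_ring) simp
  have "s ^ j * r ^ (Suc q - j) \<le> s ^ q * r + r ^ Suc q" if "j \<le> q" for j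
  proof -
    have "s ^ j * r ^ (q - j) \<le> max s r ^ j * max s r ^ (q - j)"
      using assms by (intro mult_mono power_mono) auto
    also have "\<dots> = max s r ^ q" using that by (simp add: power_add[symmetric])
    also have "\<dots> \<le> s ^ q + r ^ q" using assms by (cases "s \<le> r") auto
    finally have "r * (s ^ j * r ^ (q - j)) \<le> r * (s ^ q + r ^ q)"
      using assms by (intro mult_left_mono)
    moreover have "r ^ (Suc q - j) = r * r ^ (q - j)" using that by (simp add: Suc_diff_le)
    ultimately show ?thesis by (simp add: algebra_simps)
  qed
  then have "(\<Sum>j\<le>q. of_nat (Suc q choose j) * s ^ j * r ^ (Suc q - j))
      \<le> (\<Sum>j\<le>q. of_nat (Suc q choose j) * (s ^ q * r + r ^ Suc q))"
    by (intro sum_mono) (simp add: mult.assoc mult_left_mono)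
  also have "\<dots> \<le> (\<Sum>j\<le>Suc q. of_nat (Suc q choose j) * (s ^ q * r + r ^ Suc q))"
    using assms by (intro sum_mono2) auto
  also have "\<dots> = real (\<Sum>j\<le>Suc q. Suc q choose j) * (s ^ q * r + r ^ Suc q)"
    by (simp only: sum_distrib_right of_nat_sum)
  also have "\<dots> = 2 ^ Suc q * (s ^ q * r + r ^ Suc q)"
    by (subst choose_row_sum) simp
  finally show ?thesis using m by linarith
qed

text \<open>The diagonal keeps the constant \<open>1\<close>, which is what lets the moment recursion below contract;
  in the remaining terms two different indices occur, so that independence can be applied to them.\<close>

lemma power_sum_split_diagonal:
  fixes a b :: "'i \<Rightarrow> real"
  assumes I: "finite I" and a: "\<And>i. i \<in> I \<Longrightarrow> 0 \<le> a i" and b: "\<And>i. i \<in> I \<Longrightarrow> 0 \<le> b i"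
  defines "A \<equiv> \<Sum>i\<in>I. a i"
  shows "(\<Sum>i\<in>I. a i * b i) ^ Suc (Suc q) \<le> (\<Sum>i\<in>I. a i ^ Suc (Suc q) * b i ^ Suc (Suc q))
     + 2 ^ Suc q * (\<Sum>i\<in>I. \<Sum>j\<in>I - {i}. a i ^ Suc q * a j * b i ^ Suc q * b j)
     + 2 ^ Suc q * (\<Sum>i\<in>I. \<Sum>j\<in>I - {i}. a i * a j * A ^ q * b i * b j ^ Suc q)"
proof -
  define s where "s i = a i * b i" for i
  define r where "r i = (\<Sum>j\<in>I - {i}. a j * b j)" for i
  have s: "0 \<le> s i" "0 \<le> r i" if "i \<in> I" for i
    using a b that by (auto simp: s_def r_def intro!: sum_nonneg)
  have tot: "(\<Sum>j\<in>I. a j * b j) = s i + r i" if "i \<in> I" for i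
    using I that by (simp add: s_def r_def sum.remove)
  have r: "r i ^ Suc q \<le> A ^ q * (\<Sum>j\<in>I - {i}. a j * b j ^ Suc q)" if "i \<in> I" for i
  proof -
    have "r i ^ Suc q \<le> (\<Sum>j\<in>I - {i}. a j) ^ q * (\<Sum>j\<in>I - {i}. a j * b j ^ Suc q)"
      unfolding r_def using I a b by (intro power_weighted_sum_le) auto
    also have "\<dots> \<le> A ^ q * (\<Sum>j\<in>I - {i}. a j * b j ^ Suc q)"
      unfolding A_def using I a b
      by (intro mult_right_mono power_mono sum_mono2 sum_nonneg) auto
    finally show ?thesis .
  qed
  have "(\<Sum>i\<in>I. a i * b i) ^ Suc (Suc q) = (\<Sum>i\<in>I. s i * (\<Sum>j\<in>I. a j * b j) ^ Suc q)"
    by (simp add: s_def sum_distrib_right)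
  also have "\<dots> = (\<Sum>i\<in>I. s i * (s i + r i) ^ Suc q)"
    by (intro sum.cong) (simp_all add: tot)
  also have "\<dots> \<le> (\<Sum>i\<in>I. s i * (s i ^ Suc q + 2 ^ Suc q * (s i ^ q * r i + r i ^ Suc q)))"
    using s by (intro sum_mono mult_left_mono power_add_le_split) auto
  also have "\<dots> \<le> (\<Sum>i\<in>I. s i * (s i ^ Suc q + 2 ^ Suc q * (s i ^ q * r i
      + A ^ q * (\<Sum>j\<in>I - {i}. a j * b j ^ Suc q))))"
    using s r by (intro sum_mono mult_left_mono add_left_mono) auto
  also have "\<dots> = (\<Sum>i\<in>I. s i ^ Suc (Suc q)) + 2 ^ Suc q * (\<Sum>i\<in>I. s i ^ Suc q * r i)
      + 2 ^ Suc q * (\<Sum>i\<in>I. s i * A ^ q * (\<Sum>j\<in>I - {i}. a j * b j ^ Suc q))"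
    by (simp add: sum.distrib sum_distrib_left algebra_simps)
  also have "\<dots> = (\<Sum>i\<in>I. a i ^ Suc (Suc q) * b i ^ Suc (Suc q))
     + 2 ^ Suc q * (\<Sum>i\<in>I. \<Sum>j\<in>I - {i}. a i ^ Suc q * a j * b i ^ Suc q * b j)
     + 2 ^ Suc q * (\<Sum>i\<in>I. \<Sum>j\<in>I - {i}. a i * a j * A ^ q * b i * b j ^ Suc q)"
    by (simp only: s_def r_def sum_distrib_left power_mult_distrib mult_ac)
  finally show ?thesis .
qed

context marked_tree_law
begin

lemma measurable_mass [measurable]: "(\<lambda>\<xi>. mass \<xi> m) \<in> borel_measurable Env"
proof -
  have "(\<lambda>\<xi>. enn2real (level_sum_nn m (\<lambda>v. ennreal (weight \<xi> v)))) \<in> borel_measurable Env"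
    by measurable
  then show ?thesis by (simp flip: ennreal_mass)
qed

text \<open>With \<open>\<psi>\<close> as in the statement, \<open>phi a m\<close> is \<open>exp (m * \<psi> a)\<close>.\<close>

definition phi :: "nat \<Rightarrow> nat \<Rightarrow> ennreal" where
  "phi a m = (\<integral>\<^sup>+\<xi>. level_sum_nn m (\<lambda>v. ennreal (weight \<xi> v ^ a)) \<partial>Env)"

lemma nn_integral_weighted_subtree:
  assumes [measurable]: "\<Phi> \<in> borel_measurable Env"
  shows "(\<integral>\<^sup>+\<xi>. level_sum_nn m (\<lambda>v. ennreal (weight \<xi> v ^ a) * \<Phi> (subtree v \<xi>)) \<partial>Env)
       = phi a m * (\<integral>\<^sup>+\<xi>. \<Phi> \<xi> \<partial>Env)"
  unfolding phi_def by (rule many_to_one_subtree) (auto simp: weight_graft)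

lemma phi_0 [simp]: "phi a 0 = 1"
  by (simp add: phi_def)

lemma phi_add: "phi a (m + j) = phi a m * phi a j"
proof -
  have "phi a (m + j) = (\<integral>\<^sup>+\<xi>. level_sum_nn m (\<lambda>v. ennreal (weight \<xi> v ^ a) *
      level_sum_nn j (\<lambda>w. ennreal (weight (subtree v \<xi>) w ^ a))) \<partial>Env)"
    unfolding phi_def level_sum_nn_append
    by (simp add: weight_append power_mult_distrib ennreal_mult level_sum_nn_cmult)
  also have "\<dots> = phi a m * phi a j"
    by (subst nn_integral_weighted_subtree) (simp_all add: phi_def)
  finally show ?thesis .
qed

lemma phi_power: "phi a m = phi a 1 ^ m"
proof (induction m)
  case (Suc m)
  then show ?case using phi_add[of a 1 m] by simp
qed simp

lemma nn_integral_level_sum_nn2: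
  assumes [measurable]: "\<And>v w. F v w \<in> borel_measurable M"
  shows "(\<integral>\<^sup>+x. level_sum_nn m (\<lambda>v. level_sum_nn j (\<lambda>w. F v w x)) \<partial>M)
       = level_sum_nn m (\<lambda>v. level_sum_nn j (\<lambda>w. \<integral>\<^sup>+x. F v w x \<partial>M))"
proof -
  have "(\<integral>\<^sup>+x. level_sum_nn m (\<lambda>v. level_sum_nn j (\<lambda>w. F v w x)) \<partial>M)
      = level_sum_nn m (\<lambda>v. \<integral>\<^sup>+x. level_sum_nn j (\<lambda>w. F v w x) \<partial>M)"
    by (rule nn_integral_level_sum_nn) measurable
  also have "\<dots> = level_sum_nn m (\<lambda>v. level_sum_nn j (\<lambda>w. \<integral>\<^sup>+x. F v w x \<partial>M))"
    by (intro level_sum_nn_cong nn_integral_level_sum_nn) measurable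
  finally show ?thesis .
qed

lemma nn_integral_two_weighted_subtrees:
  assumes [measurable]: "\<Phi> \<in> borel_measurable Env" "\<Psi> \<in> borel_measurable Env"
    and G [measurable]: "\<And>v w. G v w \<in> borel_measurable Env"
    and inv: "\<And>v w \<xi> \<xi>'. length v = m \<Longrightarrow> length w = m \<Longrightarrow> G v w (graft v \<xi>' \<xi>) = G v w \<xi>"
             "\<And>v w \<xi> \<xi>'. length v = m \<Longrightarrow> length w = m \<Longrightarrow> G v w (graft w \<xi>' \<xi>) = G v w \<xi>"
  shows "(\<integral>\<^sup>+\<xi>. level_sum_nn m (\<lambda>v. level_sum_nn m (\<lambda>w.
            of_bool (v \<noteq> w) * G v w \<xi> * \<Phi> (subtree v \<xi>) * \<Psi> (subtree w \<xi>))) \<partial>Env)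
       = (\<integral>\<^sup>+\<xi>. level_sum_nn m (\<lambda>v. level_sum_nn m (\<lambda>w. of_bool (v \<noteq> w) * G v w \<xi>)) \<partial>Env)
           * (\<integral>\<^sup>+\<xi>. \<Phi> \<xi> \<partial>Env) * (\<integral>\<^sup>+\<xi>. \<Psi> \<xi> \<partial>Env)"
proof -
  have "(\<integral>\<^sup>+\<xi>. of_bool (v \<noteq> w) * G v w \<xi> * \<Phi> (subtree v \<xi>) * \<Psi> (subtree w \<xi>) \<partial>Env)
      = (\<integral>\<^sup>+\<xi>. of_bool (v \<noteq> w) * G v w \<xi> \<partial>Env) * (\<integral>\<^sup>+\<xi>. \<Phi> \<xi> \<partial>Env) * (\<integral>\<^sup>+\<xi>. \<Psi> \<xi> \<partial>Env)"
    if "length v = m" "length w = m" for v w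
  proof (cases "v = w")
    case False
    with that have "\<not> prefix v w" "\<not> prefix w v" by (auto simp: prefix_def)
    then show ?thesis using that
      by (intro nn_integral_two_subtrees) (auto simp: inv)
  qed simp
  then have "level_sum_nn m (\<lambda>v. level_sum_nn m (\<lambda>w. \<integral>\<^sup>+\<xi>. of_bool (v \<noteq> w) * G v w \<xi> * \<Phi> (subtree v \<xi>) * \<Psi> (subtree w \<xi>) \<partial>Env))
      = level_sum_nn m (\<lambda>v. level_sum_nn m (\<lambda>w. (\<integral>\<^sup>+\<xi>. of_bool (v \<noteq> w) * G v w \<xi> \<partial>Env) * (\<integral>\<^sup>+\<xi>. \<Phi> \<xi> \<partial>Env) * (\<integral>\<^sup>+\<xi>. \<Psi> \<xi> \<partial>Env)))"
    by (rule level_sum_nn_cong[OF level_sum_nn_cong])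
  also have "\<dots> = level_sum_nn m (\<lambda>v. level_sum_nn m (\<lambda>w. \<integral>\<^sup>+\<xi>. of_bool (v \<noteq> w) * G v w \<xi> \<partial>Env))
           * (\<integral>\<^sup>+\<xi>. \<Phi> \<xi> \<partial>Env) * (\<integral>\<^sup>+\<xi>. \<Psi> \<xi> \<partial>Env)"
    by (simp only: level_sum_nn_multc)
  finally show ?thesis
    by (subst (1 2) nn_integral_level_sum_nn2; measurable)
qed

text \<open>Expanding the product of two sums over a generation, the diagonal sees both functionals on the
  same subtree and gives \<open>phi 2\<close>; off the diagonal the subtrees are independent.\<close>

lemma weighted_square_split:
  assumes [measurable]: "\<Phi> \<in> borel_measurable Env" "\<Psi> \<in> borel_measurable Env"
  shows "(\<integral>\<^sup>+\<xi>. level_sum_nn m (\<lambda>v. ennreal (weight \<xi> v) * \<Phi> (subtree v \<xi>))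
              * level_sum_nn m (\<lambda>v. ennreal (weight \<xi> v) * \<Psi> (subtree v \<xi>)) \<partial>Env)
       = phi 2 m * (\<integral>\<^sup>+\<xi>. \<Phi> \<xi> * \<Psi> \<xi> \<partial>Env) +
         (\<integral>\<^sup>+\<xi>. level_sum_nn m (\<lambda>v. level_sum_nn m (\<lambda>w. of_bool (v \<noteq> w) * ennreal (weight \<xi> v * weight \<xi> w))) \<partial>Env)
           * (\<integral>\<^sup>+\<xi>. \<Phi> \<xi> \<partial>Env) * (\<integral>\<^sup>+\<xi>. \<Psi> \<xi> \<partial>Env)"
proof -
  have diag: "level_sum_nn m (\<lambda>w. of_bool (v = w) * f w) = f v" if "length v = m" for v and f :: "nat list \<Rightarrow> ennreal"
    unfolding level_sum_nn_def
    by (subst nn_integral_count_space'[where A="{v}"]) (use that in auto)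
  have "level_sum_nn m (\<lambda>v. ennreal (weight \<xi> v) * \<Phi> (subtree v \<xi>))
              * level_sum_nn m (\<lambda>v. ennreal (weight \<xi> v) * \<Psi> (subtree v \<xi>))
      = level_sum_nn m (\<lambda>v. ennreal (weight \<xi> v ^ 2) * (\<Phi> (subtree v \<xi>) * \<Psi> (subtree v \<xi>)))
      + level_sum_nn m (\<lambda>v. level_sum_nn m (\<lambda>w. of_bool (v \<noteq> w) * ennreal (weight \<xi> v * weight \<xi> w)
           * \<Phi> (subtree v \<xi>) * \<Psi> (subtree w \<xi>)))" for \<xi>
  proof -
    let ?t = "\<lambda>v w. ennreal (weight \<xi> v * weight \<xi> w) * \<Phi> (subtree v \<xi>) * \<Psi> (subtree w \<xi>)"
    have "level_sum_nn m (\<lambda>v. ennreal (weight \<xi> v) * \<Phi> (subtree v \<xi>))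
              * level_sum_nn m (\<lambda>v. ennreal (weight \<xi> v) * \<Psi> (subtree v \<xi>))
       = level_sum_nn m (\<lambda>v. level_sum_nn m (\<lambda>w. ?t v w))"
      by (subst level_sum_nn_multc[symmetric], subst level_sum_nn_cmult[symmetric])
         (simp add: ennreal_mult mult_ac)
    also have "\<dots> = level_sum_nn m (\<lambda>v. level_sum_nn m (\<lambda>w. of_bool (v = w) * ?t v w + of_bool (v \<noteq> w) * ?t v w))"
      by (intro level_sum_nn_cong) auto
    also have "\<dots> = level_sum_nn m (\<lambda>v. ?t v v + level_sum_nn m (\<lambda>w. of_bool (v \<noteq> w) * ?t v w))"
      by (intro level_sum_nn_cong) (simp only: level_sum_nn_add diag)
    finally show ?thesis by (simp add: level_sum_nn_add power2_eq_square mult_ac)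
  qed
  then have "(\<integral>\<^sup>+\<xi>. level_sum_nn m (\<lambda>v. ennreal (weight \<xi> v) * \<Phi> (subtree v \<xi>))
              * level_sum_nn m (\<lambda>v. ennreal (weight \<xi> v) * \<Psi> (subtree v \<xi>)) \<partial>Env)
     = (\<integral>\<^sup>+\<xi>. level_sum_nn m (\<lambda>v. ennreal (weight \<xi> v ^ 2) * (\<Phi> (subtree v \<xi>) * \<Psi> (subtree v \<xi>))) \<partial>Env)
     + (\<integral>\<^sup>+\<xi>. level_sum_nn m (\<lambda>v. level_sum_nn m (\<lambda>w. of_bool (v \<noteq> w) * ennreal (weight \<xi> v * weight \<xi> w)
           * \<Phi> (subtree v \<xi>) * \<Psi> (subtree w \<xi>))) \<partial>Env)"
    by (simp only:) (intro nn_integral_add; measurable)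
  then show ?thesis
    using nn_integral_weighted_subtree[of "\<lambda>\<xi>. \<Phi> \<xi> * \<Psi> \<xi>" m 2]
    by (subst (asm) nn_integral_two_weighted_subtrees) (simp_all add: weight_graft)
qed

end

lemma mass_graft: "length v = m \<Longrightarrow> mass (graft v \<xi>' \<xi>) m = mass \<xi> m"
proof -
  assume v: "length v = m"
  have "ennreal (mass (graft v \<xi>' \<xi>) m) = ennreal (mass \<xi> m)"
    unfolding ennreal_mass by (intro level_sum_nn_cong) (simp add: weight_graft v)
  then show "mass (graft v \<xi>' \<xi>) m = mass \<xi> m" by simp
qed

context marked_tree_law
begin

text \<open>The first generation splits the mass into independent parts. After expanding the power, the
  diagonal contracts by \<open>phi\<close>, and the off-diagonal terms involve lower moments of the parts only.\<close>

lemma nn_integral_mass_power_recursion: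
  assumes one: "(\<integral>\<^sup>+\<xi>. ennreal (mass \<xi> l) \<partial>Env) = 1"
  shows "(\<integral>\<^sup>+\<xi>. ennreal (mass \<xi> (1 + l) ^ Suc (Suc q)) \<partial>Env)
     \<le> phi (Suc (Suc q)) 1 * (\<integral>\<^sup>+\<xi>. ennreal (mass \<xi> l ^ Suc (Suc q)) \<partial>Env)
     + 2 * 2 ^ Suc q * (\<integral>\<^sup>+\<xi>. ennreal (mass \<xi> 1 ^ Suc (Suc q)) \<partial>Env)
         * (\<integral>\<^sup>+\<xi>. ennreal (mass \<xi> l ^ Suc q) \<partial>Env)"
proof -
  let ?w = "\<lambda>\<xi> v. weight \<xi> v" and ?b = "\<lambda>\<xi> v. mass (subtree v \<xi>) l"
  let ?P = "Suc (Suc q)"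
  define D where "D \<xi> = level_sum_nn 1 (\<lambda>v. ennreal (?w \<xi> v ^ ?P) * ennreal (?b \<xi> v ^ ?P))" for \<xi>
  define X where "X \<xi> = level_sum_nn 1 (\<lambda>v. level_sum_nn 1 (\<lambda>u. of_bool (v \<noteq> u)
      * ennreal (?w \<xi> v ^ Suc q * ?w \<xi> u) * ennreal (?b \<xi> v ^ Suc q) * ennreal (?b \<xi> u)))" for \<xi>
  define Y where "Y \<xi> = level_sum_nn 1 (\<lambda>v. level_sum_nn 1 (\<lambda>u. of_bool (v \<noteq> u)
      * ennreal (?w \<xi> v * ?w \<xi> u * mass \<xi> 1 ^ q) * ennreal (?b \<xi> v) * ennreal (?b \<xi> u ^ Suc q)))" for \<xi>
  have [measurable]: "D \<in> borel_measurable Env" "X \<in> borel_measurable Env" "Y \<in> borel_measurable Env"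
    unfolding D_def X_def Y_def by measurable
  have off: "level_sum_nn 1 (\<lambda>v. level_sum_nn 1 (\<lambda>u. of_bool (v \<noteq> u) * ennreal (f v u)))
      = ennreal (\<Sum>v\<in>generation \<xi> 1. \<Sum>u\<in>generation \<xi> 1 - {v}. f v u)"
    if "\<And>v u. 0 \<le> f v u" "\<And>v u. v \<notin> tree \<xi> \<or> u \<notin> tree \<xi> \<Longrightarrow> f v u = 0" for f \<xi>
  proof -
    have "level_sum_nn 1 (\<lambda>u. of_bool (v \<noteq> u) * ennreal (f v u)) = ennreal (\<Sum>u\<in>generation \<xi> 1 - {v}. f v u)" for v
    proof -
      have "level_sum_nn 1 (\<lambda>u. of_bool (v \<noteq> u) * ennreal (f v u)) = (\<Sum>u\<in>generation \<xi> 1. of_bool (v \<noteq> u) * ennreal (f v u))"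
        by (rule level_sum_nn_generation) (use that in auto)
      also have "\<dots> = (\<Sum>u\<in>generation \<xi> 1 - {v}. ennreal (f v u))"
        by (rule sum.mono_neutral_cong_right) auto
      also have "\<dots> = ennreal (\<Sum>u\<in>generation \<xi> 1 - {v}. f v u)"
        using that by (intro sum_ennreal) auto
      finally show ?thesis .
    qed
    then show ?thesis
      using that by (subst level_sum_nn_generation[of _ \<xi>]) (auto intro!: sum_ennreal sum_nonneg)
  qed
  have pw: "ennreal (mass \<xi> (1 + l) ^ ?P) \<le> D \<xi> + ennreal (2 ^ Suc q) * X \<xi> + ennreal (2 ^ Suc q) * Y \<xi>" for \<xi>
  proof -
    let ?G = "generation \<xi> 1"
    have D: "D \<xi> = ennreal (\<Sum>v\<in>?G. ?w \<xi> v ^ ?P * ?b \<xi> v ^ ?P)"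
      unfolding D_def by (subst level_sum_nn_weight[symmetric]) (simp_all add: ennreal_mult)
    have X: "X \<xi> = ennreal (\<Sum>v\<in>?G. \<Sum>u\<in>?G - {v}. ?w \<xi> v ^ Suc q * ?w \<xi> u * ?b \<xi> v ^ Suc q * ?b \<xi> u)"
      unfolding X_def by (subst off[symmetric]) (auto simp: ennreal_mult weight_eq_0 mult.assoc)
    have Y: "Y \<xi> = ennreal (\<Sum>v\<in>?G. \<Sum>u\<in>?G - {v}. ?w \<xi> v * ?w \<xi> u * mass \<xi> 1 ^ q * ?b \<xi> v * ?b \<xi> u ^ Suc q)"
      unfolding Y_def by (subst off[symmetric]) (auto simp: ennreal_mult weight_eq_0 mult.assoc)
    have gen: "ennreal (a + 2 ^ Suc q * b + 2 ^ Suc q * c) = ennreal a + ennreal (2 ^ Suc q) * ennreal b + ennreal (2 ^ Suc q) * ennreal c"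
      if "0 \<le> a" "0 \<le> b" "0 \<le> c" for a b c :: real
      using that by (simp add: ennreal_mult del: power_Suc)
    have "mass \<xi> (1 + l) ^ ?P \<le> (\<Sum>v\<in>?G. ?w \<xi> v ^ ?P * ?b \<xi> v ^ ?P)
       + 2 ^ Suc q * (\<Sum>v\<in>?G. \<Sum>u\<in>?G - {v}. ?w \<xi> v ^ Suc q * ?w \<xi> u * ?b \<xi> v ^ Suc q * ?b \<xi> u)
       + 2 ^ Suc q * (\<Sum>v\<in>?G. \<Sum>u\<in>?G - {v}. ?w \<xi> v * ?w \<xi> u * mass \<xi> 1 ^ q * ?b \<xi> v * ?b \<xi> u ^ Suc q)"
      unfolding mass_append unfolding mass_def[of \<xi> 1] by (rule power_sum_split_diagonal) auto
    then have "ennreal (mass \<xi> (1 + l) ^ ?P) \<le> ennreal (\<dots>)" by (rule ennreal_leI)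
    also have "\<dots> = D \<xi> + ennreal (2 ^ Suc q) * X \<xi> + ennreal (2 ^ Suc q) * Y \<xi>"
      unfolding D X Y by (rule gen; intro sum_nonneg mult_nonneg_nonneg zero_le_power; simp)
    finally show ?thesis .
  qed
  have ID: "(\<integral>\<^sup>+\<xi>. D \<xi> \<partial>Env) = phi ?P 1 * (\<integral>\<^sup>+\<xi>. ennreal (mass \<xi> l ^ ?P) \<partial>Env)"
    unfolding D_def by (rule nn_integral_weighted_subtree) measurable
  let ?M1 = "\<integral>\<^sup>+\<xi>. ennreal (mass \<xi> 1 ^ ?P) \<partial>Env" and ?Mq = "\<integral>\<^sup>+\<xi>. ennreal (mass \<xi> l ^ Suc q) \<partial>Env"
  have IX: "(\<integral>\<^sup>+\<xi>. X \<xi> \<partial>Env) \<le> ?M1 * ?Mq"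
  proof -
    have "(\<integral>\<^sup>+\<xi>. X \<xi> \<partial>Env) = (\<integral>\<^sup>+\<xi>. level_sum_nn 1 (\<lambda>v. level_sum_nn 1 (\<lambda>u. of_bool (v \<noteq> u)
      * ennreal (?w \<xi> v ^ Suc q * ?w \<xi> u))) \<partial>Env) * ?Mq * (\<integral>\<^sup>+\<xi>. ennreal (mass \<xi> l) \<partial>Env)"
      unfolding X_def by (rule nn_integral_two_weighted_subtrees) (measurable, auto simp: weight_graft)
    also have "(\<integral>\<^sup>+\<xi>. level_sum_nn 1 (\<lambda>v. level_sum_nn 1 (\<lambda>u. of_bool (v \<noteq> u)
      * ennreal (?w \<xi> v ^ Suc q * ?w \<xi> u))) \<partial>Env) \<le> ?M1"
    proof (rule nn_integral_mono)
      fix \<xi>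
      let ?G = "generation \<xi> 1"
      have "(\<Sum>v\<in>?G. \<Sum>u\<in>?G - {v}. ?w \<xi> v ^ Suc q * ?w \<xi> u) \<le> (\<Sum>v\<in>?G. \<Sum>u\<in>?G. (?w \<xi> v * mass \<xi> 1 ^ q) * ?w \<xi> u)"
      proof (intro sum_mono order_trans[OF sum_mono2[of ?G "?G - {v}" for v]])
        fix v u assume "v \<in> ?G" "u \<in> ?G"
        then have "?w \<xi> v \<le> mass \<xi> 1" unfolding mass_def by (intro member_le_sum) auto
        then show "?w \<xi> v ^ Suc q * ?w \<xi> u \<le> (?w \<xi> v * mass \<xi> 1 ^ q) * ?w \<xi> u"
          by (auto intro!: mult_right_mono mult_left_mono power_mono)
      qed auto
      also have "\<dots> = mass \<xi> 1 ^ ?P"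
        by (simp add: mass_def sum_product[symmetric] sum_distrib_right[symmetric] mult_ac)
      finally show "level_sum_nn 1 (\<lambda>v. level_sum_nn 1 (\<lambda>u. of_bool (v \<noteq> u)
        * ennreal (?w \<xi> v ^ Suc q * ?w \<xi> u))) \<le> ennreal (mass \<xi> 1 ^ ?P)"
        by (subst off[of _ \<xi>]) (auto simp: weight_eq_0 intro: ennreal_leI)
    qed
    finally show ?thesis by (simp add: one mult_right_mono)
  qed
  have IY: "(\<integral>\<^sup>+\<xi>. Y \<xi> \<partial>Env) \<le> ?M1 * ?Mq"
  proof -
    have "(\<integral>\<^sup>+\<xi>. Y \<xi> \<partial>Env) = (\<integral>\<^sup>+\<xi>. level_sum_nn 1 (\<lambda>v. level_sum_nn 1 (\<lambda>u. of_bool (v \<noteq> u)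
      * ennreal (?w \<xi> v * ?w \<xi> u * mass \<xi> 1 ^ q))) \<partial>Env) * (\<integral>\<^sup>+\<xi>. ennreal (mass \<xi> l) \<partial>Env) * ?Mq"
      unfolding Y_def by (rule nn_integral_two_weighted_subtrees) (measurable, auto simp: weight_graft mass_graft)
    also have "(\<integral>\<^sup>+\<xi>. level_sum_nn 1 (\<lambda>v. level_sum_nn 1 (\<lambda>u. of_bool (v \<noteq> u)
      * ennreal (?w \<xi> v * ?w \<xi> u * mass \<xi> 1 ^ q))) \<partial>Env) \<le> ?M1"
    proof (rule nn_integral_mono)
      fix \<xi>
      let ?G = "generation \<xi> 1"
      have "(\<Sum>v\<in>?G. \<Sum>u\<in>?G - {v}. ?w \<xi> v * ?w \<xi> u * mass \<xi> 1 ^ q) \<le> (\<Sum>v\<in>?G. \<Sum>u\<in>?G. ?w \<xi> v * ?w \<xi> u * mass \<xi> 1 ^ q)"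
        by (intro sum_mono sum_mono2) auto
      also have "\<dots> = mass \<xi> 1 ^ ?P"
        by (simp add: mass_def sum_product[symmetric] sum_distrib_right[symmetric] mult_ac)
      finally show "level_sum_nn 1 (\<lambda>v. level_sum_nn 1 (\<lambda>u. of_bool (v \<noteq> u)
        * ennreal (?w \<xi> v * ?w \<xi> u * mass \<xi> 1 ^ q))) \<le> ennreal (mass \<xi> 1 ^ ?P)"
        by (subst off[of _ \<xi>]) (auto simp: weight_eq_0 intro: ennreal_leI)
    qed
    finally show ?thesis by (simp add: one mult_right_mono)
  qed
  have "(\<integral>\<^sup>+\<xi>. ennreal (mass \<xi> (1 + l) ^ ?P) \<partial>Env)
      \<le> (\<integral>\<^sup>+\<xi>. D \<xi> + ennreal (2 ^ Suc q) * X \<xi> + ennreal (2 ^ Suc q) * Y \<xi> \<partial>Env)"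
    by (intro nn_integral_mono pw)
  also have "\<dots> = (\<integral>\<^sup>+\<xi>. D \<xi> \<partial>Env) + ennreal (2 ^ Suc q) * (\<integral>\<^sup>+\<xi>. X \<xi> \<partial>Env) + ennreal (2 ^ Suc q) * (\<integral>\<^sup>+\<xi>. Y \<xi> \<partial>Env)"
    by (simp add: nn_integral_add nn_integral_cmult)
  also have "\<dots> \<le> phi ?P 1 * (\<integral>\<^sup>+\<xi>. ennreal (mass \<xi> l ^ ?P) \<partial>Env) + ennreal (2 ^ Suc q) * (?M1 * ?Mq)
      + ennreal (2 ^ Suc q) * (?M1 * ?Mq)"
    unfolding ID using IX IY by (intro add_mono mult_left_mono order_refl) auto
  also have "\<dots> = phi ?P 1 * (\<integral>\<^sup>+\<xi>. ennreal (mass \<xi> l ^ ?P) \<partial>Env) + 2 * 2 ^ Suc q * ?M1 * ?Mq"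
  proof -
    have "ennreal (2 ^ Suc q) = 2 ^ Suc q" by (metis ennreal_numeral ennreal_power zero_le_numeral)
    then show ?thesis by (simp only: add.assoc mult.assoc mult_2 flip: mult_2)
  qed
  finally show ?thesis .
qed

end

text \<open>All that is needed of the reproduction law: the additive martingale has mean one, \<open>\<psi>\<close> is
  negative at the integers from \<open>2\<close> to \<open>P\<close>, and the first generation has a moment of order \<open>P\<close>. The
  application is to \<open>P = 2 * k\<close>.\<close>

locale regular_law = marked_tree_law \<nu> for \<nu> +
  fixes P :: nat
  assumes P2: "2 \<le> P"
    and phi_one: "phi 1 1 = 1"
    and phi_less_one: "\<And>p. 2 \<le> p \<Longrightarrow> p \<le> P \<Longrightarrow> phi p 1 < 1"
    and moment: "(\<integral>\<^sup>+\<xi>. ennreal (mass \<xi> 1 ^ P) \<partial>Env) < \<infinity>"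
begin

lemma phi_1 [simp]: "phi (Suc 0) m = 1"
  using phi_power[of 1 m] phi_one by simp

lemma nn_integral_mass [simp]: "(\<integral>\<^sup>+\<xi>. ennreal (mass \<xi> l) \<partial>Env) = 1"
  using phi_1[of l] unfolding phi_def ennreal_mass by simp

lemma moment_le:
  assumes "p \<le> P" shows "(\<integral>\<^sup>+\<xi>. ennreal (mass \<xi> 1 ^ p) \<partial>Env) < \<infinity>"
proof -
  have "mass \<xi> 1 ^ p \<le> 1 + mass \<xi> 1 ^ P" for \<xi>
  proof (cases "mass \<xi> 1 \<le> 1")
    case True
    then have "mass \<xi> 1 ^ p \<le> 1" by (intro power_le_one) auto
    then show ?thesis using zero_le_power[OF mass_nonneg, of \<xi> 1 P] by linarith
  next
    case False
    then have "mass \<xi> 1 ^ p \<le> mass \<xi> 1 ^ P" using assms by (intro power_increasing) auto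
    then show ?thesis by simp
  qed
  then have "(\<integral>\<^sup>+\<xi>. ennreal (mass \<xi> 1 ^ p) \<partial>Env) \<le> (\<integral>\<^sup>+\<xi>. 1 + ennreal (mass \<xi> 1 ^ P) \<partial>Env)"
    by (intro nn_integral_mono) (metis ennreal_1 ennreal_leI ennreal_plus mass_nonneg zero_le_one zero_le_power)
  also have "\<dots> = 1 + (\<integral>\<^sup>+\<xi>. ennreal (mass \<xi> 1 ^ P) \<partial>Env)"
    by (subst nn_integral_add) auto
  also have "\<dots> < \<infinity>" using moment by simp
  finally show ?thesis .
qed

text \<open>Induction on the order: with the lower moments bounded, the recursion reads \<open>x (l + 1) \<le> r * x
  l + C\<close> with \<open>r < 1\<close>.\<close>

lemma moment_bounded:
  assumes "1 \<le> p" "p \<le> P"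
  shows "\<exists>K::real. 0 \<le> K \<and> (\<forall>l. (\<integral>\<^sup>+\<xi>. ennreal (mass \<xi> l ^ p) \<partial>Env) \<le> ennreal K)"
  using assms
proof (induction p)
  case (Suc p)
  show ?case
  proof (cases p)
    case 0
    then show ?thesis by (intro exI[of _ 1]) simp
  next
    case (Suc q)
    then obtain K where K: "0 \<le> K" "\<And>l. (\<integral>\<^sup>+\<xi>. ennreal (mass \<xi> l ^ Suc q) \<partial>Env) \<le> ennreal K"
      using Suc.IH Suc.prems by auto
    have p: "Suc (Suc q) \<le> P" using Suc Suc.prems by simp
    have ph: "phi (Suc (Suc q)) 1 < 1" using phi_less_one[of "Suc (Suc q)"] p by simp
    then obtain r where r: "phi (Suc (Suc q)) 1 = ennreal r" "0 \<le> r" "r < 1"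
      by (cases "phi (Suc (Suc q)) 1") (auto simp: ennreal_less_one_iff)
    obtain N where N: "(\<integral>\<^sup>+\<xi>. ennreal (mass \<xi> 1 ^ Suc (Suc q)) \<partial>Env) = ennreal N" "0 \<le> N"
      using moment_le[OF p] by (cases "\<integral>\<^sup>+\<xi>. ennreal (mass \<xi> 1 ^ Suc (Suc q)) \<partial>Env") auto
    define C where "C = 2 * 2 ^ Suc q * N * K"
    \<comment> \<open>the fixed point of \<open>x \<mapsto> r * x + C\<close>; at least \<open>1\<close>, the value for generation \<open>0\<close>\<close>
    define K' where "K' = max 1 (C / (1 - r))"
    have K': "r * K' + C \<le> K'" "1 \<le> K'"
    proof -
      have "C / (1 - r) \<le> K'" unfolding K'_def by simp
      then show "r * K' + C \<le> K'" using r by (simp add: field_simps)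
    qed (simp add: K'_def)
    have C: "0 \<le> C" using N K by (simp add: C_def)
    have "(\<integral>\<^sup>+\<xi>. ennreal (mass \<xi> l ^ Suc (Suc q)) \<partial>Env) \<le> ennreal K'" for l
    proof (induction l)
      case 0
      then show ?case using K' ennreal_leI[of 1 K'] by simp
    next
      case (Suc l)
      have "(\<integral>\<^sup>+\<xi>. ennreal (mass \<xi> (1 + l) ^ Suc (Suc q)) \<partial>Env)
          \<le> ennreal r * (\<integral>\<^sup>+\<xi>. ennreal (mass \<xi> l ^ Suc (Suc q)) \<partial>Env)
            + 2 * 2 ^ Suc q * ennreal N * (\<integral>\<^sup>+\<xi>. ennreal (mass \<xi> l ^ Suc q) \<partial>Env)"
        using nn_integral_mass_power_recursion[of l q] unfolding r N by simp
      also have "\<dots> \<le> ennreal r * ennreal K' + 2 * 2 ^ Suc q * ennreal N * ennreal K"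
        by (intro add_mono mult_left_mono Suc.IH K) auto
      also have "2 * 2 ^ Suc q * ennreal N * ennreal K = ennreal C"
        unfolding C_def using N K by (simp add: ennreal_mult flip: ennreal_power)
      also have "ennreal r * ennreal K' + ennreal C = ennreal (r * K' + C)"
        using r K' C by (simp add: ennreal_mult)
      also have "\<dots> \<le> ennreal K'" using K' by (intro ennreal_leI) simp
      finally show ?case by simp
    qed
    then show ?thesis using Suc K' by (intro exI[of _ K']) auto
  qed
qed simp

end

section \<open>The limit of the additive martingale\<close>

definition limit_mass :: "env \<Rightarrow> real" where
  "limit_mass \<xi> = lim (\<lambda>m. mass \<xi> m)"

text \<open>Turns a bound on second moments into one on first moments without square roots of extended
  reals.\<close>

lemma abs_le_square_over_plus:
  fixes d t :: real
  assumes "t > 0" shows "\<bar>d\<bar> \<le> d\<^sup>2 / t + t"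
proof (cases "\<bar>d\<bar> \<le> t")
  case True
  moreover have "0 \<le> d\<^sup>2 / t" using assms by simp
  ultimately show ?thesis by linarith
next
  case False
  then have "t * \<bar>d\<bar> \<le> \<bar>d\<bar> * \<bar>d\<bar>" by (intro mult_right_mono) auto
  also have "\<dots> = d\<^sup>2" by (simp add: power2_eq_square)
  finally have "t * \<bar>d\<bar> \<le> d\<^sup>2" .
  then have "\<bar>d\<bar> \<le> d\<^sup>2 / t" using assms by (simp add: field_simps)
  then show ?thesis using assms by linarith
qed

lemma nn_integral_abs_le_of_square:
  fixes f :: "'a \<Rightarrow> real"
  assumes [measurable]: "f \<in> borel_measurable M" and "emeasure M (space M) = 1"
    and "(\<integral>\<^sup>+x. ennreal ((f x)\<^sup>2) \<partial>M) \<le> ennreal (K * t\<^sup>2)" "t > 0" "K \<ge> 0"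
  shows "(\<integral>\<^sup>+x. ennreal \<bar>f x\<bar> \<partial>M) \<le> ennreal ((K + 1) * t)"
proof -
  have "(\<integral>\<^sup>+x. ennreal \<bar>f x\<bar> \<partial>M) \<le> (\<integral>\<^sup>+x. ennreal (1 / t) * ennreal ((f x)\<^sup>2) + ennreal t \<partial>M)"
  proof (rule nn_integral_mono)
    fix x
    have "ennreal \<bar>f x\<bar> \<le> ennreal (1 / t * (f x)\<^sup>2 + t)"
      using abs_le_square_over_plus[OF \<open>t > 0\<close>, of "f x"] by (intro ennreal_leI) simp
    also have "\<dots> = ennreal (1 / t) * ennreal ((f x)\<^sup>2) + ennreal t"
      using \<open>t > 0\<close> by (simp add: ennreal_mult[symmetric] ennreal_plus[symmetric] del: ennreal_plus)
    finally show "ennreal \<bar>f x\<bar> \<le> ennreal (1 / t) * ennreal ((f x)\<^sup>2) + ennreal t" .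
  qed
  also have "\<dots> = ennreal (1 / t) * (\<integral>\<^sup>+x. ennreal ((f x)\<^sup>2) \<partial>M) + ennreal t"
    by (subst nn_integral_add) (simp_all add: nn_integral_cmult assms(2))
  also have "\<dots> \<le> ennreal (1 / t) * ennreal (K * t\<^sup>2) + ennreal t"
    using assms(3) by (intro add_right_mono mult_left_mono) auto
  also have "\<dots> = ennreal (1 / t * (K * t\<^sup>2) + t)"
    using assms(4,5) by (simp add: ennreal_mult[symmetric] ennreal_plus[symmetric] del: ennreal_plus)
  also have "1 / t * (K * t\<^sup>2) + t = (K + 1) * t"
    using assms(4) by (simp add: power2_eq_square field_simps)
  finally show ?thesis .
qed

lemma AE_summable_of_nn_integral_geometric:
  fixes f :: "nat \<Rightarrow> 'a \<Rightarrow> real"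
  assumes [measurable]: "\<And>m. f m \<in> borel_measurable M"
    and le: "\<And>m. (\<integral>\<^sup>+x. ennreal \<bar>f m x\<bar> \<partial>M) \<le> ennreal (K * t ^ m)" and "0 < t" "t < 1" "0 \<le> K"
  shows "AE x in M. summable (\<lambda>m. \<bar>f m x\<bar>)"
proof -
  have "(\<integral>\<^sup>+x. (\<Sum>m. ennreal \<bar>f m x\<bar>) \<partial>M) = (\<Sum>m. \<integral>\<^sup>+x. ennreal \<bar>f m x\<bar> \<partial>M)"
    by (rule nn_integral_suminf) auto
  also have "\<dots> \<le> (\<Sum>m. ennreal (K * t ^ m))"
    by (intro suminf_le le) auto
  also have "\<dots> = ennreal (\<Sum>m. K * t ^ m)"
    using assms by (intro suminf_ennreal2) (auto intro!: summable_mult summable_geometric)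
  also have "\<dots> < \<infinity>" by simp
  finally have "AE x in M. (\<Sum>m. ennreal \<bar>f m x\<bar>) \<noteq> \<infinity>"
    by (intro nn_integral_PInf_AE) auto
  then show ?thesis
    by eventually_elim (rule summable_suminf_not_top, auto)
qed

text \<open>The graph of \<open>y ^ Suc p\<close> lies above its tangent at \<open>x\<close>.\<close>

lemma young_inequality_power:
  fixes x y :: real
  assumes "0 \<le> x" "0 \<le> y"
  shows "real (Suc p) * (x ^ p * y) \<le> y ^ Suc p + real p * x ^ Suc p"
proof (cases "x = 0")
  case True
  then show ?thesis using assms by (cases p) auto
next
  case False
  then have x: "x > 0" using assms by simp
  have "1 + real (Suc p) * (y / x - 1) \<le> (1 + (y / x - 1)) ^ Suc p"
    using assms x by (intro Bernoulli_inequality) simp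
  also have "\<dots> = y ^ Suc p / x ^ Suc p" by (simp add: power_divide)
  finally have "(1 + real (Suc p) * (y / x - 1)) * x ^ Suc p \<le> y ^ Suc p"
    using x by (simp add: pos_le_divide_eq)
  moreover have "(1 + real (Suc p) * (y / x - 1)) * x ^ Suc p
      = real (Suc p) * (x ^ p * y) - real p * x ^ Suc p"
    using x by (simp add: field_simps)
  ultimately show ?thesis by linarith
qed

context regular_law
begin

definition mass_bound :: "nat \<Rightarrow> real" where
  "mass_bound p = (SOME K. 0 \<le> K \<and> (\<forall>l. (\<integral>\<^sup>+\<xi>. ennreal (mass \<xi> l ^ p) \<partial>Env) \<le> ennreal K))"

lemma mass_bound:
  assumes "1 \<le> p" "p \<le> P"
  shows "0 \<le> mass_bound p" "(\<integral>\<^sup>+\<xi>. ennreal (mass \<xi> l ^ p) \<partial>Env) \<le> ennreal (mass_bound p)"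
  using someI_ex[OF moment_bounded[OF assms]] unfolding mass_bound_def by auto

text \<open>The lower bound \<open>1/4\<close> keeps the rate positive, so that it can be divided by.\<close>

definition rate :: real where
  "rate = sqrt (max (1/4) (enn2real (phi 2 1)))"

lemma phi_2_le: "phi 2 m \<le> ennreal (rate ^ m * rate ^ m)"
  and rate: "0 < rate" "rate < 1"
proof -
  have "phi 2 1 < 1" using phi_less_one[of 2] P2 by simp
  then obtain r where r: "phi 2 1 = ennreal r" "0 \<le> r" "r < 1"
    by (cases "phi 2 1") (auto simp: ennreal_less_one_iff)
  have rr: "rate\<^sup>2 = max (1/4) r" unfolding rate_def using r by simp
  show "0 < rate" unfolding rate_def by simp
  show "rate < 1" unfolding rate_def using r by simp
  have "phi 2 m = ennreal (r ^ m)" using phi_power[of 2 m] r by (simp add: ennreal_power)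
  also have "\<dots> \<le> ennreal ((rate\<^sup>2) ^ m)" using r rr by (intro ennreal_leI power_mono) auto
  finally show "phi 2 m \<le> ennreal (rate ^ m * rate ^ m)"
    by (simp add: power2_eq_square power_mult_distrib)
qed

text \<open>The centred sum has variance \<open>phi 2 m\<close> times the variance of \<open>\<Phi>\<close>, since the off-diagonal terms
  cancel. As integrals of nonnegative functions cannot be subtracted, the square is expanded with
  the mixed term moved to the left-hand side.\<close>

lemma centered_square:
  fixes \<Phi> :: "env \<Rightarrow> real"
  assumes [measurable]: "\<Phi> \<in> borel_measurable Env" and nn: "\<And>\<xi>. 0 \<le> \<Phi> \<xi>"
    and c: "(\<integral>\<^sup>+\<xi>. ennreal (\<Phi> \<xi>) \<partial>Env) = ennreal c" "0 \<le> c"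
    and fin: "(\<integral>\<^sup>+\<xi>. ennreal ((\<Phi> \<xi>)\<^sup>2) \<partial>Env) \<le> ennreal K" "0 \<le> K"
  shows "(\<integral>\<^sup>+\<xi>. ennreal (((\<Sum>v\<in>generation \<xi> m. weight \<xi> v * \<Phi> (subtree v \<xi>)) - c * mass \<xi> m)\<^sup>2) \<partial>Env)
     \<le> ennreal (K * (rate ^ m * rate ^ m))"
proof -
  define Y where "Y \<xi> = (\<Sum>v\<in>generation \<xi> m. weight \<xi> v * \<Phi> (subtree v \<xi>))" for \<xi>
  have eY: "ennreal (Y \<xi>) = level_sum_nn m (\<lambda>v. ennreal (weight \<xi> v) * ennreal (\<Phi> (subtree v \<xi>)))" for \<xi>
    unfolding Y_def using level_sum_nn_weight[of "\<lambda>v. \<Phi> (subtree v \<xi>)" 1 m \<xi>] nn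
    by (simp add: ennreal_mult)
  have Y0: "0 \<le> Y \<xi>" for \<xi> unfolding Y_def using nn by (intro sum_nonneg mult_nonneg_nonneg) auto
  have [measurable]: "Y \<in> borel_measurable Env"
  proof -
    have "(\<lambda>\<xi>. enn2real (ennreal (Y \<xi>))) \<in> borel_measurable Env" unfolding eY by measurable
    then show ?thesis using Y0 by simp
  qed
  define b where "b = (\<integral>\<^sup>+\<xi>. level_sum_nn m (\<lambda>v. level_sum_nn m (\<lambda>w. of_bool (v \<noteq> w) * ennreal (weight \<xi> v * weight \<xi> w))) \<partial>Env)"
  have YY: "(\<integral>\<^sup>+\<xi>. ennreal ((Y \<xi>)\<^sup>2) \<partial>Env) = phi 2 m * (\<integral>\<^sup>+\<xi>. ennreal ((\<Phi> \<xi>)\<^sup>2) \<partial>Env) + b * ennreal c * ennreal c"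
    using weighted_square_split[of "\<lambda>\<xi>. ennreal (\<Phi> \<xi>)" "\<lambda>\<xi>. ennreal (\<Phi> \<xi>)" m, folded b_def] Y0 nn
    by (simp add: eY[symmetric] c power2_eq_square ennreal_mult)
  have YW: "(\<integral>\<^sup>+\<xi>. ennreal (Y \<xi> * mass \<xi> m) \<partial>Env) = phi 2 m * ennreal c + b * ennreal c"
    using weighted_square_split[of "\<lambda>\<xi>. ennreal (\<Phi> \<xi>)" "\<lambda>\<xi>. 1" m, folded b_def] Y0
    by (simp add: eY[symmetric] c ennreal_mult ennreal_mass)
  have WW: "(\<integral>\<^sup>+\<xi>. ennreal ((mass \<xi> m)\<^sup>2) \<partial>Env) = phi 2 m + b"
    using weighted_square_split[of "\<lambda>\<xi>. 1" "\<lambda>\<xi>. 1" m, folded b_def]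
    by (simp add: power2_eq_square ennreal_mult ennreal_mass)
  have "phi 2 m + b \<le> ennreal (mass_bound 2)"
    using mass_bound(2)[of 2 m] P2 unfolding WW by simp
  also have "\<dots> < \<infinity>" by simp
  finally have "phi 2 m + b < \<infinity>" .
  then obtain f b' where f: "phi 2 m = ennreal f" "0 \<le> f" and b': "b = ennreal b'" "0 \<le> b'"
    by (cases "phi 2 m"; cases b) auto
  obtain S where S: "(\<integral>\<^sup>+\<xi>. ennreal ((\<Phi> \<xi>)\<^sup>2) \<partial>Env) = ennreal S" "0 \<le> S" "S \<le> K"
    using fin by (cases "\<integral>\<^sup>+\<xi>. ennreal ((\<Phi> \<xi>)\<^sup>2) \<partial>Env") (auto simp: top_unique)
  have "(\<integral>\<^sup>+\<xi>. ennreal ((Y \<xi> - c * mass \<xi> m)\<^sup>2) \<partial>Env) + ennreal (2 * c) * (\<integral>\<^sup>+\<xi>. ennreal (Y \<xi> * mass \<xi> m) \<partial>Env)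
      = (\<integral>\<^sup>+\<xi>. ennreal ((Y \<xi> - c * mass \<xi> m)\<^sup>2) + ennreal (2 * c) * ennreal (Y \<xi> * mass \<xi> m) \<partial>Env)"
    by (subst nn_integral_add) (auto simp: nn_integral_cmult)
  also have "\<dots> = (\<integral>\<^sup>+\<xi>. ennreal ((Y \<xi>)\<^sup>2) + ennreal (c\<^sup>2) * ennreal ((mass \<xi> m)\<^sup>2) \<partial>Env)"
  proof (rule nn_integral_cong)
    fix \<xi>
    have "(Y \<xi> - c * mass \<xi> m)\<^sup>2 + 2 * c * (Y \<xi> * mass \<xi> m) = (Y \<xi>)\<^sup>2 + c\<^sup>2 * (mass \<xi> m)\<^sup>2"
      by (simp add: power2_eq_square algebra_simps)
    then show "ennreal ((Y \<xi> - c * mass \<xi> m)\<^sup>2) + ennreal (2 * c) * ennreal (Y \<xi> * mass \<xi> m)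
      = ennreal ((Y \<xi>)\<^sup>2) + ennreal (c\<^sup>2) * ennreal ((mass \<xi> m)\<^sup>2)"
      using c(2) Y0[of \<xi>]
      by (simp add: ennreal_mult[symmetric] ennreal_plus[symmetric] del: ennreal_plus)
  qed
  also have "\<dots> = (\<integral>\<^sup>+\<xi>. ennreal ((Y \<xi>)\<^sup>2) \<partial>Env) + ennreal (c\<^sup>2) * (\<integral>\<^sup>+\<xi>. ennreal ((mass \<xi> m)\<^sup>2) \<partial>Env)"
    by (subst nn_integral_add) (auto simp: nn_integral_cmult)
  finally have eq: "(\<integral>\<^sup>+\<xi>. ennreal ((Y \<xi> - c * mass \<xi> m)\<^sup>2) \<partial>Env) + ennreal (2 * c * (f * c + b' * c))
      = ennreal (f * S + b' * c * c + c\<^sup>2 * (f + b'))"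
    unfolding YY YW WW S f b' using c f b' S
    by (simp add: ennreal_mult[symmetric] ennreal_plus[symmetric] del: ennreal_plus)
  then obtain X where X: "(\<integral>\<^sup>+\<xi>. ennreal ((Y \<xi> - c * mass \<xi> m)\<^sup>2) \<partial>Env) = ennreal X" "0 \<le> X"
    by (cases "\<integral>\<^sup>+\<xi>. ennreal ((Y \<xi> - c * mass \<xi> m)\<^sup>2) \<partial>Env") auto
  have "X + 2 * c * (f * c + b' * c) = f * S + b' * c * c + c\<^sup>2 * (f + b')"
    using eq c f b' S X by (simp add: ennreal_plus[symmetric] del: ennreal_plus)
  then have "X = f * (S - c\<^sup>2)" by (simp add: power2_eq_square algebra_simps)
  also have "\<dots> \<le> f * K" using f S by (intro mult_left_mono) (auto intro: order_trans[of _ S])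
  also have "f * K \<le> (rate ^ m * rate ^ m) * K"
    using phi_2_le[of m] rate f fin by (intro mult_right_mono) auto
  finally have "X \<le> K * (rate ^ m * rate ^ m)" by (simp add: mult.commute)
  then show ?thesis using X unfolding Y_def by (simp add: ennreal_leI)
qed

lemma mass_increment_square:
  "(\<integral>\<^sup>+\<xi>. ennreal ((mass \<xi> (m + j) - mass \<xi> m)\<^sup>2) \<partial>Env) \<le> ennreal (mass_bound 2 * (rate ^ m * rate ^ m))"
  using centered_square[of "\<lambda>\<xi>. mass \<xi> j" 1 "mass_bound 2" m] mass_bound[of 2] P2
  by (simp add: mass_append)

lemma AE_mass_convergent: "AE \<xi> in Env. (\<lambda>m. mass \<xi> m) \<longlonglongrightarrow> limit_mass \<xi>"
proof -
  have "(\<integral>\<^sup>+\<xi>. ennreal \<bar>mass \<xi> (Suc m) - mass \<xi> m\<bar> \<partial>Env) \<le> ennreal ((mass_bound 2 + 1) * rate ^ m)" for m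
    using mass_increment_square[of m 1] mass_bound(1)[of 2] P2 rate
    by (intro nn_integral_abs_le_of_square) (auto simp: power2_eq_square)
  then have "AE \<xi> in Env. summable (\<lambda>m. \<bar>mass \<xi> (Suc m) - mass \<xi> m\<bar>)"
    using rate mass_bound(1)[of 2] P2
    by (intro AE_summable_of_nn_integral_geometric[where K="mass_bound 2 + 1" and t=rate]) auto
  then show ?thesis
  proof eventually_elim
    case (elim \<xi>)
    then have "summable (\<lambda>m. mass \<xi> (Suc m) - mass \<xi> m)"
      by (rule summable_rabs_cancel)
    then have "convergent (\<lambda>n. \<Sum>m<n. mass \<xi> (Suc m) - mass \<xi> m)"
      by (simp add: summable_iff_convergent)
    then have "convergent (\<lambda>n. mass \<xi> n - mass \<xi> 0)" by (simp add: sum_lessThan_telescope)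
    then have "convergent (\<lambda>n. mass \<xi> n)" using convergent_diff_const_right_iff by blast
    then show ?case unfolding limit_mass_def by (rule convergent_LIMSEQ_iff[THEN iffD1])
  qed
qed

lemma measurable_limit_mass [measurable]: "limit_mass \<in> borel_measurable Env"
  unfolding limit_mass_def[abs_def] by (rule borel_measurable_lim_metric) measurable

lemma AE_limit_mass_nonneg: "AE \<xi> in Env. 0 \<le> limit_mass \<xi>"
  using AE_mass_convergent by eventually_elim (rule LIMSEQ_le_const, auto)

lemma limit_mass_square:
  "(\<integral>\<^sup>+\<xi>. ennreal ((limit_mass \<xi> - mass \<xi> m)\<^sup>2) \<partial>Env) \<le> ennreal (mass_bound 2 * (rate ^ m * rate ^ m))"
proof -
  have "(\<integral>\<^sup>+\<xi>. ennreal ((limit_mass \<xi> - mass \<xi> m)\<^sup>2) \<partial>Env)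
      = (\<integral>\<^sup>+\<xi>. liminf (\<lambda>j. ennreal ((mass \<xi> (m + j) - mass \<xi> m)\<^sup>2)) \<partial>Env)"
  proof (rule nn_integral_cong_AE, use AE_mass_convergent in eventually_elim)
    case (elim \<xi>)
    have "(\<lambda>j. mass \<xi> (m + j)) \<longlonglongrightarrow> limit_mass \<xi>"
      using LIMSEQ_ignore_initial_segment[OF elim, of m] by (simp add: add.commute)
    then have "(\<lambda>j. ennreal ((mass \<xi> (m + j) - mass \<xi> m)\<^sup>2)) \<longlonglongrightarrow> ennreal ((limit_mass \<xi> - mass \<xi> m)\<^sup>2)"
      by (intro tendsto_intros)
    then show ?case by (rule lim_imp_Liminf[OF trivial_limit_sequentially, symmetric])
  qed
  also have "\<dots> \<le> liminf (\<lambda>j. \<integral>\<^sup>+\<xi>. ennreal ((mass \<xi> (m + j) - mass \<xi> m)\<^sup>2) \<partial>Env)"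
    by (rule nn_integral_liminf) measurable
  also have "\<dots> \<le> ennreal (mass_bound 2 * (rate ^ m * rate ^ m))"
    by (intro Liminf_le[OF trivial_limit_sequentially] always_eventually allI mass_increment_square)
  finally show ?thesis .
qed

lemma limit_mass_abs:
  "(\<integral>\<^sup>+\<xi>. ennreal \<bar>limit_mass \<xi> - mass \<xi> m\<bar> \<partial>Env) \<le> ennreal ((mass_bound 2 + 1) * rate ^ m)"
  using limit_mass_square[of m] mass_bound(1)[of 2] P2 rate
  by (intro nn_integral_abs_le_of_square) (auto simp: power2_eq_square)

text \<open>Convergence in mean preserves the expectation.\<close>

lemma nn_integral_limit_mass: "(\<integral>\<^sup>+\<xi>. ennreal (limit_mass \<xi>) \<partial>Env) = 1"
proof -
  define x where "x = (\<integral>\<^sup>+\<xi>. ennreal (limit_mass \<xi>) \<partial>Env)"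
  have t: "(\<lambda>m. ennreal ((mass_bound 2 + 1) * rate ^ m)) \<longlonglongrightarrow> ennreal ((mass_bound 2 + 1) * 0)"
    using rate by (intro tendsto_ennrealI tendsto_mult tendsto_const LIMSEQ_power_zero) auto
  have up: "x \<le> 1 + ennreal ((mass_bound 2 + 1) * rate ^ m)" for m
  proof -
    have "x \<le> (\<integral>\<^sup>+\<xi>. ennreal (mass \<xi> m) + ennreal \<bar>limit_mass \<xi> - mass \<xi> m\<bar> \<partial>Env)"
      unfolding x_def
    proof (rule nn_integral_mono)
      fix \<xi>
      have "ennreal (limit_mass \<xi>) \<le> ennreal (mass \<xi> m + \<bar>limit_mass \<xi> - mass \<xi> m\<bar>)"
        by (intro ennreal_leI) auto
      then show "ennreal (limit_mass \<xi>) \<le> ennreal (mass \<xi> m) + ennreal \<bar>limit_mass \<xi> - mass \<xi> m\<bar>"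
        by simp
    qed
    also have "\<dots> \<le> 1 + ennreal ((mass_bound 2 + 1) * rate ^ m)"
      by (subst nn_integral_add) (auto intro!: limit_mass_abs)
    finally show ?thesis .
  qed
  have low: "1 \<le> x + ennreal ((mass_bound 2 + 1) * rate ^ m)" for m
  proof -
    have "1 = (\<integral>\<^sup>+\<xi>. ennreal (mass \<xi> m) \<partial>Env)" by simp
    also have "\<dots> \<le> (\<integral>\<^sup>+\<xi>. ennreal (limit_mass \<xi>) + ennreal \<bar>limit_mass \<xi> - mass \<xi> m\<bar> \<partial>Env)"
    proof (rule nn_integral_mono_AE, use AE_limit_mass_nonneg in eventually_elim)
      case (elim \<xi>)
      then have "ennreal (mass \<xi> m) \<le> ennreal (limit_mass \<xi> + \<bar>limit_mass \<xi> - mass \<xi> m\<bar>)"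
        by (intro ennreal_leI) auto
      then show ?case using elim by simp
    qed
    also have "\<dots> \<le> x + ennreal ((mass_bound 2 + 1) * rate ^ m)"
      unfolding x_def by (subst nn_integral_add) (auto intro!: limit_mass_abs add_left_mono)
    finally show ?thesis .
  qed
  have "x \<le> 1 + ennreal ((mass_bound 2 + 1) * 0)"
    by (rule LIMSEQ_le_const[OF tendsto_add[OF tendsto_const t]]) (intro exI[of _ 0] allI impI up)
  moreover have "1 \<le> x + ennreal ((mass_bound 2 + 1) * 0)"
    by (rule LIMSEQ_le_const[OF tendsto_add[OF tendsto_const t]]) (intro exI[of _ 0] allI impI low)
  ultimately have "x = 1" by (intro antisym) simp_all
  then show ?thesis by (simp only: x_def)
qed

lemma nn_integral_limit_mass_power:
  assumes "1 \<le> p" "p \<le> P"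
  shows "(\<integral>\<^sup>+\<xi>. ennreal (limit_mass \<xi> ^ p) \<partial>Env) \<le> ennreal (mass_bound p)"
proof -
  have "(\<integral>\<^sup>+\<xi>. ennreal (limit_mass \<xi> ^ p) \<partial>Env) = (\<integral>\<^sup>+\<xi>. liminf (\<lambda>m. ennreal (mass \<xi> m ^ p)) \<partial>Env)"
  proof (rule nn_integral_cong_AE, use AE_mass_convergent in eventually_elim)
    case (elim \<xi>)
    then have "(\<lambda>m. ennreal (mass \<xi> m ^ p)) \<longlonglongrightarrow> ennreal (limit_mass \<xi> ^ p)"
      by (intro tendsto_intros)
    then show ?case by (rule lim_imp_Liminf[OF trivial_limit_sequentially, symmetric])
  qed
  also have "\<dots> \<le> liminf (\<lambda>m. \<integral>\<^sup>+\<xi>. ennreal (mass \<xi> m ^ p) \<partial>Env)"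
    by (rule nn_integral_liminf) measurable
  also have "\<dots> \<le> ennreal (mass_bound p)"
    by (intro Liminf_le[OF trivial_limit_sequentially] always_eventually allI mass_bound assms)
  finally show ?thesis .
qed

text \<open>The mass that the limit measure puts on the descendants of a vertex.\<close>

definition limit_measure :: "env \<Rightarrow> nat list \<Rightarrow> real" where
  "limit_measure \<xi> v = weight \<xi> v * limit_mass (subtree v \<xi>)"

lemma measurable_limit_measure [measurable]: "(\<lambda>\<xi>. limit_measure \<xi> v) \<in> borel_measurable Env"
  unfolding limit_measure_def by measurable

text \<open>The almost sure properties of an environment that the deterministic arguments on tuples use:
  every subtree has a limiting mass, and the limit measure charges no single ray.\<close>

definition regular_env :: "env \<Rightarrow> bool" where
  "regular_env \<xi> \<longleftrightarrow> (\<forall>v. (\<lambda>m. mass (subtree v \<xi>) m) \<longlonglongrightarrow> limit_mass (subtree v \<xi>)) \<and>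
     (\<lambda>m. \<Sum>v\<in>generation \<xi> m. (limit_measure \<xi> v)\<^sup>2) \<longlonglongrightarrow> 0"

lemma regular_env_limit_nonneg:
  assumes "regular_env \<xi>" shows "0 \<le> limit_mass (subtree v \<xi>)"
proof (rule LIMSEQ_le_const)
  show "(\<lambda>m. mass (subtree v \<xi>) m) \<longlonglongrightarrow> limit_mass (subtree v \<xi>)"
    using assms unfolding regular_env_def by blast
qed auto

lemma regular_env_limit_measure_nonneg: "regular_env \<xi> \<Longrightarrow> 0 \<le> limit_measure \<xi> v"
  unfolding limit_measure_def by (simp add: regular_env_limit_nonneg)

lemma limit_mass_split:
  assumes "regular_env \<xi>"
  shows "limit_mass \<xi> = (\<Sum>v\<in>generation \<xi> m. limit_measure \<xi> v)"
proof (rule LIMSEQ_unique)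
  have "(\<lambda>j. mass \<xi> (m + j)) \<longlonglongrightarrow> (\<Sum>v\<in>generation \<xi> m. weight \<xi> v * limit_mass (subtree v \<xi>))"
    unfolding mass_append using assms by (intro tendsto_intros) (auto simp: regular_env_def)
  then show "(\<lambda>j. mass \<xi> (m + j)) \<longlonglongrightarrow> (\<Sum>v\<in>generation \<xi> m. limit_measure \<xi> v)"
    by (simp add: limit_measure_def)
  have "(\<lambda>j. mass \<xi> j) \<longlonglongrightarrow> limit_mass \<xi>"
    using assms unfolding regular_env_def by (metis subtree_Nil)
  then show "(\<lambda>j. mass \<xi> (m + j)) \<longlonglongrightarrow> limit_mass \<xi>"
    using LIMSEQ_ignore_initial_segment[of _ _ m] by (simp add: add.commute)
qed

lemma ennreal_sum_limit_measure_square: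
  "ennreal (\<Sum>v\<in>generation \<xi> m. (limit_measure \<xi> v)\<^sup>2)
    = level_sum_nn m (\<lambda>v. ennreal (weight \<xi> v ^ 2) * ennreal ((limit_mass (subtree v \<xi>))\<^sup>2))"
  using level_sum_nn_weight[of "\<lambda>v. (limit_mass (subtree v \<xi>))\<^sup>2" 2 m \<xi>]
  by (simp add: limit_measure_def power_mult_distrib ennreal_mult)

text \<open>By the branching property the expectation is \<open>phi 2 m\<close> times the second moment of the limiting
  mass.\<close>

lemma nn_integral_sum_limit_measure_square:
  "(\<integral>\<^sup>+\<xi>. ennreal (\<Sum>v\<in>generation \<xi> m. (limit_measure \<xi> v)\<^sup>2) \<partial>Env) \<le> ennreal (mass_bound 2 * (rate ^ m * rate ^ m))"
proof -
  have "(\<integral>\<^sup>+\<xi>. ennreal (\<Sum>v\<in>generation \<xi> m. (limit_measure \<xi> v)\<^sup>2) \<partial>Env)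
      = phi 2 m * (\<integral>\<^sup>+\<xi>. ennreal ((limit_mass \<xi>)\<^sup>2) \<partial>Env)"
    unfolding ennreal_sum_limit_measure_square by (rule nn_integral_weighted_subtree) measurable
  also have "\<dots> \<le> ennreal (rate ^ m * rate ^ m) * ennreal (mass_bound 2)"
    using P2 by (intro mult_mono phi_2_le nn_integral_limit_mass_power) auto
  finally show ?thesis using rate mass_bound(1)[of 2] P2 by (simp add: ennreal_mult[symmetric] mult.commute)
qed

lemma measurable_sum_limit_measure_square [measurable]:
  "(\<lambda>\<xi>. \<Sum>v\<in>generation \<xi> m. (limit_measure \<xi> v)\<^sup>2) \<in> borel_measurable Env"
proof -
  have "(\<lambda>\<xi>. enn2real (ennreal (\<Sum>v\<in>generation \<xi> m. (limit_measure \<xi> v)\<^sup>2))) \<in> borel_measurable Env"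
    unfolding ennreal_sum_limit_measure_square by measurable
  then show ?thesis by (simp add: sum_nonneg)
qed

lemma AE_regular_env: "AE \<xi> in Env. regular_env \<xi>"
proof -
  have "(\<integral>\<^sup>+\<xi>. ennreal \<bar>\<Sum>v\<in>generation \<xi> m. (limit_measure \<xi> v)\<^sup>2\<bar> \<partial>Env) \<le> ennreal (mass_bound 2 * (rate * rate) ^ m)" for m
    using nn_integral_sum_limit_measure_square[of m] by (simp add: sum_nonneg power_mult_distrib)
  moreover have "rate * rate < 1" using rate mult_strict_mono[of rate 1 rate 1] by simp
  ultimately have "AE \<xi> in Env. summable (\<lambda>m. \<bar>\<Sum>v\<in>generation \<xi> m. (limit_measure \<xi> v)\<^sup>2\<bar>)"
    using rate mass_bound(1)[of 2] P2
    by (intro AE_summable_of_nn_integral_geometric[where K="mass_bound 2" and t="rate * rate"]) auto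
  with AE_subtree[OF AE_mass_convergent] show ?thesis
  proof eventually_elim
    case (elim \<xi>)
    then show ?case unfolding regular_env_def
      using summable_LIMSEQ_zero[OF elim(2)] tendsto_rabs_zero_iff by blast
  qed
qed

text \<open>The mass is the conditional expectation of its limit, so its powers are bounded by those of
  the limit. Instead of conditioning, the tangent inequality is applied to \<open>mass ^ P\<close>, the mixed
  term being computed by the branching property.\<close>

lemma nn_integral_mass_power_le_limit:
  "(\<integral>\<^sup>+\<xi>. ennreal (mass \<xi> m ^ P) \<partial>Env) \<le> (\<integral>\<^sup>+\<xi>. ennreal (limit_mass \<xi> ^ P) \<partial>Env)"
proof -
  obtain p where p: "P = Suc p" using P2 by (cases P) auto
  have "(\<integral>\<^sup>+\<xi>. ennreal (mass \<xi> m ^ p * limit_mass \<xi>) \<partial>Env)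
      = (\<integral>\<^sup>+\<xi>. level_sum_nn m (\<lambda>v. ennreal (weight \<xi> v * mass \<xi> m ^ p) * ennreal (limit_mass (subtree v \<xi>))) \<partial>Env)"
  proof (rule nn_integral_cong_AE, use AE_regular_env in eventually_elim)
    case (elim \<xi>)
    have "ennreal (mass \<xi> m ^ p * limit_mass \<xi>)
        = ennreal (\<Sum>v\<in>generation \<xi> m. weight \<xi> v ^ 1 * (mass \<xi> m ^ p * limit_mass (subtree v \<xi>)))"
      using limit_mass_split[OF elim, of m] by (simp add: limit_measure_def sum_distrib_left mult_ac)
    also have "\<dots> = level_sum_nn m (\<lambda>v. ennreal (weight \<xi> v ^ 1 * (mass \<xi> m ^ p * limit_mass (subtree v \<xi>))))"
      using regular_env_limit_nonneg[OF elim] by (intro level_sum_nn_weight[symmetric]) auto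
    also have "\<dots> = level_sum_nn m (\<lambda>v. ennreal (weight \<xi> v * mass \<xi> m ^ p) * ennreal (limit_mass (subtree v \<xi>)))"
      using regular_env_limit_nonneg[OF elim]
      by (intro level_sum_nn_cong) (simp add: ennreal_mult[symmetric] mult.assoc)
    finally show ?case .
  qed
  also have "\<dots> = (\<integral>\<^sup>+\<xi>. level_sum_nn m (\<lambda>v. ennreal (weight \<xi> v * mass \<xi> m ^ p)) \<partial>Env) * 1"
    unfolding nn_integral_limit_mass[symmetric]
    by (rule many_to_one_subtree) (measurable, simp add: weight_graft mass_graft)
  also have "\<dots> = (\<integral>\<^sup>+\<xi>. ennreal (mass \<xi> m ^ Suc p) \<partial>Env)"
    by (simp add: ennreal_mult level_sum_nn_multc ennreal_mass)
  \<comment> \<open>the substitute for conditioning on the first \<open>m\<close> generations\<close>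
  finally have key: "(\<integral>\<^sup>+\<xi>. ennreal (mass \<xi> m ^ p * limit_mass \<xi>) \<partial>Env) = (\<integral>\<^sup>+\<xi>. ennreal (mass \<xi> m ^ Suc p) \<partial>Env)" .
  define A where "A = (\<integral>\<^sup>+\<xi>. ennreal (mass \<xi> m ^ Suc p) \<partial>Env)"
  define B where "B = (\<integral>\<^sup>+\<xi>. ennreal (limit_mass \<xi> ^ Suc p) \<partial>Env)"
  have "ennreal (real (Suc p)) * A = (\<integral>\<^sup>+\<xi>. ennreal (real (Suc p)) * ennreal (mass \<xi> m ^ p * limit_mass \<xi>) \<partial>Env)"
    unfolding A_def key[symmetric] by (subst nn_integral_cmult) auto
  also have "\<dots> \<le> (\<integral>\<^sup>+\<xi>. ennreal (limit_mass \<xi> ^ Suc p) + ennreal (real p) * ennreal (mass \<xi> m ^ Suc p) \<partial>Env)"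
  proof (rule nn_integral_mono_AE, use AE_limit_mass_nonneg in eventually_elim)
    case (elim \<xi>)
    have "ennreal (real (Suc p) * (mass \<xi> m ^ p * limit_mass \<xi>)) \<le> ennreal (limit_mass \<xi> ^ Suc p + real p * mass \<xi> m ^ Suc p)"
      using elim by (intro ennreal_leI young_inequality_power) auto
    then show ?case using elim
      by (simp add: ennreal_mult[symmetric] ennreal_plus[symmetric] del: ennreal_plus)
  qed
  also have "\<dots> = B + ennreal (real p) * A"
    unfolding A_def B_def by (subst nn_integral_add) (auto simp: nn_integral_cmult)
  finally have le: "ennreal (real (Suc p)) * A \<le> B + ennreal (real p) * A" .
  have "A \<noteq> \<infinity>" "B \<noteq> \<infinity>"
    using mass_bound(2)[of P m] nn_integral_limit_mass_power[of P] P2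
    unfolding A_def B_def p by (auto simp: top_unique)
  then obtain a b where ab: "A = ennreal a" "B = ennreal b" "0 \<le> a" "0 \<le> b"
    by (cases A; cases B) auto
  have "ennreal (real (Suc p) * a) = ennreal (real (Suc p)) * A"
    using ab by (subst ennreal_mult) auto
  also have "\<dots> \<le> B + ennreal (real p) * A" by (rule le)
  also have "\<dots> = ennreal (b + real p * a)"
    using ab by (subst ennreal_plus) (auto simp: ennreal_mult)
  finally have "real (Suc p) * a \<le> b + real p * a"
    using ab by (subst (asm) ennreal_le_iff) auto
  then have "A \<le> B" unfolding ab by (intro ennreal_leI) (simp add: algebra_simps)
  then show ?thesis unfolding A_def B_def p .
qed

text \<open>Scheffe: almost sure convergence together with convergence of the norms, whose upper bound is
  the preceding lemma.\<close>

lemma mass_power_convergence_L1: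
  "(\<lambda>m. \<integral>\<^sup>+\<xi>. ennreal \<bar>mass \<xi> m ^ P - limit_mass \<xi> ^ P\<bar> \<partial>Env) \<longlonglongrightarrow> 0"
proof -
  have abs: "(\<integral>\<^sup>+\<xi>. ennreal (norm (limit_mass \<xi> ^ P)) \<partial>Env) = (\<integral>\<^sup>+\<xi>. ennreal (limit_mass \<xi> ^ P) \<partial>Env)"
    by (rule nn_integral_cong_AE) (use AE_limit_mass_nonneg in eventually_elim, simp)
  have "(\<lambda>m. \<integral>\<^sup>+\<xi>. ennreal (norm (mass \<xi> m ^ P - limit_mass \<xi> ^ P)) \<partial>Env) \<longlonglongrightarrow> 0"
  proof (rule Scheffe_lemma2)
    show "integrable Env (\<lambda>\<xi>. limit_mass \<xi> ^ P)"
    proof (rule integrableI_bounded)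
      show "(\<integral>\<^sup>+\<xi>. ennreal (norm (limit_mass \<xi> ^ P)) \<partial>Env) < \<infinity>"
        unfolding abs using nn_integral_limit_mass_power[of P] P2 by (auto intro: le_less_trans)
    qed measurable
    show "AE \<xi> in Env. (\<lambda>m. mass \<xi> m ^ P) \<longlonglongrightarrow> limit_mass \<xi> ^ P"
      using AE_mass_convergent by eventually_elim (rule tendsto_power)
    show "(\<integral>\<^sup>+\<xi>. ennreal (norm (mass \<xi> m ^ P)) \<partial>Env) \<le> (\<integral>\<^sup>+\<xi>. ennreal (norm (limit_mass \<xi> ^ P)) \<partial>Env)" for m
      using nn_integral_mass_power_le_limit[of m] by (simp only: abs) simp
  qed measurable
  then show ?thesis by simp
qed

end

section \<open>Sums over tuples of vertices\<close>

lemma le_length_longest_common_prefix: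
  "n \<le> length (longest_common_prefix x y) \<longleftrightarrow> n \<le> length x \<and> n \<le> length y \<and> take n x = take n y"
proof (induction x y arbitrary: n rule: longest_common_prefix.induct)
  case (1 a x b y)
  then show ?case by (cases n) auto
next
  case ("2_1" y)
  then show ?case by (cases n) auto
next
  case ("2_2" x)
  then show ?case by (cases n) auto
qed

lemma longest_common_prefix_take_less:
  assumes "l \<le> m" "m \<le> length x" "m \<le> length y"
  shows "length (longest_common_prefix (take m x) (take m y)) < l \<longleftrightarrow> length (longest_common_prefix x y) < l"
  using assms le_length_longest_common_prefix[of l "take m x" "take m y"] le_length_longest_common_prefix[of l x y]
  by (auto simp: not_le[symmetric] min_def)

lemma f_lambda_bounds: "0 \<le> f_lambda k lam x" "f_lambda k lam x \<le> 1"
  unfolding f_lambda_def by (auto intro!: prod_nonneg prod_le_1)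

lemma f_lambda_take:
  assumes "\<And>i. i \<in> {2..k} \<Longrightarrow> lam i \<le> m" "\<And>i. i \<in> {1..k} \<Longrightarrow> m \<le> length (x i)"
  shows "f_lambda k lam (\<lambda>i\<in>{1..k}. take m (x i)) = f_lambda k lam x"
  unfolding f_lambda_def
proof (rule prod.cong[OF refl])
  fix i assume i: "i \<in> {2..k}"
  then have i': "i - 1 \<in> {1..k}" "i \<in> {1..k}" by auto
  show "of_bool (length (longest_common_prefix ((\<lambda>i\<in>{1..k}. take m (x i)) (i - 1)) ((\<lambda>i\<in>{1..k}. take m (x i)) i)) < lam i)
      = (of_bool (length (longest_common_prefix (x (i - 1)) (x i)) < lam i) :: real)"
    unfolding restrict_apply'[OF i'(1)] restrict_apply'[OF i'(2)]
    by (subst longest_common_prefix_take_less) (use assms i i' in auto)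
qed

text \<open>The push-forward of the weights \<open>g\<close> on \<open>D\<close> to generation \<open>m\<close>.\<close>

definition block_sum :: "nat \<Rightarrow> nat list set \<Rightarrow> (nat list \<Rightarrow> real) \<Rightarrow> nat list \<Rightarrow> real" where
  "block_sum m D g u = (\<Sum>x | x \<in> D \<and> take m x = u. g x)"

lemma sum_tuples_by_blocks:
  fixes g :: "nat list \<Rightarrow> real" and k :: nat
  assumes "finite D" "finite T" "take m ` D \<subseteq> T"
  shows "(\<Sum>x\<in>{1..k} \<rightarrow>\<^sub>E D. h (\<lambda>i\<in>{1..k}. take m (x i)) * (\<Prod>i=1..k. g (x i)))
       = (\<Sum>u\<in>{1..k} \<rightarrow>\<^sub>E T. h u * (\<Prod>i=1..k. block_sum m D g (u i)))"
proof -
  let ?t = "\<lambda>x. (\<lambda>i\<in>{1..k}. take m (x i))" and ?P = "{1..k} \<rightarrow>\<^sub>E D"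
  have fin: "finite ?P" "finite ({1..k} \<rightarrow>\<^sub>E T)" using assms by (simp_all add: finite_PiE)
  have "(\<Sum>x\<in>?P. h (?t x) * (\<Prod>i=1..k. g (x i)))
      = (\<Sum>u\<in>{1..k} \<rightarrow>\<^sub>E T. \<Sum>x\<in>{x\<in>?P. ?t x = u}. h (?t x) * (\<Prod>i=1..k. g (x i)))"
    using fin assms(3) by (intro sum.group[symmetric]) (auto simp: PiE_iff)
  also have "\<dots> = (\<Sum>u\<in>{1..k} \<rightarrow>\<^sub>E T. h u * (\<Prod>i=1..k. block_sum m D g (u i)))"
  proof (rule sum.cong[OF refl])
    fix u assume u: "u \<in> {1..k} \<rightarrow>\<^sub>E T"
    have "{x\<in>?P. ?t x = u} = (\<Pi>\<^sub>E i\<in>{1..k}. {x\<in>D. take m x = u i})"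
      using u by (auto simp: PiE_iff fun_eq_iff restrict_def extensional_def)
    moreover have "(\<Prod>i=1..k. block_sum m D g (u i)) = (\<Sum>x\<in>(\<Pi>\<^sub>E i\<in>{1..k}. {x\<in>D. take m x = u i}). \<Prod>i=1..k. g (x i))"
      unfolding block_sum_def using assms by (intro prod_sum_PiE) auto
    moreover have "(\<Sum>x\<in>{x\<in>?P. ?t x = u}. h (?t x) * (\<Prod>i=1..k. g (x i))) = h u * (\<Sum>x\<in>{x\<in>?P. ?t x = u}. \<Prod>i=1..k. g (x i))"
      unfolding sum_distrib_left by (rule sum.cong) auto
    ultimately show "(\<Sum>x\<in>{x\<in>?P. ?t x = u}. h (?t x) * (\<Prod>i=1..k. g (x i))) = h u * (\<Prod>i=1..k. block_sum m D g (u i))"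
      by (simp only:)
  qed
  finally show ?thesis .
qed

text \<open>Merging the coordinates \<open>i\<close> and \<open>j\<close> squares one factor; the other \<open>k - 2\<close> coordinates are
  free.\<close>

lemma sum_coincident_tuples:
  fixes G :: "nat list \<Rightarrow> real" and k :: nat
  assumes T: "finite T" and ij: "i \<in> {1..k}" "j \<in> {1..k}" "i \<noteq> j"
  shows "(\<Sum>u\<in>{1..k} \<rightarrow>\<^sub>E T. of_bool (u i = u j) * (\<Prod>l=1..k. G (u l)))
       = (\<Sum>u\<in>T. (G u)\<^sup>2) * (\<Sum>u\<in>T. G u) ^ (k - 2)"
proof -
  have "(\<Sum>u\<in>{1..k} \<rightarrow>\<^sub>E T. of_bool (u i = u j) * (\<Prod>l=1..k. G (u l)))
      = (\<Sum>u\<in>{1..k} \<rightarrow>\<^sub>E T. \<Sum>t\<in>T. \<Prod>l=1..k. (if l \<in> {i, j} then of_bool (u l = t) else 1) * G (u l))"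
  proof (rule sum.cong[OF refl])
    fix u assume u: "u \<in> {1..k} \<rightarrow>\<^sub>E T"
    have "(\<Prod>l=1..k. (if l \<in> {i, j} then of_bool (u l = t) else 1) * G (u l))
        = of_bool (u i = t \<and> u j = t) * (\<Prod>l=1..k. G (u l))" for t
    proof -
      have "(\<Prod>l=1..k. (if l \<in> {i, j} then of_bool (u l = t) else 1)) = (\<Prod>l\<in>{i, j}. of_bool (u l = t) :: real)"
        using ij by (intro prod.mono_neutral_cong_right) auto
      also have "\<dots> = of_bool (u i = t \<and> u j = t)" using ij by auto
      finally show ?thesis by (simp only: prod.distrib)
    qed
    then have "(\<Sum>t\<in>T. \<Prod>l=1..k. (if l \<in> {i, j} then of_bool (u l = t) else 1) * G (u l))
        = (\<Sum>t\<in>T. if t = u i then of_bool (u i = u j) * (\<Prod>l=1..k. G (u l)) else 0)"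
      by (auto intro!: sum.cong)
    also have "\<dots> = of_bool (u i = u j) * (\<Prod>l=1..k. G (u l))"
      using T u ij by (subst sum.delta) (auto simp: PiE_iff)
    finally show "of_bool (u i = u j) * (\<Prod>l=1..k. G (u l))
       = (\<Sum>t\<in>T. \<Prod>l=1..k. (if l \<in> {i, j} then of_bool (u l = t) else 1) * G (u l))" by simp
  qed
  also have "\<dots> = (\<Sum>t\<in>T. \<Sum>u\<in>{1..k} \<rightarrow>\<^sub>E T. \<Prod>l=1..k. (if l \<in> {i, j} then of_bool (u l = t) else 1) * G (u l))"
    by (rule sum.swap)
  also have "\<dots> = (\<Sum>t\<in>T. \<Prod>l=1..k. \<Sum>v\<in>T. (if l \<in> {i, j} then of_bool (v = t) else 1) * G v)"
    using T by (intro sum.cong refl prod_sum_PiE[symmetric]) auto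
  also have "\<dots> = (\<Sum>t\<in>T. (G t)\<^sup>2 * (\<Sum>u\<in>T. G u) ^ (k - 2))"
  proof (rule sum.cong[OF refl])
    fix t assume t: "t \<in> T"
    have "(\<Sum>v\<in>T. (if l \<in> {i, j} then of_bool (v = t) else 1) * G v) = (if l \<in> {i, j} then G t else \<Sum>u\<in>T. G u)" for l
      using T t by (auto simp: of_bool_def if_distrib[where f="\<lambda>x. x * _"] cong: if_cong)
    then have "(\<Prod>l=1..k. \<Sum>v\<in>T. (if l \<in> {i, j} then of_bool (v = t) else 1) * G v)
        = (\<Prod>l=1..k. if l \<in> {i, j} then G t else \<Sum>u\<in>T. G u)" by simp
    also have "\<dots> = (\<Prod>l\<in>{1..k} - {i, j}. if l \<in> {i, j} then G t else \<Sum>u\<in>T. G u)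
        * (\<Prod>l\<in>{i, j}. if l \<in> {i, j} then G t else \<Sum>u\<in>T. G u)"
      using ij by (intro prod.subset_diff) auto
    also have "(\<Prod>l\<in>{1..k} - {i, j}. if l \<in> {i, j} then G t else \<Sum>u\<in>T. G u) = (\<Prod>l\<in>{1..k} - {i, j}. \<Sum>u\<in>T. G u)"
      by (intro prod.cong) auto
    also have "(\<Prod>l\<in>{i, j}. if l \<in> {i, j} then G t else \<Sum>u\<in>T. G u) = (G t)\<^sup>2"
      using ij by (simp add: power2_eq_square)
    also have "(\<Prod>l\<in>{1..k} - {i, j}. \<Sum>u\<in>T. G u) = (\<Sum>u\<in>T. G u) ^ (k - 2)"
    proof -
      have "card ({1..k} - {i, j}) = k - 2" using ij by (subst card_Diff_subset) auto
      then show ?thesis by simp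
    qed
    finally show "(\<Prod>l=1..k. \<Sum>v\<in>T. (if l \<in> {i, j} then of_bool (v = t) else 1) * G v) = (G t)\<^sup>2 * (\<Sum>u\<in>T. G u) ^ (k - 2)"
      by (simp add: mult.commute)
  qed
  finally show ?thesis by (simp add: sum_distrib_right)
qed

lemma Delta_subset: "Delta k D \<subseteq> {1..k} \<rightarrow>\<^sub>E D"
  by (auto simp: Delta_def)

text \<open>Vertices of the same generation are comparable only if they are equal.\<close>

lemma Delta_level:
  assumes "\<And>u. u \<in> T \<Longrightarrow> length u = m"
  shows "Delta k T = {u \<in> {1..k} \<rightarrow>\<^sub>E T. inj_on u {1..k}}"
proof -
  have "prefix (u i) (u j) \<longleftrightarrow> u i = u j" if "u \<in> {1..k} \<rightarrow>\<^sub>E T" "i \<in> {1..k}" "j \<in> {1..k}" for u i j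
  proof -
    have "length (u i) = m" "length (u j) = m" using that assms by (auto simp: PiE_iff)
    then show ?thesis by (auto simp: prefix_def)
  qed
  then have "(\<forall>i\<in>{1..k}. \<forall>j\<in>{1..k}. i \<noteq> j \<longrightarrow> \<not> prefix (u i) (u j) \<and> \<not> prefix (u j) (u i))
      \<longleftrightarrow> inj_on u {1..k}" if "u \<in> {1..k} \<rightarrow>\<^sub>E T" for u
    using that unfolding inj_on_def by metis
  then show ?thesis unfolding Delta_def by blast
qed

text \<open>On tuples whose entries have different ancestors in generation \<open>m\<close>, incomparability is
  automatic and \<open>f_lambda\<close> only sees the ancestors, so the sum factorises over blocks. The other
  tuples are counted by a union bound over the pairs of entries in the same block.\<close>

lemma tuple_sum_block_approximation:
  fixes g :: "nat list \<Rightarrow> real"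
  assumes D: "finite D" "\<And>x. x \<in> D \<Longrightarrow> m \<le> length x" "\<And>x. x \<in> D \<Longrightarrow> 0 \<le> g x"
    and T: "finite T" "take m ` D \<subseteq> T" "\<And>u. u \<in> T \<Longrightarrow> length u = m"
    and lam: "\<And>i. i \<in> {2..k} \<Longrightarrow> lam i \<le> m"
  shows "\<bar>tuple_sum k D (\<lambda>x. f_lambda k lam x * (\<Prod>i=1..k. g (x i)))
           - tuple_sum k T (\<lambda>u. f_lambda k lam u * (\<Prod>i=1..k. block_sum m D g (u i)))\<bar>
     \<le> real k ^ 2 * ((\<Sum>u\<in>T. (block_sum m D g u)\<^sup>2) * (\<Sum>u\<in>T. block_sum m D g u) ^ (k - 2))"
proof -
  let ?P = "{1..k} \<rightarrow>\<^sub>E D" and ?I = "{1..k}"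
  let ?t = "\<lambda>x. (\<lambda>i\<in>?I. take m (x i))" and ?G = "block_sum m D g"
  let ?w = "\<lambda>x. \<Prod>i=1..k. g (x i)"
  let ?f = "f_lambda k lam"
  have DT: "Delta k T = {u \<in> ?I \<rightarrow>\<^sub>E T. inj_on u ?I}" by (rule Delta_level) (rule T)
  define A where "A = {x \<in> ?P. inj_on (?t x) ?I}"
  have finP: "finite ?P" using D by (simp add: finite_PiE)
  have w0: "0 \<le> ?w x" if "x \<in> ?P" for x
    using that D(3) by (intro prod_nonneg) (auto simp: PiE_iff)
  have ft: "?f (?t x) = ?f x" if "x \<in> ?P" for x
    using that D(2) lam by (intro f_lambda_take) (auto simp: PiE_iff)
  \<comment> \<open>tuples with ancestors in pairwise different blocks are incomparable\<close>
  have A_Delta: "A \<subseteq> Delta k D"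
  proof
    fix x assume "x \<in> A"
    then have xP: "x \<in> ?P" and inj: "inj_on (?t x) ?I" unfolding A_def by blast+
    have "\<not> prefix (x i) (x j)" if ij: "i \<in> ?I" "j \<in> ?I" "i \<noteq> j" for i j
    proof
      assume "prefix (x i) (x j)"
      then obtain z where "x j = x i @ z" by (auto simp: prefix_def)
      moreover have "m \<le> length (x i)" using xP ij D(2) by (auto simp: PiE_iff)
      ultimately have "?t x i = ?t x j" using ij by simp
      then show False using inj_onD[OF inj _ ij(1,2)] ij(3) by simp
    qed
    then show "x \<in> Delta k D" using xP unfolding Delta_def by blast
  qed
  have "(\<Sum>x\<in>A. ?f x * ?w x) = (\<Sum>x\<in>?P. (of_bool (inj_on (?t x) ?I) * ?f (?t x)) * ?w x)"
    unfolding A_def using finP ft by (intro sum.mono_neutral_cong_left) auto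
  also have "\<dots> = (\<Sum>u\<in>?I \<rightarrow>\<^sub>E T. (of_bool (inj_on u ?I) * ?f u) * (\<Prod>i=1..k. ?G (u i)))"
    by (rule sum_tuples_by_blocks) (use D T in auto)
  also have "\<dots> = tuple_sum k T (\<lambda>u. ?f u * (\<Prod>i=1..k. ?G (u i)))"
    unfolding tuple_sum_def DT using T(1)
    by (intro sum.mono_neutral_cong_right) (auto intro!: finite_PiE)
  finally have main: "(\<Sum>x\<in>A. ?f x * ?w x) = tuple_sum k T (\<lambda>u. ?f u * (\<Prod>i=1..k. ?G (u i)))" .
  have "tuple_sum k D (\<lambda>x. ?f x * ?w x) - (\<Sum>x\<in>A. ?f x * ?w x) = (\<Sum>x\<in>Delta k D - A. ?f x * ?w x)"
    unfolding tuple_sum_def using finP finite_subset[OF Delta_subset] A_Delta by (subst sum_diff) auto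
  moreover have "0 \<le> (\<Sum>x\<in>Delta k D - A. ?f x * ?w x)"
  proof (intro sum_nonneg mult_nonneg_nonneg f_lambda_bounds)
    fix x assume "x \<in> Delta k D - A"
    then show "0 \<le> ?w x" using Delta_subset by (intro w0) blast
  qed
  moreover have "(\<Sum>x\<in>Delta k D - A. ?f x * ?w x)
      \<le> (\<Sum>x\<in>?P. (\<Sum>i\<in>?I. \<Sum>j\<in>?I. of_bool (i \<noteq> j \<and> ?t x i = ?t x j)) * ?w x)"
  proof -
    have "(\<Sum>x\<in>Delta k D - A. ?f x * ?w x) \<le> (\<Sum>x\<in>Delta k D - A. (\<Sum>i\<in>?I. \<Sum>j\<in>?I. of_bool (i \<noteq> j \<and> ?t x i = ?t x j)) * ?w x)"
    proof (intro sum_mono mult_right_mono)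
      fix x assume x: "x \<in> Delta k D - A"
      then have xP: "x \<in> ?P" using Delta_subset by blast
      then have "\<not> inj_on (?t x) ?I" using x by (auto simp: A_def)
      then obtain i j where ij: "i \<in> ?I" "j \<in> ?I" "i \<noteq> j" "?t x i = ?t x j" by (auto simp: inj_on_def)
      have "1 = (of_bool (i \<noteq> j \<and> ?t x i = ?t x j) :: real)" using ij by simp
      also have "\<dots> \<le> (\<Sum>j\<in>?I. of_bool (i \<noteq> j \<and> ?t x i = ?t x j))"
        using ij by (intro member_le_sum) auto
      also have "\<dots> \<le> (\<Sum>i\<in>?I. \<Sum>j\<in>?I. of_bool (i \<noteq> j \<and> ?t x i = ?t x j))"
        using ij by (intro member_le_sum[of i _ "\<lambda>i. \<Sum>j\<in>?I. of_bool (i \<noteq> j \<and> ?t x i = ?t x j)"] sum_nonneg) auto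
      finally show "?f x \<le> (\<Sum>i\<in>?I. \<Sum>j\<in>?I. of_bool (i \<noteq> j \<and> ?t x i = ?t x j))"
        using f_lambda_bounds(2)[of k lam x] by linarith
      show "0 \<le> ?w x" using w0 xP .
    qed
    also have "\<dots> \<le> (\<Sum>x\<in>?P. (\<Sum>i\<in>?I. \<Sum>j\<in>?I. of_bool (i \<noteq> j \<and> ?t x i = ?t x j)) * ?w x)"
      using finP Delta_subset w0 by (intro sum_mono2 mult_nonneg_nonneg sum_nonneg) auto
    finally show ?thesis .
  qed
  moreover have "(\<Sum>x\<in>?P. (\<Sum>i\<in>?I. \<Sum>j\<in>?I. of_bool (i \<noteq> j \<and> ?t x i = ?t x j)) * ?w x)
      \<le> real k ^ 2 * ((\<Sum>u\<in>T. (?G u)\<^sup>2) * (\<Sum>u\<in>T. ?G u) ^ (k - 2))"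
  proof -
    have "(\<Sum>x\<in>?P. (\<Sum>i\<in>?I. \<Sum>j\<in>?I. of_bool (i \<noteq> j \<and> ?t x i = ?t x j)) * ?w x)
        = (\<Sum>u\<in>?I \<rightarrow>\<^sub>E T. (\<Sum>i\<in>?I. \<Sum>j\<in>?I. of_bool (i \<noteq> j \<and> u i = u j)) * (\<Prod>i=1..k. ?G (u i)))"
      using sum_tuples_by_blocks[OF D(1) T(1,2), where k=k and g=g
          and h="\<lambda>u. \<Sum>i\<in>?I. \<Sum>j\<in>?I. of_bool (i \<noteq> j \<and> u i = u j)"] .
    also have "\<dots> = (\<Sum>i\<in>?I. \<Sum>j\<in>?I. \<Sum>u\<in>?I \<rightarrow>\<^sub>E T. of_bool (i \<noteq> j \<and> u i = u j) * (\<Prod>i=1..k. ?G (u i)))"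
      unfolding sum_distrib_right
      by (subst sum.swap, rule sum.cong[OF refl], rule sum.swap)
    also have "\<dots> \<le> (\<Sum>i\<in>?I. \<Sum>j\<in>?I. (\<Sum>u\<in>T. (?G u)\<^sup>2) * (\<Sum>u\<in>T. ?G u) ^ (k - 2))"
    proof (intro sum_mono)
      fix i j assume ij: "i \<in> ?I" "j \<in> ?I"
      have G0: "0 \<le> ?G u" for u unfolding block_sum_def using D by (intro sum_nonneg) auto
      show "(\<Sum>u\<in>?I \<rightarrow>\<^sub>E T. of_bool (i \<noteq> j \<and> u i = u j) * (\<Prod>i=1..k. ?G (u i)))
          \<le> (\<Sum>u\<in>T. (?G u)\<^sup>2) * (\<Sum>u\<in>T. ?G u) ^ (k - 2)"
      proof (cases "i = j")
        case True
        then show ?thesis using G0 by (auto intro!: mult_nonneg_nonneg zero_le_power sum_nonneg)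
      next
        case False
        then show ?thesis using sum_coincident_tuples[OF T(1) ij, of ?G] by simp
      qed
    qed
    also have "\<dots> = real k ^ 2 * ((\<Sum>u\<in>T. (?G u)\<^sup>2) * (\<Sum>u\<in>T. ?G u) ^ (k - 2))"
      by (simp add: power2_eq_square mult.assoc)
    finally show ?thesis .
  qed
  ultimately show ?thesis using main by linarith
qed

text \<open>Telescoping: the factors are exchanged one at a time.\<close>

lemma abs_prod_diff_le:
  fixes a b :: "'i \<Rightarrow> real"
  assumes "finite I" "\<And>i. i \<in> I \<Longrightarrow> 0 \<le> a i" "\<And>i. i \<in> I \<Longrightarrow> 0 \<le> b i"
  shows "\<bar>(\<Prod>i\<in>I. a i) - (\<Prod>i\<in>I. b i)\<bar> \<le> (\<Sum>j\<in>I. \<Prod>i\<in>I. if i = j then \<bar>a i - b i\<bar> else max (a i) (b i))"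
  using assms
proof (induction I rule: finite_induct)
  case (insert x I)
  let ?c = "\<lambda>i. max (a i) (b i)" and ?d = "\<lambda>i. \<bar>a i - b i\<bar>"
  have nn: "0 \<le> a x" "0 \<le> b x" "0 \<le> (\<Prod>i\<in>I. b i)" using insert by (auto intro: prod_nonneg)
  have "(\<Prod>i\<in>insert x I. a i) - (\<Prod>i\<in>insert x I. b i)
      = a x * ((\<Prod>i\<in>I. a i) - (\<Prod>i\<in>I. b i)) + (a x - b x) * (\<Prod>i\<in>I. b i)"
    using insert by (simp add: algebra_simps)
  then have "\<bar>(\<Prod>i\<in>insert x I. a i) - (\<Prod>i\<in>insert x I. b i)\<bar>
      \<le> a x * \<bar>(\<Prod>i\<in>I. a i) - (\<Prod>i\<in>I. b i)\<bar> + ?d x * (\<Prod>i\<in>I. b i)"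
    using nn abs_triangle_ineq[of "a x * ((\<Prod>i\<in>I. a i) - (\<Prod>i\<in>I. b i))" "(a x - b x) * (\<Prod>i\<in>I. b i)"]
    by (simp add: abs_mult)
  also have "\<dots> \<le> ?c x * (\<Sum>j\<in>I. \<Prod>i\<in>I. if i = j then ?d i else ?c i) + ?d x * (\<Prod>i\<in>I. ?c i)"
    using insert nn by (intro add_mono mult_mono prod_mono) (auto simp: le_max_iff_disj)
  also have "?d x * (\<Prod>i\<in>I. ?c i) = (\<Prod>i\<in>insert x I. if i = x then ?d i else ?c i)"
    using insert by (auto intro!: prod.cong)
  also have "?c x * (\<Sum>j\<in>I. \<Prod>i\<in>I. if i = j then ?d i else ?c i)
      = (\<Sum>j\<in>I. \<Prod>i\<in>insert x I. if i = j then ?d i else ?c i)"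
    unfolding sum_distrib_left using insert by (intro sum.cong refl) auto
  finally show ?case using insert by simp
qed simp

lemma tuple_sum_perturbation:
  fixes G H :: "nat list \<Rightarrow> real"
  assumes T: "finite T" and G: "\<And>u. u \<in> T \<Longrightarrow> 0 \<le> G u" and H: "\<And>u. u \<in> T \<Longrightarrow> 0 \<le> H u"
  shows "\<bar>tuple_sum k T (\<lambda>u. f_lambda k lam u * (\<Prod>i=1..k. G (u i)))
        - tuple_sum k T (\<lambda>u. f_lambda k lam u * (\<Prod>i=1..k. H (u i)))\<bar>
     \<le> real k * ((\<Sum>u\<in>T. \<bar>G u - H u\<bar>) * (\<Sum>u\<in>T. max (G u) (H u)) ^ (k - 1))"
proof -
  let ?I = "{1..k}" and ?P = "{1..k} \<rightarrow>\<^sub>E T"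
  let ?d = "\<lambda>u. \<bar>G u - H u\<bar>" and ?c = "\<lambda>u. max (G u) (H u)"
  have finP: "finite ?P" using T by (simp add: finite_PiE)
  have "\<bar>tuple_sum k T (\<lambda>u. f_lambda k lam u * (\<Prod>i=1..k. G (u i)))
        - tuple_sum k T (\<lambda>u. f_lambda k lam u * (\<Prod>i=1..k. H (u i)))\<bar>
      = \<bar>\<Sum>u\<in>Delta k T. f_lambda k lam u * ((\<Prod>i=1..k. G (u i)) - (\<Prod>i=1..k. H (u i)))\<bar>"
    unfolding tuple_sum_def by (simp add: sum_subtractf[symmetric] right_diff_distrib)
  also have "\<dots> \<le> (\<Sum>u\<in>Delta k T. \<bar>f_lambda k lam u * ((\<Prod>i=1..k. G (u i)) - (\<Prod>i=1..k. H (u i)))\<bar>)"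
    by (rule sum_abs)
  also have "\<dots> \<le> (\<Sum>u\<in>Delta k T. \<Sum>j\<in>?I. \<Prod>i\<in>?I. if i = j then ?d (u i) else ?c (u i))"
  proof (rule sum_mono)
    fix u assume "u \<in> Delta k T"
    then have u: "u \<in> ?P" using Delta_subset by blast
    have "\<bar>f_lambda k lam u * ((\<Prod>i=1..k. G (u i)) - (\<Prod>i=1..k. H (u i)))\<bar> \<le> 1 * \<bar>(\<Prod>i=1..k. G (u i)) - (\<Prod>i=1..k. H (u i))\<bar>"
      unfolding abs_mult using f_lambda_bounds[of k lam u] by (intro mult_right_mono) auto
    also have "\<dots> \<le> (\<Sum>j\<in>?I. \<Prod>i\<in>?I. if i = j then ?d (u i) else ?c (u i))"
      using u G H by (simp, intro abs_prod_diff_le) (auto simp: PiE_iff)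
    finally show "\<bar>f_lambda k lam u * ((\<Prod>i=1..k. G (u i)) - (\<Prod>i=1..k. H (u i)))\<bar>
      \<le> (\<Sum>j\<in>?I. \<Prod>i\<in>?I. if i = j then ?d (u i) else ?c (u i))" .
  qed
  also have "\<dots> \<le> (\<Sum>u\<in>?P. \<Sum>j\<in>?I. \<Prod>i\<in>?I. if i = j then ?d (u i) else ?c (u i))"
    using finP Delta_subset G by (intro sum_mono2 sum_nonneg prod_nonneg) (auto simp: PiE_iff le_max_iff_disj)
  also have "\<dots> = (\<Sum>j\<in>?I. \<Sum>u\<in>?P. \<Prod>i\<in>?I. if i = j then ?d (u i) else ?c (u i))"
    by (rule sum.swap)
  also have "\<dots> = (\<Sum>j\<in>?I. \<Prod>i\<in>?I. \<Sum>v\<in>T. if i = j then ?d v else ?c v)"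
    using T by (intro sum.cong refl prod_sum_PiE[symmetric]) auto
  also have "\<dots> = (\<Sum>j\<in>?I. (\<Sum>v\<in>T. ?d v) * (\<Sum>v\<in>T. ?c v) ^ (k - 1))"
  proof (rule sum.cong[OF refl])
    fix j assume j: "j \<in> ?I"
    have "(\<Prod>i\<in>?I. \<Sum>v\<in>T. if i = j then ?d v else ?c v) = (\<Sum>v\<in>T. ?d v) * (\<Prod>i\<in>?I - {j}. \<Sum>v\<in>T. ?c v)"
      using j by (subst prod.remove[of _ j]) (auto intro!: prod.cong)
    then show "(\<Prod>i\<in>?I. \<Sum>v\<in>T. if i = j then ?d v else ?c v) = (\<Sum>v\<in>T. ?d v) * (\<Sum>v\<in>T. ?c v) ^ (k - 1)"
      using j by simp
  qed
  finally show ?thesis by simp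
qed

text \<open>Both \<open>X\<close> and \<open>Y\<close> are close to the same functional of the block weights, so they are close to
  each other as soon as the blocks carry nearly the same weights and none is heavy. Only the squares
  of \<open>H\<close> occur in the bound, since those of \<open>G\<close> are recovered from \<open>(G u)\<^sup>2 \<le> 2 * (H u)\<^sup>2 + 2 * \<bar>G u
  - H u\<bar>\<close>.\<close>

lemma tuple_sum_stability:
  fixes G H :: "nat list \<Rightarrow> real"
  assumes T: "finite T" and G: "\<And>u. u \<in> T \<Longrightarrow> 0 \<le> G u" and H: "\<And>u. u \<in> T \<Longrightarrow> 0 \<le> H u"
    and k: "2 \<le> k"
    and X: "\<bar>X - tuple_sum k T (\<lambda>u. f_lambda k lam u * (\<Prod>i=1..k. G (u i)))\<bar>
        \<le> real k ^ 2 * ((\<Sum>u\<in>T. (G u)\<^sup>2) * (\<Sum>u\<in>T. G u) ^ (k - 2))"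
    and Y: "\<bar>Y - tuple_sum k T (\<lambda>u. f_lambda k lam u * (\<Prod>i=1..k. H (u i)))\<bar>
        \<le> real k ^ 2 * ((\<Sum>u\<in>T. (H u)\<^sup>2) * (\<Sum>u\<in>T. H u) ^ (k - 2))"
    and M: "(\<Sum>u\<in>T. H u) \<le> M" and e: "(\<Sum>u\<in>T. \<bar>G u - H u\<bar>) \<le> e" "e \<le> 1"
  shows "\<bar>X - Y\<bar> \<le> 3 * real k ^ 2 * (M + 1) ^ k * ((\<Sum>u\<in>T. (H u)\<^sup>2) + e)"
proof -
  define s where "s = (\<Sum>u\<in>T. (H u)\<^sup>2)"
  have s0: "0 \<le> s" unfolding s_def by (intro sum_nonneg) auto
  have "0 \<le> (\<Sum>u\<in>T. \<bar>G u - H u\<bar>)" by (simp add: sum_nonneg)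
  then have e0: "0 \<le> e" using e(1) by linarith
  have "0 \<le> (\<Sum>u\<in>T. H u)" using H by (rule sum_nonneg)
  then have M0: "0 \<le> M" using M by linarith
  have max: "(\<Sum>u\<in>T. max (G u) (H u)) \<le> M + 1"
  proof -
    have "(\<Sum>u\<in>T. max (G u) (H u)) \<le> (\<Sum>u\<in>T. H u + \<bar>G u - H u\<bar>)" by (intro sum_mono) auto
    then show ?thesis using M e by (simp add: sum.distrib)
  qed
  have GM: "(\<Sum>u\<in>T. G u) \<le> M + 1" by (rule order_trans[OF sum_mono max]) simp
  have G2: "(\<Sum>u\<in>T. (G u)\<^sup>2) \<le> 2 * s + 2 * e"
  proof -
    have "(\<Sum>u\<in>T. (G u)\<^sup>2) \<le> (\<Sum>u\<in>T. 2 * (H u)\<^sup>2 + 2 * \<bar>G u - H u\<bar>)"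
    proof (rule sum_mono)
      fix u assume u: "u \<in> T"
      have "\<bar>G u - H u\<bar> \<le> 1"
      proof -
        have "\<bar>G u - H u\<bar> \<le> (\<Sum>u\<in>T. \<bar>G u - H u\<bar>)"
          using u T by (intro member_le_sum) auto
        then show ?thesis using e by linarith
      qed
      then have "\<bar>G u - H u\<bar> * \<bar>G u - H u\<bar> \<le> 1 * \<bar>G u - H u\<bar>"
        by (intro mult_right_mono) auto
      then have a: "(G u - H u)\<^sup>2 \<le> \<bar>G u - H u\<bar>" by (simp add: power2_eq_square)
      have b: "(G u)\<^sup>2 \<le> 2 * (H u)\<^sup>2 + 2 * (G u - H u)\<^sup>2"
        using zero_le_square[of "G u - 2 * H u"] by (simp add: power2_eq_square algebra_simps)
      show "(G u)\<^sup>2 \<le> 2 * (H u)\<^sup>2 + 2 * \<bar>G u - H u\<bar>"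
        by (rule order_trans[OF b]) (intro add_left_mono mult_left_mono a; simp)
    qed
    also have "\<dots> = 2 * s + 2 * (\<Sum>u\<in>T. \<bar>G u - H u\<bar>)"
      by (simp add: s_def sum.distrib sum_distrib_left)
    finally show ?thesis using e by linarith
  qed
  let ?B = "(M + 1) ^ k" and ?k = "real k ^ 2"
  have pow: "(M + 1) ^ j \<le> ?B" if "j \<le> k" for j using that M0 by (intro power_increasing) auto
  have 1: "?k * ((\<Sum>u\<in>T. (G u)\<^sup>2) * (\<Sum>u\<in>T. G u) ^ (k - 2)) \<le> ?k * ((2 * s + 2 * e) * ?B)"
  proof (intro mult_left_mono mult_mono)
    show "(\<Sum>u\<in>T. G u) ^ (k - 2) \<le> ?B"
      using GM G by (intro order_trans[OF power_mono pow]) (auto intro: sum_nonneg)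
    show "0 \<le> (\<Sum>u\<in>T. G u) ^ (k - 2)" using G by (intro zero_le_power sum_nonneg) auto
  qed (use G2 s0 e0 in auto)
  have 2: "?k * ((\<Sum>u\<in>T. (H u)\<^sup>2) * (\<Sum>u\<in>T. H u) ^ (k - 2)) \<le> ?k * (s * ?B)"
  proof (intro mult_left_mono mult_mono)
    show "(\<Sum>u\<in>T. H u) ^ (k - 2) \<le> ?B"
      using M H by (intro order_trans[OF power_mono[of _ "M + 1"] pow]) (auto intro: sum_nonneg)
    show "0 \<le> (\<Sum>u\<in>T. H u) ^ (k - 2)" using H by (intro zero_le_power sum_nonneg) auto
  qed (use s0 in \<open>auto simp: s_def\<close>)
  have 3: "real k * ((\<Sum>u\<in>T. \<bar>G u - H u\<bar>) * (\<Sum>u\<in>T. max (G u) (H u)) ^ (k - 1)) \<le> ?k * (e * ?B)"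
  proof (intro mult_mono)
    show "real k \<le> ?k" using k by (simp add: power2_eq_square)
    show "(\<Sum>u\<in>T. max (G u) (H u)) ^ (k - 1) \<le> ?B"
      using max G by (intro order_trans[OF power_mono pow]) (auto intro!: sum_nonneg simp: le_max_iff_disj)
    show "0 \<le> (\<Sum>u\<in>T. max (G u) (H u)) ^ (k - 1)" using G by (intro zero_le_power sum_nonneg) (auto simp: le_max_iff_disj)
    then show "0 \<le> (\<Sum>u\<in>T. \<bar>G u - H u\<bar>) * (\<Sum>u\<in>T. max (G u) (H u)) ^ (k - 1)"
      by (intro mult_nonneg_nonneg sum_nonneg) auto
  qed (use e e0 in auto)
  have pert: "\<bar>tuple_sum k T (\<lambda>u. f_lambda k lam u * (\<Prod>i=1..k. G (u i)))
        - tuple_sum k T (\<lambda>u. f_lambda k lam u * (\<Prod>i=1..k. H (u i)))\<bar>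
     \<le> real k * ((\<Sum>u\<in>T. \<bar>G u - H u\<bar>) * (\<Sum>u\<in>T. max (G u) (H u)) ^ (k - 1))"
    by (rule tuple_sum_perturbation) (rule T G H, assumption?)+
  have "\<bar>X - Y\<bar> \<le> ?k * ((2 * s + 2 * e) * ?B) + ?k * (s * ?B) + ?k * (e * ?B)"
    using X Y pert 1 2 3 by linarith
  also have "\<dots> = 3 * ?k * ?B * (s + e)" by (simp add: algebra_simps)
  finally show ?thesis unfolding s_def .
qed

section \<open>The limiting tuple sum\<close>

lemma Delta_mem: "x \<in> Delta k D \<Longrightarrow> i \<in> {1..k} \<Longrightarrow> x i \<in> D"
  using Delta_subset by (blast dest: PiE_mem)

lemma level_sum_eq_tuple_sum:
  assumes "1 \<le> k"
  shows "level_sum k lam l \<xi> = tuple_sum k (generation \<xi> l) (\<lambda>x. f_lambda k lam x * (\<Prod>i=1..k. weight \<xi> (x i)))"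
  unfolding level_sum_def tuple_sum_def
proof (rule sum.cong[OF refl])
  fix x assume "x \<in> Delta k (generation \<xi> l)"
  then have x: "x i \<in> tree \<xi>" if "i \<in> {1..k}" for i
    using Delta_mem[OF _ that] by (auto simp: generation_def)
  have "{1..k} = insert 1 {2..k}" using assms by auto
  then have "(\<Prod>i=1..k. weight \<xi> (x i)) = weight \<xi> (x 1) * (\<Prod>i=2..k. weight \<xi> (x i))" by simp
  also have "\<dots> = exp (- V \<xi> (x 1)) * (\<Prod>i=2..k. exp (- V \<xi> (x i)))"
    using x assms by (simp add: weight_eq_exp_V)
  finally show "exp (- V \<xi> (x 1)) * (\<Prod>i=2..k. exp (- V \<xi> (x i)) *
               of_bool (length (longest_common_prefix (x (i - 1)) (x i)) < lam i))
      = f_lambda k lam x * (\<Prod>i=1..k. weight \<xi> (x i))"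
    by (simp add: f_lambda_def prod.distrib)
qed

lemma level_sum_nonneg: "0 \<le> level_sum k lam l \<xi>"
  unfolding level_sum_def tuple_sum_def by (intro sum_nonneg mult_nonneg_nonneg prod_nonneg) auto

text \<open>Dropping incomparability and \<open>f_lambda\<close> leaves a \<open>k\<close>-fold product of the mass.\<close>

lemma level_sum_le_mass_power:
  assumes "1 \<le> k" shows "level_sum k lam l \<xi> \<le> mass \<xi> l ^ k"
proof -
  let ?G = "generation \<xi> l"
  have "level_sum k lam l \<xi> \<le> (\<Sum>x\<in>Delta k ?G. \<Prod>i=1..k. weight \<xi> (x i))"
    unfolding level_sum_eq_tuple_sum[OF assms] tuple_sum_def
  proof (rule sum_mono)
    fix x
    show "f_lambda k lam x * (\<Prod>i=1..k. weight \<xi> (x i)) \<le> (\<Prod>i=1..k. weight \<xi> (x i))"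
      using f_lambda_bounds[of k lam x] by (intro mult_left_le_one_le prod_nonneg) auto
  qed
  also have "\<dots> \<le> (\<Sum>x\<in>{1..k} \<rightarrow>\<^sub>E ?G. \<Prod>i=1..k. weight \<xi> (x i))"
    by (intro sum_mono2 finite_PiE Delta_subset prod_nonneg) auto
  also have "\<dots> = (\<Prod>i=1..k. \<Sum>v\<in>?G. weight \<xi> v)"
    by (rule prod_sum_PiE[symmetric]) auto
  also have "\<dots> = mass \<xi> l ^ k" by (simp add: mass_def)
  finally show ?thesis .
qed

lemma block_sum_generation:
  assumes "length u = m" "u \<in> tree \<xi>"
  shows "block_sum m (generation \<xi> (m + j)) (weight \<xi>) u = weight \<xi> u * mass (subtree u \<xi>) j"
proof -
  have "{x. x \<in> generation \<xi> (m + j) \<and> take m x = u} = (@) u ` generation (subtree u \<xi>) j"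
  proof (intro equalityI subsetI)
    fix x assume "x \<in> {x. x \<in> generation \<xi> (m + j) \<and> take m x = u}"
    then have x: "x \<in> tree \<xi>" "length x = m + j" "x = u @ drop m x"
      by (auto simp: generation_def)
    have "u @ drop m x \<in> tree \<xi>" by (metis x(1) x(3))
    then have "drop m x \<in> generation (subtree u \<xi>) j"
      using x(2) unfolding in_tree_append by (simp add: generation_def)
    then show "x \<in> (@) u ` generation (subtree u \<xi>) j" using x(3) by (rule image_eqI[rotated])
  qed (use assms in \<open>auto simp: generation_def in_tree_append\<close>)
  then have "block_sum m (generation \<xi> (m + j)) (weight \<xi>) u = (\<Sum>x\<in>(@) u ` generation (subtree u \<xi>) j. weight \<xi> x)"
    by (simp add: block_sum_def)
  also have "\<dots> = (\<Sum>w\<in>generation (subtree u \<xi>) j. weight \<xi> (u @ w))"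
    by (subst sum.reindex) (auto simp: inj_on_def)
  finally show ?thesis by (simp add: weight_append mass_def sum_distrib_left)
qed

text \<open>The block of \<open>u\<close> has weight \<open>weight u\<close> times the mass of the subtree of \<open>u\<close>, which converges
  to the limit measure as \<open>j \<rightarrow> \<infinity>\<close>.\<close>

lemma level_sum_block_approximation:
  assumes "1 \<le> k" "\<And>i. i \<in> {2..k} \<Longrightarrow> lam i \<le> m"
  defines "G \<equiv> \<lambda>\<xi> j u. weight \<xi> u * mass (subtree u \<xi>) j"
  shows "\<bar>level_sum k lam (m + j) \<xi> - tuple_sum k (generation \<xi> m) (\<lambda>u. f_lambda k lam u * (\<Prod>i=1..k. G \<xi> j (u i)))\<bar>
     \<le> real k ^ 2 * ((\<Sum>u\<in>generation \<xi> m. (G \<xi> j u)\<^sup>2) * (\<Sum>u\<in>generation \<xi> m. G \<xi> j u) ^ (k - 2))"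
proof -
  let ?T = "generation \<xi> m" and ?D = "generation \<xi> (m + j)"
  have b: "block_sum m ?D (weight \<xi>) u = G \<xi> j u" if "u \<in> ?T" for u
    unfolding G_def using that by (intro block_sum_generation) (auto simp: generation_def)
  have "take m ` ?D \<subseteq> ?T"
  proof
    fix u assume "u \<in> take m ` ?D"
    then obtain x where x: "x \<in> tree \<xi>" "length x = m + j" "u = take m x" by (auto simp: generation_def)
    then have "take m x @ drop m x \<in> tree \<xi>" by simp
    then show "u \<in> ?T" using x unfolding in_tree_append by (simp add: generation_def)
  qed
  then have "\<bar>tuple_sum k ?D (\<lambda>x. f_lambda k lam x * (\<Prod>i=1..k. weight \<xi> (x i)))
           - tuple_sum k ?T (\<lambda>u. f_lambda k lam u * (\<Prod>i=1..k. block_sum m ?D (weight \<xi>) (u i)))\<bar>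
     \<le> real k ^ 2 * ((\<Sum>u\<in>?T. (block_sum m ?D (weight \<xi>) u)\<^sup>2) * (\<Sum>u\<in>?T. block_sum m ?D (weight \<xi>) u) ^ (k - 2))"
    using assms(2) by (intro tuple_sum_block_approximation finite_generation) (auto simp: generation_def)
  moreover have "tuple_sum k ?T (\<lambda>u. f_lambda k lam u * (\<Prod>i=1..k. block_sum m ?D (weight \<xi>) (u i)))
      = tuple_sum k ?T (\<lambda>u. f_lambda k lam u * (\<Prod>i=1..k. G \<xi> j (u i)))"
    unfolding tuple_sum_def
  proof (rule sum.cong[OF refl])
    fix x assume "x \<in> Delta k ?T"
    then have "x i \<in> ?T" if "i \<in> {1..k}" for i using that by (rule Delta_mem)
    then show "f_lambda k lam x * (\<Prod>i=1..k. block_sum m ?D (weight \<xi>) (x i)) = f_lambda k lam x * (\<Prod>i=1..k. G \<xi> j (x i))"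
      by (simp add: b)
  qed
  ultimately show ?thesis
    unfolding level_sum_eq_tuple_sum[OF assms(1)] by (simp add: b)
qed

definition tuple_limit :: "nat \<Rightarrow> (nat \<Rightarrow> nat) \<Rightarrow> env \<Rightarrow> real" where
  "tuple_limit k lam \<xi> = lim (\<lambda>l. level_sum k lam l \<xi>)"

lemma borel_measurable_nn_integral_count_space:
  assumes I: "countable I" and "\<And>i. f i \<in> borel_measurable M"
  shows "(\<lambda>x. \<integral>\<^sup>+i. f i x \<partial>count_space I) \<in> borel_measurable M"
proof -
  interpret sigma_finite_measure "count_space I"
    by (rule sigma_finite_measure_count_space_countable) fact
  have "(\<lambda>(i, x). f i x) \<in> borel_measurable (count_space I \<Otimes>\<^sub>M M)"
    using assms by (intro measurable_pair_measure_countable1) auto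
  then have "(\<lambda>(x, i). f i x) \<in> borel_measurable (M \<Otimes>\<^sub>M count_space I)"
    by (subst measurable_pair_swap_iff) (simp add: case_prod_beta)
  from borel_measurable_nn_integral[OF this] show ?thesis by simp
qed

context marked_tree_law
begin

text \<open>The exponents are positive, so a tuple with an entry off the tree contributes zero and the sum
  may be taken over all tuples of labels, a countable set.\<close>

lemma measurable_Delta_sum:
  assumes \<beta>: "\<And>i. i \<in> {1..j} \<Longrightarrow> 1 \<le> \<beta> i" and g: "\<And>x. 0 \<le> g x"
  shows "(\<lambda>\<xi>. \<Sum>x\<in>Delta j (generation \<xi> l). g x * (\<Prod>i=1..j. weight \<xi> (x i) ^ \<beta> i)) \<in> borel_measurable Env"
proof -
  let ?I = "Delta j {v. length v = l}"
  let ?f = "\<lambda>x \<xi>. ennreal (g x * (\<Prod>i=1..j. weight \<xi> (x i) ^ \<beta> i))"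
  have fin: "finite (Delta j (generation \<xi> l))" for \<xi>
    by (rule finite_subset[OF Delta_subset]) (simp add: finite_PiE)
  have "ennreal (\<Sum>x\<in>Delta j (generation \<xi> l). g x * (\<Prod>i=1..j. weight \<xi> (x i) ^ \<beta> i)) = (\<integral>\<^sup>+x. ?f x \<xi> \<partial>count_space ?I)" for \<xi>
  proof -
    have "(\<integral>\<^sup>+x. ?f x \<xi> \<partial>count_space ?I) = (\<Sum>x\<in>Delta j (generation \<xi> l). ?f x \<xi>)"
    proof (rule nn_integral_count_space')
      fix x assume x: "x \<in> ?I" "x \<notin> Delta j (generation \<xi> l)"
      then obtain i where i: "i \<in> {1..j}" "x i \<notin> tree \<xi>" by (auto simp: Delta_def PiE_iff generation_def)
      then have "(\<Prod>i=1..j. weight \<xi> (x i) ^ \<beta> i) = 0"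
        using weight_eq_0[OF i(2)] \<beta>[OF i(1)] by (intro prod_zero) (auto intro!: bexI[of _ i])
      then show "?f x \<xi> = 0" by (simp only: mult_zero_right ennreal_0)
    next
      show "Delta j (generation \<xi> l) \<subseteq> ?I" by (auto simp: Delta_def PiE_iff generation_def)
    qed (rule fin)
    also have "\<dots> = ennreal (\<Sum>x\<in>Delta j (generation \<xi> l). g x * (\<Prod>i=1..j. weight \<xi> (x i) ^ \<beta> i))"
      by (intro sum_ennreal mult_nonneg_nonneg g prod_nonneg) auto
    finally show ?thesis by simp
  qed
  then have "(\<lambda>\<xi>. \<Sum>x\<in>Delta j (generation \<xi> l). g x * (\<Prod>i=1..j. weight \<xi> (x i) ^ \<beta> i))
      = (\<lambda>\<xi>. enn2real (\<integral>\<^sup>+x. ?f x \<xi> \<partial>count_space ?I))"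
    by (metis (no_types, lifting) enn2real_ennreal g mult_nonneg_nonneg prod_nonneg sum_nonneg weight_nonneg zero_le_power)
  moreover have "countable ?I"
    by (rule countable_subset[OF Delta_subset countable_PiE]) auto
  then have "(\<lambda>\<xi>. \<integral>\<^sup>+x. ?f x \<xi> \<partial>count_space ?I) \<in> borel_measurable Env"
    by (rule borel_measurable_nn_integral_count_space) measurable
  ultimately show ?thesis by simp
qed

lemma measurable_level_sum:
  assumes "1 \<le> k"
  shows "level_sum k lam l \<in> borel_measurable Env"
proof -
  have "level_sum k lam l
      = (\<lambda>\<xi>. \<Sum>x\<in>Delta k (generation \<xi> l). f_lambda k lam x * (\<Prod>i=1..k. weight \<xi> (x i) ^ 1))"
    by (rule ext) (simp add: level_sum_eq_tuple_sum[OF assms] tuple_sum_def)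
  also have "\<dots> \<in> borel_measurable Env"
    by (rule measurable_Delta_sum) (simp_all add: f_lambda_bounds)
  finally show ?thesis .
qed

lemma measurable_tuple_limit: "1 \<le> k \<Longrightarrow> tuple_limit k lam \<in> borel_measurable Env"
  unfolding tuple_limit_def[abs_def] by (intro borel_measurable_lim_metric measurable_level_sum)

lemma survival_iff_mass: "\<xi> \<in> survival \<longleftrightarrow> (\<forall>l. 0 < mass \<xi> l)"
proof -
  have "generation \<xi> l \<noteq> {} \<longleftrightarrow> 0 < mass \<xi> l" for l
  proof
    assume "generation \<xi> l \<noteq> {}"
    then obtain v where v: "v \<in> generation \<xi> l" by auto
    then have "0 < weight \<xi> v" by (simp add: generation_def tree_iff_weight)
    also have "weight \<xi> v \<le> mass \<xi> l" unfolding mass_def using v by (intro member_le_sum) auto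
    finally show "0 < mass \<xi> l" .
  qed (auto simp: mass_def)
  then show ?thesis by (simp add: survival_def)
qed

lemma survival_sets [measurable]: "survival \<in> sets Env"
proof -
  have "survival = {\<xi> \<in> space Env. \<forall>l. 0 < mass \<xi> l}" using survival_iff_mass by auto
  also have "\<dots> \<in> sets Env" by measurable
  finally show ?thesis .
qed

lemma sets_star: "sets (env_measure_star \<nu>) = sets Env"
  by (simp add: env_measure_star_def)

lemma AE_star: "AE \<xi> in Env. Q \<xi> \<Longrightarrow> AE \<xi> in env_measure_star \<nu>. Q \<xi>"
  unfolding env_measure_star_def by (rule AE_uniform_measureI) auto

text \<open>Conditioning on survival changes integrals by at most the inverse of the survival probability.
  If that probability were zero, the conditioned measure would be null and the bound trivial.\<close>

lemma nn_integral_star_le: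
  "\<exists>C::real. 0 \<le> C \<and> (\<forall>f \<in> borel_measurable Env. (\<integral>\<^sup>+\<xi>. f \<xi> \<partial>env_measure_star \<nu>) \<le> ennreal C * (\<integral>\<^sup>+\<xi>. f \<xi> \<partial>Env))"
proof -
  define p where "p = measure Env survival"
  have p: "emeasure Env survival = ennreal p" unfolding p_def by (rule env.emeasure_eq_measure)
  have p0: "0 \<le> p" by (simp add: p_def)
  have eq: "(\<integral>\<^sup>+\<xi>. f \<xi> \<partial>env_measure_star \<nu>) = (\<integral>\<^sup>+\<xi>. f \<xi> * indicator survival \<xi> \<partial>Env) / ennreal p"
    if "f \<in> borel_measurable Env" for f
    unfolding env_measure_star_def p[symmetric] by (rule nn_integral_uniform_measure) (use that in auto)
  have le: "(\<integral>\<^sup>+\<xi>. f \<xi> * indicator survival \<xi> \<partial>Env) \<le> (\<integral>\<^sup>+\<xi>. f \<xi> \<partial>Env)" for f :: "env \<Rightarrow> ennreal"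
    by (intro nn_integral_mono) (auto simp: indicator_def)
  show ?thesis
  proof (cases "p = 0")
    case True
    have "(\<integral>\<^sup>+\<xi>. f \<xi> * indicator survival \<xi> \<partial>Env) = 0" if [measurable]: "f \<in> borel_measurable Env" for f
    proof -
      have "AE \<xi> in Env. \<xi> \<notin> survival"
        using p True by (intro AE_not_in) (auto simp: null_sets_def)
      then have "AE \<xi> in Env. f \<xi> * indicator survival \<xi> = 0" by eventually_elim simp
      then show ?thesis by (subst nn_integral_0_iff_AE) auto
    qed
    then show ?thesis by (intro exI[of _ 0]) (auto simp: eq)
  next
    case False
    then have "ennreal (1 / p) = inverse (ennreal p)"
      using p0 by (simp add: inverse_ennreal inverse_eq_divide)
    then have "(\<integral>\<^sup>+\<xi>. f \<xi> \<partial>env_measure_star \<nu>) \<le> ennreal (1 / p) * (\<integral>\<^sup>+\<xi>. f \<xi> \<partial>Env)"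
      if "f \<in> borel_measurable Env" for f
      unfolding eq[OF that] divide_ennreal_def using le[of f] by (simp add: mult.commute mult_left_mono)
    then show ?thesis using p0 by (intro exI[of _ "1 / p"]) auto
  qed
qed

end

context regular_law
begin

text \<open>The level sums are Cauchy: for fixed \<open>m\<close> they are eventually within the block error of the
  fixed number obtained from the limit measure, and this error tends to zero with \<open>m\<close> because the
  limit measure has no heavy block.\<close>

lemma tuple_limit_regular:
  assumes reg: "regular_env \<xi>" and k: "2 \<le> k"
  defines "H \<equiv> limit_measure \<xi>"
  shows level_sum_tendsto: "(\<lambda>l. level_sum k lam l \<xi>) \<longlonglongrightarrow> tuple_limit k lam \<xi>"
    and tuple_limit_block_approximation: "\<And>m. (\<And>i. i \<in> {2..k} \<Longrightarrow> lam i \<le> m) \<Longrightarrow>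
      \<bar>tuple_limit k lam \<xi> - tuple_sum k (generation \<xi> m) (\<lambda>u. f_lambda k lam u * (\<Prod>i=1..k. H (u i)))\<bar>
     \<le> real k ^ 2 * ((\<Sum>u\<in>generation \<xi> m. (H u)\<^sup>2) * (\<Sum>u\<in>generation \<xi> m. H u) ^ (k - 2))"
proof -
  define F where "F m = tuple_sum k (generation \<xi> m) (\<lambda>u. f_lambda k lam u * (\<Prod>i=1..k. H (u i)))" for m
  define E where "E m = real k ^ 2 * ((\<Sum>u\<in>generation \<xi> m. (H u)\<^sup>2) * (\<Sum>u\<in>generation \<xi> m. H u) ^ (k - 2))" for m
  define G where "G j u = weight \<xi> u * mass (subtree u \<xi>) j" for j u
  define M where "M = Max (lam ` {2..k})"
  have M: "lam i \<le> M" if "i \<in> {2..k}" for i unfolding M_def using that by (intro Max_ge) auto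
  have GH: "(\<lambda>j. G j u) \<longlonglongrightarrow> H u" for u
    unfolding G_def H_def limit_measure_def using reg
    by (intro tendsto_mult tendsto_const) (auto simp: regular_env_def)
  define S where "S m j = tuple_sum k (generation \<xi> m) (\<lambda>u. f_lambda k lam u * (\<Prod>i=1..k. G j (u i)))" for m j
  define R where "R m j = real k ^ 2 * ((\<Sum>u\<in>generation \<xi> m. (G j u)\<^sup>2) * (\<Sum>u\<in>generation \<xi> m. G j u) ^ (k - 2))" for m j
  have tF: "(\<lambda>j. S m j) \<longlonglongrightarrow> F m" for m
    unfolding F_def S_def tuple_sum_def by (intro tendsto_sum tendsto_mult tendsto_const tendsto_prod GH)
  have tE: "(\<lambda>j. R m j) \<longlonglongrightarrow> E m" for m
    unfolding E_def R_def by (intro tendsto_mult tendsto_const tendsto_power tendsto_sum GH)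
  have tE0: "E \<longlonglongrightarrow> 0"
  proof -
    have "E = (\<lambda>m. real k ^ 2 * ((\<Sum>u\<in>generation \<xi> m. (H u)\<^sup>2) * limit_mass \<xi> ^ (k - 2)))"
      unfolding E_def H_def by (simp add: limit_mass_split[OF reg, symmetric])
    moreover have "(\<lambda>m. \<Sum>u\<in>generation \<xi> m. (H u)\<^sup>2) \<longlonglongrightarrow> 0"
      using reg unfolding regular_env_def H_def by blast
    from tendsto_mult_left_zero[OF this, of "limit_mass \<xi> ^ (k - 2)"]
    have "(\<lambda>m. (\<Sum>u\<in>generation \<xi> m. (H u)\<^sup>2) * limit_mass \<xi> ^ (k - 2)) \<longlonglongrightarrow> 0" by simp
    ultimately show ?thesis by (simp add: tendsto_mult_right_zero)
  qed
  have ap: "\<bar>level_sum k lam (m + j) \<xi> - S m j\<bar> \<le> R m j" if "\<And>i. i \<in> {2..k} \<Longrightarrow> lam i \<le> m" for m j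
    unfolding G_def S_def R_def using k that by (intro level_sum_block_approximation) auto
  have "Cauchy (\<lambda>l. level_sum k lam l \<xi>)"
  proof (rule metric_CauchyI)
    fix e :: real assume e: "0 < e"
    have "eventually (\<lambda>m. E m < e / 4) sequentially"
      using tE0 e by (intro order_tendstoD(2)) auto
    then obtain m where m: "E m < e / 4" "M \<le> m"
      using eventually_happens[OF eventually_conj[OF _ eventually_ge_at_top[of M]]] by auto
    have lam: "lam i \<le> m" if "i \<in> {2..k}" for i using M[OF that] m by simp
    have ap': "\<bar>level_sum k lam (m + j) \<xi> - S m j\<bar> \<le> R m j" for j
      by (rule ap) (rule lam)
    have 1: "eventually (\<lambda>j. \<bar>S m j - F m\<bar> < e / 4) sequentially"
      using tendstoD[OF tF[of m], of "e / 4"] e by (simp add: dist_real_def)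
    have 2: "eventually (\<lambda>j. R m j < e / 4) sequentially"
      using tE[of m] m(1) by (rule order_tendstoD(2))
    have "eventually (\<lambda>j. \<bar>level_sum k lam (m + j) \<xi> - F m\<bar> < e / 2) sequentially"
      using 1 2
    proof eventually_elim
      case (elim j)
      then show ?case using ap'[of j] by linarith
    qed
    then obtain N where N: "\<bar>level_sum k lam (m + j) \<xi> - F m\<bar> < e / 2" if "N \<le> j" for j
      unfolding eventually_sequentially by blast
    have "dist (level_sum k lam l \<xi>) (level_sum k lam l' \<xi>) < e" if "m + N \<le> l" "m + N \<le> l'" for l l'
    proof -
      have "\<bar>level_sum k lam l \<xi> - F m\<bar> < e / 2" "\<bar>level_sum k lam l' \<xi> - F m\<bar> < e / 2"
        using N[of "l - m"] N[of "l' - m"] that by auto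
      then show ?thesis unfolding dist_real_def by linarith
    qed
    then show "\<exists>N. \<forall>l\<ge>N. \<forall>l'\<ge>N. dist (level_sum k lam l \<xi>) (level_sum k lam l' \<xi>) < e" by blast
  qed
  then show lim: "(\<lambda>l. level_sum k lam l \<xi>) \<longlonglongrightarrow> tuple_limit k lam \<xi>"
    unfolding tuple_limit_def by (simp add: Cauchy_convergent_iff convergent_LIMSEQ_iff)
  fix m assume m: "\<And>i. i \<in> {2..k} \<Longrightarrow> lam i \<le> m"
  have "(\<lambda>j. level_sum k lam (m + j) \<xi>) \<longlonglongrightarrow> tuple_limit k lam \<xi>"
    using LIMSEQ_ignore_initial_segment[OF lim, of m] by (simp add: add.commute)
  then have "(\<lambda>j. \<bar>level_sum k lam (m + j) \<xi> - S m j\<bar>) \<longlonglongrightarrow> \<bar>tuple_limit k lam \<xi> - F m\<bar>"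
    by (intro tendsto_rabs tendsto_diff tF)
  moreover have "\<bar>level_sum k lam (m + j) \<xi> - S m j\<bar> \<le> R m j" for j
    by (rule ap) (rule m)
  ultimately have "\<bar>tuple_limit k lam \<xi> - F m\<bar> \<le> E m"
    by (intro LIMSEQ_le[OF _ tE]) auto
  then show "\<bar>tuple_limit k lam \<xi> - tuple_sum k (generation \<xi> m) (\<lambda>u. f_lambda k lam u * (\<Prod>i=1..k. H (u i)))\<bar>
     \<le> real k ^ 2 * ((\<Sum>u\<in>generation \<xi> m. (H u)\<^sup>2) * (\<Sum>u\<in>generation \<xi> m. H u) ^ (k - 2))"
    unfolding F_def E_def .
qed

text \<open>The squared difference is at most \<open>2 * mass ^ P + 2 * limit_mass ^ P\<close>, a bound that is not
  fixed but converges in mean. Truncating at the limit of this bound leaves a dominated convergence,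
  and the overshoot is at most \<open>2 * \<bar>mass ^ P - limit_mass ^ P\<bar>\<close>.\<close>

lemma level_sum_nn_convergence_L2:
  assumes k: "2 \<le> k" and P: "P = 2 * k"
  shows "(\<lambda>l. \<integral>\<^sup>+\<xi>. ennreal ((level_sum k lam l \<xi> - tuple_limit k lam \<xi>)\<^sup>2) \<partial>Env) \<longlonglongrightarrow> 0"
    and "(\<integral>\<^sup>+\<xi>. ennreal ((tuple_limit k lam \<xi>)\<^sup>2) \<partial>Env) < \<infinity>"
    and "(\<integral>\<^sup>+\<xi>. ennreal ((level_sum k lam l \<xi>)\<^sup>2) \<partial>Env) < \<infinity>"
proof -
  note [measurable] = measurable_level_sum measurable_tuple_limit
  have k1 [simp]: "Suc 0 \<le> k" using k by simp
  let ?A = "tuple_limit k lam" and ?X = "\<lambda>l \<xi>. level_sum k lam l \<xi>"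
  have Xsq: "(?X l \<xi>)\<^sup>2 \<le> mass \<xi> l ^ P" for l \<xi>
    unfolding P power_mult[symmetric] mult.commute[of 2 k]
    using power_mono[OF level_sum_le_mass_power level_sum_nonneg, of k lam l \<xi> 2] k by (simp add: power_mult)
  have Asq: "(?A \<xi>)\<^sup>2 \<le> limit_mass \<xi> ^ P" if "regular_env \<xi>" for \<xi>
  proof (rule LIMSEQ_le)
    show "(\<lambda>l. (?X l \<xi>)\<^sup>2) \<longlonglongrightarrow> (?A \<xi>)\<^sup>2" by (intro tendsto_power level_sum_tendsto that k)
    have "(\<lambda>l. mass (subtree [] \<xi>) l) \<longlonglongrightarrow> limit_mass (subtree [] \<xi>)"
      using that unfolding regular_env_def by blast
    then show "(\<lambda>l. mass \<xi> l ^ P) \<longlonglongrightarrow> limit_mass \<xi> ^ P" by (intro tendsto_power) simp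
  qed (use Xsq in blast)
  have finW: "(\<integral>\<^sup>+\<xi>. ennreal (limit_mass \<xi> ^ P) \<partial>Env) < \<infinity>"
    using nn_integral_limit_mass_power[of P] P2 by (auto intro: le_less_trans)
  have "(\<integral>\<^sup>+\<xi>. ennreal ((?A \<xi>)\<^sup>2) \<partial>Env) \<le> (\<integral>\<^sup>+\<xi>. ennreal (limit_mass \<xi> ^ P) \<partial>Env)"
    by (rule nn_integral_mono_AE, use AE_regular_env in eventually_elim) (intro ennreal_leI Asq)
  then show "(\<integral>\<^sup>+\<xi>. ennreal ((?A \<xi>)\<^sup>2) \<partial>Env) < \<infinity>" using finW by (rule le_less_trans)
  have "(\<integral>\<^sup>+\<xi>. ennreal ((?X l \<xi>)\<^sup>2) \<partial>Env) \<le> (\<integral>\<^sup>+\<xi>. ennreal (mass \<xi> l ^ P) \<partial>Env)"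
    by (intro nn_integral_mono ennreal_leI Xsq)
  also have "\<dots> < \<infinity>" using mass_bound(2)[of P l] P2 by (auto intro: le_less_trans)
  finally show "(\<integral>\<^sup>+\<xi>. ennreal ((?X l \<xi>)\<^sup>2) \<partial>Env) < \<infinity>" .
  \<comment> \<open>truncated at an integrable bound that does not depend on \<open>l\<close>\<close>
  define Y where "Y l \<xi> = min ((?X l \<xi> - ?A \<xi>)\<^sup>2) (4 * limit_mass \<xi> ^ P)" for l \<xi>
  have [measurable]: "Y l \<in> borel_measurable Env" for l
    unfolding Y_def using k by measurable
  have Y0: "(\<lambda>l. \<integral>\<^sup>+\<xi>. ennreal (Y l \<xi>) \<partial>Env) \<longlonglongrightarrow> (\<integral>\<^sup>+\<xi>. 0 \<partial>Env)"
  proof (rule nn_integral_dominated_convergence[where w="\<lambda>\<xi>. ennreal (4 * limit_mass \<xi> ^ P)"])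
    show "(\<integral>\<^sup>+\<xi>. ennreal (4 * limit_mass \<xi> ^ P) \<partial>Env) < \<infinity>"
      using finW by (simp add: ennreal_mult' nn_integral_cmult ennreal_mult_less_top)
    show "AE \<xi> in Env. (\<lambda>l. ennreal (Y l \<xi>)) \<longlonglongrightarrow> 0"
      using AE_regular_env
    proof eventually_elim
      case (elim \<xi>)
      have nn: "0 \<le> 4 * limit_mass \<xi> ^ P" using regular_env_limit_nonneg[OF elim, of "[]"] by simp
      have "(\<lambda>l. Y l \<xi>) \<longlonglongrightarrow> min ((?A \<xi> - ?A \<xi>)\<^sup>2) (4 * limit_mass \<xi> ^ P)"
        unfolding Y_def by (intro tendsto_min tendsto_power tendsto_diff tendsto_const level_sum_tendsto elim k)
      then have "(\<lambda>l. Y l \<xi>) \<longlonglongrightarrow> 0" using nn by (simp add: min_def)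
      then show ?case using tendsto_ennrealI by fastforce
    qed
  qed (auto simp: Y_def intro!: AE_I2 ennreal_leI)
  have up: "(\<integral>\<^sup>+\<xi>. ennreal ((?X l \<xi> - ?A \<xi>)\<^sup>2) \<partial>Env)
      \<le> (\<integral>\<^sup>+\<xi>. ennreal (Y l \<xi>) \<partial>Env) + 2 * (\<integral>\<^sup>+\<xi>. ennreal \<bar>mass \<xi> l ^ P - limit_mass \<xi> ^ P\<bar> \<partial>Env)" for l
  proof -
    have "(\<integral>\<^sup>+\<xi>. ennreal ((?X l \<xi> - ?A \<xi>)\<^sup>2) \<partial>Env)
       \<le> (\<integral>\<^sup>+\<xi>. ennreal (Y l \<xi>) + 2 * ennreal \<bar>mass \<xi> l ^ P - limit_mass \<xi> ^ P\<bar> \<partial>Env)"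
    proof (rule nn_integral_mono_AE, use AE_regular_env in eventually_elim)
      case (elim \<xi>)
      have nn: "0 \<le> limit_mass \<xi> ^ P" using regular_env_limit_nonneg[OF elim, of "[]"] by simp
      have "(?X l \<xi> - ?A \<xi>)\<^sup>2 \<le> 2 * (?X l \<xi>)\<^sup>2 + 2 * (?A \<xi>)\<^sup>2"
        using zero_le_square[of "?X l \<xi> + ?A \<xi>"] by (simp add: power2_eq_square algebra_simps)
      then have "(?X l \<xi> - ?A \<xi>)\<^sup>2 \<le> Y l \<xi> + 2 * \<bar>mass \<xi> l ^ P - limit_mass \<xi> ^ P\<bar>"
        using Xsq[of l \<xi>] Asq[OF elim] unfolding Y_def by (simp add: min_def abs_if split: if_splits)
      then have "ennreal ((?X l \<xi> - ?A \<xi>)\<^sup>2) \<le> ennreal (Y l \<xi> + 2 * \<bar>mass \<xi> l ^ P - limit_mass \<xi> ^ P\<bar>)"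
        by (rule ennreal_leI)
      also have "\<dots> = ennreal (Y l \<xi>) + 2 * ennreal \<bar>mass \<xi> l ^ P - limit_mass \<xi> ^ P\<bar>"
        using nn by (subst ennreal_plus) (auto simp: Y_def ennreal_mult)
      finally show ?case .
    qed
    also have "\<dots> = (\<integral>\<^sup>+\<xi>. ennreal (Y l \<xi>) \<partial>Env) + 2 * (\<integral>\<^sup>+\<xi>. ennreal \<bar>mass \<xi> l ^ P - limit_mass \<xi> ^ P\<bar> \<partial>Env)"
      by (subst nn_integral_add) (auto simp: nn_integral_cmult)
    finally show ?thesis .
  qed
  show "(\<lambda>l. \<integral>\<^sup>+\<xi>. ennreal ((?X l \<xi> - ?A \<xi>)\<^sup>2) \<partial>Env) \<longlonglongrightarrow> 0"
  proof (rule tendsto_sandwich[OF _ _ tendsto_const])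
    show "\<forall>\<^sub>F l in sequentially. (\<integral>\<^sup>+\<xi>. ennreal ((?X l \<xi> - ?A \<xi>)\<^sup>2) \<partial>Env)
      \<le> (\<integral>\<^sup>+\<xi>. ennreal (Y l \<xi>) \<partial>Env) + 2 * (\<integral>\<^sup>+\<xi>. ennreal \<bar>mass \<xi> l ^ P - limit_mass \<xi> ^ P\<bar> \<partial>Env)"
      by (intro always_eventually allI up)
    have "(\<lambda>l. (\<integral>\<^sup>+\<xi>. ennreal (Y l \<xi>) \<partial>Env) + 2 * (\<integral>\<^sup>+\<xi>. ennreal \<bar>mass \<xi> l ^ P - limit_mass \<xi> ^ P\<bar> \<partial>Env)) \<longlonglongrightarrow> 0 + 2 * 0"
      using Y0 by (intro tendsto_add ennreal_tendsto_cmult mass_power_convergence_L1) simp_all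
    then show "(\<lambda>l. (\<integral>\<^sup>+\<xi>. ennreal (Y l \<xi>) \<partial>Env) + 2 * (\<integral>\<^sup>+\<xi>. ennreal \<bar>mass \<xi> l ^ P - limit_mass \<xi> ^ P\<bar> \<partial>Env)) \<longlonglongrightarrow> 0"
      by simp
  qed simp
qed

lemma level_sum_tendsto_in_L2:
  assumes k: "2 \<le> k" and P: "P = 2 * k"
  shows "tendsto_in_L2 (env_measure_star \<nu>) (level_sum k lam) (tuple_limit k lam)"
proof -
  let ?S = "env_measure_star \<nu>" and ?A = "tuple_limit k lam" and ?X = "level_sum k lam"
  have k1: "1 \<le> k" using k by simp
  note mX = measurable_level_sum[OF k1] and mA = measurable_tuple_limit[OF k1]
  have star: "f \<in> borel_measurable ?S" if "f \<in> borel_measurable Env" for f :: "env \<Rightarrow> real"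
    using that by (simp add: measurable_cong_sets[OF sets_star refl])
  obtain C where C: "0 \<le> C" "\<And>f. f \<in> borel_measurable Env \<Longrightarrow> (\<integral>\<^sup>+\<xi>. f \<xi> \<partial>?S) \<le> ennreal C * (\<integral>\<^sup>+\<xi>. f \<xi> \<partial>Env)"
    using nn_integral_star_le by blast
  note L2 = level_sum_nn_convergence_L2[OF k P, of lam]
  have in_L2I: "in_L2 ?S f" if "f \<in> borel_measurable Env" "(\<integral>\<^sup>+\<xi>. ennreal ((f \<xi>)\<^sup>2) \<partial>Env) < \<infinity>" for f
  proof -
    have "(\<integral>\<^sup>+\<xi>. ennreal ((f \<xi>)\<^sup>2) \<partial>?S) \<le> ennreal C * (\<integral>\<^sup>+\<xi>. ennreal ((f \<xi>)\<^sup>2) \<partial>Env)"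
      using that(1) by (intro C) measurable
    also have "\<dots> < \<infinity>" using that(2) by (simp add: ennreal_mult_less_top)
    finally have "integrable ?S (\<lambda>\<xi>. (f \<xi>)\<^sup>2)"
      using star[OF that(1)] by (intro integrableI_bounded) auto
    then show ?thesis using star[OF that(1)] by (simp add: in_L2_def)
  qed
  have "(\<lambda>l. \<integral>\<^sup>+\<xi>. ennreal ((?X l \<xi> - ?A \<xi>)\<^sup>2) \<partial>?S) \<longlonglongrightarrow> 0"
  proof (rule tendsto_sandwich[OF _ _ tendsto_const])
    show "\<forall>\<^sub>F l in sequentially. (\<integral>\<^sup>+\<xi>. ennreal ((?X l \<xi> - ?A \<xi>)\<^sup>2) \<partial>?S)
        \<le> ennreal C * (\<integral>\<^sup>+\<xi>. ennreal ((?X l \<xi> - ?A \<xi>)\<^sup>2) \<partial>Env)"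
      using mX mA by (intro always_eventually allI C) measurable
    have "(\<lambda>l. ennreal C * (\<integral>\<^sup>+\<xi>. ennreal ((?X l \<xi> - ?A \<xi>)\<^sup>2) \<partial>Env)) \<longlonglongrightarrow> ennreal C * 0"
      by (intro ennreal_tendsto_cmult L2) auto
    then show "(\<lambda>l. ennreal C * (\<integral>\<^sup>+\<xi>. ennreal ((?X l \<xi> - ?A \<xi>)\<^sup>2) \<partial>Env)) \<longlonglongrightarrow> 0" by simp
  qed auto
  then have "(\<lambda>l. enn2real (\<integral>\<^sup>+\<xi>. ennreal ((?X l \<xi> - ?A \<xi>)\<^sup>2) \<partial>?S)) \<longlonglongrightarrow> 0"
    by (intro tendsto_enn2real) simp_all
  moreover have "(\<integral>\<xi>. (?X l \<xi> - ?A \<xi>)\<^sup>2 \<partial>?S) = enn2real (\<integral>\<^sup>+\<xi>. ennreal ((?X l \<xi> - ?A \<xi>)\<^sup>2) \<partial>?S)" for l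
    using star[OF mX] star[OF mA] by (intro integral_eq_nn_integral) auto
  ultimately have "(\<lambda>l. \<integral>\<xi>. (?X l \<xi> - ?A \<xi>)\<^sup>2 \<partial>?S) \<longlonglongrightarrow> 0"
    by (simp only:)
  then show ?thesis
    unfolding tendsto_in_L2_def by (intro conjI allI in_L2I mX mA L2(2,3))
qed

end

section \<open>Hitting probabilities of one excursion\<close>

text \<open>The sum of \<open>exp (V y - V x)\<close> over the ancestors \<open>y\<close> of \<open>x\<close>, including \<open>x\<close>. Read from \<open>x\<close>
  downwards it is a perpetuity, and it does not change much when the first generations are
  forgotten.\<close>

definition backward_sum :: "env \<Rightarrow> nat list \<Rightarrow> real" where
  "backward_sum \<xi> x = (\<Sum>j\<le>length x. weight (subtree (take j x) \<xi>) (drop j x))"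

text \<open>Equal to \<open>1 / (\<Sum>y\<le>x. exp (V y))\<close>, the inverse effective resistance between the parent of the
  root and \<open>x\<close>: the probability that an excursion of the walk visits \<open>x\<close>.\<close>

definition hit :: "env \<Rightarrow> nat list \<Rightarrow> real" where
  "hit \<xi> x = weight \<xi> x / backward_sum \<xi> x"

definition hit_sum :: "env \<Rightarrow> nat \<Rightarrow> real" where
  "hit_sum \<xi> l = (\<Sum>x\<in>generation \<xi> l. hit \<xi> x)"

lemma backward_sum_Nil [simp]: "backward_sum \<xi> [] = 1"
  by (simp add: backward_sum_def)

lemma backward_sum_snoc: "backward_sum \<xi> (x @ [i]) = 1 + edge_weight (\<xi> x) i * backward_sum \<xi> x"
proof -
  have "(\<Sum>j\<le>length x. weight (subtree (take j (x @ [i])) \<xi>) (drop j (x @ [i])))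
      = (\<Sum>j\<le>length x. edge_weight (\<xi> x) i * weight (subtree (take j x) \<xi>) (drop j x))"
    by (intro sum.cong refl) (simp add: weight_snoc subtree_apply)
  then show ?thesis unfolding backward_sum_def by (simp add: sum_distrib_left)
qed

lemma backward_sum_append_ge: "backward_sum (subtree v \<xi>) w \<le> backward_sum \<xi> (v @ w)"
proof -
  have "backward_sum (subtree v \<xi>) w = (\<Sum>j\<in>(\<lambda>j. length v + j) ` {..length w}. weight (subtree (take j (v @ w)) \<xi>) (drop j (v @ w)))"
    unfolding backward_sum_def by (subst sum.reindex) (auto simp: subtree_subtree)
  also have "\<dots> \<le> backward_sum \<xi> (v @ w)"
    unfolding backward_sum_def by (intro sum_mono2) auto
  finally show ?thesis .
qed

lemma backward_sum_ge_1: "1 \<le> backward_sum \<xi> x"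
  using backward_sum_append_ge[of x \<xi> "[]"] by simp

lemma backward_sum_pos [simp]: "0 < backward_sum \<xi> x"
  using backward_sum_ge_1[of \<xi> x] by linarith

lemma hit_nonneg [simp]: "0 \<le> hit \<xi> x"
  unfolding hit_def by (simp add: less_imp_le)

lemma hit_le_weight: "hit \<xi> x \<le> weight \<xi> x"
  unfolding hit_def using mult_left_mono[OF backward_sum_ge_1, of "weight \<xi> x" \<xi> x]
  by (simp add: pos_divide_le_eq)

lemma hit_sum_nonneg [simp]: "0 \<le> hit_sum \<xi> l"
  unfolding hit_sum_def by (simp add: sum_nonneg)

lemma hit_sum_le_mass: "hit_sum \<xi> l \<le> mass \<xi> l"
  unfolding hit_sum_def mass_def by (intro sum_mono hit_le_weight)

text \<open>Forgetting the ancestors before \<open>v\<close> shortens the backward sum.\<close>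

lemma hit_append_le: "hit \<xi> (v @ w) \<le> weight \<xi> v * hit (subtree v \<xi>) w"
proof -
  have "hit \<xi> (v @ w) \<le> weight \<xi> (v @ w) / backward_sum (subtree v \<xi>) w"
    unfolding hit_def by (intro divide_left_mono backward_sum_append_ge mult_pos_pos) auto
  then show ?thesis by (simp add: hit_def weight_append)
qed

lemma ennreal_hit_sum:
  "ennreal (hit_sum \<xi> l) = level_sum_nn l (\<lambda>v. ennreal (weight \<xi> v) * ennreal (1 / backward_sum \<xi> v))"
  using level_sum_nn_weight[of "\<lambda>v. 1 / backward_sum \<xi> v" 1 l \<xi>]
  by (simp add: hit_sum_def hit_def ennreal_mult[symmetric] less_imp_le)

lemma backward_sum_graft: "backward_sum (graft v \<xi>' \<xi>) v = backward_sum \<xi> v"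
  unfolding backward_sum_def
proof (rule sum.cong[OF refl])
  fix j assume j: "j \<in> {..length v}"
  show "weight (subtree (take j v) (graft v \<xi>' \<xi>)) (drop j v) = weight (subtree (take j v) \<xi>) (drop j v)"
  proof (rule weight_cong)
    fix i assume i: "i < length (drop j v)"
    then have "\<not> prefix v (take j v @ take i (drop j v))" by (auto dest: prefix_length_le)
    then show "subtree (take j v) (graft v \<xi>' \<xi>) (take i (drop j v)) = subtree (take j v) \<xi> (take i (drop j v))"
      by (simp add: subtree_apply graft_def)
  qed
qed

context marked_tree_law
begin

lemma measurable_backward_sum [measurable]: "(\<lambda>\<xi>. backward_sum \<xi> v) \<in> borel_measurable Env"
  unfolding backward_sum_def by measurable

lemma measurable_hit [measurable]: "(\<lambda>\<xi>. hit \<xi> v) \<in> borel_measurable Env"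
  unfolding hit_def by measurable

lemma measurable_hit_sum [measurable]: "(\<lambda>\<xi>. hit_sum \<xi> l) \<in> borel_measurable Env"
proof -
  have "(\<lambda>\<xi>. enn2real (ennreal (hit_sum \<xi> l))) \<in> borel_measurable Env"
    unfolding ennreal_hit_sum by measurable
  then show ?thesis by simp
qed

text \<open>One step of the Markov kernel of the backward sums, under the size-biased law.\<close>

definition backward_kernel :: "(real \<Rightarrow> ennreal) \<Rightarrow> real \<Rightarrow> ennreal" where
  "backward_kernel f y = (\<integral>\<^sup>+\<xi>. level_sum_nn 1 (\<lambda>w. ennreal (weight \<xi> w) * f (1 + weight \<xi> w * y)) \<partial>Env)"

lemma measurable_backward_kernel [measurable]:
  assumes [measurable]: "f \<in> borel_measurable borel"
  shows "backward_kernel f \<in> borel_measurable borel"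
proof -
  have "(\<lambda>(y, \<xi>). level_sum_nn 1 (\<lambda>w. ennreal (weight \<xi> w) * f (1 + weight \<xi> w * y))) \<in> borel_measurable (borel \<Otimes>\<^sub>M Env)"
    unfolding case_prod_beta
  proof (rule borel_measurable_level_sum_nn)
    fix w
    have "(\<lambda>x. weight (snd x) w) \<in> borel_measurable (borel \<Otimes>\<^sub>M Env)"
      by (rule measurable_compose[OF measurable_snd measurable_weight])
    then show "(\<lambda>x. ennreal (weight (snd x) w) * f (1 + weight (snd x) w * fst x)) \<in> borel_measurable (borel \<Otimes>\<^sub>M Env)"
      by measurable
  qed
  from env.borel_measurable_nn_integral[OF this] show ?thesis
    unfolding backward_kernel_def[abs_def] by simp
qed

text \<open>The last edge is independent of the ancestral line, and adding it maps the backward sum \<open>y\<close> to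
  \<open>1 + weight * y\<close>.\<close>

lemma nn_integral_backward_sum_Suc:
  assumes [measurable]: "f \<in> borel_measurable borel"
  shows "(\<integral>\<^sup>+\<xi>. level_sum_nn (Suc b) (\<lambda>v. ennreal (weight \<xi> v) * f (backward_sum \<xi> v)) \<partial>Env)
       = (\<integral>\<^sup>+\<xi>. level_sum_nn b (\<lambda>v. ennreal (weight \<xi> v) * backward_kernel f (backward_sum \<xi> v)) \<partial>Env)"
proof -
  define g where "g v \<xi> = level_sum_nn 1 (\<lambda>w. ennreal (weight (subtree v \<xi>) w) * f (1 + weight (subtree v \<xi>) w * backward_sum \<xi> v))" for v \<xi>
  have [measurable]: "g v \<in> borel_measurable Env" for v unfolding g_def by measurable
  have step: "level_sum_nn (Suc b) (\<lambda>v. ennreal (weight \<xi> v) * f (backward_sum \<xi> v))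
      = level_sum_nn b (\<lambda>v. ennreal (weight \<xi> v) * g v \<xi>)" for \<xi>
  proof -
    have "level_sum_nn (b + 1) (\<lambda>v. ennreal (weight \<xi> v) * f (backward_sum \<xi> v))
        = level_sum_nn b (\<lambda>v. level_sum_nn 1 (\<lambda>w. ennreal (weight \<xi> (v @ w)) * f (backward_sum \<xi> (v @ w))))"
      by (rule level_sum_nn_append)
    also have "\<dots> = level_sum_nn b (\<lambda>v. ennreal (weight \<xi> v) * g v \<xi>)"
    proof (rule level_sum_nn_cong)
      fix v :: "nat list"
      have "level_sum_nn 1 (\<lambda>w. ennreal (weight \<xi> (v @ w)) * f (backward_sum \<xi> (v @ w)))
          = level_sum_nn 1 (\<lambda>w. ennreal (weight \<xi> v) * (ennreal (weight (subtree v \<xi>) w) * f (1 + weight (subtree v \<xi>) w * backward_sum \<xi> v)))"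
      proof (rule level_sum_nn_cong)
        fix w :: "nat list" assume "length w = 1"
        then obtain i where w: "w = [i]" by (cases w) auto
        have "weight (subtree v \<xi>) [i] = edge_weight (\<xi> v) i"
          using weight_snoc[of "subtree v \<xi>" "[]" i] by (simp add: subtree_apply)
        then show "ennreal (weight \<xi> (v @ w)) * f (backward_sum \<xi> (v @ w))
            = ennreal (weight \<xi> v) * (ennreal (weight (subtree v \<xi>) w) * f (1 + weight (subtree v \<xi>) w * backward_sum \<xi> v))"
          unfolding w by (simp add: weight_snoc backward_sum_snoc ennreal_mult mult.assoc)
      qed
      then show "level_sum_nn 1 (\<lambda>w. ennreal (weight \<xi> (v @ w)) * f (backward_sum \<xi> (v @ w))) = ennreal (weight \<xi> v) * g v \<xi>"
        by (simp add: g_def level_sum_nn_cmult)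
    qed
    finally show ?thesis by simp
  qed
  have "(\<integral>\<^sup>+\<xi>. ennreal (weight \<xi> v) * g v \<xi> \<partial>Env) = (\<integral>\<^sup>+\<xi>. ennreal (weight \<xi> v) * backward_kernel f (backward_sum \<xi> v) \<partial>Env)" for v
    by (subst nn_integral_graft[of _ v])
       (simp_all add: g_def weight_graft backward_sum_graft backward_kernel_def nn_integral_cmult)
  then show ?thesis
    unfolding step by (simp add: nn_integral_level_sum_nn)
qed

definition hit_mean :: "nat \<Rightarrow> real" where
  "hit_mean b = enn2real (\<integral>\<^sup>+\<xi>. ennreal (hit_sum \<xi> b) \<partial>Env)"

end

lemma inverse_ennreal_antimono: "(a::ennreal) \<le> b \<Longrightarrow> inverse b \<le> inverse a"
proof -
  assume le: "a \<le> b"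
  show ?thesis
  proof (cases "a = 0 \<or> b = \<infinity>")
    case False
    then obtain x y where "a = ennreal x" "b = ennreal y" "0 < x" "0 \<le> y"
      using le by (cases a; cases b) (auto simp: less_le top_unique)
    moreover from this le have "x \<le> y" by simp
    ultimately show ?thesis by (simp add: inverse_ennreal le_imp_inverse_le ennreal_leI)
  qed auto
qed

text \<open>The sum \<open>\<Sum>j\<le>b. exp (- S j)\<close> as a function of the increments \<open>x\<close> of the walk; prepending an
  increment acts like one step of the kernel above.\<close>

definition partial_perpetuity :: "nat \<Rightarrow> (nat \<Rightarrow> real) \<Rightarrow> real" where
  "partial_perpetuity b x = (\<Sum>j\<le>b. exp (- (\<Sum>i<j. x i)))"

lemma partial_perpetuity_Suc:
  "partial_perpetuity (Suc b) (case_nat s x) = 1 + exp (- s) * partial_perpetuity b x"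
  unfolding partial_perpetuity_def
  by (subst sum.atMost_Suc_shift)
     (simp add: sum.lessThan_Suc_shift sum_distrib_left exp_add[symmetric] exp_minus[symmetric] del: sum.lessThan_Suc)

lemma measurable_partial_perpetuity [measurable]:
  "partial_perpetuity b \<in> borel_measurable (PiM UNIV (\<lambda>_. borel))"
  unfolding partial_perpetuity_def by measurable

context regular_law
begin

lemma walk_step_law:
  assumes S: "many_to_one_walk \<nu> M S"
    and f [measurable]: "f \<in> borel_measurable borel" and b: "\<And>y. 0 \<le> f y" "\<And>y. f y \<le> (1::real)"
  shows "(\<integral>\<^sup>+s. ennreal (f (1 + exp (- S 1 s) * y)) \<partial>M) = backward_kernel (\<lambda>y. ennreal (f y)) y"
proof -
  interpret M: prob_space M using S by (simp add: many_to_one_walk_def)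
  have [measurable]: "S 1 \<in> borel_measurable M" using S by (simp add: many_to_one_walk_def)
  define t where "t s = f (1 + exp (- s) * y)" for s
  have t [measurable]: "t \<in> borel_measurable borel" unfolding t_def by measurable
  have "bounded (range t)" unfolding bounded_iff t_def using b by (intro exI[of _ 1]) auto
  then have eq: "(\<integral>s. t (S 1 s) \<partial>M) = (\<integral>\<xi>. (\<Sum>x\<in>generation \<xi> 1. t (V \<xi> x) * exp (- V \<xi> x)) \<partial>Env)"
    using S t by (simp add: many_to_one_walk_def)
  define g where "g \<xi> = (\<Sum>x\<in>generation \<xi> 1. weight \<xi> x ^ 1 * f (1 + weight \<xi> x * y))" for \<xi>
  have g: "(\<Sum>x\<in>generation \<xi> 1. t (V \<xi> x) * exp (- V \<xi> x)) = g \<xi>" for \<xi>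
    unfolding g_def t_def by (intro sum.cong refl) (auto simp: generation_def weight_eq_exp_V)
  have eg: "ennreal (g \<xi>) = level_sum_nn 1 (\<lambda>w. ennreal (weight \<xi> w) * ennreal (f (1 + weight \<xi> w * y)))" for \<xi>
    unfolding g_def using b by (subst level_sum_nn_weight[symmetric]) (auto simp: ennreal_mult)
  have g0: "0 \<le> g \<xi>" for \<xi> unfolding g_def using b by (intro sum_nonneg mult_nonneg_nonneg) auto
  have [measurable]: "g \<in> borel_measurable Env"
  proof -
    have "(\<lambda>\<xi>. enn2real (ennreal (g \<xi>))) \<in> borel_measurable Env" unfolding eg by measurable
    then show ?thesis using g0 by simp
  qed
  have le: "(\<integral>\<^sup>+\<xi>. ennreal (g \<xi>) \<partial>Env) \<le> 1"
  proof -
    have "g \<xi> \<le> mass \<xi> 1" for \<xi>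
      unfolding g_def mass_def using b by (intro sum_mono) (simp add: mult_left_le)
    then have "(\<integral>\<^sup>+\<xi>. ennreal (g \<xi>) \<partial>Env) \<le> (\<integral>\<^sup>+\<xi>. ennreal (mass \<xi> 1) \<partial>Env)"
      by (intro nn_integral_mono ennreal_leI)
    then show ?thesis by (simp only: nn_integral_mass)
  qed
  have "(\<integral>s. t (S 1 s) \<partial>M) = enn2real (\<integral>\<^sup>+s. ennreal (t (S 1 s)) \<partial>M)"
    by (intro integral_eq_nn_integral) (measurable, simp add: t_def b)
  moreover have "(\<integral>\<xi>. g \<xi> \<partial>Env) = enn2real (\<integral>\<^sup>+\<xi>. ennreal (g \<xi>) \<partial>Env)"
    using g0 by (intro integral_eq_nn_integral) auto
  ultimately have "enn2real (\<integral>\<^sup>+s. ennreal (t (S 1 s)) \<partial>M) = enn2real (\<integral>\<^sup>+\<xi>. ennreal (g \<xi>) \<partial>Env)"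
    using eq by (simp only: g)
  moreover have "(\<integral>\<^sup>+s. ennreal (t (S 1 s)) \<partial>M) \<le> (\<integral>\<^sup>+s. 1 \<partial>M)"
    using b by (intro nn_integral_mono) (auto simp: t_def)
  then have "(\<integral>\<^sup>+s. ennreal (t (S 1 s)) \<partial>M) \<noteq> \<infinity>" by (auto simp: M.emeasure_space_1 top_unique)
  moreover have "(\<integral>\<^sup>+\<xi>. ennreal (g \<xi>) \<partial>Env) \<noteq> \<infinity>" using le by (auto simp: top_unique)
  ultimately have "(\<integral>\<^sup>+s. ennreal (t (S 1 s)) \<partial>M) = (\<integral>\<^sup>+\<xi>. ennreal (g \<xi>) \<partial>Env)"
    by (metis ennreal_enn2real_if infinity_ennreal_def)
  then show ?thesis unfolding t_def eg backward_kernel_def .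
qed

lemma backward_kernel_bounds:
  assumes "f \<in> borel_measurable borel" "\<And>y. 0 \<le> f y" "\<And>y. f y \<le> (1::real)"
  shows "backward_kernel (\<lambda>y. ennreal (f y)) y \<le> 1"
proof -
  have "backward_kernel (\<lambda>y. ennreal (f y)) y \<le> (\<integral>\<^sup>+\<xi>. level_sum_nn 1 (\<lambda>w. ennreal (weight \<xi> w) * 1) \<partial>Env)"
    unfolding backward_kernel_def using assms
    by (intro nn_integral_mono level_sum_nn_mono mult_left_mono) (auto simp: ennreal_le_1)
  then show ?thesis by (simp only: mult_1_right ennreal_mass[symmetric] nn_integral_mass)
qed

text \<open>Along a size-biased line the displacements are i.i.d. with the law of \<open>S 1\<close>. Both sides
  iterate the same kernel: the backward sum by appending an edge to the line, the perpetuity by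
  prepending an increment to the sequence.\<close>

lemma nn_integral_backward_sum:
  assumes S: "many_to_one_walk \<nu> M S"
    and f: "f \<in> borel_measurable borel" "\<And>y. 0 \<le> f y" "\<And>y. f y \<le> (1::real)"
  shows "(\<integral>\<^sup>+\<xi>. level_sum_nn b (\<lambda>v. ennreal (weight \<xi> v) * ennreal (f (backward_sum \<xi> v))) \<partial>Env)
       = (\<integral>\<^sup>+s. ennreal (f (\<Sum>j\<le>b. exp (- S j s))) \<partial>M)"
proof -
  interpret M: prob_space M using S by (simp add: many_to_one_walk_def)
  have mS [measurable]: "S j \<in> borel_measurable M" for j using S by (simp add: many_to_one_walk_def)
  define \<rho> where "\<rho> = distr M borel (S 1)"
  define X where "X j s = S (Suc j) s - S j s" for j s
  have [measurable]: "X j \<in> borel_measurable M" for j unfolding X_def by measurable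
  have rho: "distr M borel (X j) = \<rho>" for j
    using S unfolding many_to_one_walk_def \<rho>_def X_def[abs_def] by blast
  have indep: "M.indep_vars (\<lambda>_. borel) X UNIV"
    using S unfolding many_to_one_walk_def X_def[abs_def] by blast
  have law: "distr M (PiM UNIV (\<lambda>_. borel)) (\<lambda>s j. X j s) = PiM UNIV (\<lambda>_. \<rho>)"
    using M.indep_vars_iff_distr_eq_PiM[where I=UNIV and X=X and M'="\<lambda>_. borel"] indep by (simp add: rho restrict_UNIV)
  interpret R: prob_space \<rho> unfolding \<rho>_def by (rule M.prob_space_distr) measurable
  interpret Seq: sequence_space \<rho> ..
  have sets_rho [measurable_cong]: "sets \<rho> = sets borel" by (simp add: \<rho>_def)
  have sets_seq: "sets (PiM UNIV (\<lambda>_::nat. \<rho>)) = sets (PiM UNIV (\<lambda>_. borel))"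
    by (intro sets_PiM_cong) (auto simp: sets_rho)
  have sum_X: "(\<Sum>i<j. X i s) = S j s" if "s \<in> space M" for j s
    unfolding X_def using S that sum_lessThan_telescope[of "\<lambda>i. S i s" j]
    by (simp add: many_to_one_walk_def)
  have main: "(\<integral>\<^sup>+\<xi>. level_sum_nn b (\<lambda>v. ennreal (weight \<xi> v) * ennreal (f (backward_sum \<xi> v))) \<partial>Env)
      = (\<integral>\<^sup>+x. ennreal (f (partial_perpetuity b x)) \<partial>PiM UNIV (\<lambda>_. \<rho>))"
    using f
  proof (induction b arbitrary: f)
    case 0
    then show ?case by (simp add: partial_perpetuity_def Seq.P.emeasure_space_1)
  next
    case (Suc b)
    note [measurable] = Suc.prems(1)
    define h where "h y = enn2real (backward_kernel (\<lambda>y. ennreal (f y)) y)" for y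
    have h: "ennreal (h y) = backward_kernel (\<lambda>y. ennreal (f y)) y" for y
      unfolding h_def using backward_kernel_bounds[OF Suc.prems, of y]
      by (intro ennreal_enn2real) (auto simp: less_top[symmetric] top_unique)
    have hm [measurable]: "h \<in> borel_measurable borel" unfolding h_def by measurable
    have h1: "h y \<le> 1" for y
      using backward_kernel_bounds[OF Suc.prems, of y] unfolding h[symmetric] by simp
    have h0: "0 \<le> h y" for y by (simp add: h_def)
    have pp [measurable]: "partial_perpetuity n \<in> borel_measurable (PiM UNIV (\<lambda>_. \<rho>))" for n
      using measurable_partial_perpetuity[of n] by (simp add: measurable_cong_sets[OF sets_seq refl])
    have "(\<integral>\<^sup>+\<xi>. level_sum_nn (Suc b) (\<lambda>v. ennreal (weight \<xi> v) * ennreal (f (backward_sum \<xi> v))) \<partial>Env)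
        = (\<integral>\<^sup>+\<xi>. level_sum_nn b (\<lambda>v. ennreal (weight \<xi> v) * ennreal (h (backward_sum \<xi> v))) \<partial>Env)"
      by (subst nn_integral_backward_sum_Suc) (simp_all add: h)
    also have "\<dots> = (\<integral>\<^sup>+x. ennreal (h (partial_perpetuity b x)) \<partial>PiM UNIV (\<lambda>_. \<rho>))"
      by (rule Suc.IH[OF hm h0 h1])
    also have "\<dots> = (\<integral>\<^sup>+x. \<integral>\<^sup>+s. ennreal (f (1 + exp (- s) * partial_perpetuity b x)) \<partial>\<rho> \<partial>PiM UNIV (\<lambda>_. \<rho>))"
    proof (rule nn_integral_cong)
      fix x
      show "ennreal (h (partial_perpetuity b x)) = (\<integral>\<^sup>+s. ennreal (f (1 + exp (- s) * partial_perpetuity b x)) \<partial>\<rho>)"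
        unfolding h \<rho>_def walk_step_law[OF S Suc.prems, symmetric] by (subst nn_integral_distr) auto
    qed
    also have "\<dots> = (\<integral>\<^sup>+s. \<integral>\<^sup>+x. ennreal (f (1 + exp (- s) * partial_perpetuity b x)) \<partial>PiM UNIV (\<lambda>_. \<rho>) \<partial>\<rho>)"
    proof -
      interpret pair_sigma_finite \<rho> "PiM UNIV (\<lambda>_::nat. \<rho>)" ..
      have "(\<lambda>(s, x). ennreal (f (1 + exp (- s) * partial_perpetuity b x))) \<in> borel_measurable (\<rho> \<Otimes>\<^sub>M PiM UNIV (\<lambda>_. \<rho>))"
        by measurable
      from Fubini[OF this] show ?thesis by simp
    qed
    also have "\<dots> = (\<integral>\<^sup>+p. ennreal (f (partial_perpetuity (Suc b) (case p of (s, x) \<Rightarrow> case_nat s x))) \<partial>(\<rho> \<Otimes>\<^sub>M PiM UNIV (\<lambda>_. \<rho>)))"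
      by (subst Seq.P.nn_integral_fst[symmetric]) (auto simp: partial_perpetuity_Suc)
    also have "\<dots> = (\<integral>\<^sup>+x. ennreal (f (partial_perpetuity (Suc b) x)) \<partial>PiM UNIV (\<lambda>_. \<rho>))"
      by (subst (2) Seq.PiM_iter[symmetric], subst nn_integral_distr) (auto simp: Seq.PiM_iter)
    finally show ?case .
  qed
  also have "\<dots> = (\<integral>\<^sup>+s. ennreal (f (partial_perpetuity b (\<lambda>j. X j s))) \<partial>M)"
    unfolding law[symmetric] using f(1) by (subst nn_integral_distr) (auto intro!: measurable_PiM_single')
  also have "\<dots> = (\<integral>\<^sup>+s. ennreal (f (\<Sum>j\<le>b. exp (- S j s))) \<partial>M)"
    by (intro nn_integral_cong) (simp add: partial_perpetuity_def sum_X)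
  finally show ?thesis .
qed

lemma hit_mean_bounds: "0 \<le> hit_mean b" "hit_mean b \<le> 1"
  and ennreal_hit_mean: "ennreal (hit_mean b) = (\<integral>\<^sup>+\<xi>. ennreal (hit_sum \<xi> b) \<partial>Env)"
proof -
  have le: "(\<integral>\<^sup>+\<xi>. ennreal (hit_sum \<xi> b) \<partial>Env) \<le> 1"
  proof -
    have "(\<integral>\<^sup>+\<xi>. ennreal (hit_sum \<xi> b) \<partial>Env) \<le> (\<integral>\<^sup>+\<xi>. ennreal (mass \<xi> b) \<partial>Env)"
      by (intro nn_integral_mono ennreal_leI hit_sum_le_mass)
    then show ?thesis by simp
  qed
  then show e: "ennreal (hit_mean b) = (\<integral>\<^sup>+\<xi>. ennreal (hit_sum \<xi> b) \<partial>Env)"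
    unfolding hit_mean_def by (intro ennreal_enn2real) (auto simp: less_top[symmetric] top_unique)
  show "0 \<le> hit_mean b" by (simp add: hit_mean_def)
  show "hit_mean b \<le> 1" using le unfolding e[symmetric] by simp
qed

text \<open>Truncating at \<open>1\<close> makes the test function \<open>1 / y\<close> bounded and changes nothing, since both sums
  contain the summand \<open>1\<close>.\<close>

lemma hit_mean_walk:
  assumes S: "many_to_one_walk \<nu> M S"
  shows "ennreal (hit_mean b) = (\<integral>\<^sup>+s. inverse (\<Sum>j\<le>b. ennreal (exp (- S j s))) \<partial>M)"
proof -
  \<comment> \<open>bounded, as required for the many-to-one formula\<close>
  define f where "f y = 1 / max 1 y" for y :: real
  have f: "f \<in> borel_measurable borel" "\<And>y. 0 \<le> f y" "\<And>y. f y \<le> 1"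
    unfolding f_def by measurable
  have "ennreal (hit_mean b) = (\<integral>\<^sup>+\<xi>. level_sum_nn b (\<lambda>v. ennreal (weight \<xi> v) * ennreal (f (backward_sum \<xi> v))) \<partial>Env)"
    unfolding ennreal_hit_mean ennreal_hit_sum f_def
    by (simp add: max_absorb2 backward_sum_ge_1)
  also have "\<dots> = (\<integral>\<^sup>+s. ennreal (f (\<Sum>j\<le>b. exp (- S j s))) \<partial>M)"
    by (rule nn_integral_backward_sum[OF S f])
  also have "\<dots> = (\<integral>\<^sup>+s. inverse (\<Sum>j\<le>b. ennreal (exp (- S j s))) \<partial>M)"
  proof (rule nn_integral_cong)
    fix s assume s: "s \<in> space M"
    have "1 = exp (- S 0 s)" using S s by (simp add: many_to_one_walk_def)
    also have "\<dots> \<le> (\<Sum>j\<le>b. exp (- S j s))" by (rule member_le_sum) auto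
    finally have "1 \<le> (\<Sum>j\<le>b. exp (- S j s))" .
    then have "ennreal (f (\<Sum>j\<le>b. exp (- S j s))) = inverse (ennreal (\<Sum>j\<le>b. exp (- S j s)))"
      unfolding f_def by (subst inverse_ennreal) (auto simp: max_absorb2 inverse_eq_divide)
    then show "ennreal (f (\<Sum>j\<le>b. exp (- S j s))) = inverse (\<Sum>j\<le>b. ennreal (exp (- S j s)))"
      by (simp add: sum_ennreal)
  qed
  finally show ?thesis .
qed

lemma hit_mean_tendsto_c_infty:
  assumes S: "many_to_one_walk \<nu> M S"
  shows "hit_mean \<longlonglongrightarrow> c_infty M S" "c_infty M S \<le> hit_mean b" "0 \<le> c_infty M S"
proof -
  interpret M: prob_space M using S by (simp add: many_to_one_walk_def)
  have [measurable]: "S j \<in> borel_measurable M" for j using S by (simp add: many_to_one_walk_def)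
  define I where "I = (\<integral>\<^sup>+s. inverse (\<Sum>j. ennreal (exp (- S j s))) \<partial>M)"
  have part: "inverse (\<Sum>j\<le>b. ennreal (exp (- S j s))) \<le> 1" if "s \<in> space M" for b s
  proof -
    have "(1::ennreal) = ennreal (exp (- S 0 s))" using S that by (simp add: many_to_one_walk_def)
    also have "\<dots> \<le> (\<Sum>j\<le>b. ennreal (exp (- S j s)))" by (rule member_le_sum) auto
    finally show ?thesis using inverse_ennreal_antimono by fastforce
  qed
  have "(\<lambda>b. \<integral>\<^sup>+s. inverse (\<Sum>j\<le>b. ennreal (exp (- S j s))) \<partial>M) \<longlonglongrightarrow> I"
    unfolding I_def
  proof (rule nn_integral_dominated_convergence[where w="\<lambda>_. 1"])
    show "AE s in M. (\<lambda>b. inverse (\<Sum>j\<le>b. ennreal (exp (- S j s)))) \<longlonglongrightarrow> inverse (\<Sum>j. ennreal (exp (- S j s)))"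
    proof (intro AE_I2)
      fix s
      have "(\<lambda>b. \<Sum>j<Suc b. ennreal (exp (- S j s))) \<longlonglongrightarrow> (\<Sum>j. ennreal (exp (- S j s)))"
        by (rule LIMSEQ_Suc[OF summable_LIMSEQ]) auto
      then show "(\<lambda>b. inverse (\<Sum>j\<le>b. ennreal (exp (- S j s)))) \<longlonglongrightarrow> inverse (\<Sum>j. ennreal (exp (- S j s)))"
        by (intro continuous_on_tendsto_compose[OF continuous_on_inverse_ennreal[OF continuous_on_id[of UNIV]]])
           (simp_all only: lessThan_Suc_atMost UNIV_I always_eventually simp_thms)
    qed
    show "AE s in M. inverse (\<Sum>j\<le>b. ennreal (exp (- S j s))) \<le> 1" for b
      by (intro AE_I2 part)
  qed (simp_all add: M.emeasure_space_1)
  then have lim: "(\<lambda>b. ennreal (hit_mean b)) \<longlonglongrightarrow> I" by (simp add: hit_mean_walk[OF S])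
  have I1: "I \<le> 1" by (rule LIMSEQ_le_const2[OF lim]) (use hit_mean_bounds in \<open>auto intro: ennreal_le_1[THEN iffD2]\<close>)
  then have I: "I = ennreal (c_infty M S)"
    unfolding c_infty_def I_def by (intro ennreal_enn2real[symmetric]) (auto simp: less_top[symmetric] top_unique)
  show c0: "0 \<le> c_infty M S" by (simp add: c_infty_def)
  show "hit_mean \<longlonglongrightarrow> c_infty M S"
    using lim unfolding I by (subst (asm) tendsto_ennreal_iff) (auto simp: hit_mean_bounds c0)
  have "I \<le> ennreal (hit_mean b)"
    unfolding I_def hit_mean_walk[OF S]
    by (intro nn_integral_mono inverse_ennreal_antimono sum_le_suminf) auto
  then show "c_infty M S \<le> hit_mean b" unfolding I using hit_mean_bounds by simp
qed

end

section \<open>Sums of hitting probabilities over the descendants of a vertex\<close>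

lemma sum_generation_blocks:
  fixes g :: "nat list \<Rightarrow> real"
  shows "block_sum m (generation \<xi> (m + j)) g u
     = (if u \<in> generation \<xi> m then \<Sum>w\<in>generation (subtree u \<xi>) j. g (u @ w) else 0)"
proof (cases "u \<in> generation \<xi> m")
  case True
  have "{x. x \<in> generation \<xi> (m + j) \<and> take m x = u} = (@) u ` generation (subtree u \<xi>) j"
  proof (intro equalityI subsetI)
    fix x assume "x \<in> {x. x \<in> generation \<xi> (m + j) \<and> take m x = u}"
    then have x: "x \<in> tree \<xi>" "length x = m + j" "take m x = u" by (auto simp: generation_def)
    then have e: "x = u @ drop m x" by (metis append_take_drop_id)
    have "u @ drop m x \<in> tree \<xi>" by (metis x(1) e)
    then have "drop m x \<in> generation (subtree u \<xi>) j"
      using x(2) unfolding in_tree_append by (simp add: generation_def)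
    then show "x \<in> (@) u ` generation (subtree u \<xi>) j" using e by (rule image_eqI[rotated])
  qed (use True in \<open>auto simp: generation_def in_tree_append\<close>)
  then have "block_sum m (generation \<xi> (m + j)) g u = (\<Sum>x\<in>(@) u ` generation (subtree u \<xi>) j. g x)"
    by (simp add: block_sum_def)
  also have "\<dots> = (\<Sum>w\<in>generation (subtree u \<xi>) j. g (u @ w))"
    by (subst sum.reindex) (auto simp: inj_on_def)
  finally show ?thesis using True by simp
next
  case False
  have "x \<notin> generation \<xi> (m + j)" if "take m x = u" for x
  proof
    assume x: "x \<in> generation \<xi> (m + j)"
    then have "take m x @ drop m x \<in> tree \<xi>" "length x = m + j" by (auto simp: generation_def)
    then have "u \<in> generation \<xi> m" using that unfolding in_tree_append by (auto simp: generation_def)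
    then show False using False by simp
  qed
  then have e: "{x. x \<in> generation \<xi> (m + j) \<and> take m x = u} = {}" by blast
  show ?thesis unfolding block_sum_def e using False by simp
qed

text \<open>Twice this number bounds the probability that one excursion visits both \<open>x\<close> and \<open>y\<close>: reach
  their last common ancestor and then each of them from there.\<close>

definition pair_bound :: "env \<Rightarrow> nat list \<Rightarrow> nat list \<Rightarrow> real" where
  "pair_bound \<xi> x y = hit \<xi> x * hit \<xi> y / hit \<xi> (longest_common_prefix x y)"

lemma pair_bound_nonneg: "0 \<le> pair_bound \<xi> x y"
  unfolding pair_bound_def by (intro divide_nonneg_nonneg mult_nonneg_nonneg) auto

context regular_law
begin

text \<open>Truncating the backward sums after \<open>b\<close> steps makes the contributions of the vertices of
  generation \<open>n\<close> independent, so that they average out.\<close>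

definition truncated_hit_sum :: "nat \<Rightarrow> nat \<Rightarrow> env \<Rightarrow> real" where
  "truncated_hit_sum b n \<xi> = (\<Sum>v\<in>generation \<xi> n. weight \<xi> v * hit_sum (subtree v \<xi>) b)"

lemma ennreal_truncated_hit_sum:
  "ennreal (truncated_hit_sum b n \<xi>) = level_sum_nn n (\<lambda>v. ennreal (weight \<xi> v) * ennreal (hit_sum (subtree v \<xi>) b))"
  using level_sum_nn_weight[of "\<lambda>v. hit_sum (subtree v \<xi>) b" 1 n \<xi>]
  by (simp add: truncated_hit_sum_def ennreal_mult)

lemma truncated_hit_sum_nonneg [simp]: "0 \<le> truncated_hit_sum b n \<xi>"
  unfolding truncated_hit_sum_def by (intro sum_nonneg mult_nonneg_nonneg) auto

lemma measurable_truncated_hit_sum [measurable]: "(\<lambda>\<xi>. truncated_hit_sum b n \<xi>) \<in> borel_measurable Env"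
proof -
  have "(\<lambda>\<xi>. enn2real (ennreal (truncated_hit_sum b n \<xi>))) \<in> borel_measurable Env"
    unfolding ennreal_truncated_hit_sum by measurable
  then show ?thesis by simp
qed

lemma hit_sum_le_truncated: "hit_sum \<xi> (n + b) \<le> truncated_hit_sum b n \<xi>"
  unfolding hit_sum_def truncated_hit_sum_def sum_generation_append sum_distrib_left
  by (intro sum_mono hit_append_le)

lemma truncated_hit_sum_append:
  "truncated_hit_sum b (m + n) \<xi> = (\<Sum>u\<in>generation \<xi> m. weight \<xi> u * truncated_hit_sum b n (subtree u \<xi>))"
  unfolding truncated_hit_sum_def sum_generation_append
  by (simp add: weight_append subtree_subtree sum_distrib_left mult.assoc)

lemma nn_integral_truncated_hit_sum:
  "(\<integral>\<^sup>+\<xi>. ennreal (truncated_hit_sum b n \<xi>) \<partial>Env) = ennreal (hit_mean b)"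
  using nn_integral_weighted_subtree[of "\<lambda>\<xi>. ennreal (hit_sum \<xi> b)" n 1]
  unfolding ennreal_truncated_hit_sum ennreal_hit_mean by simp

lemma truncated_hit_sum_L1:
  "(\<integral>\<^sup>+\<xi>. ennreal \<bar>truncated_hit_sum b n \<xi> - hit_mean b * mass \<xi> n\<bar> \<partial>Env) \<le> ennreal ((mass_bound 2 + 1) * rate ^ n)"
proof -
  have "(\<integral>\<^sup>+\<xi>. ennreal ((hit_sum \<xi> b)\<^sup>2) \<partial>Env) \<le> (\<integral>\<^sup>+\<xi>. ennreal (mass \<xi> b ^ 2) \<partial>Env)"
    by (intro nn_integral_mono ennreal_leI power_mono hit_sum_le_mass hit_sum_nonneg)
  also have "\<dots> \<le> ennreal (mass_bound 2)" using P2 by (intro mass_bound) auto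
  finally have sq: "(\<integral>\<^sup>+\<xi>. ennreal ((hit_sum \<xi> b)\<^sup>2) \<partial>Env) \<le> ennreal (mass_bound 2)" .
  have "(\<integral>\<^sup>+\<xi>. ennreal ((truncated_hit_sum b n \<xi> - hit_mean b * mass \<xi> n)\<^sup>2) \<partial>Env)
      \<le> ennreal (mass_bound 2 * (rate ^ n * rate ^ n))"
    unfolding truncated_hit_sum_def
    using mass_bound(1)[of 2] P2
    by (intro centered_square sq) (simp_all add: ennreal_hit_mean hit_mean_bounds)
  then show ?thesis
    using rate mass_bound(1)[of 2] P2
    by (intro nn_integral_abs_le_of_square) (auto simp: power2_eq_square)
qed

text \<open>Two approximations are combined: the averaging of the truncated sums over independent
  subtrees, and the convergence of the mass. What remains is the bias \<open>hit_mean b - c\<close>.\<close>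

lemma truncated_hit_sum_limit_L1:
  assumes "0 \<le> c" "c \<le> hit_mean b"
  shows "(\<integral>\<^sup>+\<xi>. ennreal \<bar>truncated_hit_sum b n \<xi> - c * limit_mass \<xi>\<bar> \<partial>Env)
    \<le> ennreal (2 * (mass_bound 2 + 1) * rate ^ n + (hit_mean b - c))"
proof -
  let ?K = "(mass_bound 2 + 1) * rate ^ n" and ?h = "hit_mean b"
  have K0: "0 \<le> ?K" using mass_bound(1)[of 2] P2 rate by simp
  have "(\<integral>\<^sup>+\<xi>. ennreal \<bar>truncated_hit_sum b n \<xi> - c * limit_mass \<xi>\<bar> \<partial>Env)
     \<le> (\<integral>\<^sup>+\<xi>. ennreal \<bar>truncated_hit_sum b n \<xi> - ?h * mass \<xi> n\<bar> + ennreal \<bar>limit_mass \<xi> - mass \<xi> n\<bar>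
          + ennreal (?h - c) * ennreal (limit_mass \<xi>) \<partial>Env)"
  proof (rule nn_integral_mono_AE, use AE_limit_mass_nonneg in eventually_elim)
    case (elim \<xi>)
    let ?W = "limit_mass \<xi>" and ?m = "mass \<xi> n" and ?t = "truncated_hit_sum b n \<xi>"
    have "?t - c * ?W = (?t - ?h * ?m) + ?h * (?m - ?W) + (?h - c) * ?W" by (simp add: algebra_simps)
    then have "\<bar>?t - c * ?W\<bar> \<le> \<bar>?t - ?h * ?m\<bar> + \<bar>?h * (?m - ?W)\<bar> + \<bar>(?h - c) * ?W\<bar>" by linarith
    also have "\<bar>?h * (?m - ?W)\<bar> \<le> 1 * \<bar>?W - ?m\<bar>"
      unfolding abs_mult abs_minus_commute[of ?m] using hit_mean_bounds[of b] by (intro mult_right_mono) auto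
    also have "\<bar>(?h - c) * ?W\<bar> = (?h - c) * ?W" using assms elim by simp
    finally have "ennreal \<bar>?t - c * ?W\<bar> \<le> ennreal (\<bar>?t - ?h * ?m\<bar> + 1 * \<bar>?W - ?m\<bar> + (?h - c) * ?W)"
      by (intro ennreal_leI) auto
    also have "\<dots> = ennreal \<bar>?t - ?h * ?m\<bar> + ennreal \<bar>?W - ?m\<bar> + ennreal (?h - c) * ennreal ?W"
      using assms elim by (simp add: ennreal_mult)
    finally show ?case .
  qed
  also have "\<dots> = (\<integral>\<^sup>+\<xi>. ennreal \<bar>truncated_hit_sum b n \<xi> - ?h * mass \<xi> n\<bar> \<partial>Env)
      + (\<integral>\<^sup>+\<xi>. ennreal \<bar>limit_mass \<xi> - mass \<xi> n\<bar> \<partial>Env) + ennreal (?h - c) * 1"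
    by (simp add: nn_integral_add nn_integral_cmult nn_integral_limit_mass)
  also have "\<dots> \<le> ennreal ?K + ennreal ?K + ennreal (?h - c) * 1"
    by (intro add_mono truncated_hit_sum_L1 limit_mass_abs order_refl)
  also have "\<dots> = ennreal (2 * (mass_bound 2 + 1) * rate ^ n + (?h - c))"
    using K0 assms by (simp add: ennreal_plus[symmetric] algebra_simps del: ennreal_plus)
  finally show ?thesis .
qed

definition block_error :: "real \<Rightarrow> nat \<Rightarrow> nat \<Rightarrow> env \<Rightarrow> real" where
  "block_error c m l \<xi> = (\<Sum>u\<in>generation \<xi> m. \<bar>block_sum m (generation \<xi> l) (hit \<xi>) u - c * limit_measure \<xi> u\<bar>)"

lemma measurable_block_error [measurable]: "(\<lambda>\<xi>. block_error c m (m + j) \<xi>) \<in> borel_measurable Env"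
proof -
  define h where "h u \<xi> = enn2real (level_sum_nn j (\<lambda>w. ennreal (hit \<xi> (u @ w))))" for u \<xi>
  have [measurable]: "h u \<in> borel_measurable Env" for u unfolding h_def by measurable
  have z: "u @ w \<notin> tree \<xi> \<Longrightarrow> hit \<xi> (u @ w) = 0" for u w \<xi> by (simp add: hit_def weight_eq_0)
  have h: "h u \<xi> = block_sum m (generation \<xi> (m + j)) (hit \<xi>) u" if "u \<in> generation \<xi> m" for u \<xi>
  proof -
    have "level_sum_nn j (\<lambda>w. ennreal (hit \<xi> (u @ w))) = (\<Sum>w\<in>generation (subtree u \<xi>) j. ennreal (hit \<xi> (u @ w)))"
      by (rule level_sum_nn_generation) (use that in \<open>auto simp: z in_tree_append generation_def\<close>)
    then show ?thesis using that by (simp add: h_def sum_generation_blocks sum_ennreal sum_nonneg)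
  qed
  have "ennreal (block_error c m (m + j) \<xi>) = level_sum_nn m (\<lambda>u. of_bool (0 < weight \<xi> u) * ennreal \<bar>h u \<xi> - c * limit_measure \<xi> u\<bar>)" for \<xi>
  proof -
    have "level_sum_nn m (\<lambda>u. of_bool (0 < weight \<xi> u) * ennreal \<bar>h u \<xi> - c * limit_measure \<xi> u\<bar>)
        = (\<Sum>u\<in>generation \<xi> m. of_bool (0 < weight \<xi> u) * ennreal \<bar>h u \<xi> - c * limit_measure \<xi> u\<bar>)"
      by (rule level_sum_nn_generation) (auto simp: weight_eq_0)
    also have "\<dots> = (\<Sum>u\<in>generation \<xi> m. ennreal \<bar>block_sum m (generation \<xi> (m + j)) (hit \<xi>) u - c * limit_measure \<xi> u\<bar>)"
      by (intro sum.cong refl) (auto simp: h generation_def tree_iff_weight)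
    finally show ?thesis by (simp add: block_error_def sum_ennreal)
  qed
  then have "(\<lambda>\<xi>. block_error c m (m + j) \<xi>)
     = (\<lambda>\<xi>. enn2real (level_sum_nn m (\<lambda>u. of_bool (0 < weight \<xi> u) * ennreal \<bar>h u \<xi> - c * limit_measure \<xi> u\<bar>)))"
    by (metis enn2real_ennreal abs_ge_zero block_error_def sum_nonneg)
  also have "\<dots> \<in> borel_measurable Env" by measurable
  finally show ?thesis .
qed

text \<open>Each block sum of \<open>hit\<close> is at most its truncated version. The total loss from truncation is
  therefore the difference of the totals, whose mean is \<open>hit_mean b - hit_mean (m + (n + b))\<close>, at
  most \<open>hit_mean b - c\<close>.\<close>

lemma block_error_bound:
  assumes "0 \<le> c" "\<And>b. c \<le> hit_mean b"
  shows "(\<integral>\<^sup>+\<xi>. ennreal (block_error c m (m + (n + b)) \<xi>) \<partial>Env)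
     \<le> ennreal (2 * (mass_bound 2 + 1) * rate ^ n + 2 * (hit_mean b - c))"
proof -
  let ?l = "m + (n + b)" and ?K = "2 * (mass_bound 2 + 1) * rate ^ n"
  have K0: "0 \<le> ?K" using mass_bound(1)[of 2] P2 rate by simp
  define A where "A \<xi> = (\<Sum>u\<in>generation \<xi> m. weight \<xi> u * \<bar>truncated_hit_sum b n (subtree u \<xi>) - c * limit_mass (subtree u \<xi>)\<bar>)" for \<xi>
  have eA: "ennreal (A \<xi>) = level_sum_nn m (\<lambda>u. ennreal (weight \<xi> u ^ 1) * ennreal \<bar>truncated_hit_sum b n (subtree u \<xi>) - c * limit_mass (subtree u \<xi>)\<bar>)" for \<xi>
    using level_sum_nn_weight[of "\<lambda>u. \<bar>truncated_hit_sum b n (subtree u \<xi>) - c * limit_mass (subtree u \<xi>)\<bar>" 1 m \<xi>]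
    by (simp add: A_def ennreal_mult)
  have A0: "0 \<le> A \<xi>" for \<xi> unfolding A_def by (intro sum_nonneg mult_nonneg_nonneg) auto
  \<comment> \<open>the loss from truncation, summed over the blocks, telescopes into totals\<close>
  have pw: "block_error c m ?l \<xi> + hit_sum \<xi> ?l \<le> truncated_hit_sum b (m + n) \<xi> + A \<xi>" for \<xi>
  proof -
    have "block_error c m ?l \<xi> \<le> (\<Sum>u\<in>generation \<xi> m. (weight \<xi> u * truncated_hit_sum b n (subtree u \<xi>) - block_sum m (generation \<xi> ?l) (hit \<xi>) u)
        + weight \<xi> u * \<bar>truncated_hit_sum b n (subtree u \<xi>) - c * limit_mass (subtree u \<xi>)\<bar>)"
      unfolding block_error_def
    proof (rule sum_mono)
      fix u assume u: "u \<in> generation \<xi> m"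
      let ?w = "weight \<xi> u" and ?t = "truncated_hit_sum b n (subtree u \<xi>)" and ?B = "block_sum m (generation \<xi> ?l) (hit \<xi>) u"
      have "?B = (\<Sum>w\<in>generation (subtree u \<xi>) (n + b). hit \<xi> (u @ w))"
        using u by (simp add: sum_generation_blocks)
      also have "\<dots> \<le> (\<Sum>w\<in>generation (subtree u \<xi>) (n + b). ?w * hit (subtree u \<xi>) w)"
        by (intro sum_mono hit_append_le)
      also have "\<dots> = ?w * hit_sum (subtree u \<xi>) (n + b)" by (simp add: hit_sum_def sum_distrib_left)
      also have "\<dots> \<le> ?w * ?t" by (intro mult_left_mono hit_sum_le_truncated) auto
      finally have "?B \<le> ?w * ?t" .
      moreover have "\<bar>?w * ?t - c * limit_measure \<xi> u\<bar> = ?w * \<bar>?t - c * limit_mass (subtree u \<xi>)\<bar>"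
      proof -
        have "?w * ?t - c * limit_measure \<xi> u = ?w * (?t - c * limit_mass (subtree u \<xi>))"
          by (simp add: limit_measure_def algebra_simps)
        then show ?thesis by (simp add: abs_mult)
      qed
      ultimately show "\<bar>?B - c * limit_measure \<xi> u\<bar> \<le> (?w * ?t - ?B) + ?w * \<bar>?t - c * limit_mass (subtree u \<xi>)\<bar>"
        by linarith
    qed
    also have "\<dots> = truncated_hit_sum b (m + n) \<xi> - (\<Sum>u\<in>generation \<xi> m. block_sum m (generation \<xi> ?l) (hit \<xi>) u) + A \<xi>"
      by (simp add: A_def truncated_hit_sum_append sum.distrib sum_subtractf)
    also have "(\<Sum>u\<in>generation \<xi> m. block_sum m (generation \<xi> ?l) (hit \<xi>) u) = hit_sum \<xi> ?l"
      unfolding hit_sum_def sum_generation_append[where m=m] by (intro sum.cong refl) (simp add: sum_generation_blocks)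
    finally show ?thesis by simp
  qed
  have BE0: "0 \<le> block_error c m ?l \<xi>" for \<xi> unfolding block_error_def by (simp add: sum_nonneg)
  have IA: "(\<integral>\<^sup>+\<xi>. ennreal (A \<xi>) \<partial>Env) \<le> ennreal (?K + (hit_mean b - c))"
  proof -
    have "(\<integral>\<^sup>+\<xi>. ennreal (A \<xi>) \<partial>Env) = phi 1 m * (\<integral>\<^sup>+\<xi>. ennreal \<bar>truncated_hit_sum b n \<xi> - c * limit_mass \<xi>\<bar> \<partial>Env)"
      unfolding eA by (rule nn_integral_weighted_subtree) measurable
    then show ?thesis using truncated_hit_sum_limit_L1[OF assms, of b n] by simp
  qed
  have mA [measurable]: "A \<in> borel_measurable Env"
  proof -
    have "(\<lambda>\<xi>. enn2real (ennreal (A \<xi>))) \<in> borel_measurable Env" unfolding eA by measurable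
    then show ?thesis using A0 by simp
  qed
  have e: "ennreal (hit_mean b + (?K + (hit_mean b - c))) = ennreal (hit_mean b) + ennreal (?K + (hit_mean b - c))"
    using K0 assms(2)[of b] hit_mean_bounds[of b] by (intro ennreal_plus) auto
  have "(\<integral>\<^sup>+\<xi>. ennreal (block_error c m ?l \<xi>) \<partial>Env) + ennreal (hit_mean ?l)
      = (\<integral>\<^sup>+\<xi>. ennreal (block_error c m ?l \<xi>) + ennreal (hit_sum \<xi> ?l) \<partial>Env)"
    unfolding ennreal_hit_mean by (subst nn_integral_add) auto
  also have "\<dots> \<le> (\<integral>\<^sup>+\<xi>. ennreal (truncated_hit_sum b (m + n) \<xi>) + ennreal (A \<xi>) \<partial>Env)"
    using pw BE0 A0 by (intro nn_integral_mono) (simp add: ennreal_plus[symmetric] ennreal_leI del: ennreal_plus)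
  also have "\<dots> = ennreal (hit_mean b) + (\<integral>\<^sup>+\<xi>. ennreal (A \<xi>) \<partial>Env)"
    by (subst nn_integral_add) (auto simp: nn_integral_truncated_hit_sum)
  also have "\<dots> \<le> ennreal (hit_mean b) + ennreal (?K + (hit_mean b - c))"
    using IA by (intro add_left_mono)
  finally have le: "(\<integral>\<^sup>+\<xi>. ennreal (block_error c m ?l \<xi>) \<partial>Env) + ennreal (hit_mean ?l)
      \<le> ennreal (hit_mean b + (?K + (hit_mean b - c)))"
    unfolding e .
  then obtain x where x: "(\<integral>\<^sup>+\<xi>. ennreal (block_error c m ?l \<xi>) \<partial>Env) = ennreal x" "0 \<le> x"
    by (cases "\<integral>\<^sup>+\<xi>. ennreal (block_error c m ?l \<xi>) \<partial>Env") (auto simp: top_unique)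
  have "x + hit_mean ?l \<le> hit_mean b + (?K + (hit_mean b - c))"
  proof -
    have "ennreal (x + hit_mean ?l) \<le> ennreal (hit_mean b + (?K + (hit_mean b - c)))"
      using le x hit_mean_bounds by simp
    moreover have "0 \<le> hit_mean b + (?K + (hit_mean b - c))" using K0 assms(2)[of b] hit_mean_bounds[of b] by simp
    ultimately show ?thesis by (simp only: ennreal_le_iff)
  qed
  then have "x \<le> ?K + 2 * (hit_mean b - c)" using assms(2)[of ?l] by simp
  then show ?thesis unfolding x by (rule ennreal_leI)
qed

lemma sum_common_ancestor:
  "(\<Sum>x\<in>generation \<xi> (l + i). \<Sum>y\<in>generation \<xi> (l + j). if take l x = take l y then f (take l x) * g (take l x) (drop l x) * h (take l x) (drop l y) else (0::real))
   = (\<Sum>z\<in>generation \<xi> l. f z * (\<Sum>x\<in>generation (subtree z \<xi>) i. g z x) * (\<Sum>y\<in>generation (subtree z \<xi>) j. h z y))"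
proof -
  have "(\<Sum>x\<in>generation \<xi> (l + i). \<Sum>y\<in>generation \<xi> (l + j). if take l x = take l y then f (take l x) * g (take l x) (drop l x) * h (take l x) (drop l y) else 0)
     = (\<Sum>z\<in>generation \<xi> l. \<Sum>x\<in>generation (subtree z \<xi>) i. \<Sum>z'\<in>generation \<xi> l. \<Sum>y\<in>generation (subtree z' \<xi>) j.
          if z = z' then f z * g z x * h z y else 0)"
    unfolding sum_generation_append by (intro sum.cong refl) (auto simp: generation_def)
  also have "\<dots> = (\<Sum>z\<in>generation \<xi> l. \<Sum>x\<in>generation (subtree z \<xi>) i. \<Sum>y\<in>generation (subtree z \<xi>) j. f z * g z x * h z y)"
  proof (rule sum.cong[OF refl], rule sum.cong[OF refl])
    fix z x assume z: "z \<in> generation \<xi> l" and "x \<in> generation (subtree z \<xi>) i"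
    have "(\<Sum>z'\<in>generation \<xi> l. \<Sum>y\<in>generation (subtree z' \<xi>) j. if z = z' then f z * g z x * h z y else 0)
        = (\<Sum>z'\<in>generation \<xi> l. if z = z' then \<Sum>y\<in>generation (subtree z' \<xi>) j. f z * g z x * h z y else 0)"
      by (intro sum.cong refl) auto
    also have "\<dots> = (\<Sum>y\<in>generation (subtree z \<xi>) j. f z * g z x * h z y)"
      using z by (subst sum.delta') auto
    finally show "(\<Sum>z'\<in>generation \<xi> l. \<Sum>y\<in>generation (subtree z' \<xi>) j. if z = z' then f z * g z x * h z y else 0)
        = (\<Sum>y\<in>generation (subtree z \<xi>) j. f z * g z x * h z y)" .
  qed
  also have "\<dots> = (\<Sum>z\<in>generation \<xi> l. f z * (\<Sum>x\<in>generation (subtree z \<xi>) i. g z x) * (\<Sum>y\<in>generation (subtree z \<xi>) j. h z y))"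
    by (simp only: mult.assoc sum_product) (simp only: sum_distrib_left)
  finally show ?thesis .
qed

text \<open>The summand for the length of the last common ancestor already suffices. Summing over all
  common ancestors removes the exact ancestor from the formula, after which the subtrees factorise.\<close>

lemma pair_bound_le:
  assumes x: "x \<in> generation \<xi> i" and y: "y \<in> generation \<xi> j"
  shows "pair_bound \<xi> x y \<le> (\<Sum>l\<le>min i j. if take l x = take l y then
     (weight \<xi> (take l x) * backward_sum \<xi> (take l x)) * weight (subtree (take l x) \<xi>) (drop l x)
       * weight (subtree (take l x) \<xi>) (drop l y) else 0)"
proof -
  let ?z = "longest_common_prefix x y"
  define l where "l = length ?z"
  have len: "length x = i" "length y = j" using x y by (auto simp: generation_def)
  have l: "l \<le> min i j" "take l x = take l y" "take l x = ?z"
    using le_length_longest_common_prefix[of l x y] len longest_common_prefix_prefix1[of x y]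
    by (auto simp: l_def prefix_def) (metis append_eq_conv_conj)
  have "x = ?z @ drop l x" "y = ?z @ drop l y" using l by (metis append_take_drop_id)+
  then have wx: "weight \<xi> x = weight \<xi> ?z * weight (subtree ?z \<xi>) (drop l x)"
    and wy: "weight \<xi> y = weight \<xi> ?z * weight (subtree ?z \<xi>) (drop l y)"
    by (metis weight_append)+
  have z0: "0 < weight \<xi> ?z" using weight_take_pos[of \<xi> x l] x l by (simp add: generation_def tree_iff_weight)
  have "pair_bound \<xi> x y \<le> weight \<xi> x * weight \<xi> y / hit \<xi> ?z"
    unfolding pair_bound_def by (intro divide_right_mono mult_mono hit_le_weight) auto
  also have "\<dots> = (weight \<xi> ?z * backward_sum \<xi> ?z) * weight (subtree ?z \<xi>) (drop l x) * weight (subtree ?z \<xi>) (drop l y)"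
    unfolding wx wy hit_def using z0 by (simp add: field_simps)
  also have "\<dots> = (if take l x = take l y then
     (weight \<xi> (take l x) * backward_sum \<xi> (take l x)) * weight (subtree (take l x) \<xi>) (drop l x)
       * weight (subtree (take l x) \<xi>) (drop l y) else 0)" using l by simp
  also have "\<dots> \<le> (\<Sum>l\<le>min i j. if take l x = take l y then
     (weight \<xi> (take l x) * backward_sum \<xi> (take l x)) * weight (subtree (take l x) \<xi>) (drop l x)
       * weight (subtree (take l x) \<xi>) (drop l y) else 0)"
  proof (rule member_le_sum[of l "{..min i j}" "\<lambda>l. if take l x = take l y then
     (weight \<xi> (take l x) * backward_sum \<xi> (take l x)) * weight (subtree (take l x) \<xi>) (drop l x)
       * weight (subtree (take l x) \<xi>) (drop l y) else 0"])
    show "l \<in> {..min i j}" using l by simp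
  qed (auto intro!: mult_nonneg_nonneg simp: less_imp_le)
  finally show ?thesis .
qed

lemma sum_pair_bound_le:
  "(\<Sum>x\<in>generation \<xi> i. \<Sum>y\<in>generation \<xi> j. pair_bound \<xi> x y)
     \<le> (\<Sum>l\<le>min i j. \<Sum>z\<in>generation \<xi> l. (weight \<xi> z * backward_sum \<xi> z) * mass (subtree z \<xi>) (i - l) * mass (subtree z \<xi>) (j - l))"
proof -
  let ?t = "\<lambda>l x y. if take l x = take l y then
     (weight \<xi> (take l x) * backward_sum \<xi> (take l x)) * weight (subtree (take l x) \<xi>) (drop l x)
       * weight (subtree (take l x) \<xi>) (drop l y) else 0"
  have "(\<Sum>x\<in>generation \<xi> i. \<Sum>y\<in>generation \<xi> j. pair_bound \<xi> x y)
      \<le> (\<Sum>x\<in>generation \<xi> i. \<Sum>y\<in>generation \<xi> j. \<Sum>l\<le>min i j. ?t l x y)"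
    by (intro sum_mono pair_bound_le)
  also have "\<dots> = (\<Sum>x\<in>generation \<xi> i. \<Sum>l\<le>min i j. \<Sum>y\<in>generation \<xi> j. ?t l x y)"
    by (intro sum.cong refl sum.swap)
  also have "\<dots> = (\<Sum>l\<le>min i j. \<Sum>x\<in>generation \<xi> i. \<Sum>y\<in>generation \<xi> j. ?t l x y)"
    by (rule sum.swap)
  also have "\<dots> = (\<Sum>l\<le>min i j. \<Sum>z\<in>generation \<xi> l. (weight \<xi> z * backward_sum \<xi> z) * mass (subtree z \<xi>) (i - l) * mass (subtree z \<xi>) (j - l))"
  proof (rule sum.cong[OF refl])
    fix l assume "l \<in> {..min i j}"
    then have "l + (i - l) = i" "l + (j - l) = j" by auto
    then show "(\<Sum>x\<in>generation \<xi> i. \<Sum>y\<in>generation \<xi> j. ?t l x y) = (\<Sum>z\<in>generation \<xi> l. (weight \<xi> z * backward_sum \<xi> z) * mass (subtree z \<xi>) (i - l) * mass (subtree z \<xi>) (j - l))"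
      using sum_common_ancestor[where \<xi>=\<xi> and l=l and i="i - l" and j="j - l"
          and f="\<lambda>z. weight \<xi> z * backward_sum \<xi> z"
          and g="\<lambda>z. weight (subtree z \<xi>)" and h="\<lambda>z. weight (subtree z \<xi>)"]
      by (simp add: mass_def)
  qed
  finally show ?thesis .
qed

text \<open>The product \<open>weight z * backward_sum z\<close> is a sum over ancestors \<open>w\<close> of \<open>weight w\<close> times a
  squared weight between \<open>w\<close> and \<open>z\<close>, hence a geometric series in \<open>phi 2\<close>.\<close>

lemma nn_integral_weight_backward_sum:
  "(\<integral>\<^sup>+\<xi>. level_sum_nn l (\<lambda>z. ennreal (weight \<xi> z * backward_sum \<xi> z)) \<partial>Env) \<le> ennreal (1 / (1 - rate))"
proof -
  have split: "level_sum_nn l (\<lambda>z. ennreal (weight \<xi> z * backward_sum \<xi> z))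
      = (\<Sum>r\<le>l. level_sum_nn r (\<lambda>w. ennreal (weight \<xi> w ^ 1) * level_sum_nn (l - r) (\<lambda>z. ennreal (weight (subtree w \<xi>) z ^ 2))))" for \<xi>
  proof -
    have "level_sum_nn l (\<lambda>z. ennreal (weight \<xi> z * backward_sum \<xi> z))
       = level_sum_nn l (\<lambda>z. \<Sum>r\<le>l. ennreal (weight \<xi> (take r z) * weight (subtree (take r z) \<xi>) (drop r z) ^ 2))"
    proof (rule level_sum_nn_cong)
      fix z :: "nat list" assume z: "length z = l"
      have "weight \<xi> z = weight \<xi> (take r z) * weight (subtree (take r z) \<xi>) (drop r z)" for r
        using weight_append[of \<xi> "take r z" "drop r z"] by simp
      then have "weight \<xi> z * backward_sum \<xi> z = (\<Sum>r\<le>l. weight \<xi> (take r z) * weight (subtree (take r z) \<xi>) (drop r z) ^ 2)"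
        unfolding backward_sum_def z sum_distrib_left
        by (intro sum.cong refl) (metis mult.assoc power2_eq_square)
      then show "ennreal (weight \<xi> z * backward_sum \<xi> z) = (\<Sum>r\<le>l. ennreal (weight \<xi> (take r z) * weight (subtree (take r z) \<xi>) (drop r z) ^ 2))"
        by (simp add: sum_ennreal)
    qed
    also have "\<dots> = (\<Sum>r\<le>l. level_sum_nn l (\<lambda>z. ennreal (weight \<xi> (take r z) * weight (subtree (take r z) \<xi>) (drop r z) ^ 2)))"
      unfolding level_sum_nn_def by (rule nn_integral_sum) auto
    also have "\<dots> = (\<Sum>r\<le>l. level_sum_nn r (\<lambda>w. ennreal (weight \<xi> w ^ 1) * level_sum_nn (l - r) (\<lambda>z. ennreal (weight (subtree w \<xi>) z ^ 2))))"
    proof (rule sum.cong[OF refl])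
      fix r assume r: "r \<in> {..l}"
      have "level_sum_nn (r + (l - r)) (\<lambda>z. ennreal (weight \<xi> (take r z) * weight (subtree (take r z) \<xi>) (drop r z) ^ 2))
          = level_sum_nn r (\<lambda>w. level_sum_nn (l - r) (\<lambda>z. ennreal (weight \<xi> w) * ennreal (weight (subtree w \<xi>) z ^ 2)))"
        unfolding level_sum_nn_append by (intro level_sum_nn_cong) (simp add: ennreal_mult)
      then show "level_sum_nn l (\<lambda>z. ennreal (weight \<xi> (take r z) * weight (subtree (take r z) \<xi>) (drop r z) ^ 2))
         = level_sum_nn r (\<lambda>w. ennreal (weight \<xi> w ^ 1) * level_sum_nn (l - r) (\<lambda>z. ennreal (weight (subtree w \<xi>) z ^ 2)))"
        using r by (simp add: level_sum_nn_cmult)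
    qed
    finally show ?thesis .
  qed
  have "(\<integral>\<^sup>+\<xi>. level_sum_nn l (\<lambda>z. ennreal (weight \<xi> z * backward_sum \<xi> z)) \<partial>Env)
     = (\<Sum>r\<le>l. \<integral>\<^sup>+\<xi>. level_sum_nn r (\<lambda>w. ennreal (weight \<xi> w ^ 1) * level_sum_nn (l - r) (\<lambda>z. ennreal (weight (subtree w \<xi>) z ^ 2))) \<partial>Env)"
    unfolding split by (rule nn_integral_sum) measurable
  also have "\<dots> = (\<Sum>r\<le>l. phi 1 r * phi 2 (l - r))"
    unfolding phi_def[of 2] by (intro sum.cong refl nn_integral_weighted_subtree) measurable
  also have "\<dots> \<le> (\<Sum>r\<le>l. ennreal (rate ^ (l - r)))"
  proof (rule sum_mono)
    fix r
    have "rate ^ (l - r) * rate ^ (l - r) \<le> rate ^ (l - r) * 1"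
      using rate by (intro mult_left_mono power_le_one) auto
    then show "phi 1 r * phi 2 (l - r) \<le> ennreal (rate ^ (l - r))"
      using phi_2_le[of "l - r"] by (simp add: order_trans[OF _ ennreal_leI])
  qed
  also have "\<dots> = ennreal (\<Sum>r\<le>l. rate ^ (l - r))" using rate by (intro sum_ennreal) auto
  also have "(\<Sum>r\<le>l. rate ^ (l - r)) = (\<Sum>r\<le>l. rate ^ r)"
    by (rule sum.reindex_bij_witness[of _ "\<lambda>r. l - r" "\<lambda>r. l - r"]) auto
  also have "\<dots> \<le> 1 / (1 - rate)"
  proof -
    have "(\<Sum>r\<le>l. rate ^ r) \<le> (\<Sum>r. rate ^ r)" using rate by (intro sum_le_suminf summable_geometric) auto
    then show ?thesis using rate by (simp add: suminf_geometric)
  qed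
  finally show ?thesis by (simp add: ennreal_leI)
qed

definition pair_const :: real where
  "pair_const = mass_bound 2 / (1 - rate)"

lemma pair_const_nonneg: "0 \<le> pair_const"
  unfolding pair_const_def using mass_bound(1)[of 2] P2 rate by simp

text \<open>Given a common ancestor in generation \<open>l\<close>, the two masses above it contribute at most their
  second moment; there are \<open>min i j + 1\<close> possible \<open>l\<close>.\<close>

lemma nn_integral_sum_pair_bound:
  "(\<integral>\<^sup>+\<xi>. ennreal (\<Sum>x\<in>generation \<xi> i. \<Sum>y\<in>generation \<xi> j. pair_bound \<xi> x y) \<partial>Env)
    \<le> ennreal (pair_const * real (min i j + 1))"
proof -
  let ?B = "\<lambda>l \<xi>. \<Sum>z\<in>generation \<xi> l. (weight \<xi> z * backward_sum \<xi> z) * mass (subtree z \<xi>) (i - l) * mass (subtree z \<xi>) (j - l)"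
  have eB: "ennreal (?B l \<xi>) = level_sum_nn l (\<lambda>z. ennreal (weight \<xi> z * backward_sum \<xi> z) * ennreal (mass (subtree z \<xi>) (i - l) * mass (subtree z \<xi>) (j - l)))" for l \<xi>
    using level_sum_nn_weight[of "\<lambda>z. backward_sum \<xi> z * (mass (subtree z \<xi>) (i - l) * mass (subtree z \<xi>) (j - l))" 1 l \<xi>]
    by (simp add: ennreal_mult[symmetric] less_imp_le mult.assoc)
  have IB: "(\<integral>\<^sup>+\<xi>. ennreal (?B l \<xi>) \<partial>Env) \<le> ennreal pair_const" for l
  proof -
    have "(\<integral>\<^sup>+\<xi>. ennreal (?B l \<xi>) \<partial>Env)
       = (\<integral>\<^sup>+\<xi>. level_sum_nn l (\<lambda>z. ennreal (weight \<xi> z * backward_sum \<xi> z)) \<partial>Env)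
         * (\<integral>\<^sup>+\<xi>. ennreal (mass \<xi> (i - l) * mass \<xi> (j - l)) \<partial>Env)"
      unfolding eB by (rule many_to_one_subtree) (measurable, simp add: weight_graft backward_sum_graft)
    also have "(\<integral>\<^sup>+\<xi>. ennreal (mass \<xi> (i - l) * mass \<xi> (j - l)) \<partial>Env) \<le> ennreal (mass_bound 2)"
    proof -
      have "(\<integral>\<^sup>+\<xi>. ennreal (mass \<xi> (i - l) * mass \<xi> (j - l)) \<partial>Env)
        \<le> (\<integral>\<^sup>+\<xi>. ennreal (1/2) * ennreal (mass \<xi> (i - l) ^ 2) + ennreal (1/2) * ennreal (mass \<xi> (j - l) ^ 2) \<partial>Env)"
      proof (rule nn_integral_mono)
        fix \<xi>
        have "mass \<xi> (i - l) * mass \<xi> (j - l) \<le> 1/2 * mass \<xi> (i - l) ^ 2 + 1/2 * mass \<xi> (j - l) ^ 2"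
          using sum_squares_bound[of "mass \<xi> (i - l)" "mass \<xi> (j - l)"] by simp
        then have "ennreal (mass \<xi> (i - l) * mass \<xi> (j - l)) \<le> ennreal (1/2 * mass \<xi> (i - l) ^ 2 + 1/2 * mass \<xi> (j - l) ^ 2)"
          by (rule ennreal_leI)
        then show "ennreal (mass \<xi> (i - l) * mass \<xi> (j - l)) \<le> ennreal (1/2) * ennreal (mass \<xi> (i - l) ^ 2) + ennreal (1/2) * ennreal (mass \<xi> (j - l) ^ 2)"
          by (simp only: ennreal_plus ennreal_mult zero_le_power2 zero_le_power mult_nonneg_nonneg zero_le_divide_1_iff zero_le_numeral)
      qed
      also have "\<dots> = ennreal (1/2) * (\<integral>\<^sup>+\<xi>. ennreal (mass \<xi> (i - l) ^ 2) \<partial>Env) + ennreal (1/2) * (\<integral>\<^sup>+\<xi>. ennreal (mass \<xi> (j - l) ^ 2) \<partial>Env)"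
        by (subst nn_integral_add) (simp_all add: nn_integral_cmult)
      also have "\<dots> \<le> ennreal (1/2) * ennreal (mass_bound 2) + ennreal (1/2) * ennreal (mass_bound 2)"
        using P2 by (intro add_mono mult_left_mono mass_bound) auto
      also have "\<dots> = ennreal (mass_bound 2)"
      proof -
        have "ennreal (1/2 * mass_bound 2 + 1/2 * mass_bound 2) = ennreal (1/2) * ennreal (mass_bound 2) + ennreal (1/2) * ennreal (mass_bound 2)"
          using mass_bound(1)[of 2] P2
          by (simp only: ennreal_plus ennreal_mult mult_nonneg_nonneg zero_le_divide_1_iff zero_le_numeral)
        then show ?thesis by simp
      qed
      finally show ?thesis .
    qed
    finally have "(\<integral>\<^sup>+\<xi>. ennreal (?B l \<xi>) \<partial>Env) \<le> ennreal (1 / (1 - rate)) * ennreal (mass_bound 2)"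
      using nn_integral_weight_backward_sum[of l] by (meson mult_mono order_trans zero_le order_refl mult_left_mono mult_right_mono)
    then show ?thesis
      unfolding pair_const_def using mass_bound(1)[of 2] P2 rate by (simp add: ennreal_mult[symmetric])
  qed
  have B0: "0 \<le> ?B l \<xi>" for l \<xi> by (intro sum_nonneg mult_nonneg_nonneg) (auto simp: less_imp_le)
  have "(\<integral>\<^sup>+\<xi>. ennreal (\<Sum>x\<in>generation \<xi> i. \<Sum>y\<in>generation \<xi> j. pair_bound \<xi> x y) \<partial>Env)
      \<le> (\<integral>\<^sup>+\<xi>. (\<Sum>l\<le>min i j. ennreal (?B l \<xi>)) \<partial>Env)"
  proof (rule nn_integral_mono)
    fix \<xi>
    have "ennreal (\<Sum>x\<in>generation \<xi> i. \<Sum>y\<in>generation \<xi> j. pair_bound \<xi> x y) \<le> ennreal (\<Sum>l\<le>min i j. ?B l \<xi>)"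
      by (intro ennreal_leI sum_pair_bound_le)
    also have "\<dots> = (\<Sum>l\<le>min i j. ennreal (?B l \<xi>))" using B0 by (intro sum_ennreal[symmetric])
    finally show "ennreal (\<Sum>x\<in>generation \<xi> i. \<Sum>y\<in>generation \<xi> j. pair_bound \<xi> x y) \<le> (\<Sum>l\<le>min i j. ennreal (?B l \<xi>))" .
  qed
  also have "\<dots> = (\<Sum>l\<le>min i j. \<integral>\<^sup>+\<xi>. ennreal (?B l \<xi>) \<partial>Env)"
    by (rule nn_integral_sum) (unfold eB, measurable)
  also have "\<dots> \<le> (\<Sum>l\<le>min i j. ennreal pair_const)" by (intro sum_mono IB)
  also have "\<dots> = ennreal (\<Sum>l\<le>min i j. pair_const)" using pair_const_nonneg by (intro sum_ennreal)
  also have "(\<Sum>l\<le>min i j. pair_const) = pair_const * real (min i j + 1)" by simp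
  finally show ?thesis .
qed

end

section \<open>Recurrence: escaping to high generations\<close>

text \<open>The probability of reaching generation \<open>m\<close> of the tree above the root before the parent of
  the root.\<close>

primrec escape :: "nat \<Rightarrow> env \<Rightarrow> real" where
  "escape 0 \<xi> = 1"
| "escape (Suc m) \<xi> = (let B = \<Sum>v\<in>generation \<xi> 1. weight \<xi> v * escape m (subtree v \<xi>) in B / (1 + B))"

lemma escape_bounds: "0 \<le> escape m \<xi>" "escape m \<xi> \<le> 1"
proof (induction m arbitrary: \<xi>)
  case (Suc m)
  { case 1 show ?case using Suc by (auto simp: Let_def intro!: divide_nonneg_nonneg add_nonneg_nonneg sum_nonneg mult_nonneg_nonneg) }
  { case 2
    have "0 \<le> (\<Sum>v\<in>generation \<xi> 1. weight \<xi> v * escape m (subtree v \<xi>))"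
      using Suc by (intro sum_nonneg mult_nonneg_nonneg) auto
    then show ?case by (simp add: Let_def divide_le_eq) }
qed auto

lemma escape_antimono: "escape (Suc m) \<xi> \<le> escape m \<xi>"
proof (induction m arbitrary: \<xi>)
  case 0
  then show ?case using escape_bounds(2)[of "Suc 0" \<xi>] by simp
next
  case (Suc m)
  have mono: "a / (1 + a) \<le> b / (1 + b)" if "0 \<le> a" "a \<le> b" for a b :: real
    using that by (simp add: field_simps)
  have "(\<Sum>v\<in>generation \<xi> 1. weight \<xi> v * escape (Suc m) (subtree v \<xi>)) \<le> (\<Sum>v\<in>generation \<xi> 1. weight \<xi> v * escape m (subtree v \<xi>))"
    by (intro sum_mono mult_left_mono Suc) auto
  moreover have "0 \<le> (\<Sum>v\<in>generation \<xi> 1. weight \<xi> v * escape (Suc m) (subtree v \<xi>))"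
    by (intro sum_nonneg mult_nonneg_nonneg weight_nonneg escape_bounds)
  ultimately show ?case
    unfolding escape.simps(2)[of "Suc m"] escape.simps(2)[of m] Let_def by (intro mono)
qed

context regular_law
begin

lemma measurable_escape [measurable]: "escape m \<in> borel_measurable Env"
proof (induction m)
  case (Suc m)
  note [measurable] = Suc
  have "(\<lambda>\<xi>. enn2real (level_sum_nn 1 (\<lambda>v. ennreal (weight \<xi> v ^ 1 * escape m (subtree v \<xi>))))) \<in> borel_measurable Env"
    by measurable
  then have [measurable]: "(\<lambda>\<xi>. \<Sum>v\<in>generation \<xi> 1. weight \<xi> v * escape m (subtree v \<xi>)) \<in> borel_measurable Env"
    by (subst (asm) level_sum_nn_weight) (auto simp: escape_bounds sum_nonneg)
  show ?case unfolding escape.simps Let_def by measurable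
qed simp

text \<open>The limit \<open>e\<close> satisfies \<open>e = B / (1 + B)\<close> with \<open>B\<close> the weighted sum of the limits of the
  children, and \<open>B\<close> has the same mean as \<open>e\<close> because the weights have total mean one. As \<open>B = e + B
  * e\<close>, the product \<open>B * e\<close> has mean zero.\<close>

lemma AE_escape_tendsto_0: "AE \<xi> in Env. (\<lambda>m. escape m \<xi>) \<longlonglongrightarrow> 0"
proof -
  define e where "e \<xi> = lim (\<lambda>m. escape m \<xi>)" for \<xi>
  have [measurable]: "e \<in> borel_measurable Env"
    unfolding e_def[abs_def] by (rule borel_measurable_lim_metric) measurable
  have lim: "(\<lambda>m. escape m \<xi>) \<longlonglongrightarrow> e \<xi>" for \<xi>
  proof -
    have "convergent (\<lambda>m. escape m \<xi>)"
    proof (rule Bseq_monoseq_convergent)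
      show "Bseq (\<lambda>m. escape m \<xi>)" using escape_bounds by (intro BseqI'[of _ 1]) auto
      show "monoseq (\<lambda>m. escape m \<xi>)" by (intro decseq_imp_monoseq decseq_SucI escape_antimono)
    qed
    then show ?thesis unfolding e_def by (rule convergent_LIMSEQ_iff[THEN iffD1])
  qed
  have e01: "0 \<le> e \<xi>" "e \<xi> \<le> 1" for \<xi>
    using LIMSEQ_le_const[OF lim, of 0 \<xi>] LIMSEQ_le_const2[OF lim, of \<xi> 1] escape_bounds by auto
  define B where "B \<xi> = (\<Sum>v\<in>generation \<xi> 1. weight \<xi> v * e (subtree v \<xi>))" for \<xi>
  have B0: "0 \<le> B \<xi>" for \<xi> unfolding B_def using e01 by (intro sum_nonneg mult_nonneg_nonneg) auto
  have eB: "ennreal (B \<xi>) = level_sum_nn 1 (\<lambda>v. ennreal (weight \<xi> v ^ 1) * ennreal (e (subtree v \<xi>)))" for \<xi>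
    using level_sum_nn_weight[of "\<lambda>v. e (subtree v \<xi>)" 1 1 \<xi>] e01 by (simp add: B_def ennreal_mult)
  have [measurable]: "B \<in> borel_measurable Env"
  proof -
    have "(\<lambda>\<xi>. enn2real (ennreal (B \<xi>))) \<in> borel_measurable Env" unfolding eB by measurable
    then show ?thesis using B0 by simp
  qed
  have eq: "e \<xi> = B \<xi> / (1 + B \<xi>)" for \<xi>
  proof (rule LIMSEQ_unique[OF LIMSEQ_Suc[OF lim]])
    have "(\<lambda>m. \<Sum>v\<in>generation \<xi> 1. weight \<xi> v * escape m (subtree v \<xi>)) \<longlonglongrightarrow> B \<xi>"
      unfolding B_def by (intro tendsto_intros lim)
    then show "(\<lambda>m. escape (Suc m) \<xi>) \<longlonglongrightarrow> B \<xi> / (1 + B \<xi>)"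
      unfolding escape.simps Let_def using B0[of \<xi>] by (intro tendsto_intros) auto
  qed
  have "(\<integral>\<^sup>+\<xi>. ennreal (B \<xi>) \<partial>Env) = phi 1 1 * (\<integral>\<^sup>+\<xi>. ennreal (e \<xi>) \<partial>Env)"
    unfolding eB by (rule nn_integral_weighted_subtree) measurable
  then have same: "(\<integral>\<^sup>+\<xi>. ennreal (B \<xi>) \<partial>Env) = (\<integral>\<^sup>+\<xi>. ennreal (e \<xi>) \<partial>Env)" by simp
  have fin: "(\<integral>\<^sup>+\<xi>. ennreal (e \<xi>) \<partial>Env) \<noteq> \<infinity>"
  proof -
    have "(\<integral>\<^sup>+\<xi>. ennreal (e \<xi>) \<partial>Env) \<le> (\<integral>\<^sup>+\<xi>. 1 \<partial>Env)" using e01 by (intro nn_integral_mono) (auto simp: ennreal_le_1)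
    then show ?thesis by (auto simp: top_unique)
  qed
  have split: "ennreal (B \<xi>) = ennreal (e \<xi>) + ennreal (B \<xi> * e \<xi>)" for \<xi>
  proof -
    have "e \<xi> * (1 + B \<xi>) = B \<xi>" unfolding eq[of \<xi>] using B0[of \<xi>] by simp
    then have "B \<xi> = e \<xi> + B \<xi> * e \<xi>" by (simp add: algebra_simps)
    then show ?thesis using e01 B0 by (metis ennreal_plus mult_nonneg_nonneg)
  qed
  have "(\<integral>\<^sup>+\<xi>. ennreal (e \<xi>) \<partial>Env) = (\<integral>\<^sup>+\<xi>. ennreal (e \<xi>) \<partial>Env) + (\<integral>\<^sup>+\<xi>. ennreal (B \<xi> * e \<xi>) \<partial>Env)"
    unfolding same[symmetric] by (subst split, subst nn_integral_add) (auto simp: same)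
  then have "(\<integral>\<^sup>+\<xi>. ennreal (B \<xi> * e \<xi>) \<partial>Env) = 0"
    using fin ennreal_add_left_cancel[of "\<integral>\<^sup>+\<xi>. ennreal (e \<xi>) \<partial>Env" 0] by auto
  then have "AE \<xi> in Env. ennreal (B \<xi> * e \<xi>) = 0"
    by (subst (asm) nn_integral_0_iff_AE) auto
  then show ?thesis
  proof eventually_elim
    case (elim \<xi>)
    then have "B \<xi> * e \<xi> = 0"
      using mult_nonneg_nonneg[OF B0[of \<xi>] e01(1)[of \<xi>]] by (metis ennreal_eq_0_iff order_antisym)
    then have "e \<xi> = 0" by (metis div_0 eq mult_eq_0_iff)
    then show ?case using lim[of \<xi>] by simp
  qed
qed

end

section \<open>The walk in a fixed environment\<close>

text \<open>The transition operator of the walk: the mean of \<open>f\<close> after one step from \<open>v\<close>.\<close>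

definition walk_step :: "env \<Rightarrow> (vertex \<Rightarrow> real) \<Rightarrow> vertex \<Rightarrow> real" where
  "walk_step \<xi> f v = (case v of None \<Rightarrow> f (Some [])
     | Some u \<Rightarrow> (exp (- V \<xi> u) * f (parent u) + (\<Sum>i<length (\<xi> u). exp (- V \<xi> (u @ [i])) * f (Some (u @ [i]))))
         / (exp (- V \<xi> u) + (\<Sum>i<length (\<xi> u). exp (- V \<xi> (u @ [i])))))"

lemma walk_step_None [simp]: "walk_step \<xi> f None = f (Some [])"
  by (simp add: walk_step_def)

lemma conductance_pos: "0 < exp (- V \<xi> u) + (\<Sum>i<length (\<xi> u). exp (- V \<xi> (u @ [i])))"
  by (intro add_pos_nonneg sum_nonneg) auto

lemma walk_step_eq_iff:
  "walk_step \<xi> f (Some u) = c \<longleftrightarrow>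
     exp (- V \<xi> u) * (f (parent u) - c) + (\<Sum>i<length (\<xi> u). exp (- V \<xi> (u @ [i])) * (f (Some (u @ [i])) - c)) = 0"
  using conductance_pos[of \<xi> u]
  by (simp add: walk_step_def divide_eq_eq right_diff_distrib sum_subtractf sum_distrib_right
      distrib_left algebra_simps flip: sum_distrib_left)

lemma walk_step_mono:
  assumes "\<And>y. f y \<le> g y" shows "walk_step \<xi> f v \<le> walk_step \<xi> g v"
proof (cases v)
  case (Some u)
  then show ?thesis using assms conductance_pos[of \<xi> u]
    by (simp add: walk_step_def) (intro divide_right_mono add_mono mult_left_mono sum_mono; simp)
qed (simp add: assms)

lemma walk_step_linear:
  "walk_step \<xi> (\<lambda>y. a * f y + b * g y + c) v = a * walk_step \<xi> f v + b * walk_step \<xi> g v + c"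
proof (cases v)
  case (Some u)
  let ?w = "exp (- V \<xi> u)" and ?e = "\<lambda>i. exp (- V \<xi> (u @ [i]))" and ?I = "{..<length (\<xi> u)}"
  have "?w * (a * f (parent u) + b * g (parent u) + c) + (\<Sum>i\<in>?I. ?e i * (a * f (Some (u @ [i])) + b * g (Some (u @ [i])) + c))
     = a * (?w * f (parent u) + (\<Sum>i\<in>?I. ?e i * f (Some (u @ [i])))) + b * (?w * g (parent u) + (\<Sum>i\<in>?I. ?e i * g (Some (u @ [i]))))
      + c * (?w + (\<Sum>i\<in>?I. ?e i))"
    by (simp add: distrib_left sum.distrib sum_distrib_left mult_ac)
  moreover have "(a * p + b * q + c * z) / z = a * (p / z) + b * (q / z) + c" if "0 < z" for p q z :: real
    using that by (simp add: field_simps)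
  ultimately show ?thesis unfolding Some walk_step_def option.case
    using conductance_pos[of \<xi> u] by simp
qed simp

lemma walk_step_const [simp]: "walk_step \<xi> (\<lambda>_. c) v = c"
  using walk_step_linear[of \<xi> 0 "\<lambda>_. 0" 0 "\<lambda>_. 0" c v] by simp

lemma walk_step_nonneg: "(\<And>y. 0 \<le> f y) \<Longrightarrow> 0 \<le> walk_step \<xi> f v"
  using walk_step_mono[of "\<lambda>_. 0" f \<xi> v] by simp

lemma trans_prob_nonneg: "0 \<le> trans_prob \<xi> v y"
  by (cases v) (auto intro!: divide_nonneg_nonneg add_nonneg_nonneg sum_nonneg)

lemma parent_neq_child: "parent u \<noteq> Some (u @ [i])"
  by (cases u rule: rev_cases) (auto simp: parent_def)

lemma nn_integral_trans_prob:
  assumes f: "\<And>y. 0 \<le> f y"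
  shows "(\<integral>\<^sup>+y. ennreal (trans_prob \<xi> v y) * ennreal (f y) \<partial>count_space UNIV) = ennreal (walk_step \<xi> f v)"
proof (cases v)
  case None
  have "(\<integral>\<^sup>+y. ennreal (trans_prob \<xi> v y) * ennreal (f y) \<partial>count_space UNIV) = (\<Sum>y\<in>{Some []}. ennreal (trans_prob \<xi> v y) * ennreal (f y))"
    by (rule nn_integral_count_space') (auto simp: None)
  then show ?thesis by (simp add: None)
next
  case (Some u)
  let ?w = "exp (- V \<xi> u)" and ?e = "\<lambda>i. exp (- V \<xi> (u @ [i]))" and ?I = "{..<length (\<xi> u)}"
  let ?Z = "?w + (\<Sum>i\<in>?I. ?e i)" and ?c = "\<lambda>i. Some (u @ [i])"
  have tp: "trans_prob \<xi> v (parent u) = ?w / ?Z" by (simp add: Some)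
  have tc: "trans_prob \<xi> v (?c i) = ?e i / ?Z" if "i \<in> ?I" for i
    using that parent_neq_child[of u i] by (auto simp: Some)
  have "(\<integral>\<^sup>+y. ennreal (trans_prob \<xi> v y) * ennreal (f y) \<partial>count_space UNIV)
      = (\<Sum>y\<in>insert (parent u) (?c ` ?I). ennreal (trans_prob \<xi> v y) * ennreal (f y))"
    by (rule nn_integral_count_space') (auto simp: Some)
  also have "\<dots> = ennreal (\<Sum>y\<in>insert (parent u) (?c ` ?I). trans_prob \<xi> v y * f y)"
    using f trans_prob_nonneg by (subst sum_ennreal[symmetric]) (auto simp: ennreal_mult)
  also have "(\<Sum>y\<in>insert (parent u) (?c ` ?I). trans_prob \<xi> v y * f y)
      = trans_prob \<xi> v (parent u) * f (parent u) + (\<Sum>y\<in>?c ` ?I. trans_prob \<xi> v y * f y)"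
    using parent_neq_child[of u] by (intro sum.insert) auto
  also have "(\<Sum>y\<in>?c ` ?I. trans_prob \<xi> v y * f y) = (\<Sum>i\<in>?I. ?e i / ?Z * f (?c i))"
    by (subst sum.reindex) (auto simp: inj_on_def tc intro!: sum.cong)
  also have "trans_prob \<xi> v (parent u) * f (parent u) + \<dots> = walk_step \<xi> f v"
    by (simp add: tp Some walk_step_def add_divide_distrib sum_divide_distrib)
  finally show ?thesis .
qed

abbreviation path_to :: "nat \<Rightarrow> (nat \<Rightarrow> vertex) \<Rightarrow> vertex list" where
  "path_to n X \<equiv> map X [0..<Suc n]"

lemma path_to_Suc: "path_to (Suc n) X = path_to n X @ [X (Suc n)]"
  by simp

locale quenched_walk =
  fixes \<xi> :: env and Q :: "(nat \<Rightarrow> vertex) measure"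
  assumes law: "quenched_law \<xi> Q"
begin

sublocale prob_space Q
  using law by (simp add: quenched_law_def)

lemma sets_Q [measurable_cong]: "sets Q = sets (PiM UNIV (\<lambda>_. count_space UNIV))"
  using law by (simp add: quenched_law_def)

lemma space_Q [simp]: "space Q = UNIV"
  using sets_eq_imp_space_eq[OF sets_Q] by (simp add: space_PiM)

lemma cylinder_sets: "{X. \<forall>i\<le>n. X i = x i} \<in> sets Q"
proof -
  have [measurable]: "(\<lambda>X. X i) \<in> measurable Q (count_space UNIV)" for i
    by (simp add: measurable_cong_sets[OF sets_Q refl])
  have "{X \<in> space Q. \<forall>i\<le>n. X i = x i} \<in> sets Q" by measurable
  then show ?thesis by simp
qed

lemma path_eq_iff: "path_to n X = l \<longleftrightarrow> length l = Suc n \<and> (\<forall>i\<le>n. X i = l ! i)"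
  by (auto simp: list_eq_iff_nth_eq less_Suc_eq_le simp del: upt_Suc)

lemma path_eq_sets: "{X. path_to n X = l} \<in> sets Q"
proof (cases "length l = Suc n")
  case True
  then have "{X. path_to n X = l} = {X. \<forall>i\<le>n. X i = l ! i}" by (simp only: path_eq_iff) simp
  then show ?thesis using cylinder_sets by simp
next
  case False
  then have "{X. path_to n X = l} = {}" by (simp only: path_eq_iff) simp
  then show ?thesis by simp
qed

lemma measurable_path: "path_to n \<in> measurable Q (count_space UNIV)"
proof (rule measurable_count_space_eq2_countable[THEN iffD2])
  show "path_to n \<in> space Q \<rightarrow> UNIV \<and> (\<forall>l\<in>UNIV. path_to n -` {l} \<inter> space Q \<in> sets Q)"
    using path_eq_sets by (auto simp: vimage_def)
qed

lemma path_pred_sets: "{X. P (path_to n X)} \<in> sets Q"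
proof -
  have "path_to n -` {l. P l} \<inter> space Q \<in> sets Q"
    by (rule measurable_sets[OF measurable_path]) simp
  then show ?thesis by (simp add: vimage_def)
qed

definition path_prob :: "nat \<Rightarrow> vertex list \<Rightarrow> real" where
  "path_prob n l = (if length l = Suc n then of_bool (l ! 0 = Some []) * (\<Prod>i<n. trans_prob \<xi> (l ! i) (l ! Suc i)) else 0)"

lemma emeasure_path: "emeasure Q {X. path_to n X = l} = ennreal (path_prob n l)"
proof (cases "length l = Suc n")
  case True
  then have "{X. path_to n X = l} = {X. \<forall>i\<le>n. X i = l ! i}" by (simp only: path_eq_iff) simp
  then have "emeasure Q {X. path_to n X = l} = ennreal (measure Q {X. \<forall>i\<le>n. X i = l ! i})"
    by (simp only: emeasure_eq_measure)
  then show ?thesis using True law by (simp add: quenched_law_def path_prob_def)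
next
  case False
  then have "{X. path_to n X = l} = {}" by (simp only: path_eq_iff) simp
  then show ?thesis using False by (simp add: path_prob_def)
qed

lemma nn_integral_path:
  fixes H :: "vertex list \<Rightarrow> ennreal"
  shows "(\<integral>\<^sup>+X. H (path_to n X) \<partial>Q) = (\<integral>\<^sup>+l. H l * ennreal (path_prob n l) \<partial>count_space UNIV)"
proof -
  have "(\<integral>\<^sup>+X. H (path_to n X) \<partial>Q) = (\<integral>\<^sup>+X. \<integral>\<^sup>+l. H l * indicator {X. path_to n X = l} X \<partial>count_space UNIV \<partial>Q)"
  proof (rule nn_integral_cong)
    fix X
    have "(\<integral>\<^sup>+l. H l * indicator {X. path_to n X = l} X \<partial>count_space UNIV) = (\<Sum>l\<in>{path_to n X}. H l * indicator {X. path_to n X = l} X)"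
      by (rule nn_integral_count_space') (auto simp: indicator_def simp del: upt_Suc)
    then show "H (path_to n X) = (\<integral>\<^sup>+l. H l * indicator {X. path_to n X = l} X \<partial>count_space UNIV)"
      by (simp add: indicator_def del: upt_Suc)
  qed
  also have "\<dots> = (\<integral>\<^sup>+l. \<integral>\<^sup>+X. H l * indicator {X. path_to n X = l} X \<partial>Q \<partial>count_space UNIV)"
    using path_eq_sets by (intro nn_integral_count_space_nn_integral) (auto simp del: upt_Suc)
  also have "\<dots> = (\<integral>\<^sup>+l. H l * ennreal (path_prob n l) \<partial>count_space UNIV)"
    unfolding emeasure_path[symmetric]
    using path_eq_sets by (intro nn_integral_cong nn_integral_cmult_indicator) (simp del: upt_Suc)
  finally show ?thesis .
qed

lemma path_prob_snoc: "length l = Suc n \<Longrightarrow> path_prob (Suc n) (l @ [y]) = path_prob n l * trans_prob \<xi> (last l) y"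
proof -
  assume l: "length l = Suc n"
  then have "l \<noteq> []" by auto
  have "(\<Prod>i<n. trans_prob \<xi> ((l @ [y]) ! i) ((l @ [y]) ! Suc i)) = (\<Prod>i<n. trans_prob \<xi> (l ! i) (l ! Suc i))"
    using l by (intro prod.cong) (auto simp: nth_append)
  moreover have "(l @ [y]) ! n = last l" "(l @ [y]) ! Suc n = y" "(l @ [y]) ! 0 = l ! 0"
    using l \<open>l \<noteq> []\<close> by (auto simp: nth_append last_conv_nth)
  ultimately show ?thesis using l by (simp add: path_prob_def)
qed

text \<open>The Markov property: given the path up to time \<open>n\<close>, the next vertex
  has the transition law from its last entry.\<close>

lemma nn_integral_path_Suc:
  fixes f :: "vertex list \<Rightarrow> real"
  assumes "\<And>l. 0 \<le> f l"
  shows "(\<integral>\<^sup>+X. ennreal (f (path_to (Suc n) X)) \<partial>Q)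
     = (\<integral>\<^sup>+X. ennreal (walk_step \<xi> (\<lambda>y. f (path_to n X @ [y])) (last (path_to n X))) \<partial>Q)"
proof -
  have p0: "0 \<le> path_prob n l" for n l
    unfolding path_prob_def by (auto intro!: prod_nonneg trans_prob_nonneg)
  have bij: "bij_betw (\<lambda>(l, y). l @ [y]) UNIV {l::vertex list. l \<noteq> []}"
    by (rule bij_betwI[where g="\<lambda>l. (butlast l, last l)"]) auto
  have "(\<integral>\<^sup>+X. ennreal (f (path_to (Suc n) X)) \<partial>Q) = (\<integral>\<^sup>+l. ennreal (f l) * ennreal (path_prob (Suc n) l) \<partial>count_space UNIV)"
    by (rule nn_integral_path)
  also have "\<dots> = (\<integral>\<^sup>+l. ennreal (f l) * ennreal (path_prob (Suc n) l) \<partial>count_space {l. l \<noteq> []})"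
    by (rule nn_integral_count_space_eq) (auto simp: path_prob_def)
  also have "\<dots> = (\<integral>\<^sup>+p. (\<lambda>l. ennreal (f l) * ennreal (path_prob (Suc n) l)) (case p of (l, y) \<Rightarrow> l @ [y]) \<partial>count_space UNIV)"
    using nn_integral_bij_count_space[OF bij, symmetric] by simp
  also have "\<dots> = (\<integral>\<^sup>+l. \<integral>\<^sup>+y. ennreal (f (l @ [y])) * ennreal (path_prob (Suc n) (l @ [y])) \<partial>count_space UNIV \<partial>count_space UNIV)"
    by (subst nn_integral_fst_count_space[symmetric]) simp
  also have "\<dots> = (\<integral>\<^sup>+l. ennreal (walk_step \<xi> (\<lambda>y. f (l @ [y])) (last l)) * ennreal (path_prob n l) \<partial>count_space UNIV)"
  proof (rule nn_integral_cong)
    fix l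
    show "(\<integral>\<^sup>+y. ennreal (f (l @ [y])) * ennreal (path_prob (Suc n) (l @ [y])) \<partial>count_space UNIV)
        = ennreal (walk_step \<xi> (\<lambda>y. f (l @ [y])) (last l)) * ennreal (path_prob n l)"
    proof (cases "length l = Suc n")
      case True
      have "(\<integral>\<^sup>+y. ennreal (f (l @ [y])) * ennreal (path_prob (Suc n) (l @ [y])) \<partial>count_space UNIV)
          = (\<integral>\<^sup>+y. ennreal (path_prob n l) * (ennreal (trans_prob \<xi> (last l) y) * ennreal (f (l @ [y]))) \<partial>count_space UNIV)"
        by (intro nn_integral_cong) (simp add: path_prob_snoc[OF True] ennreal_mult p0 trans_prob_nonneg mult_ac)
      also have "\<dots> = ennreal (path_prob n l) * ennreal (walk_step \<xi> (\<lambda>y. f (l @ [y])) (last l))"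
        by (subst nn_integral_cmult) (simp_all add: nn_integral_trans_prob assms)
      finally show ?thesis by (simp add: mult.commute)
    qed (simp add: path_prob_def)
  qed
  also have "\<dots> = (\<integral>\<^sup>+X. ennreal (walk_step \<xi> (\<lambda>y. f (path_to n X @ [y])) (last (path_to n X))) \<partial>Q)"
    by (rule nn_integral_path[symmetric])
  finally show ?thesis .
qed

lemma AE_start: "AE X in Q. X 0 = Some []"
proof -
  have "\<forall>n x. measure Q {X. \<forall>i\<le>n. X i = x i} = of_bool (x 0 = Some []) * (\<Prod>i<n. trans_prob \<xi> (x i) (x (Suc i)))"
    using law unfolding quenched_law_def by blast
  from this[rule_format, of 0 "\<lambda>_. Some []"]
  have 1: "prob {X. X 0 = Some []} = 1" by simp
  have "{X. X 0 = Some []} \<in> sets Q"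
    using cylinder_sets[of 0 "\<lambda>_. Some []"] by simp
  from prob_eq_1[OF this] 1 show ?thesis by simp
qed

text \<open>Functionals of the whole path are allowed, so that they can record returns and visits. All
  bounds on probabilities of visits below come from suitable choices of \<open>G\<close>.\<close>

lemma supermartingale:
  fixes G :: "nat \<Rightarrow> vertex list \<Rightarrow> real"
  assumes nn: "\<And>j l. 0 \<le> G j l"
    and step: "\<And>j l. l \<noteq> [] \<Longrightarrow> walk_step \<xi> (\<lambda>y. G (Suc j) (l @ [y])) (last l) \<le> G j l"
  shows "(\<integral>\<^sup>+X. ennreal (G n (path_to n X)) \<partial>Q) \<le> ennreal (G 0 [Some []])"
proof (induction n)
  case 0
  have "(\<integral>\<^sup>+X. ennreal (G 0 (path_to 0 X)) \<partial>Q) = (\<integral>\<^sup>+X. ennreal (G 0 [Some []]) \<partial>Q)"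
    by (rule nn_integral_cong_AE, use AE_start in eventually_elim) simp
  then show ?case using emeasure_space_1 by simp
next
  case (Suc n)
  have "(\<integral>\<^sup>+X. ennreal (G (Suc n) (path_to (Suc n) X)) \<partial>Q)
     = (\<integral>\<^sup>+X. ennreal (walk_step \<xi> (\<lambda>y. G (Suc n) (path_to n X @ [y])) (last (path_to n X))) \<partial>Q)"
    by (rule nn_integral_path_Suc) (rule nn)
  also have "\<dots> \<le> (\<integral>\<^sup>+X. ennreal (G n (path_to n X)) \<partial>Q)"
    by (intro nn_integral_mono ennreal_leI step) simp
  finally show ?case using Suc by (rule order_trans)
qed

end

section \<open>Harmonic functions on the tree\<close>

lemma longest_common_prefix_snoc:
  "\<not> prefix (u @ [i]) x \<Longrightarrow> longest_common_prefix (u @ [i]) x = longest_common_prefix u x"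
proof (induction u arbitrary: x)
  case Nil
  then show ?case by (cases x) auto
next
  case (Cons a u)
  then show ?case by (cases x) auto
qed

lemma longest_common_prefix_prefix: "prefix u x \<Longrightarrow> longest_common_prefix u x = u"
proof (induction u arbitrary: x)
  case (Cons a u)
  then show ?case by (cases x) auto
qed simp

lemma longest_common_prefix_commute: "longest_common_prefix x y = longest_common_prefix y x"
  by (induction x y rule: longest_common_prefix.induct) auto

lemma tree_prefix: "x \<in> tree \<xi> \<Longrightarrow> prefix u x \<Longrightarrow> u \<in> tree \<xi>"
  by (auto simp: prefix_def in_tree_append)

lemma hit_pos: "x \<in> tree \<xi> \<Longrightarrow> 0 < hit \<xi> x"
  by (simp add: hit_def tree_iff_weight)

lemma hit_Nil [simp]: "hit \<xi> [] = 1"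
  by (simp add: hit_def)

text \<open>The effective resistance between the parent of the root and \<open>u\<close>, extended by zero to that
  parent.\<close>

definition resistance :: "env \<Rightarrow> vertex \<Rightarrow> real" where
  "resistance \<xi> v = (case v of None \<Rightarrow> 0 | Some u \<Rightarrow> 1 / hit \<xi> u)"

lemma resistance_parent:
  assumes "u \<in> tree \<xi>"
  shows "resistance \<xi> (Some u) = resistance \<xi> (parent u) + 1 / weight \<xi> u"
proof (cases u rule: rev_cases)
  case Nil
  then show ?thesis by (simp add: resistance_def parent_def)
next
  case (snoc v i)
  then have v: "v \<in> tree \<xi>" "i < length (\<xi> v)"
    using assms by (simp_all add: tree_snoc)
  then have "0 < edge_weight (\<xi> v) i" "0 < weight \<xi> v"
    using tree_iff_weight[of v \<xi>] by (simp_all add: edge_weight_def)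
  then show ?thesis unfolding snoc
    by (simp add: resistance_def parent_def hit_def weight_snoc backward_sum_snoc field_simps)
qed

lemma hit_le_hit_prefix:
  assumes "x \<in> tree \<xi>" "prefix u x"
  shows "hit \<xi> x \<le> hit \<xi> u"
  using assms
proof (induction x rule: rev_induct)
  case (snoc i x)
  show ?case
  proof (cases "u = x @ [i]")
    case False
    then have u: "prefix u x" using snoc.prems by (simp add: prefix_snoc)
    have x: "x \<in> tree \<xi>" using snoc.prems by (simp add: tree_snoc)
    have "resistance \<xi> (Some x) \<le> resistance \<xi> (Some (x @ [i]))"
      using resistance_parent[OF snoc.prems(1)] by (simp add: parent_def)
    then have "hit \<xi> (x @ [i]) \<le> hit \<xi> x"
      using hit_pos[OF x] hit_pos[OF snoc.prems(1)] by (simp add: resistance_def field_simps)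
    then show ?thesis using snoc.IH[OF x u] by simp
  qed simp
qed simp

text \<open>The probability of hitting \<open>x\<close> before the parent of the root, as a function of the starting point.\<close>

definition reach :: "env \<Rightarrow> nat list \<Rightarrow> vertex \<Rightarrow> real" where
  "reach \<xi> x v = (case v of None \<Rightarrow> 0 | Some u \<Rightarrow> hit \<xi> x / hit \<xi> (longest_common_prefix u x))"

lemma reach_nonneg [simp]: "0 \<le> reach \<xi> x v"
  by (cases v) (auto simp: reach_def)

lemma reach_None [simp]: "reach \<xi> x None = 0"
  by (simp add: reach_def)

lemma reach_root [simp]: "reach \<xi> x (Some []) = hit \<xi> x"
  by (simp add: reach_def longest_common_prefix_prefix)

lemma reach_self: "x \<in> tree \<xi> \<Longrightarrow> reach \<xi> x (Some x) = 1"
  using hit_pos[of x \<xi>] by (simp add: reach_def longest_common_prefix_prefix)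

lemma reach_le_1:
  assumes "x \<in> tree \<xi>" shows "reach \<xi> x v \<le> 1"
proof (cases v)
  case (Some u)
  have p: "prefix (longest_common_prefix u x) x" by (rule longest_common_prefix_prefix2)
  then show ?thesis
    using hit_le_hit_prefix[OF assms p] hit_pos[OF tree_prefix[OF assms p]] Some by (simp add: reach_def)
qed simp

lemma reach_off:
  "\<not> prefix (u @ [i]) x \<Longrightarrow> reach \<xi> x (Some (u @ [i])) = reach \<xi> x (Some u)"
  by (simp add: reach_def longest_common_prefix_snoc)

lemma reach_on:
  "prefix u x \<Longrightarrow> reach \<xi> x (Some u) = hit \<xi> x * resistance \<xi> (Some u)"
  by (simp add: reach_def resistance_def longest_common_prefix_prefix)

lemma reach_parent_on:
  "prefix u x \<Longrightarrow> reach \<xi> x (parent u) = hit \<xi> x * resistance \<xi> (parent u)"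
  by (cases u rule: rev_cases) (auto simp: parent_def resistance_def reach_on prefix_def)

text \<open>Off the line to \<open>x\<close> the function is constant. On the line it is affine in the resistance, so
  the flows to the child on the line and to the parent cancel.\<close>

lemma reach_harmonic:
  assumes x: "x \<in> tree \<xi>" and "u \<noteq> x"
  shows "walk_step \<xi> (reach \<xi> x) (Some u) = reach \<xi> x (Some u)"
proof (cases "prefix u x")
  case False
  then have "u \<noteq> []" by auto
  then obtain v i where u: "u = v @ [i]" by (cases u rule: rev_cases) auto
  have "reach \<xi> x (parent u) = reach \<xi> x (Some u)"
    using False reach_off[of v i x \<xi>] by (simp add: u parent_def)
  moreover have "reach \<xi> x (Some (u @ [j])) = reach \<xi> x (Some u)" for j
  proof (rule reach_off)
    show "\<not> prefix (u @ [j]) x" using False by (meson append_prefixD)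
  qed
  ultimately show ?thesis by (subst walk_step_eq_iff) simp
next
  case True
  then obtain i x' where xi: "x = u @ [i] @ x'" using \<open>u \<noteq> x\<close> by (cases "drop (length u) x") (auto simp: prefix_def)
  then have ui: "u @ [i] \<in> tree \<xi>" "prefix (u @ [i]) x" using tree_prefix[OF x, of "u @ [i]"] by auto
  then have u: "u \<in> tree \<xi>" and i: "i < length (\<xi> u)" by (auto simp: tree_snoc)
  have ch: "reach \<xi> x (Some (u @ [j])) = reach \<xi> x (Some u)" if "j \<noteq> i" for j
    using that by (intro reach_off) (auto simp: xi)
  have "(\<Sum>j<length (\<xi> u). exp (- V \<xi> (u @ [j])) * (reach \<xi> x (Some (u @ [j])) - reach \<xi> x (Some u)))
      = (\<Sum>j\<in>{i}. exp (- V \<xi> (u @ [j])) * (reach \<xi> x (Some (u @ [j])) - reach \<xi> x (Some u)))"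
    using i ch by (intro sum.mono_neutral_right) auto
  also have "\<dots> = weight \<xi> (u @ [i]) * (hit \<xi> x * (resistance \<xi> (Some (u @ [i])) - resistance \<xi> (Some u)))"
    using ui True by (simp add: weight_eq_exp_V reach_on right_diff_distrib)
  also have "\<dots> = hit \<xi> x"
    using resistance_parent[OF ui(1)] ui(1) by (simp add: parent_def tree_iff_weight)
  finally have 1: "(\<Sum>j<length (\<xi> u). exp (- V \<xi> (u @ [j])) * (reach \<xi> x (Some (u @ [j])) - reach \<xi> x (Some u))) = hit \<xi> x" .
  have "exp (- V \<xi> u) * (reach \<xi> x (parent u) - reach \<xi> x (Some u))
      = - (weight \<xi> u * (hit \<xi> x * (resistance \<xi> (Some u) - resistance \<xi> (parent u))))"
    using True u by (simp add: weight_eq_exp_V reach_on reach_parent_on algebra_simps)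
  also have "\<dots> = - hit \<xi> x"
    using resistance_parent[OF u] u by (simp add: tree_iff_weight)
  finally show ?thesis using 1 by (subst walk_step_eq_iff) simp
qed

lemma reach_superharmonic:
  assumes x: "x \<in> tree \<xi>"
  shows "walk_step \<xi> (reach \<xi> x) (Some u) \<le> reach \<xi> x (Some u)"
proof (cases "u = x")
  case True
  have "walk_step \<xi> (reach \<xi> x) (Some u) \<le> walk_step \<xi> (\<lambda>_. 1) (Some u)"
    by (rule walk_step_mono) (rule reach_le_1[OF x])
  then show ?thesis using reach_self[OF x] True by simp
qed (simp add: reach_harmonic[OF x])

section \<open>Excursions and visited vertices\<close>

text \<open>Visits to \<open>None\<close>, the parent of the root, separate the excursions.\<close>

definition returns :: "vertex list \<Rightarrow> nat" where
  "returns l = length (filter (\<lambda>v. v = None) l)"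

text \<open>The last entry is not counted: a walk standing at the parent of the root has not yet begun the
  next excursion.\<close>

definition used :: "vertex list \<Rightarrow> nat" where
  "used l = returns (butlast l)"

text \<open>Visited before the \<open>t\<close>-th return. This is a property of finite paths, unlike the return times
  themselves, and never changes back to false.\<close>

definition seen :: "nat \<Rightarrow> nat list \<Rightarrow> vertex list \<Rightarrow> bool" where
  "seen t x l \<longleftrightarrow> (\<exists>j<length l. l ! j = Some x \<and> returns (take j l) < t)"

lemma returns_snoc: "returns (l @ [y]) = returns l + of_bool (y = None)"
  by (simp add: returns_def)

lemma used_snoc [simp]: "used (l @ [y]) = returns l"
  by (simp add: used_def)

lemma returns_eq_used: "l \<noteq> [] \<Longrightarrow> returns l = used l + of_bool (last l = None)"
  by (cases l rule: rev_cases) (simp_all add: returns_snoc)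

lemma seen_snoc: "seen t x (l @ [y]) \<longleftrightarrow> seen t x l \<or> (y = Some x \<and> returns l < t)"
proof -
  have "(\<exists>j<Suc n. P j) \<longleftrightarrow> (\<exists>j<n. P j) \<or> P n" for P and n :: nat
    using less_Suc_eq by blast
  then have "seen t x (l @ [y]) \<longleftrightarrow> (\<exists>j<length l. (l @ [y]) ! j = Some x \<and> returns (take j (l @ [y])) < t)
      \<or> ((l @ [y]) ! length l = Some x \<and> returns (take (length l) (l @ [y])) < t)"
    unfolding seen_def by (simp only: length_append_singleton)
  moreover have "(l @ [y]) ! j = l ! j \<and> take j (l @ [y]) = take j l" if "j < length l" for j
    using that by (simp add: nth_append)
  ultimately show ?thesis unfolding seen_def by auto
qed

lemma seen_last: "l \<noteq> [] \<Longrightarrow> last l = Some x \<Longrightarrow> used l < t \<Longrightarrow> seen t x l"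
  by (cases l rule: rev_cases) (simp_all add: seen_snoc)

lemma returns_path_Suc: "returns (map X [0..<Suc j]) = returns (map X [0..<j]) + of_bool (X j = None)"
  by (simp add: returns_snoc)

lemma T_ret_less_iff:
  assumes "X 0 \<noteq> None"
  shows "T_ret t X < enat j \<longleftrightarrow> 0 < j \<and> t \<le> returns (map X [0..<j])"
proof (induction t arbitrary: j)
  case 0
  then show ?case by (simp add: zero_enat_def)
next
  case (Suc t)
  have "T_ret (Suc t) X < enat j \<longleftrightarrow> (\<exists>i<j. T_ret t X < enat i \<and> X i = None)"
    by (auto simp: Inf_less_iff)
  also have "\<dots> \<longleftrightarrow> (\<exists>i<j. 0 < i \<and> t \<le> returns (map X [0..<i]) \<and> X i = None)"
    by (simp only: Suc.IH) blast
  also have "\<dots> \<longleftrightarrow> 0 < j \<and> Suc t \<le> returns (map X [0..<j])"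
  proof (induction j)
    case (Suc j)
    have "(\<exists>i<Suc j. 0 < i \<and> t \<le> returns (map X [0..<i]) \<and> X i = None)
        \<longleftrightarrow> (\<exists>i<j. 0 < i \<and> t \<le> returns (map X [0..<i]) \<and> X i = None)
          \<or> (0 < j \<and> t \<le> returns (map X [0..<j]) \<and> X j = None)"
      unfolding less_Suc_eq by blast
    also have "\<dots> \<longleftrightarrow> Suc t \<le> returns (map X [0..<Suc j])"
      unfolding Suc returns_path_Suc using assms by (cases "j = 0") (auto simp: returns_def)
    finally show ?case by simp
  qed simp
  finally show ?case .
qed

text \<open>The root is excluded: it is occupied at time \<open>0\<close>, which the range ignores.\<close>

lemma range_walk_iff_seen:
  assumes X0: "X 0 = Some []" and u: "u \<noteq> []" "u \<in> tree \<xi>"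
  shows "u \<in> range_walk \<xi> (T_ret t X) X \<longleftrightarrow> (\<exists>n. seen t u (path_to n X))"
proof -
  have "u \<in> range_walk \<xi> (T_ret t X) X \<longleftrightarrow> (\<exists>j\<ge>1. \<not> T_ret t X < enat j \<and> X j = Some u)"
    using u by (auto simp: range_walk_def not_less)
  also have "\<dots> \<longleftrightarrow> (\<exists>j. returns (map X [0..<j]) < t \<and> X j = Some u)"
  proof -
    have "0 < j" if "X j = Some u" for j using that X0 u(1) by (cases j) auto
    then show ?thesis using X0 by (subst T_ret_less_iff) (auto simp: not_le Suc_le_eq)
  qed
  also have "\<dots> \<longleftrightarrow> (\<exists>n. seen t u (path_to n X))"
  proof -
    have "seen t u (path_to n X) \<longleftrightarrow> (\<exists>j<Suc n. X j = Some u \<and> returns (map X [0..<j]) < t)" for n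
    proof -
      have "take j (path_to n X) = map X [0..<j]" "path_to n X ! j = X j" if "j < Suc n" for j
        using that by (auto simp: take_map simp del: upt_Suc)
      then show ?thesis unfolding seen_def by (auto simp del: upt_Suc)
    qed
    then show ?thesis by blast
  qed
  finally show ?thesis .
qed

lemma seen_frozen: "l \<noteq> [] \<Longrightarrow> t \<le> used l \<Longrightarrow> seen t x (l @ [y]) \<longleftrightarrow> seen t x l"
  using returns_eq_used[of l] by (auto simp: seen_snoc)

context quenched_walk
begin

definition visited :: "nat \<Rightarrow> nat list \<Rightarrow> (nat \<Rightarrow> vertex) set" where
  "visited t x = {X. \<exists>n. seen t x (path_to n X)}"

lemma visited_sets [measurable]: "visited t x \<in> sets Q"
proof -
  have "visited t x = (\<Union>n. {X. seen t x (path_to n X)})" by (auto simp: visited_def)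
  also have "\<dots> \<in> sets Q" by (intro sets.countable_UN) (auto intro: path_pred_sets simp del: upt_Suc)
  finally show ?thesis .
qed

lemma AE_range_walk:
  "u \<noteq> [] \<Longrightarrow> u \<in> tree \<xi> \<Longrightarrow> AE X in Q. u \<in> range_walk \<xi> (T_ret t X) X \<longleftrightarrow> X \<in> visited t u"
  using AE_start by eventually_elim (simp add: range_walk_iff_seen visited_def del: upt_Suc)

lemma seen_mono: "seen t x (path_to n X) \<Longrightarrow> n \<le> m \<Longrightarrow> seen t x (path_to m X)"
proof (induction m)
  case (Suc m)
  then show ?case
    by (cases "n = Suc m") (auto simp only: path_to_Suc[where n=m] seen_snoc le_Suc_eq)
qed simp

lemma emeasure_path_le:
  assumes "\<And>j l. 0 \<le> G j l"
    and "\<And>j l. l \<noteq> [] \<Longrightarrow> walk_step \<xi> (\<lambda>y. G (Suc j) (l @ [y])) (last l) \<le> G j l"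
    and "\<And>l. P l \<Longrightarrow> 1 \<le> G n l"
  shows "emeasure Q {X. P (path_to n X)} \<le> ennreal (G 0 [Some []])"
proof -
  have "emeasure Q {X. P (path_to n X)} = (\<integral>\<^sup>+X. indicator {X. P (path_to n X)} X \<partial>Q)"
    by (simp add: path_pred_sets del: upt_Suc)
  also have "\<dots> \<le> (\<integral>\<^sup>+X. ennreal (G n (path_to n X)) \<partial>Q)"
    using assms(3) by (intro nn_integral_mono) (auto simp: indicator_def simp del: upt_Suc intro: ennreal_leI[of 1, simplified])
  also have "\<dots> \<le> ennreal (G 0 [Some []])" using assms(1,2) by (rule supermartingale)
  finally show ?thesis .
qed

lemma emeasure_increasing_union_le:
  assumes "\<And>n. A n \<in> sets Q" "\<And>n. A n \<subseteq> A (Suc n)" "\<And>n. emeasure Q (A n) \<le> c"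
  shows "emeasure Q (\<Union>n. A n) \<le> c"
proof -
  have "(SUP n. emeasure Q (A n)) = emeasure Q (\<Union>n. A n)"
    using assms by (intro SUP_emeasure_incseq) (auto simp: incseq_Suc_iff)
  then show ?thesis using assms(3) by (metis SUP_least)
qed

subsection \<open>Probability of visiting two vertices\<close>

text \<open>A supermartingale \<open>G\<close> is constructed that is \<open>1\<close> once both vertices are seen and whose initial
  value is the bound. With \<open>r\<close> excursions left, current one included, the chance to see \<open>x\<close> is at
  most \<open>U px ?hx r\<close>: reach it now, or in one of the \<open>r - 1\<close> later excursions. If none of the two has
  been seen, \<open>G0 r\<close> weights reaching one of them now by the chance to see the other afterwards, and
  adds the later excursions: both vertices in the same excursion has chance at most \<open>2 * a\<close>, and in
  two different ones at most \<open>px * py\<close> for each ordered pair of them.\<close>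

lemma emeasure_visited_both:
  assumes x: "x \<in> tree \<xi>" "x \<noteq> []" and y: "y \<in> tree \<xi>" "y \<noteq> []" and t: "1 \<le> t"
  shows "emeasure Q (visited t x \<inter> visited t y)
     \<le> ennreal (2 * real t * pair_bound \<xi> x y + (real t)\<^sup>2 * (hit \<xi> x * hit \<xi> y))"
proof -
  define z where "z = longest_common_prefix x y"
  have z: "z \<in> tree \<xi>" using tree_prefix[OF x(1) longest_common_prefix_prefix1] by (simp add: z_def)
  define px py pz where "px = hit \<xi> x" and "py = hit \<xi> y" and "pz = hit \<xi> z"
  have p: "0 < px" "0 < py" "0 < pz" using hit_pos x y z by (auto simp: px_def py_def pz_def)
  let ?hx = "reach \<xi> x" and ?hy = "reach \<xi> y"
  have hxy: "?hx (Some y) = px / pz" "?hy (Some x) = py / pz"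
    by (simp_all add: reach_def px_def py_def pz_def z_def longest_common_prefix_commute[of y x])
  define a where "a = px * py / pz"
  define U where "U p h r v = h v + (r - 1) * p" for p r :: real and h :: "vertex \<Rightarrow> real" and v
  define G0 where "G0 r v = (py / pz + (r - 1) * py) * ?hx v + (px / pz + (r - 1) * px) * ?hy v
     + ((r - 1) * (2 * a) + (r - 1) * (r - 2) * (px * py))" for r v
  define \<Gamma> where "\<Gamma> s1 s2 r v = (if s1 \<and> s2 then 1 else if s1 then U py ?hy r v else if s2 then U px ?hx r v else G0 r v)" for s1 s2 r v
  define G where "G l = (if seen t x l \<and> seen t y l then 1 else if t \<le> used l then 0
      else \<Gamma> (seen t x l) (seen t y l) (real t - real (used l)) (last l))" for l
  \<comment> \<open>as \<open>r\<close> is a positive integer, also at \<open>r = 1\<close>, where the last factor is negative\<close>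
  have rr: "0 \<le> (r - 1) * (r - 2)" if "r = real n - real m" "m < n" for r and n m :: nat
  proof -
    obtain d where "n = m + Suc d" using \<open>m < n\<close> less_imp_Suc_add by fastforce
    then have "r = 1 + real d" using that by simp
    then show ?thesis by (cases d) auto
  qed
  have rest: "0 \<le> (r - 1) * (2 * a) + (r - 1) * (r - 2) * (px * py)" if "1 \<le> r" "0 \<le> (r - 1) * (r - 2)" for r
  proof -
    have "0 \<le> a" unfolding a_def using p by simp
    then have "0 \<le> (r - 1) * (2 * a)" using that by (intro mult_nonneg_nonneg) auto
    moreover have "0 \<le> px * py" using p by simp
    then have "0 \<le> (r - 1) * (r - 2) * (px * py)" by (rule mult_nonneg_nonneg[OF that(2)])
    ultimately show ?thesis by simp
  qed
  have G0_nonneg: "0 \<le> G0 r v" if "1 \<le> r" "0 \<le> (r - 1) * (r - 2)" for r v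
    unfolding G0_def using p that(1)
    by (intro add_nonneg_nonneg[OF _ rest[OF that]] add_nonneg_nonneg mult_nonneg_nonneg divide_nonneg_nonneg) auto
  have \<Gamma>_nonneg: "0 \<le> \<Gamma> s1 s2 r v" if "1 \<le> r" "0 \<le> (r - 1) * (r - 2)" for s1 s2 r v
    unfolding \<Gamma>_def U_def using p that G0_nonneg by auto
  have G_nonneg: "0 \<le> G l" for l
    unfolding G_def using \<Gamma>_nonneg rr[of "real t - real (used l)" t "used l"] by (auto simp: not_le)
  \<comment> \<open>entering a new vertex can only lower the value\<close>
  have enter: "\<Gamma> (s1 \<or> v = Some x) (s2 \<or> v = Some y) r v \<le> \<Gamma> s1 s2 r v" if r: "1 \<le> r" "0 \<le> (r - 1) * (r - 2)" for s1 s2 r v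
  proof -
    have Ux: "1 \<le> U px ?hx r (Some x)" and Uy: "1 \<le> U py ?hy r (Some y)"
      using r p x y by (simp_all add: U_def reach_self)
    have "py / pz + (r - 1) * py \<le> G0 r (Some x)"
    proof -
      have "0 \<le> (px / pz + (r - 1) * px) * ?hy (Some x)" using p r by simp
      then show ?thesis unfolding G0_def reach_self[OF x(1)] using rest[OF r] by simp
    qed
    then have Gx: "U py ?hy r (Some x) \<le> G0 r (Some x)" by (simp add: U_def hxy)
    have "px / pz + (r - 1) * px \<le> G0 r (Some y)"
    proof -
      have "0 \<le> (py / pz + (r - 1) * py) * ?hx (Some y)" using p r by simp
      then show ?thesis unfolding G0_def reach_self[OF y(1)] using rest[OF r] by simp
    qed
    then have Gy: "U px ?hx r (Some y) \<le> G0 r (Some y)" by (simp add: U_def hxy)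
    have Gxx: "1 \<le> G0 r (Some x)" if "x = y" using Uy Gx that by simp
    show ?thesis unfolding \<Gamma>_def using Ux Uy Gx Gy Gxx by auto
  qed
  have step_U: "walk_step \<xi> (U p h r) (Some u) \<le> U p h r (Some u)" if "walk_step \<xi> h (Some u) \<le> h (Some u)" for p h r u
    using that walk_step_linear[of \<xi> 1 h 0 h "(r - 1) * p" "Some u"] by (simp add: U_def[abs_def])
  have super: "walk_step \<xi> (\<Gamma> s1 s2 r) (Some u) \<le> \<Gamma> s1 s2 r (Some u)" if r: "1 \<le> r" for s1 s2 r u
  proof -
    have "walk_step \<xi> (G0 r) (Some u) \<le> G0 r (Some u)"
    proof -
      have "walk_step \<xi> (G0 r) (Some u) = (py / pz + (r - 1) * py) * walk_step \<xi> ?hx (Some u)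
          + (px / pz + (r - 1) * px) * walk_step \<xi> ?hy (Some u) + ((r - 1) * (2 * a) + (r - 1) * (r - 2) * (px * py))"
        unfolding G0_def[abs_def] by (rule walk_step_linear)
      also have "\<dots> \<le> G0 r (Some u)"
        unfolding G0_def using p r x y
        by (intro add_mono[OF add_mono order_refl] mult_left_mono reach_superharmonic) auto
      finally show ?thesis .
    qed
    then show ?thesis
      using step_U reach_superharmonic[OF x(1)] reach_superharmonic[OF y(1)]
      unfolding \<Gamma>_def by (cases s1; cases s2) (simp_all add: eta_contract_eq)
  qed
  \<comment> \<open>the constant terms are chosen so that starting a new excursion changes nothing\<close>
  have excursion: "\<Gamma> s1 s2 (r - 1) (Some []) = \<Gamma> s1 s2 r None" for s1 s2 r
  proof -
    have "G0 (r - 1) (Some []) = G0 r None"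
      using p by (simp add: G0_def a_def px_def[symmetric] py_def[symmetric]) (simp add: field_simps)
    then show ?thesis unfolding \<Gamma>_def U_def by (simp add: px_def py_def algebra_simps)
  qed
  have step: "walk_step \<xi> (\<lambda>y. G (l @ [y])) (last l) \<le> G l" if l: "l \<noteq> []" for l
  proof (cases "seen t x l \<and> seen t y l")
    case True
    then show ?thesis by (simp add: G_def seen_snoc)
  next
    case nb: False
    show ?thesis
    proof (cases "t \<le> used l")
      case True
      then have "t \<le> returns l" using returns_eq_used[OF l] by simp
      then have "G (l @ [v]) = 0" for v
        unfolding G_def seen_frozen[OF l True] using nb by simp
      then show ?thesis using G_nonneg[of l] by simp
    next
      case False
      define r where "r = real t - real (used l)"
      have r: "1 \<le> r" "0 \<le> (r - 1) * (r - 2)"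
        using False rr[OF r_def] by (auto simp: r_def)
      have Gl: "G l = \<Gamma> (seen t x l) (seen t y l) r (last l)"
        by (simp only: G_def r_def nb False if_False)
      show ?thesis
      proof (cases "last l")
        case None
        then have ret: "returns l = Suc (used l)" using returns_eq_used[OF l] by simp
        have s: "seen t x (l @ [Some []]) = seen t x l" "seen t y (l @ [Some []]) = seen t y l"
          using x y by (auto simp: seen_snoc)
        have "G (l @ [Some []]) \<le> G l"
        proof (cases "t \<le> returns l")
          case True
          have "G (l @ [Some []]) = 0"
            by (simp only: G_def[of "l @ [Some []]"] s used_snoc nb True if_False if_True)
          then show ?thesis using G_nonneg[of l] by simp
        next
          case nt: False
          have "G (l @ [Some []]) = \<Gamma> (seen t x l) (seen t y l) (r - 1) (Some [])"
          proof -
            have "real t - real (returns l) = r - 1" by (simp add: r_def ret)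
            then show ?thesis
              by (simp only: G_def[of "l @ [Some []]"] s used_snoc nb nt if_False last_snoc)
          qed
          then show ?thesis unfolding excursion Gl None by simp
        qed
        then show ?thesis using None by simp
      next
        case (Some u)
        then have ret: "returns l = used l" using returns_eq_used[OF l] by simp
        have "G (l @ [v]) \<le> \<Gamma> (seen t x l) (seen t y l) r v" for v
        proof -
          have "G (l @ [v]) = \<Gamma> (seen t x l \<or> v = Some x) (seen t y l \<or> v = Some y) r v"
            using False ret unfolding G_def used_snoc seen_snoc r_def \<Gamma>_def by auto
          then show ?thesis using enter[OF r] by simp
        qed
        then have "walk_step \<xi> (\<lambda>y. G (l @ [y])) (last l) \<le> walk_step \<xi> (\<Gamma> (seen t x l) (seen t y l) r) (last l)"
          by (rule walk_step_mono)
        also have "\<dots> \<le> G l" unfolding Gl Some by (rule super[OF r(1)])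
        finally show ?thesis .
      qed
    qed
  qed
  have init: "G [Some []] \<le> 2 * real t * pair_bound \<xi> x y + (real t)\<^sup>2 * (px * py)"
  proof -
    have "\<not> seen t x [Some []]" "\<not> seen t y [Some []]" "used [Some []] = 0"
      using x y by (auto simp: seen_def used_def returns_def)
    then have "G [Some []] = G0 (real t) (Some [])" using t by (simp add: G_def \<Gamma>_def)
    also have "\<dots> = 2 * real t * a + real t * (real t - 1) * (px * py)"
      using p by (simp add: G0_def a_def px_def[symmetric] py_def[symmetric]) (simp add: field_simps)
    also have "\<dots> \<le> 2 * real t * a + (real t)\<^sup>2 * (px * py)"
      using p by (intro add_left_mono mult_right_mono) (auto simp: power2_eq_square mult_left_mono)
    finally show ?thesis by (simp add: pair_bound_def a_def px_def py_def pz_def z_def)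
  qed
  have "emeasure Q {X. seen t x (path_to n X) \<and> seen t y (path_to n X)} \<le> ennreal (G [Some []])" for n
  proof (rule emeasure_path_le[where G="\<lambda>_. G" and P="\<lambda>l. seen t x l \<and> seen t y l"])
    show "1 \<le> G l" if "seen t x l \<and> seen t y l" for l using that by (simp add: G_def)
  qed (rule G_nonneg step, assumption?)+
  then have fin: "emeasure Q {X. seen t x (path_to n X) \<and> seen t y (path_to n X)} \<le> ennreal (2 * real t * pair_bound \<xi> x y + (real t)\<^sup>2 * (px * py))" for n
    using init by (meson ennreal_leI order_trans)
  have "visited t x \<inter> visited t y = (\<Union>n. {X. seen t x (path_to n X) \<and> seen t y (path_to n X)})"
  proof (intro equalityI subsetI)
    fix X assume "X \<in> visited t x \<inter> visited t y"
    then obtain n m where "seen t x (path_to n X)" "seen t y (path_to m X)" by (auto simp: visited_def simp del: upt_Suc)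
    then have "seen t x (path_to (max n m) X) \<and> seen t y (path_to (max n m) X)"
      by (meson max.cobounded1 max.cobounded2 seen_mono)
    then show "X \<in> (\<Union>n. {X. seen t x (path_to n X) \<and> seen t y (path_to n X)})" by blast
  qed (auto simp: visited_def simp del: upt_Suc)
  also have "emeasure Q \<dots> \<le> ennreal (2 * real t * pair_bound \<xi> x y + (real t)\<^sup>2 * (px * py))"
  proof (rule emeasure_increasing_union_le)
    show "{X. seen t x (path_to n X) \<and> seen t y (path_to n X)} \<in> sets Q" for n by (rule path_pred_sets)
    show "{X. seen t x (path_to n X) \<and> seen t y (path_to n X)} \<subseteq> {X. seen t x (path_to (Suc n) X) \<and> seen t y (path_to (Suc n) X)}" for n
      by (auto intro!: seen_mono[where n=n and m="Suc n"] simp del: upt_Suc)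
  qed (rule fin)
  finally show ?thesis unfolding px_def py_def .
qed

text \<open>The chance of missing \<open>x\<close> in the current excursion, times that of missing it in all later
  ones, is a martingale until \<open>x\<close> is seen.\<close>

lemma emeasure_finished_not_seen:
  assumes x: "x \<in> tree \<xi>" "x \<noteq> []" and t: "1 \<le> t"
  shows "emeasure Q {X. \<exists>n. t \<le> used (path_to n X) \<and> \<not> seen t x (path_to n X)} \<le> ennreal ((1 - hit \<xi> x) ^ t)"
proof -
  let ?h = "reach \<xi> x" and ?p = "hit \<xi> x"
  have p1: "?p \<le> 1" using reach_le_1[OF x(1), of "Some []"] by simp
  define G where "G l = (if seen t x l then 0 else if t \<le> used l then 1
      else (1 - ?h (last l)) * (1 - ?p) ^ (t - 1 - used l))" for l
  have G_nonneg: "0 \<le> G l" for l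
    unfolding G_def using reach_le_1[OF x(1)] p1 by auto
  have step: "walk_step \<xi> (\<lambda>y. G (l @ [y])) (last l) \<le> G l" if l: "l \<noteq> []" for l
  proof (cases "seen t x l")
    case True
    then show ?thesis by (simp add: G_def seen_snoc)
  next
    case ns: False
    show ?thesis
    proof (cases "t \<le> used l")
      case True
      then have "t \<le> returns l" using returns_eq_used[OF l] by simp
      then have "G (l @ [v]) = 1" for v unfolding G_def seen_frozen[OF l True] using ns by simp
      then show ?thesis using ns True by (simp add: G_def)
    next
      case nt: False
      show ?thesis
      proof (cases "last l")
        case None
        then have ret: "returns l = Suc (used l)" using returns_eq_used[OF l] by simp
        have s: "seen t x (l @ [Some []]) = seen t x l" using x by (auto simp: seen_snoc)
        have "G (l @ [Some []]) = (1 - ?p) ^ (t - 1 - used l)"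
        proof (cases "t \<le> returns l")
          case True
          then show ?thesis using ns by (simp add: G_def s ret)
        next
          case False
          then have "t - 1 - used l = Suc (t - 1 - returns l)" using ret by simp
          then show ?thesis using False ns by (simp add: G_def s)
        qed
        then show ?thesis using None ns nt by (simp add: G_def[of l])
      next
        case (Some u)
        then have ret: "returns l = used l" using returns_eq_used[OF l] by simp
        have ux: "u \<noteq> x" using seen_last[OF l, of x t] ns nt Some by auto
        let ?c = "(1 - ?p) ^ (t - 1 - used l)"
        have "G (l @ [v]) = (- ?c) * ?h v + 0 * ?h v + ?c" for v
          using ns nt reach_self[OF x(1)] by (auto simp: G_def seen_snoc ret algebra_simps)
        then have "walk_step \<xi> (\<lambda>y. G (l @ [y])) (last l) = (- ?c) * walk_step \<xi> ?h (last l) + 0 * walk_step \<xi> ?h (last l) + ?c"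
          by (simp only: walk_step_linear)
        also have "\<dots> = G l" using reach_harmonic[OF x(1) ux] ns nt Some by (simp add: G_def algebra_simps)
        finally show ?thesis by simp
      qed
    qed
  qed
  have init: "G [Some []] = (1 - ?p) ^ t"
  proof -
    have "\<not> seen t x [Some []]" "used [Some []] = 0" using x by (auto simp: seen_def used_def returns_def)
    then show ?thesis using t by (cases t) (auto simp: G_def)
  qed
  have le: "emeasure Q {X. t \<le> used (path_to n X) \<and> \<not> seen t x (path_to n X)} \<le> ennreal (G [Some []])" for n
  proof (rule emeasure_path_le[where G="\<lambda>_. G" and P="\<lambda>l. t \<le> used l \<and> \<not> seen t x l"])
    show "1 \<le> G l" if "t \<le> used l \<and> \<not> seen t x l" for l using that by (simp add: G_def)
  qed (rule G_nonneg step, assumption?)+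
  have "{X. \<exists>n. t \<le> used (path_to n X) \<and> \<not> seen t x (path_to n X)} = (\<Union>n. {X. t \<le> used (path_to n X) \<and> \<not> seen t x (path_to n X)})"
    by auto
  also have "emeasure Q \<dots> \<le> ennreal (G [Some []])"
  proof (rule emeasure_increasing_union_le[OF _ _ le])
    show "{X. t \<le> used (path_to n X) \<and> \<not> seen t x (path_to n X)} \<in> sets Q" for n by (rule path_pred_sets)
    show "{X. t \<le> used (path_to n X) \<and> \<not> seen t x (path_to n X)} \<subseteq> {X. t \<le> used (path_to (Suc n) X) \<and> \<not> seen t x (path_to (Suc n) X)}" for n
    proof safe
      fix X assume u: "t \<le> used (path_to n X)" and s: "\<not> seen t x (path_to n X)"
      have ne: "path_to n X \<noteq> []" by simp
      show "t \<le> used (path_to (Suc n) X)" unfolding path_to_Suc[where n=n] used_snoc using u returns_eq_used[OF ne] by simp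
      assume "seen t x (path_to (Suc n) X)"
      then show False using s unfolding path_to_Suc[where n=n] seen_frozen[OF ne u] by simp
    qed
  qed
  finally show ?thesis unfolding init .
qed

end

section \<open>Excursions are finite\<close>

lemma sum_generation_1: "(\<Sum>v\<in>generation \<xi> 1. f v) = (\<Sum>i<length (\<xi> []). f [i])"
proof -
  have "generation \<xi> 1 = (\<lambda>i. [i]) ` {..<length (\<xi> [])}"
    using generation_Suc[of \<xi> 0] by (simp add: generation_0)
  then show ?thesis by (simp add: sum.reindex inj_on_def)
qed

text \<open>One minus the probability of reaching generation \<open>m\<close> before the parent of the root: the
  subtree of each ancestor has to be left through its root.\<close>

definition stay :: "env \<Rightarrow> nat \<Rightarrow> vertex \<Rightarrow> real" where
  "stay \<xi> m v = (case v of None \<Rightarrow> 1 | Some u \<Rightarrow> \<Prod>j\<le>length u. 1 - escape (m - j) (subtree (take j u) \<xi>))"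

lemma stay_snoc: "stay \<xi> m (Some (u @ [i])) = stay \<xi> m (Some u) * (1 - escape (m - Suc (length u)) (subtree (u @ [i]) \<xi>))"
proof -
  have "(\<Prod>j\<le>length u. 1 - escape (m - j) (subtree (take j (u @ [i])) \<xi>)) = (\<Prod>j\<le>length u. 1 - escape (m - j) (subtree (take j u) \<xi>))"
    by (intro prod.cong) auto
  then show ?thesis by (simp add: stay_def)
qed

lemma stay_parent: "stay \<xi> m (Some u) = stay \<xi> m (parent u) * (1 - escape (m - length u) (subtree u \<xi>))"
proof (cases u rule: rev_cases)
  case (snoc v i)
  then show ?thesis using stay_snoc[of \<xi> m v i] by (simp add: parent_def)
qed (simp add: stay_def parent_def)

lemma stay_boundary: "length u = m \<Longrightarrow> stay \<xi> m (Some u) = 0"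
  using stay_parent[of \<xi> m u] by simp

lemma stay_harmonic:
  assumes u: "u \<in> tree \<xi>" "length u < m"
  shows "walk_step \<xi> (stay \<xi> m) (Some u) = stay \<xi> m (Some u)"
proof -
  obtain m' where m': "m - length u = Suc m'" using u(2) by (metis Suc_diff_Suc)
  then have m'': "m - Suc (length u) = m'" by simp
  let ?s = "stay \<xi> m" and ?I = "{..<length (\<xi> u)}"
  define e where "e i = escape m' (subtree (u @ [i]) \<xi>)" for i
  define B where "B = (\<Sum>i\<in>?I. edge_weight (\<xi> u) i * e i)"
  have B0: "0 \<le> B" unfolding B_def e_def using escape_bounds by (intro sum_nonneg mult_nonneg_nonneg) auto
  have w1: "weight (subtree u \<xi>) [i] = edge_weight (\<xi> u) i" for i
    using weight_snoc[of "subtree u \<xi>" "[]" i] by (simp add: subtree_apply)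
  have "escape (m - length u) (subtree u \<xi>) = B / (1 + B)"
    unfolding m' escape.simps sum_generation_1 by (simp add: w1 subtree_subtree subtree_apply B_def e_def Let_def)
  moreover have "1 - B / (1 + B) = 1 / (1 + B)" using B0 by (simp add: field_simps)
  ultimately have "?s (Some u) = ?s (parent u) / (1 + B)"
    using stay_parent[of \<xi> m u] by simp
  then have par: "?s (parent u) - ?s (Some u) = ?s (Some u) * B"
    using B0 by (simp add: field_simps)
  have "(\<Sum>i\<in>?I. exp (- V \<xi> (u @ [i])) * (?s (Some (u @ [i])) - ?s (Some u)))
      = (\<Sum>i\<in>?I. - weight \<xi> u * ?s (Some u) * (edge_weight (\<xi> u) i * e i))"
  proof (rule sum.cong[OF refl])
    fix i assume "i \<in> ?I"
    then have "u @ [i] \<in> tree \<xi>" using u by (simp add: tree_snoc)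
    then have "exp (- V \<xi> (u @ [i])) = weight \<xi> u * edge_weight (\<xi> u) i"
      by (simp add: weight_eq_exp_V[symmetric] weight_snoc)
    then show "exp (- V \<xi> (u @ [i])) * (?s (Some (u @ [i])) - ?s (Some u)) = - weight \<xi> u * ?s (Some u) * (edge_weight (\<xi> u) i * e i)"
      by (simp add: stay_snoc m'' e_def algebra_simps)
  qed
  also have "\<dots> = - weight \<xi> u * ?s (Some u) * B" unfolding B_def by (rule sum_distrib_left[symmetric])
  finally show ?thesis
    using u par by (subst walk_step_eq_iff) (simp add: weight_eq_exp_V)
qed

text \<open>Maximum principle on the tree cut at generation \<open>m\<close>: the function \<open>f + stay - 1\<close> is harmonic
  inside and at most zero on the boundary, which consists of the parent of the root and generation
  \<open>m\<close>. A vertex of least generation at which a positive maximum is attained has a parent with a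
  strictly smaller value.\<close>

lemma harmonic_le_escape:
  assumes f: "f None = 0" "\<And>v. f v \<le> 1"
    and harm: "\<And>u. u \<in> tree \<xi> \<Longrightarrow> walk_step \<xi> f (Some u) = f (Some u)"
  shows "f (Some []) \<le> escape m \<xi>"
proof -
  define g where "g v = 1 * f v + 1 * stay \<xi> m v + (- 1)" for v
  define S where "S = {u \<in> tree \<xi>. length u \<le> m}"
  have "S = (\<Union>l\<le>m. generation \<xi> l)" by (auto simp: S_def generation_def)
  then have finS: "finite S" by simp
  have rootS: "[] \<in> S" by (simp add: S_def tree.root)
  define d where "d = Max ((\<lambda>u. g (Some u)) ` S)"
  have le_d: "g (Some u) \<le> d" if "u \<in> S" for u
    unfolding d_def using finS that by (intro Max_ge) auto
  have "d \<in> (\<lambda>u. g (Some u)) ` S" unfolding d_def using finS rootS by (intro Max_in) auto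
  then have ex: "\<exists>n. \<exists>u\<in>S. length u = n \<and> g (Some u) = d" by auto
  \<comment> \<open>a maximiser closest to the root, so that its parent is no maximiser\<close>
  define n where "n = (LEAST n. \<exists>u\<in>S. length u = n \<and> g (Some u) = d)"
  obtain u where u: "u \<in> S" "length u = n" "g (Some u) = d"
    using LeastI_ex[OF ex] unfolding n_def by blast
  have least: "g (Some w) \<noteq> d" if "w \<in> S" "length w < n" for w
    using not_less_Least[of "length w" "\<lambda>n. \<exists>u\<in>S. length u = n \<and> g (Some u) = d"] that unfolding n_def by blast
  have "d \<le> 0"
  proof (rule ccontr)
    assume "\<not> d \<le> 0"
    then have d: "0 < d" by simp
    have um: "length u < m"
    proof (rule ccontr)
      assume "\<not> length u < m"
      then have "length u = m" using u(1) by (simp add: S_def)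
      then have "d \<le> 0" using u(3) f(2)[of "Some u"] by (simp add: g_def stay_boundary)
      then show False using d by simp
    qed
    have ut: "u \<in> tree \<xi>" using u(1) by (simp add: S_def)
    have "walk_step \<xi> g (Some u) = 1 * walk_step \<xi> f (Some u) + 1 * walk_step \<xi> (stay \<xi> m) (Some u) + (- 1)"
      unfolding g_def[abs_def] by (rule walk_step_linear)
    also have "\<dots> = d" using harm[OF ut] stay_harmonic[OF ut um] u(3) by (simp add: g_def)
    finally have z: "exp (- V \<xi> u) * (g (parent u) - d) + (\<Sum>i<length (\<xi> u). exp (- V \<xi> (u @ [i])) * (g (Some (u @ [i])) - d)) = 0"
      by (simp only: walk_step_eq_iff)
    have "g (parent u) < d"
    proof (cases u rule: rev_cases)
      case Nil
      then show ?thesis using d f by (simp add: parent_def g_def stay_def)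
    next
      case (snoc w i)
      then have "w \<in> S" using u(1) by (auto simp: S_def tree_snoc)
      then have "g (Some w) \<noteq> d" "g (Some w) \<le> d" using least[of w] le_d u(2) snoc by auto
      then show ?thesis using snoc by (simp add: parent_def)
    qed
    then have "exp (- V \<xi> u) * (g (parent u) - d) < 0" by (simp add: mult_less_0_iff)
    moreover have "(\<Sum>i<length (\<xi> u). exp (- V \<xi> (u @ [i])) * (g (Some (u @ [i])) - d)) \<le> 0"
    proof (rule sum_nonpos)
      fix i assume "i \<in> {..<length (\<xi> u)}"
      then have "u @ [i] \<in> S" using ut um by (simp add: S_def tree_snoc)
      then show "exp (- V \<xi> (u @ [i])) * (g (Some (u @ [i])) - d) \<le> 0"
        using le_d by (simp add: mult_le_0_iff)
    qed
    ultimately show False using z by simp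
  qed
  then have "g (Some []) \<le> 0" using le_d[OF rootS] by simp
  then show ?thesis by (simp add: g_def stay_def)
qed

text \<open>The probability that, started at \<open>v\<close>, the walk makes fewer than \<open>r\<close> visits to the parent of the
  root before time \<open>n\<close>.\<close>

primrec unfinished :: "env \<Rightarrow> nat \<Rightarrow> nat \<Rightarrow> vertex \<Rightarrow> real" where
  "unfinished \<xi> 0 r v = of_bool (1 \<le> r)"
| "unfinished \<xi> (Suc n) r v = walk_step \<xi> (unfinished \<xi> n (if v = None then r - 1 else r)) v"

lemma unfinished_bounds: "0 \<le> unfinished \<xi> n r v \<and> unfinished \<xi> n r v \<le> 1"
proof (induction n arbitrary: r v)
  case (Suc n)
  let ?r = "if v = None then r - 1 else r"
  have "walk_step \<xi> (unfinished \<xi> n ?r) v \<le> walk_step \<xi> (\<lambda>_. 1) v"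
    using Suc by (intro walk_step_mono) blast
  moreover have "0 \<le> walk_step \<xi> (unfinished \<xi> n ?r) v"
    using Suc by (intro walk_step_nonneg) blast
  ultimately show ?case by simp
qed simp

lemma unfinished_antimono: "unfinished \<xi> (Suc n) r v \<le> unfinished \<xi> n r v"
proof (induction n arbitrary: r v)
  case (Suc n)
  let ?r = "if v = None then r - 1 else r"
  have "walk_step \<xi> (unfinished \<xi> (Suc n) ?r) v \<le> walk_step \<xi> (unfinished \<xi> n ?r) v"
    by (intro walk_step_mono Suc)
  then show ?case by (simp only: unfinished.simps(2)[of _ "Suc n"] unfinished.simps(2)[of _ n])
next
  case 0
  let ?r = "if v = None then r - 1 else r"
  have "walk_step \<xi> (unfinished \<xi> 0 ?r) v \<le> walk_step \<xi> (\<lambda>_. of_bool (1 \<le> r)) v"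
    by (rule walk_step_mono) auto
  then show ?case by (simp only: unfinished.simps walk_step_const)
qed

lemma unfinished_0 [simp]: "unfinished \<xi> n 0 v = 0"
proof (induction n arbitrary: v)
  case (Suc n)
  then have "unfinished \<xi> n 0 = (\<lambda>_. 0)" by (simp add: fun_eq_iff)
  then show ?case by simp
qed simp

lemma tendsto_walk_step:
  assumes "\<And>y. (\<lambda>n. f n y) \<longlonglongrightarrow> g y"
  shows "(\<lambda>n. walk_step \<xi> (f n) v) \<longlonglongrightarrow> walk_step \<xi> g v"
proof (cases v)
  case (Some u)
  show ?thesis unfolding Some walk_step_def option.case
    using conductance_pos[of \<xi> u]
    by (intro tendsto_divide tendsto_add tendsto_mult tendsto_sum tendsto_const assms) simp
qed (simp add: assms)

text \<open>The limit in \<open>n\<close> is harmonic on the tree and, by induction on \<open>r\<close>, zero at the parent of the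
  root; hence it is at most the probability of escaping to any generation.\<close>

lemma unfinished_tendsto_0:
  assumes esc: "(\<lambda>m. escape m \<xi>) \<longlonglongrightarrow> 0"
  shows "(\<lambda>n. unfinished \<xi> n r (Some [])) \<longlonglongrightarrow> 0"
proof -
  define A where "A r v = lim (\<lambda>n. unfinished \<xi> n r v)" for r v
  have lim: "(\<lambda>n. unfinished \<xi> n r v) \<longlonglongrightarrow> A r v" for r v
  proof -
    have "convergent (\<lambda>n. unfinished \<xi> n r v)"
    proof (rule Bseq_monoseq_convergent)
      show "Bseq (\<lambda>n. unfinished \<xi> n r v)" using unfinished_bounds by (intro BseqI'[of _ 1]) (auto simp: abs_le_iff intro: order_trans[of _ 0])
      show "monoseq (\<lambda>n. unfinished \<xi> n r v)" by (intro decseq_imp_monoseq decseq_SucI unfinished_antimono)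
    qed
    then show ?thesis unfolding A_def by (rule convergent_LIMSEQ_iff[THEN iffD1])
  qed
  have A01: "0 \<le> A r v" "A r v \<le> 1" for r v
    using LIMSEQ_le_const[OF lim, of 0 r v] LIMSEQ_le_const2[OF lim, of r v 1] unfinished_bounds by blast+
  have harm: "A r v = walk_step \<xi> (A (if v = None then r - 1 else r)) v" for r v
  proof (rule LIMSEQ_unique[OF LIMSEQ_Suc[OF lim]])
    show "(\<lambda>n. unfinished \<xi> (Suc n) r v) \<longlonglongrightarrow> walk_step \<xi> (A (if v = None then r - 1 else r)) v"
      unfolding unfinished.simps by (intro tendsto_walk_step lim)
  qed
  have "A r (Some []) = 0"
  proof (induction r)
    case 0
    show ?case by (rule LIMSEQ_unique[OF lim]) simp
  next
    case (Suc r)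
    have "A (Suc r) (Some []) \<le> escape m \<xi>" for m
    proof (rule harmonic_le_escape)
      show "A (Suc r) None = 0" using harm[of "Suc r" None] Suc by simp
      show "walk_step \<xi> (A (Suc r)) (Some u) = A (Suc r) (Some u)" for u using harm[of "Suc r" "Some u"] by simp
    qed (rule A01)
    then have "A (Suc r) (Some []) \<le> 0" by (intro LIMSEQ_le_const[OF esc]) auto
    then show ?case using A01(1)[of "Suc r" "Some []"] by simp
  qed
  then show ?thesis using lim[of r "Some []"] by simp
qed

context quenched_walk
begin

lemma AE_excursions_finite:
  assumes esc: "(\<lambda>m. escape m \<xi>) \<longlonglongrightarrow> 0"
  shows "AE X in Q. \<exists>n. t \<le> used (path_to n X)"
proof -
  have le: "emeasure Q {X. used (path_to n X) < t} \<le> ennreal (unfinished \<xi> n t (Some []))" for n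
  proof -
    \<comment> \<open>remaining time and remaining excursions, as seen from the end of the path\<close>
    define G where "G j l = unfinished \<xi> (n - j) (t - used l) (last l)" for j l
    have "emeasure Q {X. used (path_to n X) < t} \<le> ennreal (G 0 [Some []])"
    proof (rule emeasure_path_le)
      show "0 \<le> G j l" for j l unfolding G_def using unfinished_bounds by blast
      show "1 \<le> G n l" if "used l < t" for l using that by (simp add: G_def)
      fix j l assume l: "l \<noteq> ([] :: vertex list)"
      have r: "t - returns l = (if last l = None then t - used l - 1 else t - used l)"
        using returns_eq_used[OF l] by simp
      have "walk_step \<xi> (\<lambda>y. G (Suc j) (l @ [y])) (last l) = walk_step \<xi> (unfinished \<xi> (n - Suc j) (t - returns l)) (last l)"
        unfolding G_def by simp
      also have "\<dots> = unfinished \<xi> (Suc (n - Suc j)) (t - used l) (last l)" unfolding r by simp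
      also have "\<dots> \<le> G j l"
      proof (cases "j < n")
        case True
        then show ?thesis by (simp add: G_def Suc_diff_Suc del: unfinished.simps)
      next
        case False
        then show ?thesis using unfinished_antimono[of \<xi> 0] by (simp add: G_def del: unfinished.simps)
      qed
      finally show "walk_step \<xi> (\<lambda>y. G (Suc j) (l @ [y])) (last l) \<le> G j l" .
    qed
    then show ?thesis by (simp add: G_def used_def returns_def)
  qed
  define Z where "Z = {X. \<forall>n. used (path_to n X) < t}"
  have "Z = (\<Inter>n. {X. used (path_to n X) < t})" by (auto simp: Z_def)
  also have "\<dots> \<in> sets Q" by (intro sets.countable_INT') (auto intro: path_pred_sets simp del: upt_Suc)
  finally have Z: "Z \<in> sets Q" .
  have "emeasure Q Z \<le> ennreal (unfinished \<xi> n t (Some []))" for n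
  proof -
    have "emeasure Q Z \<le> emeasure Q {X. used (path_to n X) < t}"
      by (intro emeasure_mono path_pred_sets) (auto simp: Z_def simp del: upt_Suc)
    then show ?thesis using le[of n] by (rule order_trans)
  qed
  moreover have "(\<lambda>n. ennreal (unfinished \<xi> n t (Some []))) \<longlonglongrightarrow> ennreal 0"
    by (intro tendsto_ennrealI unfinished_tendsto_0 esc)
  ultimately have "emeasure Q Z \<le> ennreal 0"
    by (intro LIMSEQ_le_const) auto
  then have "emeasure Q Z = 0" by simp
  then have "AE X in Q. X \<notin> Z" using Z by (intro AE_not_in) (auto simp: null_sets_def)
  then show ?thesis by eventually_elim (auto simp: Z_def not_less simp del: upt_Suc)
qed

text \<open>Almost surely all \<open>t\<close> excursions end, so a vertex that is not visited has been missed \<open>t\<close>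
  times; then \<open>(1 - p) ^ t\<close> is expanded to second order.\<close>

lemma emeasure_visited_ge:
  assumes esc: "(\<lambda>m. escape m \<xi>) \<longlonglongrightarrow> 0" and x: "x \<in> tree \<xi>" "x \<noteq> []" and t: "1 \<le> t"
  shows "real t * hit \<xi> x - (real t * hit \<xi> x)\<^sup>2 \<le> prob (visited t x)"
proof -
  let ?p = "hit \<xi> x"
  have p: "0 \<le> ?p" "?p \<le> 1" using reach_le_1[OF x(1), of "Some []"] by simp_all
  let ?N = "{X. \<exists>n. t \<le> used (path_to n X) \<and> \<not> seen t x (path_to n X)}"
  have N: "?N \<in> sets Q"
  proof -
    have "?N = (\<Union>n. {X. t \<le> used (path_to n X) \<and> \<not> seen t x (path_to n X)})" by auto
    also have "\<dots> \<in> sets Q" by (intro sets.countable_UN) (auto intro: path_pred_sets simp del: upt_Suc)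
    finally show ?thesis .
  qed
  have "emeasure Q (UNIV - visited t x) \<le> emeasure Q ?N"
  proof (rule emeasure_mono_AE)
    show "AE X in Q. X \<in> UNIV - visited t x \<longrightarrow> X \<in> ?N"
      using AE_excursions_finite[OF esc, of t] by eventually_elim (auto simp: visited_def simp del: upt_Suc)
  qed (rule N)
  also have "\<dots> \<le> ennreal ((1 - ?p) ^ t)" by (rule emeasure_finished_not_seen[OF x t])
  finally have "ennreal (prob (UNIV - visited t x)) \<le> ennreal ((1 - ?p) ^ t)"
    by (simp only: emeasure_eq_measure)
  then have "prob (UNIV - visited t x) \<le> (1 - ?p) ^ t"
    using p by (simp add: ennreal_le_iff)
  moreover have "prob (UNIV - visited t x) = 1 - prob (visited t x)"
    using prob_compl[OF visited_sets, of t x] by simp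
  moreover have "(1 - ?p) ^ t \<le> 1 - real t * ?p + (real t * ?p)\<^sup>2"
  proof (induction t)
    case (Suc t)
    have "(1 - ?p) ^ Suc t \<le> (1 - ?p) * (1 - real t * ?p + (real t * ?p)\<^sup>2)"
      using Suc p by (simp add: mult_left_mono)
    also have "\<dots> \<le> 1 - real (Suc t) * ?p + (real (Suc t) * ?p)\<^sup>2"
    proof -
      have "0 \<le> ?p * (real t * ?p)\<^sup>2" using p by simp
      moreover have "0 \<le> real t * ?p\<^sup>2" by simp
      moreover have "0 \<le> ?p\<^sup>2" by simp
      ultimately show ?thesis by (simp add: power2_eq_square algebra_simps)
    qed
    finally show ?case .
  qed simp
  ultimately show ?thesis by linarith
qed

end

section \<open>Concentration of the number of visited vertices in a fixed environment\<close>

context quenched_walk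
begin

definition visits :: "nat \<Rightarrow> nat list set \<Rightarrow> (nat \<Rightarrow> vertex) \<Rightarrow> real" where
  "visits t D X = (\<Sum>u\<in>D. indicator (visited t u) X)"

lemma integrable_indicator_visited [simp]: "integrable Q (\<lambda>X. indicator (visited t u \<inter> visited t v) X :: real)"
  "integrable Q (\<lambda>X. indicator (visited t u) X :: real)"
  by (auto simp: integrable_indicator_iff less_top[symmetric])

lemma measurable_visits [measurable]: "visits t D \<in> borel_measurable Q"
  unfolding visits_def by measurable

text \<open>The main terms \<open>(t * a)\<^sup>2\<close> cancel. What remains is the correlation within single excursions
  and the second order error in the first moment.\<close>

lemma second_moment:
  assumes esc: "(\<lambda>m. escape m \<xi>) \<longlonglongrightarrow> 0" and t: "1 \<le> t"
    and D: "finite D" "\<And>x. x \<in> D \<Longrightarrow> x \<in> tree \<xi>" "\<And>x. x \<in> D \<Longrightarrow> x \<noteq> []"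
  defines "a \<equiv> \<Sum>x\<in>D. hit \<xi> x"
  shows "integrable Q (\<lambda>X. (visits t D X - real t * a)\<^sup>2)"
    and "(\<integral>X. (visits t D X - real t * a)\<^sup>2 \<partial>Q)
      \<le> 2 * real t * (\<Sum>x\<in>D. \<Sum>y\<in>D. pair_bound \<xi> x y) + 2 * real t ^ 3 * (a * (\<Sum>x\<in>D. (hit \<xi> x)\<^sup>2))"
proof -
  define B where "B = (\<Sum>x\<in>D. \<Sum>y\<in>D. pair_bound \<xi> x y)"
  define s where "s = (\<Sum>x\<in>D. (hit \<xi> x)\<^sup>2)"
  have a0: "0 \<le> a" unfolding a_def by (simp add: sum_nonneg)
  have sq: "(visits t D X)\<^sup>2 = (\<Sum>x\<in>D. \<Sum>y\<in>D. indicator (visited t x \<inter> visited t y) X)" for X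
    unfolding visits_def power2_eq_square sum_product indicator_inter_arith ..
  have intN2: "integrable Q (\<lambda>X. (visits t D X)\<^sup>2)" unfolding sq by simp
  have intN: "integrable Q (visits t D)" unfolding visits_def[abs_def] by simp
  have EN2: "(\<integral>X. (visits t D X)\<^sup>2 \<partial>Q) \<le> 2 * real t * B + (real t * a)\<^sup>2"
  proof -
    have "(\<integral>X. (visits t D X)\<^sup>2 \<partial>Q) = (\<Sum>x\<in>D. \<Sum>y\<in>D. prob (visited t x \<inter> visited t y))"
      unfolding sq by simp
    also have "\<dots> \<le> (\<Sum>x\<in>D. \<Sum>y\<in>D. 2 * real t * pair_bound \<xi> x y + (real t)\<^sup>2 * (hit \<xi> x * hit \<xi> y))"
    proof (intro sum_mono)
      fix x y assume "x \<in> D" "y \<in> D"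
      then have "ennreal (prob (visited t x \<inter> visited t y)) \<le> ennreal (2 * real t * pair_bound \<xi> x y + (real t)\<^sup>2 * (hit \<xi> x * hit \<xi> y))"
        using emeasure_visited_both[of x y t] D t by (simp add: emeasure_eq_measure)
      moreover have "0 \<le> 2 * real t * pair_bound \<xi> x y + (real t)\<^sup>2 * (hit \<xi> x * hit \<xi> y)"
        using pair_bound_nonneg by simp
      ultimately show "prob (visited t x \<inter> visited t y) \<le> 2 * real t * pair_bound \<xi> x y + (real t)\<^sup>2 * (hit \<xi> x * hit \<xi> y)"
        by (simp only: ennreal_le_iff)
    qed
    also have "\<dots> = 2 * real t * B + (real t)\<^sup>2 * (a * a)"
      unfolding B_def a_def sum_product by (simp only: sum.distrib sum_distrib_left)
    finally show ?thesis by (simp add: power2_eq_square mult_ac)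
  qed
  have EN: "real t * a - (real t)\<^sup>2 * s \<le> (\<integral>X. visits t D X \<partial>Q)"
  proof -
    have "real t * a - (real t)\<^sup>2 * s = (\<Sum>x\<in>D. real t * hit \<xi> x - (real t * hit \<xi> x)\<^sup>2)"
      unfolding a_def s_def by (simp add: sum_subtractf sum_distrib_left power_mult_distrib)
    also have "\<dots> \<le> (\<Sum>x\<in>D. prob (visited t x))"
      using D t by (intro sum_mono emeasure_visited_ge[OF esc]) auto
    also have "\<dots> = (\<integral>X. visits t D X \<partial>Q)" unfolding visits_def by simp
    finally show ?thesis .
  qed
  have ex: "(visits t D X - real t * a)\<^sup>2 = (visits t D X)\<^sup>2 - (2 * real t * a) * visits t D X + (real t * a)\<^sup>2" for X
    by (simp add: power2_eq_square algebra_simps)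
  show "integrable Q (\<lambda>X. (visits t D X - real t * a)\<^sup>2)"
    unfolding ex using intN2 intN by simp
  have "(\<integral>X. (visits t D X - real t * a)\<^sup>2 \<partial>Q) = (\<integral>X. (visits t D X)\<^sup>2 \<partial>Q) - (2 * real t * a) * (\<integral>X. visits t D X \<partial>Q) + (real t * a)\<^sup>2"
  proof -
    have "prob UNIV = 1" using prob_space by simp
    then show ?thesis unfolding ex using intN2 intN by simp
  qed
  also have "\<dots> \<le> (2 * real t * B + (real t * a)\<^sup>2) - (2 * real t * a) * (real t * a - (real t)\<^sup>2 * s) + (real t * a)\<^sup>2"
    using EN2 EN a0 by (intro add_right_mono diff_mono mult_left_mono) auto
  also have "\<dots> = 2 * real t * B + 2 * real t ^ 3 * (a * s)"
    by (simp add: power2_eq_square power3_eq_cube algebra_simps)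
  finally show "(\<integral>X. (visits t D X - real t * a)\<^sup>2 \<partial>Q) \<le> 2 * real t * (\<Sum>x\<in>D. \<Sum>y\<in>D. pair_bound \<xi> x y) + 2 * real t ^ 3 * (a * (\<Sum>x\<in>D. (hit \<xi> x)\<^sup>2))"
    unfolding B_def s_def .
qed

text \<open>Chebyshev's inequality for the sum over the blocks, after Cauchy-Schwarz; the number of blocks
  enters as a factor and is harmless because the cut generation \<open>m\<close> is fixed.\<close>

lemma block_deviation:
  assumes esc: "(\<lambda>m. escape m \<xi>) \<longlonglongrightarrow> 0" and t: "1 \<le> t"
    and D: "finite D" "\<And>x. x \<in> D \<Longrightarrow> x \<in> tree \<xi>" "\<And>x. x \<in> D \<Longrightarrow> x \<noteq> []"
    and T: "finite T" "take m ` D \<subseteq> T" and c: "0 < c" and eps: "\<And>x. x \<in> D \<Longrightarrow> hit \<xi> x \<le> \<epsilon>"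
  shows "emeasure Q {X. c < (\<Sum>u\<in>T. \<bar>visits t {x \<in> D. take m x = u} X - real t * block_sum m D (hit \<xi>) u\<bar>)}
     \<le> ennreal (real (card T) * (2 * real t * (\<Sum>x\<in>D. \<Sum>y\<in>D. pair_bound \<xi> x y) + 2 * real t ^ 3 * (\<epsilon> * (\<Sum>x\<in>D. hit \<xi> x)\<^sup>2)) / c\<^sup>2)"
proof -
  let ?D = "\<lambda>u. {x \<in> D. take m x = u}"
  define d where "d u X = visits t (?D u) X - real t * block_sum m D (hit \<xi>) u" for u X
  define a where "a u = (\<Sum>x\<in>?D u. hit \<xi> x)" for u
  define B where "B u = (\<Sum>x\<in>?D u. \<Sum>y\<in>?D u. pair_bound \<xi> x y)" for u
  have bs: "block_sum m D (hit \<xi>) u = a u" for u by (simp add: block_sum_def a_def)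
  have a0: "0 \<le> a u" for u unfolding a_def by (simp add: sum_nonneg)
  have group: "(\<Sum>u\<in>T. \<Sum>x\<in>?D u. f x) = (\<Sum>x\<in>D. f x)" for f :: "nat list \<Rightarrow> real"
    using D(1) T by (intro sum.group)
  have sm: "integrable Q (\<lambda>X. (d u X)\<^sup>2)" "(\<integral>X. (d u X)\<^sup>2 \<partial>Q) \<le> 2 * real t * B u + 2 * real t ^ 3 * (\<epsilon> * (a u * (\<Sum>x\<in>D. hit \<xi> x)))" for u
  proof -
    have fin: "finite (?D u)" "\<And>x. x \<in> ?D u \<Longrightarrow> x \<in> tree \<xi>" "\<And>x. x \<in> ?D u \<Longrightarrow> x \<noteq> []" using D by auto
    show "integrable Q (\<lambda>X. (d u X)\<^sup>2)"
      unfolding d_def bs a_def by (rule second_moment(1)[OF esc t]) (use fin in auto)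
    have "(\<integral>X. (d u X)\<^sup>2 \<partial>Q) \<le> 2 * real t * B u + 2 * real t ^ 3 * (a u * (\<Sum>x\<in>?D u. (hit \<xi> x)\<^sup>2))"
      unfolding d_def bs a_def B_def by (rule second_moment(2)[OF esc t]) (use fin in auto)
    moreover have "(\<Sum>x\<in>?D u. (hit \<xi> x)\<^sup>2) \<le> \<epsilon> * (\<Sum>x\<in>D. hit \<xi> x)"
    proof -
      have "(\<Sum>x\<in>?D u. (hit \<xi> x)\<^sup>2) \<le> (\<Sum>x\<in>D. (hit \<xi> x)\<^sup>2)" using D by (intro sum_mono2) auto
      also have "\<dots> \<le> (\<Sum>x\<in>D. \<epsilon> * hit \<xi> x)"
        unfolding power2_eq_square using eps by (intro sum_mono mult_right_mono) auto
      finally show ?thesis by (simp add: sum_distrib_left)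
    qed
    then have "2 * real t ^ 3 * (a u * (\<Sum>x\<in>?D u. (hit \<xi> x)\<^sup>2)) \<le> 2 * real t ^ 3 * (a u * (\<epsilon> * (\<Sum>x\<in>D. hit \<xi> x)))"
      using a0[of u] by (intro mult_left_mono) auto
    moreover have "a u * (\<epsilon> * (\<Sum>x\<in>D. hit \<xi> x)) = \<epsilon> * (a u * (\<Sum>x\<in>D. hit \<xi> x))" by (rule mult.left_commute)
    ultimately show "(\<integral>X. (d u X)\<^sup>2 \<partial>Q) \<le> 2 * real t * B u + 2 * real t ^ 3 * (\<epsilon> * (a u * (\<Sum>x\<in>D. hit \<xi> x)))"
      by (simp only:)
  qed
  define F where "F X = (\<Sum>u\<in>T. \<bar>d u X\<bar>)" for X
  have Fm [measurable]: "F \<in> borel_measurable Q" unfolding F_def d_def by measurable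
  have Fsq: "(F X)\<^sup>2 \<le> real (card T) * (\<Sum>u\<in>T. (d u X)\<^sup>2)" for X
    using power_weighted_sum_le[of T "\<lambda>_. 1" "\<lambda>u. \<bar>d u X\<bar>" 1] T(1) by (simp add: F_def numeral_2_eq_2)
  have intR: "integrable Q (\<lambda>X. real (card T) * (\<Sum>u\<in>T. (d u X)\<^sup>2))" using sm(1) by simp
  have intF: "integrable Q (\<lambda>X. (F X)\<^sup>2)"
    by (rule Bochner_Integration.integrable_bound[OF intR]) (use Fsq in \<open>auto intro!: AE_I2 order_trans[OF _ abs_ge_self]\<close>)
  have "(\<integral>X. (F X)\<^sup>2 \<partial>Q) \<le> (\<integral>X. real (card T) * (\<Sum>u\<in>T. (d u X)\<^sup>2) \<partial>Q)"
    by (intro integral_mono intF intR Fsq)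
  also have "\<dots> = real (card T) * (\<Sum>u\<in>T. \<integral>X. (d u X)\<^sup>2 \<partial>Q)" using sm(1) by simp
  also have "\<dots> \<le> real (card T) * (\<Sum>u\<in>T. 2 * real t * B u + 2 * real t ^ 3 * (\<epsilon> * (a u * (\<Sum>x\<in>D. hit \<xi> x))))"
    by (intro mult_left_mono sum_mono sm(2)) simp
  also have "(\<Sum>u\<in>T. 2 * real t * B u + 2 * real t ^ 3 * (\<epsilon> * (a u * (\<Sum>x\<in>D. hit \<xi> x))))
      = 2 * real t * (\<Sum>u\<in>T. B u) + 2 * real t ^ 3 * (\<epsilon> * ((\<Sum>u\<in>T. a u) * (\<Sum>x\<in>D. hit \<xi> x)))"
  proof -
    have "(\<Sum>u\<in>T. p * f u + q * (e * (g u * r))) = p * (\<Sum>u\<in>T. f u) + q * (e * ((\<Sum>u\<in>T. g u) * r))"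
      for p q e r :: real and f g :: "nat list \<Rightarrow> real"
      by (simp add: sum.distrib sum_distrib_left sum_distrib_right)
    then show ?thesis .
  qed
  also have "(\<Sum>u\<in>T. a u) = (\<Sum>x\<in>D. hit \<xi> x)" unfolding a_def by (rule group)
  also have "real (card T) * (2 * real t * (\<Sum>u\<in>T. B u) + 2 * real t ^ 3 * (\<epsilon> * ((\<Sum>x\<in>D. hit \<xi> x) * (\<Sum>x\<in>D. hit \<xi> x))))
      \<le> real (card T) * (2 * real t * (\<Sum>x\<in>D. \<Sum>y\<in>D. pair_bound \<xi> x y) + 2 * real t ^ 3 * (\<epsilon> * (\<Sum>x\<in>D. hit \<xi> x)\<^sup>2))"
  proof -
    have "(\<Sum>u\<in>T. B u) \<le> (\<Sum>u\<in>T. \<Sum>x\<in>?D u. \<Sum>y\<in>D. pair_bound \<xi> x y)"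
      unfolding B_def using D pair_bound_nonneg by (intro sum_mono sum_mono2) auto
    also have "\<dots> = (\<Sum>x\<in>D. \<Sum>y\<in>D. pair_bound \<xi> x y)" by (rule group)
    finally show ?thesis by (intro mult_left_mono add_right_mono) (auto simp: power2_eq_square intro: mult_left_mono)
  qed
  finally have EF: "(\<integral>X. (F X)\<^sup>2 \<partial>Q) \<le> real (card T) * (2 * real t * (\<Sum>x\<in>D. \<Sum>y\<in>D. pair_bound \<xi> x y) + 2 * real t ^ 3 * (\<epsilon> * (\<Sum>x\<in>D. hit \<xi> x)\<^sup>2))" .
  have "emeasure Q {X. c < F X} \<le> (\<integral>\<^sup>+X. ennreal ((F X)\<^sup>2 / c\<^sup>2) \<partial>Q)"
  proof -
    have "{X \<in> space Q. c < F X} \<in> sets Q" by measurable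
    then have "emeasure Q {X. c < F X} = (\<integral>\<^sup>+X. indicator {X. c < F X} X \<partial>Q)" by simp
    also have "\<dots> \<le> (\<integral>\<^sup>+X. ennreal ((F X)\<^sup>2 / c\<^sup>2) \<partial>Q)"
    proof (rule nn_integral_mono)
      fix X
      show "indicator {X. c < F X} X \<le> ennreal ((F X)\<^sup>2 / c\<^sup>2)"
      proof (cases "c < F X")
        case True
        then have "c\<^sup>2 \<le> (F X)\<^sup>2" using c by (intro power_mono) auto
        then have "1 \<le> (F X)\<^sup>2 / c\<^sup>2" using c by simp
        then show ?thesis using True by (simp add: ennreal_leI[of 1, simplified])
      qed simp
    qed
    finally show ?thesis .
  qed
  also have "\<dots> = ennreal (\<integral>X. (F X)\<^sup>2 / c\<^sup>2 \<partial>Q)"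
    using intF by (intro nn_integral_eq_integral) auto
  also have "(\<integral>X. (F X)\<^sup>2 / c\<^sup>2 \<partial>Q) = (\<integral>X. (F X)\<^sup>2 \<partial>Q) / c\<^sup>2" by simp
  also have "ennreal \<dots> \<le> ennreal (real (card T) * (2 * real t * (\<Sum>x\<in>D. \<Sum>y\<in>D. pair_bound \<xi> x y) + 2 * real t ^ 3 * (\<epsilon> * (\<Sum>x\<in>D. hit \<xi> x)\<^sup>2)) / c\<^sup>2)"
    by (intro ennreal_leI divide_right_mono EF) simp
  finally show ?thesis unfolding F_def d_def .
qed

end

section \<open>Convergence of the tuple sums over visited vertices\<close>

definition levels :: "env \<Rightarrow> nat \<Rightarrow> nat \<Rightarrow> nat list set" where
  "levels \<xi> l h = {x \<in> tree \<xi>. l \<le> length x \<and> length x \<le> h}"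

lemma levels_eq: "levels \<xi> l h = (\<Union>j\<in>{l..h}. generation \<xi> j)"
  by (auto simp: levels_def generation_def)

lemma finite_levels [simp]: "finite (levels \<xi> l h)"
  by (simp add: levels_eq)

lemma sum_levels:
  fixes f :: "nat list \<Rightarrow> 'b::comm_monoid_add"
  shows "(\<Sum>x\<in>levels \<xi> l h. f x) = (\<Sum>j\<in>{l..h}. \<Sum>x\<in>generation \<xi> j. f x)"
  unfolding levels_eq
proof (rule sum.UNION_disjoint)
  show "\<forall>i\<in>{l..h}. finite (generation \<xi> i)" by (intro ballI finite_generation)
qed (auto simp: generation_def)

lemma block_sum_levels:
  "block_sum m (levels \<xi> l h) g u = (\<Sum>j\<in>{l..h}. block_sum m (generation \<xi> j) g u)"
proof -
  have "block_sum m D g u = (\<Sum>x\<in>D. if take m x = u then g x else 0)" if "finite D" for D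
    unfolding block_sum_def using that by (simp add: sum.If_cases Int_def)
  then show ?thesis by (simp add: sum_levels)
qed

lemma take_levels: "m \<le> l \<Longrightarrow> take m ` levels \<xi> l h \<subseteq> generation \<xi> m"
proof
  fix u assume m: "m \<le> l" and "u \<in> take m ` levels \<xi> l h"
  then obtain x where x: "x \<in> tree \<xi>" "l \<le> length x" "u = take m x" by (auto simp: levels_def)
  then have "take m x @ drop m x \<in> tree \<xi>" by simp
  then show "u \<in> generation \<xi> m" using x m unfolding in_tree_append by (simp add: generation_def)
qed

definition pair_total :: "env \<Rightarrow> nat \<Rightarrow> nat \<Rightarrow> real" where
  "pair_total \<xi> l h = (\<Sum>x\<in>levels \<xi> l h. \<Sum>y\<in>levels \<xi> l h. pair_bound \<xi> x y)"

definition hit_total :: "env \<Rightarrow> nat \<Rightarrow> nat \<Rightarrow> real" where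
  "hit_total \<xi> l h = (\<Sum>x\<in>levels \<xi> l h. hit \<xi> x)"

lemma pair_total_eq:
  "pair_total \<xi> l h = (\<Sum>i\<in>{l..h}. \<Sum>j\<in>{l..h}. \<Sum>x\<in>generation \<xi> i. \<Sum>y\<in>generation \<xi> j. pair_bound \<xi> x y)"
  unfolding pair_total_def sum_levels by (intro sum.cong refl sum.swap)

lemma hit_total_eq: "hit_total \<xi> l h = (\<Sum>j\<in>{l..h}. hit_sum \<xi> j)"
  by (simp add: hit_total_def sum_levels hit_sum_def)

context regular_law
begin

lemma measurable_pair_sum [measurable]:
  "(\<lambda>\<xi>. \<Sum>x\<in>generation \<xi> i. \<Sum>y\<in>generation \<xi> j. pair_bound \<xi> x y) \<in> borel_measurable Env"
proof -
  have z: "hit \<xi> x = 0" if "x \<notin> tree \<xi>" for x \<xi> using that by (simp add: hit_def weight_eq_0)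
  have "level_sum_nn i (\<lambda>x. level_sum_nn j (\<lambda>y. ennreal (pair_bound \<xi> x y)))
      = ennreal (\<Sum>x\<in>generation \<xi> i. \<Sum>y\<in>generation \<xi> j. pair_bound \<xi> x y)" for \<xi>
  proof -
    have "level_sum_nn j (\<lambda>y. ennreal (pair_bound \<xi> x y)) = ennreal (\<Sum>y\<in>generation \<xi> j. pair_bound \<xi> x y)" for x
      by (subst level_sum_nn_generation[of _ \<xi>]) (auto simp: pair_bound_def z intro!: sum_ennreal)
    moreover have "pair_bound \<xi> x y = 0" if "x \<notin> tree \<xi>" for x y using that by (simp add: pair_bound_def z)
    ultimately show ?thesis
      by (subst level_sum_nn_generation[of _ \<xi>]) (auto intro!: sum_ennreal sum_nonneg pair_bound_nonneg)
  qed
  then have "(\<lambda>\<xi>. \<Sum>x\<in>generation \<xi> i. \<Sum>y\<in>generation \<xi> j. pair_bound \<xi> x y)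
      = (\<lambda>\<xi>. enn2real (level_sum_nn i (\<lambda>x. level_sum_nn j (\<lambda>y. ennreal (pair_bound \<xi> x y)))))"
    by (simp add: sum_nonneg pair_bound_nonneg)
  also have "\<dots> \<in> borel_measurable Env" unfolding pair_bound_def by measurable
  finally show ?thesis .
qed

lemma measurable_pair_total [measurable]: "(\<lambda>\<xi>. pair_total \<xi> l h) \<in> borel_measurable Env"
  unfolding pair_total_eq by measurable

lemma measurable_hit_total [measurable]: "(\<lambda>\<xi>. hit_total \<xi> l h) \<in> borel_measurable Env"
  unfolding hit_total_eq by measurable

lemma pair_total_nonneg: "0 \<le> pair_total \<xi> l h"
  unfolding pair_total_def by (intro sum_nonneg pair_bound_nonneg)

lemma nn_integral_pair_total:
  "(\<integral>\<^sup>+\<xi>. ennreal (pair_total \<xi> l h) \<partial>Env) \<le> ennreal (pair_const * real (h + 1) * (real (h + 1 - l))\<^sup>2)"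
proof -
  have "(\<integral>\<^sup>+\<xi>. ennreal (pair_total \<xi> l h) \<partial>Env)
     = (\<integral>\<^sup>+\<xi>. (\<Sum>i\<in>{l..h}. \<Sum>j\<in>{l..h}. ennreal (\<Sum>x\<in>generation \<xi> i. \<Sum>y\<in>generation \<xi> j. pair_bound \<xi> x y)) \<partial>Env)"
    unfolding pair_total_eq
    by (intro nn_integral_cong) (simp add: sum_ennreal[symmetric] sum_nonneg pair_bound_nonneg del: sum_ennreal)
  also have "\<dots> = (\<Sum>i\<in>{l..h}. \<Sum>j\<in>{l..h}. \<integral>\<^sup>+\<xi>. ennreal (\<Sum>x\<in>generation \<xi> i. \<Sum>y\<in>generation \<xi> j. pair_bound \<xi> x y) \<partial>Env)"
    by (subst nn_integral_sum, measurable, intro sum.cong refl, subst nn_integral_sum, measurable)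
  also have "\<dots> \<le> (\<Sum>i\<in>{l..h}. \<Sum>j\<in>{l..h}. ennreal (pair_const * real (h + 1)))"
  proof (intro sum_mono order_trans[OF nn_integral_sum_pair_bound] ennreal_leI mult_left_mono)
    fix i j assume "i \<in> {l..h}" "j \<in> {l..h}"
    then show "real (min i j + 1) \<le> real (h + 1)" by auto
  qed (rule pair_const_nonneg)
  also have "\<dots> = ennreal (\<Sum>i\<in>{l..h}. \<Sum>j\<in>{l..h}. pair_const * real (h + 1))"
    using pair_const_nonneg by (simp only: sum_ennreal mult_nonneg_nonneg of_nat_0_le_iff sum_nonneg)
  also have "(\<Sum>i\<in>{l..h}. \<Sum>j\<in>{l..h}. pair_const * real (h + 1)) = pair_const * real (h + 1) * (real (h + 1 - l))\<^sup>2"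
    by (cases "l \<le> h + 1") (simp_all add: power2_eq_square of_nat_diff algebra_simps)
  finally show ?thesis .
qed

text \<open>Cauchy-Schwarz over the generations, each of which has the bounded second moment of the mass.\<close>

lemma nn_integral_hit_total_square:
  "(\<integral>\<^sup>+\<xi>. ennreal ((hit_total \<xi> l h)\<^sup>2) \<partial>Env) \<le> ennreal (mass_bound 2 * (real (h + 1 - l))\<^sup>2)"
proof -
  let ?L = "real (h + 1 - l)"
  have "(\<integral>\<^sup>+\<xi>. ennreal ((hit_total \<xi> l h)\<^sup>2) \<partial>Env) \<le> (\<integral>\<^sup>+\<xi>. (\<Sum>j\<in>{l..h}. ennreal ?L * ennreal (mass \<xi> j ^ 2)) \<partial>Env)"
  proof (rule nn_integral_mono)
    fix \<xi>
    have "(hit_total \<xi> l h)\<^sup>2 \<le> ?L * (\<Sum>j\<in>{l..h}. (hit_sum \<xi> j)\<^sup>2)"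
      using power_weighted_sum_le[of "{l..h}" "\<lambda>_. 1" "\<lambda>j. hit_sum \<xi> j" 1]
      by (simp add: hit_total_eq numeral_2_eq_2)
    also have "\<dots> \<le> ?L * (\<Sum>j\<in>{l..h}. mass \<xi> j ^ 2)"
      by (intro mult_left_mono sum_mono power_mono hit_sum_le_mass) auto
    finally have "ennreal ((hit_total \<xi> l h)\<^sup>2) \<le> ennreal (?L * (\<Sum>j\<in>{l..h}. mass \<xi> j ^ 2))" by (rule ennreal_leI)
    also have "\<dots> = (\<Sum>j\<in>{l..h}. ennreal (?L * mass \<xi> j ^ 2))"
      unfolding sum_distrib_left by (rule sum_ennreal[symmetric]) (intro mult_nonneg_nonneg of_nat_0_le_iff zero_le_power2)
    also have "\<dots> = (\<Sum>j\<in>{l..h}. ennreal ?L * ennreal (mass \<xi> j ^ 2))"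
      by (intro sum.cong[OF refl] ennreal_mult of_nat_0_le_iff zero_le_power2)
    finally show "ennreal ((hit_total \<xi> l h)\<^sup>2) \<le> (\<Sum>j\<in>{l..h}. ennreal ?L * ennreal (mass \<xi> j ^ 2))" .
  qed
  also have "\<dots> = (\<Sum>j\<in>{l..h}. ennreal ?L * (\<integral>\<^sup>+\<xi>. ennreal (mass \<xi> j ^ 2) \<partial>Env))"
    by (subst nn_integral_sum) (simp_all add: nn_integral_cmult)
  also have "\<dots> \<le> (\<Sum>j\<in>{l..h}. ennreal ?L * ennreal (mass_bound 2))"
    using P2 by (intro sum_mono mult_left_mono mass_bound) auto
  also have "\<dots> = (\<Sum>j\<in>{l..h}. ennreal (?L * mass_bound 2))"
    using mass_bound(1)[of 2] P2 by (simp add: ennreal_mult)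
  also have "\<dots> = ennreal (\<Sum>j\<in>{l..h}. ?L * mass_bound 2)"
    using mass_bound(1)[of 2] P2 by (intro sum_ennreal) auto
  also have "(\<Sum>j\<in>{l..h}. ?L * mass_bound 2) = mass_bound 2 * ?L\<^sup>2"
    by (cases "l \<le> h + 1") (simp_all add: power2_eq_square of_nat_diff algebra_simps)
  finally show ?thesis .
qed

lemma block_error_eventually_small:
  assumes c: "0 \<le> c" "\<And>b. c \<le> hit_mean b" and lim: "hit_mean \<longlonglongrightarrow> c" and \<tau>: "0 < \<tau>"
  shows "\<exists>J\<ge>m. \<forall>j\<ge>J. (\<integral>\<^sup>+\<xi>. ennreal (block_error c m j \<xi>) \<partial>Env) \<le> ennreal \<tau>"
proof -
  have "eventually (\<lambda>b. hit_mean b < c + \<tau> / 4) sequentially"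
    using lim \<tau> by (intro order_tendstoD(2)) auto
  then obtain b where b: "hit_mean b < c + \<tau> / 4" by (auto simp: eventually_sequentially)
  have "(\<lambda>n. 2 * (mass_bound 2 + 1) * rate ^ n) \<longlonglongrightarrow> 2 * (mass_bound 2 + 1) * 0"
    using rate by (intro tendsto_mult tendsto_const LIMSEQ_power_zero) auto
  then have "eventually (\<lambda>n. 2 * (mass_bound 2 + 1) * rate ^ n < \<tau> / 2) sequentially"
    using \<tau> by (intro order_tendstoD(2)) auto
  then obtain N where N: "2 * (mass_bound 2 + 1) * rate ^ n < \<tau> / 2" if "N \<le> n" for n
    unfolding eventually_sequentially by blast
  have "(\<integral>\<^sup>+\<xi>. ennreal (block_error c m j \<xi>) \<partial>Env) \<le> ennreal \<tau>" if "m + N + b \<le> j" for j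
  proof -
    define n where "n = j - m - b"
    have n: "j = m + (n + b)" "N \<le> n" using that by (auto simp: n_def)
    have "(\<integral>\<^sup>+\<xi>. ennreal (block_error c m j \<xi>) \<partial>Env) \<le> ennreal (2 * (mass_bound 2 + 1) * rate ^ n + 2 * (hit_mean b - c))"
      unfolding n(1) by (rule block_error_bound[OF c])
    also have "\<dots> \<le> ennreal \<tau>" using N[OF n(2)] b by (intro ennreal_leI) simp
    finally show ?thesis .
  qed
  then show ?thesis by (intro exI[of _ "m + N + b"]) auto
qed

text \<open>The deterministic part of the argument. In an environment in which the block sums of \<open>hit\<close> are
  close to \<open>c * limit_measure\<close> and no block is heavy, the normalised tuple sum is within \<open>\<epsilon>\<close> of its
  limit unless the block counts of visited vertices deviate, and this has small probability. The
  block weights then differ by three contributions of size \<open>\<delta>\<close>: the deviation of the counts, the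
  block error, and the difference between \<open>sqrt n\<close> and its integer part.\<close>

lemma quenched_deviation:
  assumes reg: "regular_env \<xi>" and esc: "(\<lambda>m. escape m \<xi>) \<longlonglongrightarrow> 0" and law: "quenched_law \<xi> Q"
    and k: "2 \<le> k" and lam: "\<And>i. i \<in> {2..k} \<Longrightarrow> lam i \<le> m" and ml: "m \<le> l" "1 \<le> l" "l \<le> h" and n: "1 \<le> n"
    and c: "0 \<le> c" and M: "c * limit_mass \<xi> \<le> M" and \<delta>: "0 < \<delta>" "3 * \<delta> \<le> 1"
    and heavy: "(\<Sum>u\<in>generation \<xi> m. (c * limit_measure \<xi> u)\<^sup>2) \<le> \<delta>"
    and err: "(\<Sum>j\<in>{l..h}. block_error c m j \<xi>) / real (h + 1 - l) \<le> \<delta>"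
    and nM: "M / sqrt (real n) \<le> \<delta>" and \<epsilon>: "3 * real k ^ 2 * (M + 1) ^ k * (4 * \<delta>) \<le> \<epsilon>"
    and e0: "\<And>x. x \<in> levels \<xi> l h \<Longrightarrow> hit \<xi> x \<le> e0" and K: "card (generation \<xi> m) \<le> K"
  defines "t \<equiv> nat \<lfloor>sqrt (real n)\<rfloor>" and "s \<equiv> sqrt (real n) * real (h + 1 - l)"
  shows "emeasure Q {X. \<epsilon> < \<bar>tuple_sum k {x \<in> range_walk \<xi> (T_ret t X) X. l \<le> length x \<and> length x \<le> h} (f_lambda k lam) / s ^ k
             - c ^ k * tuple_limit k lam \<xi>\<bar>}
     \<le> ennreal (real K * (2 * real t * pair_total \<xi> l h + 2 * real t ^ 3 * (e0 * (hit_total \<xi> l h)\<^sup>2)) / (\<delta> * s)\<^sup>2)"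
proof -
  interpret W: quenched_walk \<xi> Q using law by unfold_locales
  let ?lv = "levels \<xi> l h" and ?T = "generation \<xi> m"
  let ?L = "real (h + 1 - l)" and ?r = "sqrt (real n)"
  have L: "1 \<le> ?L" using ml by simp
  have r: "1 \<le> ?r" using n by simp
  have s: "0 < s" unfolding s_def using L r by (intro mult_pos_pos) linarith+
  have t1: "1 \<le> t" unfolding t_def using r by (simp add: le_nat_iff le_floor_iff)
  have tr: "real t \<le> ?r" "?r - real t \<le> 1"
  proof -
    have "real t = real_of_int \<lfloor>?r\<rfloor>" unfolding t_def using r by (subst of_nat_nat) auto
    then show "real t \<le> ?r" "?r - real t \<le> 1" by linarith+
  qed
  define H where "H u = c * limit_measure \<xi> u" for u
  define a where "a u = block_sum m ?lv (hit \<xi>) u" for u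
  define N where "N X u = W.visits t {x \<in> ?lv. take m x = u} X" for X u
  have H0: "0 \<le> H u" for u unfolding H_def using c regular_env_limit_measure_nonneg[OF reg] by simp
  have HM: "(\<Sum>u\<in>?T. H u) \<le> M"
    using M limit_mass_split[OF reg, of m] by (simp add: H_def sum_distrib_left)
  have M0: "0 \<le> M" using HM sum_nonneg[of ?T H] H0 by force
  \<comment> \<open>one \<open>\<delta>\<close> for replacing \<open>sqrt n\<close> by \<open>t\<close>, one for the block error\<close>
  have esum: "(\<Sum>u\<in>?T. \<bar>real t * a u / s - H u\<bar>) \<le> 2 * \<delta>"
  proof -
    have "\<bar>real t * a u / s - H u\<bar> \<le> \<bar>a u / ?L - H u\<bar> + H u / ?r" for u
    proof -
      have q: "real t / ?r \<le> 1" "0 \<le> real t / ?r" "1 - real t / ?r \<le> 1 / ?r"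
      proof -
        have "1 - real t / ?r = (?r - real t) / ?r" using r by (simp add: field_simps)
        also have "\<dots> \<le> 1 / ?r" using tr r by (intro divide_right_mono) auto
        finally show "1 - real t / ?r \<le> 1 / ?r" .
      qed (use tr r in \<open>auto simp: field_simps\<close>)
      have alg: "\<tau> * x / (y * z) - w = \<tau> / y * (x / z - w) - (1 - \<tau> / y) * w"
        if "y \<noteq> 0" "z \<noteq> 0" for \<tau> w x y z :: real using that by (simp add: field_simps)
      have "real t * a u / s - H u = real t / ?r * (a u / ?L - H u) - (1 - real t / ?r) * H u"
        unfolding s_def by (rule alg) (use L r in linarith)+
      then have "\<bar>real t * a u / s - H u\<bar> \<le> \<bar>real t / ?r * (a u / ?L - H u)\<bar> + \<bar>(1 - real t / ?r) * H u\<bar>"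
        by (simp only: abs_triangle_ineq4)
      also have "\<bar>real t / ?r * (a u / ?L - H u)\<bar> \<le> 1 * \<bar>a u / ?L - H u\<bar>"
        unfolding abs_mult using q by (intro mult_right_mono) auto
      also have "\<bar>(1 - real t / ?r) * H u\<bar> \<le> 1 / ?r * H u"
        unfolding abs_mult using q H0[of u] by (intro mult_mono) auto
      finally show ?thesis by simp
    qed
    then have "(\<Sum>u\<in>?T. \<bar>real t * a u / s - H u\<bar>) \<le> (\<Sum>u\<in>?T. \<bar>a u / ?L - H u\<bar> + H u / ?r)"
      by (intro sum_mono)
    also have "\<dots> = (\<Sum>u\<in>?T. \<bar>a u / ?L - H u\<bar>) + (\<Sum>u\<in>?T. H u) / ?r"
      by (simp add: sum.distrib sum_divide_distrib)
    also have "(\<Sum>u\<in>?T. H u) / ?r \<le> \<delta>" using HM nM r by (smt (verit) divide_right_mono)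
    also have "(\<Sum>u\<in>?T. \<bar>a u / ?L - H u\<bar>) \<le> \<delta>"
    proof -
      have "\<bar>a u / ?L - H u\<bar> \<le> (\<Sum>j\<in>{l..h}. \<bar>block_sum m (generation \<xi> j) (hit \<xi>) u - H u\<bar>) / ?L" for u
      proof -
        have "a u / ?L - H u = (\<Sum>j\<in>{l..h}. block_sum m (generation \<xi> j) (hit \<xi>) u - H u) / ?L"
          using L by (simp add: a_def block_sum_levels sum_subtractf field_simps)
        then show ?thesis using L by (simp add: abs_divide divide_right_mono sum_abs)
      qed
      then have "(\<Sum>u\<in>?T. \<bar>a u / ?L - H u\<bar>) \<le> (\<Sum>u\<in>?T. (\<Sum>j\<in>{l..h}. \<bar>block_sum m (generation \<xi> j) (hit \<xi>) u - H u\<bar>) / ?L)"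
        by (intro sum_mono)
      also have "\<dots> = (\<Sum>u\<in>?T. \<Sum>j\<in>{l..h}. \<bar>block_sum m (generation \<xi> j) (hit \<xi>) u - H u\<bar>) / ?L"
        by (simp add: sum_divide_distrib)
      also have "(\<Sum>u\<in>?T. \<Sum>j\<in>{l..h}. \<bar>block_sum m (generation \<xi> j) (hit \<xi>) u - H u\<bar>) = (\<Sum>j\<in>{l..h}. block_error c m j \<xi>)"
        unfolding block_error_def H_def by (rule sum.swap)
      finally show ?thesis using err by simp
    qed
    finally show ?thesis by simp
  qed
  \<comment> \<open>close block counts force close tuple sums\<close>
  have det: "\<bar>tuple_sum k {x \<in> range_walk \<xi> (T_ret t X) X. l \<le> length x \<and> length x \<le> h} (f_lambda k lam) / s ^ k
             - c ^ k * tuple_limit k lam \<xi>\<bar> \<le> \<epsilon>"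
    if vis: "\<forall>x\<in>?lv. x \<in> range_walk \<xi> (T_ret t X) X \<longleftrightarrow> X \<in> W.visited t x"
      and dev: "(\<Sum>u\<in>?T. \<bar>N X u - real t * a u\<bar>) \<le> \<delta> * s" for X
  proof -
    define D where "D = {x \<in> ?lv. X \<in> W.visited t x}"
    have D_eq: "{x \<in> range_walk \<xi> (T_ret t X) X. l \<le> length x \<and> length x \<le> h} = D"
      using vis by (auto simp: D_def levels_def range_walk_def)
    define G where "G u = N X u / s" for u
    have G: "block_sum m D (\<lambda>_. 1 / s) u = G u" for u
    proof -
      have "N X u = (\<Sum>x\<in>{x \<in> D. take m x = u}. 1)"
        unfolding N_def W.visits_def by (rule sum.mono_neutral_cong_right) (auto simp: D_def indicator_def)
      then show ?thesis by (simp add: block_sum_def G_def)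
    qed
    have G0: "0 \<le> G u" for u unfolding G_def N_def W.visits_def using s by (intro divide_nonneg_nonneg sum_nonneg) auto
    have pw: "tuple_sum k D (\<lambda>x. f_lambda k lam x * (\<Prod>i=1..k. 1 / s)) = tuple_sum k D (f_lambda k lam) / s ^ k"
      unfolding tuple_sum_def by (simp add: sum_divide_distrib power_one_over)
    have "\<bar>tuple_sum k D (\<lambda>x. f_lambda k lam x * (\<Prod>i=1..k. 1 / s))
         - tuple_sum k ?T (\<lambda>u. f_lambda k lam u * (\<Prod>i=1..k. block_sum m D (\<lambda>_. 1 / s) (u i)))\<bar>
       \<le> real k ^ 2 * ((\<Sum>u\<in>?T. (block_sum m D (\<lambda>_. 1 / s) u)\<^sup>2) * (\<Sum>u\<in>?T. block_sum m D (\<lambda>_. 1 / s) u) ^ (k - 2))"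
    proof (rule tuple_sum_block_approximation)
      show "finite D" by (rule finite_subset[of _ ?lv]) (auto simp: D_def)
      show "finite ?T" by (rule finite_generation)
      show "take m ` D \<subseteq> ?T" using take_levels[OF ml(1), of \<xi> h] by (auto simp: D_def)
    qed (use ml s lam in \<open>auto simp: D_def levels_def generation_def\<close>)
    then have X: "\<bar>tuple_sum k D (f_lambda k lam) / s ^ k - tuple_sum k ?T (\<lambda>u. f_lambda k lam u * (\<Prod>i=1..k. G (u i)))\<bar>
       \<le> real k ^ 2 * ((\<Sum>u\<in>?T. (G u)\<^sup>2) * (\<Sum>u\<in>?T. G u) ^ (k - 2))"
      unfolding pw G .
    have Y: "\<bar>c ^ k * tuple_limit k lam \<xi> - tuple_sum k ?T (\<lambda>u. f_lambda k lam u * (\<Prod>i=1..k. H (u i)))\<bar>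
       \<le> real k ^ 2 * ((\<Sum>u\<in>?T. (H u)\<^sup>2) * (\<Sum>u\<in>?T. H u) ^ (k - 2))"
    proof -
      have "tuple_sum k ?T (\<lambda>u. f_lambda k lam u * (\<Prod>i=1..k. H (u i)))
          = c ^ k * tuple_sum k ?T (\<lambda>u. f_lambda k lam u * (\<Prod>i=1..k. limit_measure \<xi> (u i)))"
        unfolding tuple_sum_def H_def sum_distrib_left by (intro sum.cong refl) (simp add: prod.distrib mult_ac)
      then have "\<bar>c ^ k * tuple_limit k lam \<xi> - tuple_sum k ?T (\<lambda>u. f_lambda k lam u * (\<Prod>i=1..k. H (u i)))\<bar>
          = c ^ k * \<bar>tuple_limit k lam \<xi> - tuple_sum k ?T (\<lambda>u. f_lambda k lam u * (\<Prod>i=1..k. limit_measure \<xi> (u i)))\<bar>"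
        using c by (simp add: right_diff_distrib[symmetric] abs_mult)
      also have "\<dots> \<le> c ^ k * (real k ^ 2 * ((\<Sum>u\<in>?T. (limit_measure \<xi> u)\<^sup>2) * (\<Sum>u\<in>?T. limit_measure \<xi> u) ^ (k - 2)))"
        using c lam by (intro mult_left_mono tuple_limit_block_approximation[OF reg k]) auto
      also have "\<dots> = real k ^ 2 * ((\<Sum>u\<in>?T. (H u)\<^sup>2) * (\<Sum>u\<in>?T. H u) ^ (k - 2))"
      proof -
        have "k = 2 + (k - 2)" using k by simp
        then have ck: "c ^ k = c\<^sup>2 * c ^ (k - 2)" by (metis power_add)
        have sq: "(\<Sum>u\<in>?T. (c * limit_measure \<xi> u)\<^sup>2) = c\<^sup>2 * (\<Sum>u\<in>?T. (limit_measure \<xi> u)\<^sup>2)"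
          by (simp only: power_mult_distrib sum_distrib_left)
        have pw: "(\<Sum>u\<in>?T. c * limit_measure \<xi> u) ^ (k - 2) = c ^ (k - 2) * (\<Sum>u\<in>?T. limit_measure \<xi> u) ^ (k - 2)"
          by (simp only: power_mult_distrib sum_distrib_left[symmetric])
        show ?thesis unfolding H_def sq pw ck by (simp only: mult_ac)
      qed
      finally show ?thesis .
    qed
    have e: "(\<Sum>u\<in>?T. \<bar>G u - H u\<bar>) \<le> 3 * \<delta>"
    proof -
      have "(\<Sum>u\<in>?T. \<bar>G u - H u\<bar>) \<le> (\<Sum>u\<in>?T. \<bar>N X u - real t * a u\<bar> / s + \<bar>real t * a u / s - H u\<bar>)"
      proof (rule sum_mono)
        fix u
        have "G u - H u = (N X u - real t * a u) / s + (real t * a u / s - H u)"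
          by (simp add: G_def diff_divide_distrib)
        then have "\<bar>G u - H u\<bar> \<le> \<bar>(N X u - real t * a u) / s\<bar> + \<bar>real t * a u / s - H u\<bar>" by (simp only: abs_triangle_ineq)
        then show "\<bar>G u - H u\<bar> \<le> \<bar>N X u - real t * a u\<bar> / s + \<bar>real t * a u / s - H u\<bar>"
          using s by (simp add: abs_divide)
      qed
      also have "\<dots> = (\<Sum>u\<in>?T. \<bar>N X u - real t * a u\<bar>) / s + (\<Sum>u\<in>?T. \<bar>real t * a u / s - H u\<bar>)"
        by (simp add: sum.distrib sum_divide_distrib)
      also have "(\<Sum>u\<in>?T. \<bar>N X u - real t * a u\<bar>) / s \<le> \<delta>" using dev s by (simp add: pos_divide_le_eq)
      finally show ?thesis using esum by linarith
    qed
    have "\<bar>tuple_sum k D (f_lambda k lam) / s ^ k - c ^ k * tuple_limit k lam \<xi>\<bar>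
        \<le> 3 * real k ^ 2 * (M + 1) ^ k * ((\<Sum>u\<in>?T. (H u)\<^sup>2) + 3 * \<delta>)"
      by (rule tuple_sum_stability[OF _ _ _ k X Y HM e \<delta>(2)]) (auto simp: G0 H0)
    also have "\<dots> \<le> 3 * real k ^ 2 * (M + 1) ^ k * (4 * \<delta>)"
      using heavy M0 unfolding H_def by (intro mult_left_mono) auto
    finally show ?thesis using \<epsilon> unfolding D_eq by linarith
  qed
  have "AE X in Q. \<forall>x\<in>?lv. x \<in> range_walk \<xi> (T_ret t X) X \<longleftrightarrow> X \<in> W.visited t x"
  proof (rule AE_finite_allI)
    fix x assume "x \<in> ?lv"
    then show "AE X in Q. x \<in> range_walk \<xi> (T_ret t X) X \<longleftrightarrow> X \<in> W.visited t x"
      using ml by (intro W.AE_range_walk) (auto simp: levels_def)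
  qed simp
  then have ae: "AE X in Q. X \<in> {X. \<epsilon> < \<bar>tuple_sum k {x \<in> range_walk \<xi> (T_ret t X) X. l \<le> length x \<and> length x \<le> h} (f_lambda k lam) / s ^ k
             - c ^ k * tuple_limit k lam \<xi>\<bar>} \<longrightarrow> X \<in> {X. \<delta> * s < (\<Sum>u\<in>?T. \<bar>N X u - real t * a u\<bar>)}"
  proof eventually_elim
    case (elim X)
    show ?case using det[OF elim] unfolding mem_Collect_eq by (meson not_less)
  qed
  have "{X \<in> space Q. \<delta> * s < (\<Sum>u\<in>?T. \<bar>N X u - real t * a u\<bar>)} \<in> sets Q"
    unfolding N_def by (measurable)
  then have "{X. \<delta> * s < (\<Sum>u\<in>?T. \<bar>N X u - real t * a u\<bar>)} \<in> sets Q" by simp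
  from emeasure_mono_AE[OF ae this]
  have "emeasure Q {X. \<epsilon> < \<bar>tuple_sum k {x \<in> range_walk \<xi> (T_ret t X) X. l \<le> length x \<and> length x \<le> h} (f_lambda k lam) / s ^ k
             - c ^ k * tuple_limit k lam \<xi>\<bar>} \<le> emeasure Q {X. \<delta> * s < (\<Sum>u\<in>?T. \<bar>N X u - real t * a u\<bar>)}" .
  also have "\<dots> \<le> ennreal (real (card ?T) * (2 * real t * (\<Sum>x\<in>?lv. \<Sum>y\<in>?lv. pair_bound \<xi> x y) + 2 * real t ^ 3 * (e0 * (\<Sum>x\<in>?lv. hit \<xi> x)\<^sup>2)) / (\<delta> * s)\<^sup>2)"
    unfolding N_def a_def
  proof (rule W.block_deviation[OF esc t1])
    show "finite ?lv" "finite ?T" by (rule finite_levels, rule finite_generation)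
    show "x \<in> tree \<xi>" "x \<noteq> []" if "x \<in> ?lv" for x using that ml by (auto simp: levels_def)
    show "0 < \<delta> * s" using s \<delta> by simp
  qed (rule take_levels[OF ml(1)], rule e0)
  also have "\<dots> \<le> ennreal (real K * (2 * real t * pair_total \<xi> l h + 2 * real t ^ 3 * (e0 * (hit_total \<xi> l h)\<^sup>2)) / (\<delta> * s)\<^sup>2)"
  proof (cases "?lv = {}")
    case True
    then show ?thesis by (simp add: pair_total_def hit_total_def)
  next
    case False
    then obtain x where "x \<in> ?lv" by auto
    then have e00: "0 \<le> e0" using e0[of x] hit_nonneg[of \<xi> x] by linarith
    show ?thesis
      unfolding pair_total_def[symmetric] hit_total_def[symmetric]
      using K e00 pair_total_nonneg[of \<xi> l h]
      by (intro ennreal_leI divide_right_mono mult_right_mono add_nonneg_nonneg mult_nonneg_nonneg) auto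
  qed
  finally show ?thesis .
qed

end

section \<open>Moments of the first generation\<close>

context marked_tree_law
begin

text \<open>The function of which \<open>\<psi>\<close> is the logarithm.\<close>

definition laplace :: "real \<Rightarrow> ennreal" where
  "laplace t = (\<integral>\<^sup>+\<xi>. (\<Sum>x\<in>generation \<xi> 1. ennreal (exp (- t * V \<xi> x))) \<partial>Env)"

lemma sum_exp_eq:
  "(\<Sum>x\<in>generation \<xi> 1. ennreal (exp (- t * V \<xi> x))) = level_sum_nn 1 (\<lambda>x. ennreal (weight \<xi> x powr t))"
proof -
  have "level_sum_nn 1 (\<lambda>x. ennreal (weight \<xi> x powr t)) = (\<Sum>x\<in>generation \<xi> 1. ennreal (weight \<xi> x powr t))"
    by (rule level_sum_nn_generation) (simp add: weight_eq_0)
  also have "\<dots> = (\<Sum>x\<in>generation \<xi> 1. ennreal (exp (- t * V \<xi> x)))"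
    by (intro sum.cong[OF refl]) (auto simp: generation_def weight_eq_exp_V powr_def)
  finally show ?thesis ..
qed

lemma psi_laplace: "psi \<nu> t = log_ennreal (laplace t)"
  by (simp add: psi_def laplace_def)

lemma phi_eq_laplace: "1 \<le> p \<Longrightarrow> phi p 1 = laplace (real p)"
  unfolding phi_def laplace_def sum_exp_eq
  by (intro nn_integral_cong level_sum_nn_cong) (simp add: powr_realpow')

lemma log_ennreal_eq_0: "log_ennreal a = 0 \<longleftrightarrow> a = 1"
  unfolding log_ennreal_def
  by (cases a) (auto simp: zero_ereal_def ennreal_eq_1 ln_eq_zero_iff order_less_le)

lemma log_ennreal_less_top: "log_ennreal a < \<infinity> \<longleftrightarrow> a < \<infinity>"
  by (cases a) (auto simp: log_ennreal_def)

lemma log_ennreal_less_0: "log_ennreal a < 0 \<longleftrightarrow> a < 1"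
  unfolding log_ennreal_def
  by (cases a) (auto simp: zero_ereal_def ennreal_less_one_iff order_less_le top_unique)

text \<open>Dominated convergence, as \<open>exp (- s * v) \<le> exp (- v) + exp (- p * v)\<close> for \<open>s\<close> between \<open>1\<close> and
  \<open>p\<close>.\<close>

lemma continuous_on_laplace:
  assumes fin: "laplace 1 < \<infinity>" "laplace p < \<infinity>"
  shows "continuous_on {1..p} laplace"
proof (rule continuous_on_sequentiallyI)
  fix t :: "nat \<Rightarrow> real" and a
  assume t: "\<forall>n. t n \<in> {1..p}" and a: "a \<in> {1..p}" and lim: "t \<longlonglongrightarrow> a"
  let ?f = "\<lambda>s \<xi>. \<Sum>x\<in>generation \<xi> 1. ennreal (exp (- s * V \<xi> x))"
  have meas [measurable]: "?f s \<in> borel_measurable Env" for s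
    unfolding sum_exp_eq by measurable
  have exp_le: "exp (- s * v) \<le> exp (- 1 * v) + exp (- p * v)" if "s \<in> {1..p}" for s v :: real
  proof (cases "0 \<le> v")
    case True
    then have "exp (- s * v) \<le> exp (- 1 * v)" using that by (simp add: mult_le_cancel_right1)
    then show ?thesis using exp_ge_zero[of "- p * v"] by linarith
  next
    case False
    then have "exp (- s * v) \<le> exp (- p * v)" using that by (simp add: mult_right_mono_neg)
    then show ?thesis using exp_ge_zero[of "- 1 * v"] by linarith
  qed
  show "(\<lambda>n. laplace (t n)) \<longlonglongrightarrow> laplace a"
    unfolding laplace_def
  proof (rule nn_integral_dominated_convergence[where w="\<lambda>\<xi>. ?f 1 \<xi> + ?f p \<xi>"])
    have "(\<integral>\<^sup>+\<xi>. ?f 1 \<xi> + ?f p \<xi> \<partial>Env) = laplace 1 + laplace p"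
      unfolding laplace_def by (rule nn_integral_add) (rule meas)+
    then show "(\<integral>\<^sup>+\<xi>. ?f 1 \<xi> + ?f p \<xi> \<partial>Env) < \<infinity>" using fin by simp
    show "AE \<xi> in Env. ?f (t n) \<xi> \<le> ?f 1 \<xi> + ?f p \<xi>" for n
    proof (rule AE_I2)
      fix \<xi>
      have "?f (t n) \<xi> \<le> (\<Sum>x\<in>generation \<xi> 1. ennreal (exp (- 1 * V \<xi> x)) + ennreal (exp (- p * V \<xi> x)))"
      proof (rule sum_mono)
        fix x
        have "ennreal (exp (- t n * V \<xi> x)) \<le> ennreal (exp (- 1 * V \<xi> x) + exp (- p * V \<xi> x))"
          using t by (intro ennreal_leI exp_le) blast
        then show "ennreal (exp (- t n * V \<xi> x)) \<le> ennreal (exp (- 1 * V \<xi> x)) + ennreal (exp (- p * V \<xi> x))"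
          by (simp only: ennreal_plus exp_ge_zero)
      qed
      then show "?f (t n) \<xi> \<le> ?f 1 \<xi> + ?f p \<xi>" by (simp only: sum.distrib)
    qed
    show "AE \<xi> in Env. (\<lambda>n. ?f (t n) \<xi>) \<longlonglongrightarrow> ?f a \<xi>"
      by (intro AE_I2 tendsto_sum tendsto_ennrealI tendsto_intros lim)
  qed measurable
qed

text \<open>The negative derivative makes \<open>laplace\<close> smaller than \<open>1\<close> right after \<open>1\<close>. If it were at least
  \<open>1\<close> at \<open>p\<close>, it would take the value \<open>1\<close> in between, against the minimality of \<open>\<kappa>\<close>.\<close>

lemma laplace_less_one:
  assumes one: "psi \<nu> 1 = 0" and deriv: "((\<lambda>t. real_of_ereal (psi \<nu> t)) has_real_derivative D) (at 1)" "D < 0"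
    and p: "1 < p" "psi \<nu> p < \<infinity>" "ereal p < kappa \<nu>"
  shows "laplace p < 1"
proof (rule ccontr)
  assume "\<not> laplace p < 1"
  then have ge: "1 \<le> laplace p" by simp
  obtain d where d: "0 < d" "\<And>h. 0 < h \<Longrightarrow> h < d \<Longrightarrow> real_of_ereal (psi \<nu> (1 + h)) < real_of_ereal (psi \<nu> 1)"
    using DERIV_neg_dec_right[OF deriv] by blast
  \<comment> \<open>a point strictly between \<open>1\<close> and \<open>p\<close> at which the derivative still decides\<close>
  define a where "a = 1 + min (d / 2) ((p - 1) / 2)"
  have a: "1 < a" "a < p" using d(1) p(1) by (auto simp: a_def min_def field_simps)
  have "real_of_ereal (psi \<nu> a) < 0" using d(2)[of "a - 1"] d(1) p(1) one by (auto simp: a_def min_def)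
  then have "psi \<nu> a < 0" by (cases "psi \<nu> a") (auto simp: zero_ereal_def)
  then have "laplace a \<le> 1" by (simp add: psi_laplace log_ennreal_less_0)
  moreover have "laplace 1 < \<infinity>" using one by (simp add: psi_laplace log_ennreal_eq_0)
  then have "continuous_on {1..p} laplace"
    using p(2) unfolding psi_laplace log_ennreal_less_top by (rule continuous_on_laplace)
  then have "continuous_on {a..p} laplace" using a by (rule_tac continuous_on_subset) auto
  ultimately obtain t where t: "a \<le> t" "t \<le> p" "laplace t = 1"
    using IVT'[of laplace a 1 p] ge a by auto
  then have "kappa \<nu> \<le> ereal t"
    unfolding kappa_def using a by (intro Inf_lower) (auto simp: psi_laplace log_ennreal_eq_0)
  also have "\<dots> \<le> ereal p" using t by simp
  finally show False using p(3) by simp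
qed

definition power_sum :: "nat \<Rightarrow> (nat \<Rightarrow> nat) \<Rightarrow> env \<Rightarrow> real" where
  "power_sum j \<beta> \<xi> = (\<Sum>x\<in>Delta j (generation \<xi> 1). \<Prod>i=1..j. weight \<xi> (x i) ^ \<beta> i)"

lemma power_sum_nonneg: "0 \<le> power_sum j \<beta> \<xi>"
  unfolding power_sum_def by (intro sum_nonneg prod_nonneg) auto

lemma measurable_power_sum:
  "(\<And>i. i \<in> {1..j} \<Longrightarrow> 1 \<le> \<beta> i) \<Longrightarrow> power_sum j \<beta> \<in> borel_measurable Env"
  unfolding power_sum_def[abs_def] using measurable_Delta_sum[where g="\<lambda>_. 1"] by simp

lemma c_moment_eq: "c_moment \<nu> j \<beta> = (\<integral>\<^sup>+\<xi>. ennreal (power_sum j \<beta> \<xi>) \<partial>Env)"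
  unfolding c_moment_def
proof (rule nn_integral_cong)
  fix \<xi>
  have "(\<Sum>x\<in>Delta j (generation \<xi> 1). ennreal (exp (- (\<Sum>i=1..j. real (\<beta> i) * V \<xi> (x i)))))
     = (\<Sum>x\<in>Delta j (generation \<xi> 1). ennreal (\<Prod>i=1..j. weight \<xi> (x i) ^ \<beta> i))"
  proof (rule sum.cong[OF refl])
    fix x assume "x \<in> Delta j (generation \<xi> 1)"
    then have x: "x i \<in> tree \<xi>" if "i \<in> {1..j}" for i
      using that by (auto simp: Delta_def PiE_iff generation_def)
    have "(\<Prod>i=1..j. weight \<xi> (x i) ^ \<beta> i) = (\<Prod>i=1..j. exp (- (real (\<beta> i) * V \<xi> (x i))))"
      using x by (intro prod.cong[OF refl]) (simp add: weight_eq_exp_V flip: exp_of_nat_mult)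
    also have "\<dots> = exp (- (\<Sum>i=1..j. real (\<beta> i) * V \<xi> (x i)))" by (simp add: exp_sum sum_negf[symmetric])
    finally show "ennreal (exp (- (\<Sum>i=1..j. real (\<beta> i) * V \<xi> (x i)))) = ennreal (\<Prod>i=1..j. weight \<xi> (x i) ^ \<beta> i)" by simp
  qed
  also have "\<dots> = ennreal (power_sum j \<beta> \<xi>)"
    unfolding power_sum_def by (intro sum_ennreal prod_nonneg) auto
  finally show "(\<Sum>x\<in>Delta j (generation \<xi> 1). ennreal (exp (- (\<Sum>i=1..j. real (\<beta> i) * V \<xi> (x i))))) = ennreal (power_sum j \<beta> \<xi>)" .
qed

text \<open>A further vertex either coincides with an entry of the tuple, raising its exponent, or extends
  the tuple.\<close>

lemma power_sum_mult_mass: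
  "power_sum j \<beta> \<xi> * mass \<xi> 1
     \<le> (\<Sum>i=1..j. power_sum j (\<beta>(i := Suc (\<beta> i))) \<xi>) + power_sum (Suc j) (\<beta>(Suc j := 1)) \<xi>"
proof -
  let ?T = "generation \<xi> 1" and ?p = "\<lambda>\<beta> j x. \<Prod>i=1..j. weight \<xi> (x i) ^ \<beta> i"
  have D: "Delta n ?T = {u \<in> {1..n} \<rightarrow>\<^sub>E ?T. inj_on u {1..n}}" for n
    by (rule Delta_level[where m=1]) (simp add: generation_def)
  have fin: "finite (Delta n ?T)" for n
    by (rule finite_subset[OF Delta_subset]) (simp add: finite_PiE)
  have "power_sum j \<beta> \<xi> * mass \<xi> 1 = (\<Sum>x\<in>Delta j ?T. \<Sum>v\<in>?T. ?p \<beta> j x * weight \<xi> v)"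
    by (simp add: power_sum_def mass_def sum_product)
  also have "\<dots> = (\<Sum>x\<in>Delta j ?T. (\<Sum>v\<in>x ` {1..j}. ?p \<beta> j x * weight \<xi> v) + (\<Sum>v\<in>?T - x ` {1..j}. ?p \<beta> j x * weight \<xi> v))"
  proof (rule sum.cong[OF refl])
    fix x assume "x \<in> Delta j ?T"
    then have sub: "x ` {1..j} \<subseteq> ?T" using Delta_mem by (intro image_subsetI) blast
    show "(\<Sum>v\<in>?T. ?p \<beta> j x * weight \<xi> v)
        = (\<Sum>v\<in>x ` {1..j}. ?p \<beta> j x * weight \<xi> v) + (\<Sum>v\<in>?T - x ` {1..j}. ?p \<beta> j x * weight \<xi> v)"
      by (subst sum.subset_diff[OF sub finite_generation]) (rule add.commute)
  qed
  also have "\<dots> = (\<Sum>x\<in>Delta j ?T. \<Sum>i=1..j. ?p (\<beta>(i := Suc (\<beta> i))) j x)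
      + (\<Sum>x\<in>Delta j ?T. \<Sum>v\<in>?T - x ` {1..j}. ?p \<beta> j x * weight \<xi> v)"
    unfolding sum.distrib
  proof (rule arg_cong2[where f="(+)", OF sum.cong[OF refl] refl])
    fix x assume "x \<in> Delta j ?T"
    then have "inj_on x {1..j}" unfolding D by blast
    then have "(\<Sum>v\<in>x ` {1..j}. ?p \<beta> j x * weight \<xi> v) = (\<Sum>i=1..j. ?p \<beta> j x * weight \<xi> (x i))"
      by (simp only: sum.reindex o_def)
    also have "\<dots> = (\<Sum>i=1..j. ?p (\<beta>(i := Suc (\<beta> i))) j x)"
    proof (rule sum.cong[OF refl])
      fix i assume i: "i \<in> {1..j}"
      have "?p (\<beta>(i := Suc (\<beta> i))) j x = weight \<xi> (x i) ^ Suc (\<beta> i) * (\<Prod>l\<in>{1..j} - {i}. weight \<xi> (x l) ^ \<beta> l)"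
        using i by (subst prod.remove[of _ i]) (auto intro!: prod.cong)
      also have "\<dots> = ?p \<beta> j x * weight \<xi> (x i)"
        using i by (subst (2) prod.remove[of _ i]) (auto simp: mult_ac)
      finally show "?p \<beta> j x * weight \<xi> (x i) = ?p (\<beta>(i := Suc (\<beta> i))) j x" ..
    qed
    finally show "(\<Sum>v\<in>x ` {1..j}. ?p \<beta> j x * weight \<xi> v) = (\<Sum>i=1..j. ?p (\<beta>(i := Suc (\<beta> i))) j x)" .
  qed
  also have "(\<Sum>x\<in>Delta j ?T. \<Sum>i=1..j. ?p (\<beta>(i := Suc (\<beta> i))) j x) = (\<Sum>i=1..j. power_sum j (\<beta>(i := Suc (\<beta> i))) \<xi>)"
    unfolding power_sum_def by (rule sum.swap)
  also have "(\<Sum>i=1..j. power_sum j (\<beta>(i := Suc (\<beta> i))) \<xi>) + (\<Sum>x\<in>Delta j ?T. \<Sum>v\<in>?T - x ` {1..j}. ?p \<beta> j x * weight \<xi> v)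
      \<le> (\<Sum>i=1..j. power_sum j (\<beta>(i := Suc (\<beta> i))) \<xi>) + power_sum (Suc j) (\<beta>(Suc j := 1)) \<xi>"
  proof (rule add_left_mono)
    let ?S = "SIGMA x:Delta j ?T. ?T - x ` {1..j}" and ?e = "\<lambda>(x, v). x(Suc j := v)"
    have ext: "x (Suc j) = undefined" if "x \<in> Delta j ?T" for x
      using that unfolding D by (auto simp: PiE_iff extensional_def)
    have inj: "inj_on ?e ?S"
    proof (rule inj_onI, clarify)
      fix x v y w assume *: "x \<in> Delta j ?T" "y \<in> Delta j ?T" "x(Suc j := v) = y(Suc j := w)"
      have "x i = y i" for i
        using fun_cong[OF *(3), of i] ext[OF *(1)] ext[OF *(2)] by (cases "i = Suc j") auto
      then have "x = y" by blast
      then show "x = y \<and> v = w" using fun_cong[OF *(3), of "Suc j"] by simp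
    qed
    have sub: "?e ` ?S \<subseteq> Delta (Suc j) ?T"
    proof clarify
      fix x v assume x: "x \<in> Delta j ?T" and v: "v \<in> ?T" "v \<notin> x ` {1..j}"
      have e: "{1..Suc j} = insert (Suc j) {1..j}" by auto
      have "x(Suc j := v) ` {1..j} = x ` {1..j}" by (rule image_cong) auto
      moreover have "inj_on (x(Suc j := v)) {1..j}"
        using x v(2) unfolding D by (intro inj_on_fun_updI) auto
      ultimately have "inj_on (x(Suc j := v)) {1..Suc j}"
        unfolding e inj_on_insert using v(2) by simp
      moreover have "x(Suc j := v) \<in> {1..Suc j} \<rightarrow>\<^sub>E ?T"
        unfolding e using x v(1) unfolding D by (intro PiE_fun_upd) auto
      ultimately show "x(Suc j := v) \<in> Delta (Suc j) ?T" unfolding D by blast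
    qed
    have "(\<Sum>x\<in>Delta j ?T. \<Sum>v\<in>?T - x ` {1..j}. ?p \<beta> j x * weight \<xi> v)
        = (\<Sum>z\<in>?S. ?p (\<beta>(Suc j := 1)) (Suc j) (?e z))"
      using fin by (subst sum.Sigma) (auto intro!: sum.cong)
    also have "\<dots> = (\<Sum>x\<in>?e ` ?S. ?p (\<beta>(Suc j := 1)) (Suc j) x)"
      by (subst sum.reindex[OF inj]) simp
    also have "\<dots> \<le> (\<Sum>x\<in>Delta (Suc j) ?T. ?p (\<beta>(Suc j := 1)) (Suc j) x)"
      by (intro sum_mono2 fin sub prod_nonneg) auto
    finally show "(\<Sum>x\<in>Delta j ?T. \<Sum>v\<in>?T - x ` {1..j}. ?p \<beta> j x * weight \<xi> v) \<le> power_sum (Suc j) (\<beta>(Suc j := 1)) \<xi>"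
      unfolding power_sum_def .
  qed
  finally show ?thesis .
qed

text \<open>Starting from the empty tuple, powers of the mass of the first generation are converted one
  factor at a time into the sums whose finiteness is assumed; the exponents never exceed \<open>K\<close> in
  total.\<close>

lemma nn_integral_power_sum_mass_finite:
  assumes c: "\<And>j \<beta>. 1 \<le> j \<Longrightarrow> (\<forall>i\<in>{1..j}. 1 \<le> \<beta> i) \<Longrightarrow> (\<Sum>i=1..j. \<beta> i) \<le> K \<Longrightarrow> c_moment \<nu> j \<beta> < \<infinity>"
    and "\<forall>i\<in>{1..j}. 1 \<le> \<beta> i" "(\<Sum>i=1..j. \<beta> i) + r \<le> K"
  shows "(\<integral>\<^sup>+\<xi>. ennreal (power_sum j \<beta> \<xi> * mass \<xi> 1 ^ r) \<partial>Env) < \<infinity>"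
  using assms(2,3)
proof (induction r arbitrary: j \<beta>)
  case 0
  show ?case
  proof (cases j)
    case 0
    have "Delta 0 A = {\<lambda>_. undefined}" for A by (auto simp: Delta_def)
    then have "power_sum j \<beta> \<xi> = 1" for \<xi> using 0 by (simp add: power_sum_def)
    then show ?thesis by (simp add: emeasure_env_UNIV)
  next
    case (Suc n)
    then show ?thesis using c[of j \<beta>] 0 by (simp add: c_moment_eq)
  qed
next
  case (Suc r)
  let ?g = "\<lambda>j \<beta> \<xi>. ennreal (power_sum j \<beta> \<xi> * mass \<xi> 1 ^ r)"
  have m [measurable]: "?g j \<beta> \<in> borel_measurable Env" if "\<forall>i\<in>{1..j}. 1 \<le> \<beta> i" for j \<beta>
  proof -
    have [measurable]: "power_sum j \<beta> \<in> borel_measurable Env"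
      by (rule measurable_power_sum) (use that in blast)
    show ?thesis by measurable
  qed
  have up: "\<forall>l\<in>{1..j}. 1 \<le> (\<beta>(i := Suc (\<beta> i))) l" for i using Suc.prems(1) by auto
  have new: "\<forall>l\<in>{1..Suc j}. 1 \<le> (\<beta>(Suc j := 1)) l" using Suc.prems(1) by auto
  have f1: "(\<integral>\<^sup>+\<xi>. ?g (Suc j) (\<beta>(Suc j := 1)) \<xi> \<partial>Env) < \<infinity>"
  proof (rule Suc.IH[OF new])
    have "(\<Sum>i=1..Suc j. (\<beta>(Suc j := 1)) i) = (\<Sum>i=1..j. \<beta> i) + 1" by simp
    then show "(\<Sum>i=1..Suc j. (\<beta>(Suc j := 1)) i) + r \<le> K" using Suc.prems(2) by linarith
  qed
  have f2: "(\<integral>\<^sup>+\<xi>. ?g j (\<beta>(i := Suc (\<beta> i))) \<xi> \<partial>Env) < \<infinity>" if i: "i \<in> {1..j}" for i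
  proof (rule Suc.IH[OF up])
    have "(\<Sum>l=1..j. (\<beta>(i := Suc (\<beta> i))) l) = Suc (\<beta> i) + (\<Sum>l\<in>{1..j} - {i}. \<beta> l)"
      using i by (subst sum.remove[of _ i]) (auto intro!: sum.cong)
    also have "\<dots> = (\<Sum>l=1..j. \<beta> l) + 1" using i by (subst (2) sum.remove[of _ i]) auto
    finally show "(\<Sum>l=1..j. (\<beta>(i := Suc (\<beta> i))) l) + r \<le> K" using Suc.prems(2) by linarith
  qed
  have "(\<integral>\<^sup>+\<xi>. ennreal (power_sum j \<beta> \<xi> * mass \<xi> 1 ^ Suc r) \<partial>Env)
      \<le> (\<integral>\<^sup>+\<xi>. (\<Sum>i=1..j. ?g j (\<beta>(i := Suc (\<beta> i))) \<xi>) + ?g (Suc j) (\<beta>(Suc j := 1)) \<xi> \<partial>Env)"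
  proof (rule nn_integral_mono)
    fix \<xi>
    have "power_sum j \<beta> \<xi> * mass \<xi> 1 ^ Suc r = (power_sum j \<beta> \<xi> * mass \<xi> 1) * mass \<xi> 1 ^ r" by simp
    also have "\<dots> \<le> ((\<Sum>i=1..j. power_sum j (\<beta>(i := Suc (\<beta> i))) \<xi>) + power_sum (Suc j) (\<beta>(Suc j := 1)) \<xi>) * mass \<xi> 1 ^ r"
      by (intro mult_right_mono power_sum_mult_mass) simp
    also have "\<dots> = (\<Sum>i=1..j. power_sum j (\<beta>(i := Suc (\<beta> i))) \<xi> * mass \<xi> 1 ^ r)
        + power_sum (Suc j) (\<beta>(Suc j := 1)) \<xi> * mass \<xi> 1 ^ r"
      by (simp add: distrib_right sum_distrib_right)
    finally have "ennreal (power_sum j \<beta> \<xi> * mass \<xi> 1 ^ Suc r)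
        \<le> ennreal ((\<Sum>i=1..j. power_sum j (\<beta>(i := Suc (\<beta> i))) \<xi> * mass \<xi> 1 ^ r)
        + power_sum (Suc j) (\<beta>(Suc j := 1)) \<xi> * mass \<xi> 1 ^ r)" by (rule ennreal_leI)
    also have "\<dots> = ennreal (\<Sum>i=1..j. power_sum j (\<beta>(i := Suc (\<beta> i))) \<xi> * mass \<xi> 1 ^ r)
        + ?g (Suc j) (\<beta>(Suc j := 1)) \<xi>"
      by (intro ennreal_plus sum_nonneg mult_nonneg_nonneg power_sum_nonneg) auto
    also have "ennreal (\<Sum>i=1..j. power_sum j (\<beta>(i := Suc (\<beta> i))) \<xi> * mass \<xi> 1 ^ r) = (\<Sum>i=1..j. ?g j (\<beta>(i := Suc (\<beta> i))) \<xi>)"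
      by (intro sum_ennreal[symmetric] mult_nonneg_nonneg power_sum_nonneg) auto
    finally show "ennreal (power_sum j \<beta> \<xi> * mass \<xi> 1 ^ Suc r)
        \<le> (\<Sum>i=1..j. ?g j (\<beta>(i := Suc (\<beta> i))) \<xi>) + ?g (Suc j) (\<beta>(Suc j := 1)) \<xi>" .
  qed
  also have "(\<integral>\<^sup>+\<xi>. (\<Sum>i=1..j. ?g j (\<beta>(i := Suc (\<beta> i))) \<xi>) + ?g (Suc j) (\<beta>(Suc j := 1)) \<xi> \<partial>Env)
      = (\<Sum>i=1..j. \<integral>\<^sup>+\<xi>. ?g j (\<beta>(i := Suc (\<beta> i))) \<xi> \<partial>Env) + (\<integral>\<^sup>+\<xi>. ?g (Suc j) (\<beta>(Suc j := 1)) \<xi> \<partial>Env)"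
  proof -
    have "(\<integral>\<^sup>+\<xi>. (\<Sum>i=1..j. ?g j (\<beta>(i := Suc (\<beta> i))) \<xi>) \<partial>Env) = (\<Sum>i=1..j. \<integral>\<^sup>+\<xi>. ?g j (\<beta>(i := Suc (\<beta> i))) \<xi> \<partial>Env)"
      by (rule nn_integral_sum) (rule m[OF up])
    moreover have "(\<lambda>\<xi>. \<Sum>i=1..j. ?g j (\<beta>(i := Suc (\<beta> i))) \<xi>) \<in> borel_measurable Env"
      by (intro borel_measurable_sum) (rule m[OF up])
    note nn_integral_add[OF this m[OF new]]
    ultimately show ?thesis by (simp only:)
  qed
  also have "\<dots> < \<infinity>" using f1 f2 by simp
  finally show ?case .
qed

text \<open>As \<open>2 * k < \<kappa>\<close>, the integers up to \<open>2 * k\<close> lie in the range in which \<open>\<psi>\<close> is finite and in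
  which mixed moments are assumed.\<close>

lemma regular_law_of_moments:
  assumes k: "2 \<le> k" and one: "psi \<nu> 1 = 0"
    and deriv: "((\<lambda>t. real_of_ereal (psi \<nu> t)) has_real_derivative D) (at 1)" "D < 0"
    and kappa: "ereal (2 * real k) < kappa \<nu>" "kappa \<nu> < \<infinity>"
    and \<delta>: "0 < \<delta>"
    and psi: "\<And>t. 1 - \<delta> \<le> t \<Longrightarrow> t \<le> of_int \<lceil>real_of_ereal (kappa \<nu>) + \<delta>\<rceil> \<Longrightarrow> psi \<nu> t < \<infinity>"
    and c: "\<And>j \<beta>. 1 \<le> j \<Longrightarrow> int j \<le> \<lceil>real_of_ereal (kappa \<nu>) + \<delta>\<rceil> \<Longrightarrow> (\<forall>i\<in>{1..j}. \<beta> i \<ge> 1) \<Longrightarrow>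
               int (\<Sum>i=1..j. \<beta> i) \<le> \<lceil>real_of_ereal (kappa \<nu>) + \<delta>\<rceil> \<Longrightarrow> c_moment \<nu> j \<beta> < \<infinity>"
  shows "regular_law \<nu> (2 * k)"
proof -
  let ?K = "\<lceil>real_of_ereal (kappa \<nu>) + \<delta>\<rceil>"
  obtain \<kappa> where \<kappa>: "kappa \<nu> = ereal \<kappa>" using kappa by (cases "kappa \<nu>") auto
  have K: "int (2 * k) \<le> ?K" using kappa \<kappa> \<delta> by simp linarith
  show ?thesis
  proof unfold_locales
    show "2 \<le> 2 * k" using k by simp
    show "phi 1 1 = 1" using one phi_eq_laplace[of 1] by (simp add: psi_laplace log_ennreal_eq_0)
    show "phi p 1 < 1" if p: "2 \<le> p" "p \<le> 2 * k" for p
    proof -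
      have "real p \<le> of_int ?K" using K p by linarith
      then have "psi \<nu> (real p) < \<infinity>" using p \<delta> by (intro psi) auto
      moreover have "ereal (real p) \<le> ereal (2 * real k)" using p by simp
      then have "ereal (real p) < kappa \<nu>" using kappa(1) by (rule le_less_trans)
      ultimately show ?thesis
        using laplace_less_one[OF one deriv, of "real p"] phi_eq_laplace[of p] p by simp
    qed
    have "(\<integral>\<^sup>+\<xi>. ennreal (power_sum 0 (\<lambda>_. 1) \<xi> * mass \<xi> 1 ^ (2 * k)) \<partial>Env) < \<infinity>"
    proof (rule nn_integral_power_sum_mass_finite[where K="nat ?K"])
      fix j and \<beta> :: "nat \<Rightarrow> nat"
      assume *: "1 \<le> j" "\<forall>i\<in>{1..j}. 1 \<le> \<beta> i" "(\<Sum>i=1..j. \<beta> i) \<le> nat ?K"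
      have "j = (\<Sum>i=1..j. 1)" by simp
      also have "\<dots> \<le> (\<Sum>i=1..j. \<beta> i)" using *(2) by (intro sum_mono) auto
      finally have "int j \<le> int (\<Sum>i=1..j. \<beta> i)" by (simp only: of_nat_le_iff)
      moreover have "int (\<Sum>i=1..j. \<beta> i) \<le> ?K" using *(3) K by linarith
      ultimately show "c_moment \<nu> j \<beta> < \<infinity>" using * by (intro c) linarith+
    qed (use K in \<open>auto simp: nat_le_iff le_nat_iff\<close>)
    moreover have "Delta 0 A = {\<lambda>_. undefined}" for A by (auto simp: Delta_def)
    then have "power_sum 0 (\<lambda>_. 1) \<xi> = 1" for \<xi> by (simp add: power_sum_def)
    ultimately show "(\<integral>\<^sup>+\<xi>. ennreal (mass \<xi> 1 ^ (2 * k)) \<partial>Env) < \<infinity>" by simp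
  qed
qed

end

section \<open>Annealed convergence\<close>

lemma one_le_ennreal_ratio:
  assumes "0 < a" "a \<le> x" shows "1 \<le> ennreal (1 / a) * ennreal x"
proof -
  have "1 \<le> 1 / a * x" using assms by (simp add: field_simps)
  then have "ennreal 1 \<le> ennreal (1 / a * x)" by (rule ennreal_leI)
  also have "\<dots> = ennreal (1 / a) * ennreal x" using assms by (intro ennreal_mult) auto
  finally show ?thesis by simp
qed

context regular_law
begin

lemma measurable_card_generation: "{\<xi>. K < card (generation \<xi> m)} \<in> sets Env"
proof -
  have "level_sum_nn m (\<lambda>v. if 0 < weight \<xi> v then 1 else 0) = of_nat (card (generation \<xi> m))" for \<xi>
  proof -
    have "level_sum_nn m (\<lambda>v. if 0 < weight \<xi> v then 1 else 0) = (\<Sum>v\<in>generation \<xi> m. if 0 < weight \<xi> v then 1 else 0)"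
      by (rule level_sum_nn_generation) (simp add: weight_eq_0)
    also have "\<dots> = (\<Sum>v\<in>generation \<xi> m. 1)"
      by (intro sum.cong[OF refl]) (auto simp: generation_def tree_iff_weight)
    finally show ?thesis by simp
  qed
  then have "{\<xi>. K < card (generation \<xi> m)}
      = {\<xi> \<in> space Env. of_nat K < level_sum_nn m (\<lambda>v. if 0 < weight \<xi> v then 1 else 0)}"
    by (simp add: space_env of_nat_less_iff)
  also have "\<dots> \<in> sets Env" by measurable
  finally show ?thesis .
qed

lemma card_generation_tight:
  assumes "0 < \<eta>"
  shows "\<exists>K. emeasure Env {\<xi>. K < card (generation \<xi> m)} < ennreal \<eta>"
proof -
  have "(\<lambda>K. emeasure Env {\<xi>. K < card (generation \<xi> m)}) \<longlonglongrightarrow> emeasure Env (\<Inter>K. {\<xi>. K < card (generation \<xi> m)})"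
    by (rule Lim_emeasure_decseq) (auto simp: decseq_def intro: measurable_card_generation)
  moreover have "(\<Inter>K. {\<xi>. K < card (generation \<xi> m)}) = {}" by auto
  ultimately have "(\<lambda>K. emeasure Env {\<xi>. K < card (generation \<xi> m)}) \<longlonglongrightarrow> 0" by simp
  then have "eventually (\<lambda>K. emeasure Env {\<xi>. K < card (generation \<xi> m)} < ennreal \<eta>) sequentially"
    by (rule order_tendstoD(2)) (use assms in simp)
  then show ?thesis by (auto simp: eventually_sequentially)
qed

text \<open>For almost every environment the probability on the left is at most the sum of six terms, each
  of which is at least \<open>1\<close> when one hypothesis of the quenched bound fails, or is that bound itself:
  too large a limiting mass, a heavy block, a large block error, too many blocks, a vertex that is
  too easy to hit, and the quenched bound. Markov's inequality is thereby built into the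
  integration.\<close>

lemma annealed_deviation:
  assumes law: "\<And>\<xi>. quenched_law \<xi> (Q \<xi>)"
    and k: "2 \<le> k" and lam: "\<And>i. i \<in> {2..k} \<Longrightarrow> lam i \<le> m" and ml: "m \<le> l" "1 \<le> l" "l \<le> h" and n: "1 \<le> n"
    and c: "0 \<le> c" "c \<le> 1" and M: "0 < M" and \<delta>: "0 < \<delta>" "3 * \<delta> \<le> 1"
    and nM: "M / sqrt (real n) \<le> \<delta>" and \<epsilon>: "3 * real k ^ 2 * (M + 1) ^ k * (4 * \<delta>) \<le> \<epsilon>"
    and \<tau>: "0 \<le> \<tau>" "\<And>j. j \<in> {l..h} \<Longrightarrow> (\<integral>\<^sup>+\<xi>. ennreal (block_error c m j \<xi>) \<partial>Env) \<le> ennreal \<tau>"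
    and B: "B \<in> sets Env" "0 \<le> e0" "\<And>\<xi> x. \<xi> \<notin> B \<Longrightarrow> x \<in> levels \<xi> l h \<Longrightarrow> hit \<xi> x \<le> e0"
    and C: "\<And>f. f \<in> borel_measurable Env \<Longrightarrow> (\<integral>\<^sup>+\<xi>. f \<xi> \<partial>env_measure_star \<nu>) \<le> ennreal C * (\<integral>\<^sup>+\<xi>. f \<xi> \<partial>Env)"
  defines "t \<equiv> nat \<lfloor>sqrt (real n)\<rfloor>" and "s \<equiv> sqrt (real n) * real (h + 1 - l)"
  shows "(\<integral>\<^sup>+\<xi>. emeasure (Q \<xi>) {X. \<epsilon> < \<bar>tuple_sum k {x \<in> range_walk \<xi> (T_ret t X) X. l \<le> length x \<and> length x \<le> h} (f_lambda k lam) / s ^ k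
             - c ^ k * tuple_limit k lam \<xi>\<bar>} \<partial>env_measure_star \<nu>)
     \<le> ennreal C * (ennreal (1 / M) + ennreal (mass_bound 2 * (rate ^ m * rate ^ m) / \<delta>) + ennreal (\<tau> / \<delta>)
         + emeasure Env {\<xi>. K < card (generation \<xi> m)} + emeasure Env B
         + ennreal (real K * (2 * real t * (pair_const * real (h + 1)) + 2 * real t ^ 3 * e0 * mass_bound 2) / (\<delta>\<^sup>2 * real n)))"
proof -
  let ?L = "real (h + 1 - l)" and ?S = "env_measure_star \<nu>"
  have L: "1 \<le> ?L" using ml by simp
  have mb: "0 \<le> mass_bound 2" using mass_bound(1)[of 2] P2 by simp
  define ev where "ev \<xi> = {X. \<epsilon> < \<bar>tuple_sum k {x \<in> range_walk \<xi> (T_ret t X) X. l \<le> length x \<and> length x \<le> h} (f_lambda k lam) / s ^ k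
             - c ^ k * tuple_limit k lam \<xi>\<bar>}" for \<xi>
  define A1 where "A1 = real K * (2 * real t) / (\<delta> * s)\<^sup>2"
  define A2 where "A2 = real K * (2 * real t ^ 3 * e0) / (\<delta> * s)\<^sup>2"
  have A0: "0 \<le> A1" "0 \<le> A2" using B(2) by (auto simp: A1_def A2_def)
  define b1 where "b1 \<xi> = ennreal (1 / M) * ennreal (limit_mass \<xi>)" for \<xi>
  define b2 where "b2 \<xi> = ennreal (1 / \<delta>) * ennreal (\<Sum>u\<in>generation \<xi> m. (limit_measure \<xi> u)\<^sup>2)" for \<xi>
  define b3 where "b3 \<xi> = ennreal (1 / (\<delta> * ?L)) * (\<Sum>j\<in>{l..h}. ennreal (block_error c m j \<xi>))" for \<xi>
  define b4 where "b4 = (indicator {\<xi>. K < card (generation \<xi> m)} :: env \<Rightarrow> ennreal)"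
  define b5 where "b5 = (indicator B :: env \<Rightarrow> ennreal)"
  define b6 where "b6 \<xi> = ennreal A1 * ennreal (pair_total \<xi> l h) + ennreal A2 * ennreal ((hit_total \<xi> l h)\<^sup>2)" for \<xi>
  define b where "b \<xi> = b1 \<xi> + (b2 \<xi> + (b3 \<xi> + (b4 \<xi> + (b5 \<xi> + b6 \<xi>))))" for \<xi>
  have me: "(\<lambda>\<xi>. block_error c m j \<xi>) \<in> borel_measurable Env" if "j \<in> {l..h}" for j
  proof -
    have "m + (j - m) = j" using that ml by simp
    then show ?thesis using measurable_block_error[of c m "j - m"] by (simp only:)
  qed
  have [measurable]: "b1 \<in> borel_measurable Env" "b2 \<in> borel_measurable Env" "b4 \<in> borel_measurable Env"
      "b5 \<in> borel_measurable Env" "b6 \<in> borel_measurable Env"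
    unfolding b1_def b2_def b4_def b5_def b6_def using B(1) measurable_card_generation[of K m] by measurable
  have [measurable]: "b3 \<in> borel_measurable Env"
    unfolding b3_def
    by (intro borel_measurable_times_ennreal borel_measurable_const borel_measurable_sum measurable_compose[OF me measurable_ennreal])
  have bm: "b \<in> borel_measurable Env" unfolding b_def[abs_def] by measurable
  have le: "AE \<xi> in Env. emeasure (Q \<xi>) (ev \<xi>) \<le> b \<xi>"
    using AE_regular_env AE_escape_tendsto_0
  proof eventually_elim
    case (elim \<xi>)
    interpret Q: prob_space "Q \<xi>" using law[of \<xi>] by (simp add: quenched_law_def)
    have one: "emeasure (Q \<xi>) (ev \<xi>) \<le> 1" by (rule Q.emeasure_le_1)
    have be: "0 \<le> block_error c m j \<xi>" for j unfolding block_error_def by (intro sum_nonneg) auto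
    have lm: "0 \<le> limit_mass \<xi>" using regular_env_limit_nonneg[OF elim(1), of "[]"] by simp
    consider "M \<le> limit_mass \<xi>" | "\<delta> \<le> (\<Sum>u\<in>generation \<xi> m. (limit_measure \<xi> u)\<^sup>2)"
      | "\<delta> * ?L \<le> (\<Sum>j\<in>{l..h}. block_error c m j \<xi>)" | "K < card (generation \<xi> m)" | "\<xi> \<in> B"
      | "limit_mass \<xi> \<le> M" "(\<Sum>u\<in>generation \<xi> m. (limit_measure \<xi> u)\<^sup>2) \<le> \<delta>"
        "(\<Sum>j\<in>{l..h}. block_error c m j \<xi>) \<le> \<delta> * ?L" "card (generation \<xi> m) \<le> K" "\<xi> \<notin> B"
      by linarith
    then show ?case
    proof cases
      case 1
      have "1 \<le> b1 \<xi>" unfolding b1_def by (rule one_le_ennreal_ratio[OF M 1])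
      also have "\<dots> \<le> b \<xi>" unfolding b_def by simp
      finally show ?thesis using one by (rule order_trans[rotated])
    next
      case 2
      have "1 \<le> b2 \<xi>" unfolding b2_def by (rule one_le_ennreal_ratio[OF \<delta>(1) 2])
      also have "\<dots> \<le> b \<xi>" unfolding b_def by (simp add: add_increasing)
      finally show ?thesis using one by (rule order_trans[rotated])
    next
      case 3
      have "1 \<le> ennreal (1 / (\<delta> * ?L)) * ennreal (\<Sum>j\<in>{l..h}. block_error c m j \<xi>)"
        using \<delta>(1) L by (intro one_le_ennreal_ratio 3 mult_pos_pos) linarith+
      also have "\<dots> = b3 \<xi>" unfolding b3_def by (simp only: sum_ennreal be)
      also have "\<dots> \<le> b \<xi>" unfolding b_def by (simp add: add_increasing)
      finally show ?thesis using one by (rule order_trans[rotated])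
    next
      case 4
      then have "1 \<le> b4 \<xi>" unfolding b4_def by simp
      also have "\<dots> \<le> b \<xi>" unfolding b_def by (simp add: add_increasing)
      finally show ?thesis using one by (rule order_trans[rotated])
    next
      case 5
      then have "1 \<le> b5 \<xi>" unfolding b5_def by simp
      also have "\<dots> \<le> b \<xi>" unfolding b_def by (simp add: add_increasing)
      finally show ?thesis using one by (rule order_trans[rotated])
    next
      case 6
      have "emeasure (Q \<xi>) (ev \<xi>)
          \<le> ennreal (real K * (2 * real t * pair_total \<xi> l h + 2 * real t ^ 3 * (e0 * (hit_total \<xi> l h)\<^sup>2)) / (\<delta> * s)\<^sup>2)"
        unfolding ev_def t_def s_def
      proof (rule quenched_deviation[OF elim(1) elim(2) law k lam ml n c(1) _ \<delta> _ _ nM \<epsilon> B(3)[OF 6(5)] 6(4)])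
        have "c * limit_mass \<xi> \<le> 1 * limit_mass \<xi>" using c lm by (intro mult_right_mono)
        then show "c * limit_mass \<xi> \<le> M" using 6(1) by simp
        have "(\<Sum>u\<in>generation \<xi> m. (c * limit_measure \<xi> u)\<^sup>2) \<le> (\<Sum>u\<in>generation \<xi> m. (limit_measure \<xi> u)\<^sup>2)"
        proof (intro sum_mono power_mono)
          fix u
          have "0 \<le> limit_measure \<xi> u" by (rule regular_env_limit_measure_nonneg[OF elim(1)])
          then show "0 \<le> c * limit_measure \<xi> u" "c * limit_measure \<xi> u \<le> limit_measure \<xi> u"
            using c by (auto intro: mult_left_le_one_le)
        qed
        then show "(\<Sum>u\<in>generation \<xi> m. (c * limit_measure \<xi> u)\<^sup>2) \<le> \<delta>" using 6(2) by linarith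
        show "(\<Sum>j\<in>{l..h}. block_error c m j \<xi>) / real (h + 1 - l) \<le> \<delta>"
          using 6(3) L by (subst pos_divide_le_eq) linarith+
      qed
      also have "real K * (2 * real t * pair_total \<xi> l h + 2 * real t ^ 3 * (e0 * (hit_total \<xi> l h)\<^sup>2)) / (\<delta> * s)\<^sup>2
          = A1 * pair_total \<xi> l h + A2 * (hit_total \<xi> l h)\<^sup>2"
        unfolding A1_def A2_def by (simp add: add_divide_distrib distrib_left mult_ac)
      also have "ennreal \<dots> = b6 \<xi>"
        unfolding b6_def using A0 pair_total_nonneg[of \<xi> l h]
        by (simp only: ennreal_plus ennreal_mult mult_nonneg_nonneg zero_le_power2)
      also have "\<dots> \<le> b \<xi>" unfolding b_def by (simp add: add_increasing)
      finally show ?thesis .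
    qed
  qed
  have i1: "(\<integral>\<^sup>+\<xi>. b1 \<xi> \<partial>Env) = ennreal (1 / M)"
    unfolding b1_def by (subst nn_integral_cmult) (simp_all add: nn_integral_limit_mass)
  have i2: "(\<integral>\<^sup>+\<xi>. b2 \<xi> \<partial>Env) \<le> ennreal (mass_bound 2 * (rate ^ m * rate ^ m) / \<delta>)"
  proof -
    have "(\<integral>\<^sup>+\<xi>. b2 \<xi> \<partial>Env) = ennreal (1 / \<delta>) * (\<integral>\<^sup>+\<xi>. ennreal (\<Sum>u\<in>generation \<xi> m. (limit_measure \<xi> u)\<^sup>2) \<partial>Env)"
      unfolding b2_def by (rule nn_integral_cmult) measurable
    also have "\<dots> \<le> ennreal (1 / \<delta>) * ennreal (mass_bound 2 * (rate ^ m * rate ^ m))"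
      by (intro mult_left_mono nn_integral_sum_limit_measure_square) simp
    also have "\<dots> = ennreal (1 / \<delta> * (mass_bound 2 * (rate ^ m * rate ^ m)))"
      using \<delta> mb rate by (intro ennreal_mult[symmetric]) auto
    finally show ?thesis by simp
  qed
  have i3: "(\<integral>\<^sup>+\<xi>. b3 \<xi> \<partial>Env) \<le> ennreal (\<tau> / \<delta>)"
  proof -
    have "(\<integral>\<^sup>+\<xi>. b3 \<xi> \<partial>Env) = ennreal (1 / (\<delta> * ?L)) * (\<integral>\<^sup>+\<xi>. (\<Sum>j\<in>{l..h}. ennreal (block_error c m j \<xi>)) \<partial>Env)"
      unfolding b3_def by (intro nn_integral_cmult borel_measurable_sum measurable_compose[OF me measurable_ennreal])
    also have "(\<integral>\<^sup>+\<xi>. (\<Sum>j\<in>{l..h}. ennreal (block_error c m j \<xi>)) \<partial>Env) = (\<Sum>j\<in>{l..h}. \<integral>\<^sup>+\<xi>. ennreal (block_error c m j \<xi>) \<partial>Env)"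
      by (intro nn_integral_sum measurable_compose[OF me measurable_ennreal])
    also have "\<dots> \<le> (\<Sum>j\<in>{l..h}. ennreal \<tau>)" by (intro sum_mono \<tau>(2))
    also have "\<dots> = ennreal (\<Sum>j\<in>{l..h}. \<tau>)" using \<tau>(1) by (intro sum_ennreal)
    also have "(\<Sum>j\<in>{l..h}. \<tau>) = ?L * \<tau>" by simp
    also have "ennreal (1 / (\<delta> * ?L)) * ennreal (?L * \<tau>) = ennreal (1 / (\<delta> * ?L) * (?L * \<tau>))"
      using \<delta> \<tau>(1) by (intro ennreal_mult[symmetric]) auto
    also have "1 / (\<delta> * ?L) * (?L * \<tau>) = \<tau> / \<delta>"
      using L \<delta> by (simp del: of_nat_diff)
    finally show ?thesis by (simp add: mult_left_mono)
  qed
  have i6: "(\<integral>\<^sup>+\<xi>. b6 \<xi> \<partial>Env)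
      \<le> ennreal (real K * (2 * real t * (pair_const * real (h + 1)) + 2 * real t ^ 3 * e0 * mass_bound 2) / (\<delta>\<^sup>2 * real n))"
  proof -
    have "(\<integral>\<^sup>+\<xi>. b6 \<xi> \<partial>Env) = ennreal A1 * (\<integral>\<^sup>+\<xi>. ennreal (pair_total \<xi> l h) \<partial>Env)
        + ennreal A2 * (\<integral>\<^sup>+\<xi>. ennreal ((hit_total \<xi> l h)\<^sup>2) \<partial>Env)"
      unfolding b6_def by (simp add: nn_integral_add nn_integral_cmult)
    also have "\<dots> \<le> ennreal A1 * ennreal (pair_const * real (h + 1) * ?L\<^sup>2) + ennreal A2 * ennreal (mass_bound 2 * ?L\<^sup>2)"
      by (intro add_mono mult_left_mono nn_integral_pair_total nn_integral_hit_total_square) auto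
    also have "\<dots> = ennreal (A1 * (pair_const * real (h + 1) * ?L\<^sup>2) + A2 * (mass_bound 2 * ?L\<^sup>2))"
      using A0 pair_const_nonneg mb
      by (simp only: ennreal_plus ennreal_mult mult_nonneg_nonneg zero_le_power2 of_nat_0_le_iff)
    also have "A1 * (pair_const * real (h + 1) * ?L\<^sup>2) + A2 * (mass_bound 2 * ?L\<^sup>2)
        = real K * (2 * real t * (pair_const * real (h + 1)) + 2 * real t ^ 3 * e0 * mass_bound 2) / (\<delta>\<^sup>2 * real n)"
    proof -
      have sq: "(\<delta> * s)\<^sup>2 = (\<delta>\<^sup>2 * real n) * ?L\<^sup>2" unfolding s_def by (simp add: power_mult_distrib del: of_nat_diff)
      have cancel: "x / (d * y) * (z * y) = x * z / d" if "y \<noteq> 0" for x y z d :: real using that by simp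
      have "?L\<^sup>2 \<noteq> 0" using L by simp
      then show ?thesis
        unfolding A1_def A2_def sq cancel[OF \<open>?L\<^sup>2 \<noteq> 0\<close>] by (simp add: add_divide_distrib distrib_left mult_ac)
    qed
    finally show ?thesis .
  qed
  have "(\<integral>\<^sup>+\<xi>. emeasure (Q \<xi>) (ev \<xi>) \<partial>?S) \<le> (\<integral>\<^sup>+\<xi>. b \<xi> \<partial>?S)"
    by (rule nn_integral_mono_AE) (rule AE_star[OF le])
  also have "\<dots> \<le> ennreal C * (\<integral>\<^sup>+\<xi>. b \<xi> \<partial>Env)" by (rule C[OF bm])
  also have "(\<integral>\<^sup>+\<xi>. b \<xi> \<partial>Env) = (\<integral>\<^sup>+\<xi>. b1 \<xi> \<partial>Env) + ((\<integral>\<^sup>+\<xi>. b2 \<xi> \<partial>Env) + ((\<integral>\<^sup>+\<xi>. b3 \<xi> \<partial>Env)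
      + (emeasure Env {\<xi>. K < card (generation \<xi> m)} + (emeasure Env B + (\<integral>\<^sup>+\<xi>. b6 \<xi> \<partial>Env)))))"
    unfolding b_def using B(1) measurable_card_generation[of K m]
    by (simp add: nn_integral_add b4_def b5_def)
  also have "ennreal C * \<dots> \<le> ennreal C * (ennreal (1 / M) + (ennreal (mass_bound 2 * (rate ^ m * rate ^ m) / \<delta>) + (ennreal (\<tau> / \<delta>)
         + (emeasure Env {\<xi>. K < card (generation \<xi> m)} + (emeasure Env B
         + ennreal (real K * (2 * real t * (pair_const * real (h + 1)) + 2 * real t ^ 3 * e0 * mass_bound 2) / (\<delta>\<^sup>2 * real n)))))))"
    by (intro mult_left_mono add_mono i2 i3 i6 order_refl) (simp_all add: i1)
  finally show ?thesis unfolding ev_def by (simp only: add.assoc)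
qed

end

section \<open>The limit theorem\<close>

lemma iter_log_at_top: "filterlim (iter_log i) at_top at_top"
proof (induction i)
  case 0
  have "iter_log 0 = (\<lambda>t. t)" by (simp add: iter_log_def[abs_def] id_def)
  then show ?case by (simp add: filterlim_ident)
next
  case (Suc i)
  have "iter_log (Suc i) = (\<lambda>t. ln (iter_log i t))" by (rule ext) (simp add: iter_log_def)
  then show ?case using filterlim_compose[OF ln_at_top Suc] by simp
qed

text \<open>In the application \<open>r\<close> is \<open>sqrt n\<close>, \<open>\<tau>\<close> its integer part and \<open>e / (r\<^sup>2) ^ 3\<close> the bound of
  order \<open>n ^ -3\<close> on \<open>hit\<close>.\<close>

lemma variance_rate:
  fixes r \<tau> a b d e :: real
  assumes r: "1 \<le> r" and \<tau>: "0 \<le> \<tau>" "\<tau> \<le> r" and nn: "0 \<le> a" "0 \<le> b" "0 < d" "0 \<le> e"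
  shows "(2 * \<tau> * a + 2 * \<tau> ^ 3 * (e / (r\<^sup>2) ^ 3) * b) / (d * r\<^sup>2) \<le> (2 * a + 2 * e * b) / d * (1 / r)"
proof -
  have 1: "\<tau> / r\<^sup>2 \<le> 1 / r"
  proof -
    have "\<tau> / r\<^sup>2 \<le> r / r\<^sup>2" using \<tau> by (intro divide_right_mono) auto
    then show ?thesis using r by (simp add: power2_eq_square)
  qed
  have 2: "\<tau> ^ 3 / (r\<^sup>2) ^ 3 / r\<^sup>2 \<le> 1 / r"
  proof -
    have "\<tau> ^ 3 / (r\<^sup>2) ^ 3 / r\<^sup>2 \<le> r ^ 3 / (r\<^sup>2) ^ 3 / r\<^sup>2"
      using \<tau> by (intro divide_right_mono power_mono) auto
    also have "\<dots> = 1 / r ^ 5" using r by (simp add: field_simps power_numeral_reduce)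
    also have "\<dots> \<le> 1 / r ^ 1" using r by (intro divide_left_mono power_increasing mult_pos_pos zero_less_power) auto
    finally show ?thesis by simp
  qed
  have "(2 * \<tau> * a + 2 * \<tau> ^ 3 * (e / (r\<^sup>2) ^ 3) * b) / (d * r\<^sup>2)
      = 2 * a / d * (\<tau> / r\<^sup>2) + 2 * e * b / d * (\<tau> ^ 3 / (r\<^sup>2) ^ 3 / r\<^sup>2)"
    using r nn by (simp add: add_divide_distrib mult_ac)
  also have "\<dots> \<le> 2 * a / d * (1 / r) + 2 * e * b / d * (1 / r)"
    using nn by (intro add_mono mult_left_mono 1 2) auto
  also have "\<dots> = (2 * a + 2 * e * b) / d * (1 / r)" by (simp add: add_divide_distrib distrib_right)
  finally show ?thesis .
qed

context regular_law
begin

text \<open>With \<open>\<zeta>\<close> the integer part of \<open>ln n\<close>, generation \<open>\<lceil>\<zeta> / \<delta>0\<rceil>\<close> precedes generation \<open>l\<close>, and off an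
  unlikely event \<open>V\<close> is at least \<open>3 * \<zeta>\<close> there; \<open>hit\<close> decreases along lines of descent.\<close>

lemma hits_small_of_delta0:
  assumes "delta0_condition \<nu> \<delta>0"
  obtains \<rho> where "0 < \<rho>"
    "\<And>n l h. 3 \<le> n \<Longrightarrow> ln (real n) / \<delta>0 \<le> real l \<Longrightarrow>
       \<exists>B\<in>sets Env. emeasure Env B \<le> ennreal (exp (- \<rho> * real (nat \<lfloor>ln (real n)\<rfloor>))) \<and>
         (\<forall>\<xi> x. \<xi> \<notin> B \<longrightarrow> x \<in> levels \<xi> l h \<longrightarrow> hit \<xi> x \<le> exp 3 / real n ^ 3)"
proof -
  obtain \<rho> where \<delta>0: "0 < \<delta>0" and \<rho>: "1 / 2 < \<rho>"
    and ev: "\<And>\<zeta>::nat. 1 \<le> \<zeta> \<Longrightarrow> 1 - exp (- \<rho> * real \<zeta>)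
        \<le> measure Env {\<xi> \<in> space Env. ereal (3 * real \<zeta>) \<le> (INF z\<in>generation \<xi> (nat \<lceil>real \<zeta> / \<delta>0\<rceil>). ereal (V \<xi> z))}"
    using assms unfolding delta0_condition_def by blast
  have "\<exists>B\<in>sets Env. emeasure Env B \<le> ennreal (exp (- \<rho> * real (nat \<lfloor>ln (real n)\<rfloor>))) \<and>
         (\<forall>\<xi> x. \<xi> \<notin> B \<longrightarrow> x \<in> levels \<xi> l h \<longrightarrow> hit \<xi> x \<le> exp 3 / real n ^ 3)"
    if n: "3 \<le> n" and low: "ln (real n) / \<delta>0 \<le> real l" for n l h
  proof -
    define \<zeta> where "\<zeta> = nat \<lfloor>ln (real n)\<rfloor>"
    define q where "q = nat \<lceil>real \<zeta> / \<delta>0\<rceil>"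
    define G where "G = {\<xi> \<in> space Env. ereal (3 * real \<zeta>) \<le> (INF z\<in>generation \<xi> q. ereal (V \<xi> z))}"
    have "exp 1 \<le> real n" using exp_le n by linarith
    then have ln1: "1 \<le> ln (real n)" using n by (subst ln_ge_iff) auto
    then have z: "1 \<le> \<zeta>" unfolding \<zeta>_def by (simp add: le_nat_iff le_floor_iff)
    have "real \<zeta> = real_of_int \<lfloor>ln (real n)\<rfloor>" unfolding \<zeta>_def using ln1 by (subst of_nat_nat) auto
    then have zl: "real \<zeta> \<le> ln (real n)" "ln (real n) \<le> real \<zeta> + 1" by linarith+
    have "real \<zeta> / \<delta>0 \<le> ln (real n) / \<delta>0" using zl \<delta>0 by (intro divide_right_mono) auto
    then have "real \<zeta> / \<delta>0 \<le> real l" using low by linarith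
    then have ql: "q \<le> l" unfolding q_def by (simp add: nat_le_iff ceiling_le_iff)
    have mG: "1 - exp (- \<rho> * real \<zeta>) \<le> measure Env G" unfolding G_def q_def by (rule ev[OF z])
    have "exp (- \<rho> * real \<zeta>) < 1" using \<rho> z by simp
    then have "measure Env G \<noteq> 0" using mG by linarith
    then have Gs: "G \<in> sets Env" using measure_notin_sets by blast
    have "measure Env (space Env - G) = 1 - measure Env G" by (rule env.prob_compl[OF Gs])
    then have "emeasure Env (space Env - G) \<le> ennreal (exp (- \<rho> * real \<zeta>))"
      unfolding env.emeasure_eq_measure using mG by (intro ennreal_leI) linarith
    moreover have "hit \<xi> x \<le> exp 3 / real n ^ 3" if "\<xi> \<notin> space Env - G" "x \<in> levels \<xi> l h" for \<xi> x
    proof -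
      have \<xi>: "\<xi> \<in> G" using that(1) by (simp add: space_env)
      have u: "take q x \<in> generation \<xi> q" using take_levels[OF ql, of \<xi> h] that(2) by blast
      have "ereal (3 * real \<zeta>) \<le> ereal (V \<xi> (take q x))"
      proof -
        have "ereal (3 * real \<zeta>) \<le> (INF z\<in>generation \<xi> q. ereal (V \<xi> z))" using \<xi> by (simp add: G_def)
        also have "\<dots> \<le> ereal (V \<xi> (take q x))" by (rule INF_lower[OF u])
        finally show ?thesis .
      qed
      then have V: "3 * real \<zeta> \<le> V \<xi> (take q x)" by simp
      have "hit \<xi> x \<le> hit \<xi> (take q x)"
        using that(2) by (intro hit_le_hit_prefix take_is_prefix) (simp add: levels_def)
      also have "\<dots> \<le> weight \<xi> (take q x)" by (rule hit_le_weight)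
      also have "\<dots> = exp (- V \<xi> (take q x))" using u by (intro weight_eq_exp_V) (simp add: generation_def)
      also have "\<dots> \<le> exp (3 - 3 * ln (real n))" using V zl by simp
      also have "\<dots> = exp 3 / real n ^ 3" using n exp_of_nat_mult[of 3 "ln (real n)"] by (simp add: exp_diff)
      finally show ?thesis .
    qed
    moreover have "space Env - G \<in> sets Env" using Gs by (rule sets.compl_sets)
    ultimately show ?thesis unfolding \<zeta>_def by blast
  qed
  moreover have "0 < \<rho>" using \<rho> by simp
  ultimately show ?thesis using that by blast
qed

text \<open>The parameters are chosen in the order \<open>M'\<close>, \<open>\<delta>\<close>, \<open>m\<close>, \<open>K\<close>, then \<open>n\<close>: each of the six terms of
  the annealed bound is made at most \<open>\<eta>\<close>. The iterated logarithm tends to infinity, so its presence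
  in the hypothesis on \<open>high\<close> makes \<open>high / sqrt n\<close> itself vanish.\<close>

lemma tuple_sum_converges_annealed:
  assumes law: "\<And>\<xi>. quenched_law \<xi> (Q \<xi>)" and k: "2 \<le> k" and S: "many_to_one_walk \<nu> M S"
    and \<delta>0: "delta0_condition \<nu> \<delta>0"
    and lh: "\<And>n. 1 \<le> n \<Longrightarrow> ln (real n) / \<delta>0 \<le> real (low n) \<and> low n \<le> high n"
    and high: "(\<lambda>n. real (high n) / sqrt (real n) * iter_log l0 (real (high n))) \<longlonglongrightarrow> 0"
  shows "tendsto_in_annealed_prob \<nu> Q
           (\<lambda>n \<xi> X. tuple_sum k (D_set low high n \<xi> X) (f_lambda k lam) /
                      (sqrt (real n) * (real (high n) - real (low n) + 1)) ^ k)
           (\<lambda>\<xi>. c_infty M S ^ k * tuple_limit k lam \<xi>)"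
  unfolding tendsto_in_annealed_prob_def
proof (intro allI impI order_tendstoI)
  fix \<epsilon> :: real and a :: ennreal
  assume \<epsilon>: "0 < \<epsilon>" and a: "0 < a"
  define c where "c = c_infty M S"
  note lim = hit_mean_tendsto_c_infty[OF S, folded c_def]
  have c1: "c \<le> 1" using lim(2)[of 0] hit_mean_bounds(2)[of 0] by linarith
  have mb: "0 \<le> mass_bound 2" using mass_bound(1)[of 2] P2 by simp
  have d0: "0 < \<delta>0" using \<delta>0 by (simp add: delta0_condition_def)
  obtain r where r: "0 < r" "ennreal r \<le> a"
  proof (cases a)
    case (real r) then show ?thesis using a that[of r] by simp
  next
    case top then show ?thesis using that[of 1] by simp
  qed
  obtain C where C: "0 \<le> C" "\<And>f. f \<in> borel_measurable Env \<Longrightarrow> (\<integral>\<^sup>+\<xi>. f \<xi> \<partial>env_measure_star \<nu>) \<le> ennreal C * (\<integral>\<^sup>+\<xi>. f \<xi> \<partial>Env)"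
    using nn_integral_star_le by blast
  \<comment> \<open>six terms, each multiplied by the constant \<open>C\<close> from conditioning on survival\<close>
  define \<eta> where "\<eta> = r / (6 * (C + 1))"
  have \<eta>: "0 < \<eta>" "C * (6 * \<eta>) < r"
  proof -
    show "0 < \<eta>" unfolding \<eta>_def using r C(1) by simp
    have "C * (6 * \<eta>) = r * (C / (C + 1))" unfolding \<eta>_def using C(1) by (simp add: field_simps)
    also have "\<dots> < r * 1" using r C(1) by (intro mult_strict_left_mono) auto
    finally show "C * (6 * \<eta>) < r" by simp
  qed
  define M' where "M' = 1 / \<eta>"
  have M': "0 < M'" using \<eta> by (simp add: M'_def)
  define E where "E = 12 * real k ^ 2 * (M' + 1) ^ k"
  have E: "0 < E" unfolding E_def using k M' by (intro mult_pos_pos zero_less_power) auto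
  define \<delta> where "\<delta> = min (1 / 3) (\<epsilon> / E)"
  have \<delta>: "0 < \<delta>" "3 * \<delta> \<le> 1" using \<epsilon> E by (auto simp: \<delta>_def)
  have "E * \<delta> \<le> \<epsilon>"
  proof -
    have "E * \<delta> \<le> E * (\<epsilon> / E)" unfolding \<delta>_def using E by (intro mult_left_mono) auto
    then show ?thesis using E by simp
  qed
  then have \<epsilon>\<delta>: "3 * real k ^ 2 * (M' + 1) ^ k * (4 * \<delta>) \<le> \<epsilon>" unfolding E_def by (simp add: mult_ac)
  have "(\<lambda>m. mass_bound 2 * (rate ^ m * rate ^ m) / \<delta>) \<longlonglongrightarrow> mass_bound 2 * (0 * 0) / \<delta>"
    using rate \<delta> by (intro tendsto_intros LIMSEQ_power_zero) auto
  then have "eventually (\<lambda>m. mass_bound 2 * (rate ^ m * rate ^ m) / \<delta> < \<eta>) sequentially"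
    by (rule order_tendstoD(2)) (use \<eta> in simp)
  moreover have "eventually (\<lambda>m. (\<Sum>i\<in>{2..k}. lam i) \<le> m) sequentially" by (rule eventually_ge_at_top)
  ultimately have "eventually (\<lambda>m. mass_bound 2 * (rate ^ m * rate ^ m) / \<delta> < \<eta> \<and> (\<Sum>i\<in>{2..k}. lam i) \<le> m) sequentially"
    by (rule eventually_conj)
  then obtain m where m: "mass_bound 2 * (rate ^ m * rate ^ m) / \<delta> < \<eta>" "(\<Sum>i\<in>{2..k}. lam i) \<le> m"
    by (auto simp: eventually_sequentially)
  have lam: "lam i \<le> m" if "i \<in> {2..k}" for i
    using member_le_sum[OF that, of lam] m(2) by simp
  obtain K where K: "emeasure Env {\<xi>. K < card (generation \<xi> m)} < ennreal \<eta>"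
    using card_generation_tight[OF \<eta>(1)] by blast
  have "0 < \<eta> * \<delta>" using \<eta> \<delta> by simp
  then obtain J where J: "m \<le> J" "\<And>j. J \<le> j \<Longrightarrow> (\<integral>\<^sup>+\<xi>. ennreal (block_error c m j \<xi>) \<partial>Env) \<le> ennreal (\<eta> * \<delta>)"
    using block_error_eventually_small[OF lim(3) lim(2) lim(1)] by blast
  obtain \<rho> where \<rho>: "0 < \<rho>" and small: "\<And>n l h. 3 \<le> n \<Longrightarrow> ln (real n) / \<delta>0 \<le> real l \<Longrightarrow>
       \<exists>B\<in>sets Env. emeasure Env B \<le> ennreal (exp (- \<rho> * real (nat \<lfloor>ln (real n)\<rfloor>))) \<and>
         (\<forall>\<xi> x. \<xi> \<notin> B \<longrightarrow> x \<in> levels \<xi> l h \<longrightarrow> hit \<xi> x \<le> exp 3 / real n ^ 3)"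
    using hits_small_of_delta0[OF \<delta>0] by blast
  have ln_top: "eventually (\<lambda>n. X \<le> ln (real n)) sequentially" for X
    using filterlim_compose[OF ln_at_top filterlim_real_sequentially] unfolding filterlim_at_top by blast
  have low_top: "eventually (\<lambda>n. N \<le> low n) sequentially" for N
    using ln_top[of "real N * \<delta>0"] eventually_ge_at_top[of 1]
  proof eventually_elim
    case (elim n)
    have "real N \<le> ln (real n) / \<delta>0" using elim(1) d0 by (simp add: pos_le_divide_eq)
    also have "\<dots> \<le> real (low n)" using lh[OF elim(2)] by blast
    finally show ?case by simp
  qed
  have inv: "(\<lambda>n. 1 / sqrt (real n)) \<longlonglongrightarrow> 0"
    using tendsto_inverse_0_at_top[OF filterlim_compose[OF sqrt_at_top filterlim_real_sequentially]]
    by (simp add: inverse_eq_divide)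
  have high_small: "(\<lambda>n. real (high n) / sqrt (real n)) \<longlonglongrightarrow> 0"
  proof (rule Lim_null_comparison[OF _ high])
    have "filterlim high at_top sequentially"
      unfolding filterlim_at_top
    proof
      fix N
      show "eventually (\<lambda>n. N \<le> high n) sequentially"
        using low_top[of N] eventually_ge_at_top[of 1]
        by eventually_elim (use lh order_trans in blast)
    qed
    then have "filterlim (\<lambda>n. iter_log l0 (real (high n))) at_top sequentially"
      by (intro filterlim_compose[OF iter_log_at_top] filterlim_compose[OF filterlim_real_sequentially])
    then have "eventually (\<lambda>n. 1 \<le> iter_log l0 (real (high n))) sequentially"
      unfolding filterlim_at_top by blast
    then show "eventually (\<lambda>n. norm (real (high n) / sqrt (real n)) \<le> real (high n) / sqrt (real n) * iter_log l0 (real (high n))) sequentially"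
    proof eventually_elim
      case (elim n)
      have "real (high n) / sqrt (real n) * 1 \<le> real (high n) / sqrt (real n) * iter_log l0 (real (high n))"
        using elim by (intro mult_left_mono) auto
      then show ?case by simp
    qed
  qed
  define G where "G n = real K * ((2 * (pair_const * real (high n + 1)) + 2 * exp 3 * mass_bound 2) / \<delta>\<^sup>2 * (1 / sqrt (real n)))" for n
  have "G \<longlonglongrightarrow> 0"
  proof -
    have "(\<lambda>n. real K * ((2 * pair_const / \<delta>\<^sup>2) * (real (high n) / sqrt (real n))
        + (2 * pair_const + 2 * exp 3 * mass_bound 2) / \<delta>\<^sup>2 * (1 / sqrt (real n)))) \<longlonglongrightarrow>
        real K * ((2 * pair_const / \<delta>\<^sup>2) * 0 + (2 * pair_const + 2 * exp 3 * mass_bound 2) / \<delta>\<^sup>2 * 0)"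
      by (intro tendsto_mult tendsto_add tendsto_const high_small inv)
    moreover have "G = (\<lambda>n. real K * ((2 * pair_const / \<delta>\<^sup>2) * (real (high n) / sqrt (real n))
        + (2 * pair_const + 2 * exp 3 * mass_bound 2) / \<delta>\<^sup>2 * (1 / sqrt (real n))))"
      unfolding G_def by (rule ext) (simp add: add_divide_distrib distrib_left distrib_right)
    ultimately show ?thesis by (simp only: mult_zero_right add_0_right)
  qed
  then have G: "eventually (\<lambda>n. G n < \<eta>) sequentially" by (rule order_tendstoD(2)) (use \<eta> in simp)
  have "(\<lambda>n. M' * (1 / sqrt (real n))) \<longlonglongrightarrow> M' * 0" by (intro tendsto_mult tendsto_const inv)
  then have Mn: "eventually (\<lambda>n. M' * (1 / sqrt (real n)) < \<delta>) sequentially"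
    by (rule order_tendstoD(2)) (use \<delta> in simp)
  show "eventually (\<lambda>n. annealed_star \<nu> Q
      (\<lambda>\<xi> X. \<epsilon> < \<bar>tuple_sum k (D_set low high n \<xi> X) (f_lambda k lam) /
                      (sqrt (real n) * (real (high n) - real (low n) + 1)) ^ k - c_infty M S ^ k * tuple_limit k lam \<xi>\<bar>) < a) sequentially"
    using G Mn low_top[of "max J 1"] ln_top[of "1 - ln \<eta> / \<rho>"] eventually_ge_at_top[of 3]
  proof eventually_elim
    case (elim n)
    have n: "1 \<le> n" "3 \<le> n" using elim(5) by auto
    have lh': "low n \<le> high n" "ln (real n) / \<delta>0 \<le> real (low n)" using lh[OF n(1)] by auto
    have low: "J \<le> low n" "1 \<le> low n" using elim(3) by auto
    obtain B where B: "B \<in> sets Env" "emeasure Env B \<le> ennreal (exp (- \<rho> * real (nat \<lfloor>ln (real n)\<rfloor>)))"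
      "\<And>\<xi> x. \<xi> \<notin> B \<Longrightarrow> x \<in> levels \<xi> (low n) (high n) \<Longrightarrow> hit \<xi> x \<le> exp 3 / real n ^ 3"
      using small[OF n(2) lh'(2), of "high n"] by blast
    have "exp (- \<rho> * real (nat \<lfloor>ln (real n)\<rfloor>)) \<le> \<eta>"
    proof -
      have "- ln \<eta> / \<rho> \<le> real (nat \<lfloor>ln (real n)\<rfloor>)" using elim(4) by linarith
      then have "\<rho> * (- ln \<eta> / \<rho>) \<le> \<rho> * real (nat \<lfloor>ln (real n)\<rfloor>)" using \<rho> by (intro mult_left_mono) auto
      then have "- ln \<eta> \<le> \<rho> * real (nat \<lfloor>ln (real n)\<rfloor>)" using \<rho> by simp
      then have "exp (- \<rho> * real (nat \<lfloor>ln (real n)\<rfloor>)) \<le> exp (ln \<eta>)" by simp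
      then show ?thesis using \<eta> by simp
    qed
    then have b5: "emeasure Env B \<le> ennreal \<eta>" using B(2) by (meson ennreal_leI order_trans)
    let ?t = "nat \<lfloor>sqrt (real n)\<rfloor>"
    have r1: "1 \<le> sqrt (real n)" using n by simp
    have "real ?t = real_of_int \<lfloor>sqrt (real n)\<rfloor>" using r1 by (subst of_nat_nat) auto
    then have t: "real ?t \<le> sqrt (real n)" by linarith
    let ?v = "real K * (2 * real ?t * (pair_const * real (high n + 1)) + 2 * real ?t ^ 3 * (exp 3 / real n ^ 3) * mass_bound 2) / (\<delta>\<^sup>2 * real n)"
    have "?v \<le> G n"
    proof -
      have "(2 * real ?t * (pair_const * real (high n + 1)) + 2 * real ?t ^ 3 * (exp 3 / ((sqrt (real n))\<^sup>2) ^ 3) * mass_bound 2) / (\<delta>\<^sup>2 * (sqrt (real n))\<^sup>2)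
          \<le> (2 * (pair_const * real (high n + 1)) + 2 * exp 3 * mass_bound 2) / \<delta>\<^sup>2 * (1 / sqrt (real n))"
        by (rule variance_rate) (use r1 t mb pair_const_nonneg \<delta> in auto)
      then have "real K * ((2 * real ?t * (pair_const * real (high n + 1)) + 2 * real ?t ^ 3 * (exp 3 / real n ^ 3) * mass_bound 2) / (\<delta>\<^sup>2 * real n)) \<le> G n"
        unfolding G_def by (intro mult_left_mono) simp_all
      then show ?thesis by simp
    qed
    then have b6: "ennreal ?v \<le> ennreal \<eta>" using elim(1) by (intro ennreal_leI) linarith
    have den: "sqrt (real n) * (real (high n) - real (low n) + 1) = sqrt (real n) * real (high n + 1 - low n)"
      using lh'(1) by simp
    have "annealed_star \<nu> Q (\<lambda>\<xi> X. \<epsilon> < \<bar>tuple_sum k (D_set low high n \<xi> X) (f_lambda k lam) /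
                      (sqrt (real n) * (real (high n) - real (low n) + 1)) ^ k - c_infty M S ^ k * tuple_limit k lam \<xi>\<bar>)
        \<le> ennreal C * (ennreal (1 / M') + ennreal (mass_bound 2 * (rate ^ m * rate ^ m) / \<delta>) + ennreal (\<eta> * \<delta> / \<delta>)
         + emeasure Env {\<xi>. K < card (generation \<xi> m)} + emeasure Env B + ennreal ?v)"
      unfolding annealed_star_def D_set_def den c_def[symmetric]
    proof (rule annealed_deviation[OF law k lam _ low(2) lh'(1) n(1) lim(3) c1 M' \<delta> _ \<epsilon>\<delta> _ _ B(1) _ B(3) C(2)])
      show "m \<le> low n" using J(1) low(1) by simp
      show "M' / sqrt (real n) \<le> \<delta>" using elim(2) by simp
      show "0 \<le> \<eta> * \<delta>" using \<eta> \<delta> by simp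
      show "(\<integral>\<^sup>+\<xi>. ennreal (block_error c m j \<xi>) \<partial>Env) \<le> ennreal (\<eta> * \<delta>)" if "j \<in> {low n..high n}" for j
        using that low(1) by (intro J(2)) auto
    qed auto
    also have "\<dots> \<le> ennreal C * (ennreal \<eta> + ennreal \<eta> + ennreal \<eta> + ennreal \<eta> + ennreal \<eta> + ennreal \<eta>)"
      using m(1) K \<delta>(1) by (intro mult_left_mono add_mono b5 b6) (auto simp: M'_def intro: ennreal_leI)
    also have "ennreal \<eta> + ennreal \<eta> + ennreal \<eta> + ennreal \<eta> + ennreal \<eta> + ennreal \<eta> = ennreal (\<eta> + \<eta> + \<eta> + \<eta> + \<eta> + \<eta>)"
      using less_imp_le[OF \<eta>(1)] by (simp only: ennreal_plus add_nonneg_nonneg)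
    also have "\<eta> + \<eta> + \<eta> + \<eta> + \<eta> + \<eta> = 6 * \<eta>" by simp
    also have "ennreal C * ennreal (6 * \<eta>) = ennreal (C * (6 * \<eta>))"
      using \<eta>(1) C(1) by (intro ennreal_mult[symmetric]) auto
    also have "\<dots> < ennreal r" using \<eta> r by (intro ennreal_lessI) auto
    also have "\<dots> \<le> a" by (rule r(2))
    finally show ?case .
  qed
qed simp

end

theorem corollary1p4:
  fixes \<nu> :: "real list measure"
    and Q :: "env \<Rightarrow> (nat \<Rightarrow> vertex) measure"
    and M :: "'s measure" and S :: "nat \<Rightarrow> 's \<Rightarrow> real"
    and k :: nat and \<delta>0 :: real
    and low high :: "nat \<Rightarrow> nat" and lam :: "nat \<Rightarrow> nat"
  assumes law: "prob_space \<nu>" "sets \<nu> = sets seq_space"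
    and supercritical: "(\<integral>\<^sup>+s. of_nat (length s) \<partial>\<nu>) > 1"
    and walk: "\<And>\<omega>. quenched_law \<omega> (Q \<omega>)"
    and S: "many_to_one_walk \<nu> M S"
    and \<delta>0: "delta0_condition \<nu> \<delta>0"
    and k: "k \<ge> 2"
    and A1: "(INF t\<in>{0..1}. psi \<nu> t) = psi \<nu> 1" "psi \<nu> 1 = 0"
            "\<exists>D<0. ((\<lambda>t. real_of_ereal (psi \<nu> t)) has_real_derivative D) (at 1)"
            "ereal (2 * real k) < kappa \<nu>" "kappa \<nu> < \<infinity>"
    and A2: "\<exists>\<delta>1>0.
               (\<forall>t. 1 - \<delta>1 \<le> t \<and> t \<le> of_int \<lceil>real_of_ereal (kappa \<nu>) + \<delta>1\<rceil> \<longrightarrow> psi \<nu> t < \<infinity>) \<and>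
               (\<forall>j \<beta>. 1 \<le> j \<and> int j \<le> \<lceil>real_of_ereal (kappa \<nu>) + \<delta>1\<rceil> \<and> (\<forall>i\<in>{1..j}. \<beta> i \<ge> 1) \<and>
                      int (\<Sum>i=1..j. \<beta> i) \<le> \<lceil>real_of_ereal (kappa \<nu>) + \<delta>1\<rceil> \<longrightarrow> c_moment \<nu> j \<beta> < \<infinity>)"
    and A3: "\<exists>h>0. AE \<omega> in env_measure \<nu>.
               (INF x\<in>tree \<omega> - {[]}. ereal (V \<omega> x - V \<omega> (butlast x))) \<ge> - ereal h"
    and A4: "\<And>n. n \<ge> 1 \<Longrightarrow> low n \<ge> 1 \<and> high n \<ge> 1"
            "\<And>n. n \<ge> 1 \<Longrightarrow> ln (real n) / \<delta>0 \<le> real (low n) \<and> low n \<le> high n"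
            "\<exists>l0. (\<lambda>n. real (high n) / sqrt (real n) * iter_log l0 (real (high n))) \<longlonglongrightarrow> 0"
    and lam: "\<And>i. i \<in> {2..k} \<Longrightarrow> lam i \<ge> 1"
  shows "\<exists>A_infty :: env \<Rightarrow> real.
           tendsto_in_L2 (env_measure_star \<nu>) (level_sum k lam) A_infty \<and>
           tendsto_in_annealed_prob \<nu> Q
             (\<lambda>n \<omega> X. tuple_sum k (D_set low high n \<omega> X) (f_lambda k lam) /
                        (sqrt (real n) * (real (high n) - real (low n) + 1)) ^ k)
             (\<lambda>\<omega>. c_infty M S ^ k * A_infty \<omega>)"
proof -
  have tree_law: "marked_tree_law \<nu>"
    by (intro marked_tree_law.intro marked_tree_law_axioms.intro law)
  obtain D where D: "((\<lambda>t. real_of_ereal (psi \<nu> t)) has_real_derivative D) (at 1)" "D < 0"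
    using A1(3) by blast
  obtain \<delta>1 where \<delta>1: "0 < \<delta>1"
    and psi: "\<And>t. 1 - \<delta>1 \<le> t \<Longrightarrow> t \<le> of_int \<lceil>real_of_ereal (kappa \<nu>) + \<delta>1\<rceil> \<Longrightarrow> psi \<nu> t < \<infinity>"
    and moments: "\<And>j \<beta>. 1 \<le> j \<Longrightarrow> int j \<le> \<lceil>real_of_ereal (kappa \<nu>) + \<delta>1\<rceil> \<Longrightarrow> (\<forall>i\<in>{1..j}. \<beta> i \<ge> 1) \<Longrightarrow>
           int (\<Sum>i=1..j. \<beta> i) \<le> \<lceil>real_of_ereal (kappa \<nu>) + \<delta>1\<rceil> \<Longrightarrow> c_moment \<nu> j \<beta> < \<infinity>"
    using A2 by blast
  have regular: "regular_law \<nu> (2 * k)"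
    by (rule marked_tree_law.regular_law_of_moments[OF tree_law k A1(2) D A1(4,5) \<delta>1 psi moments])
  obtain l0 where l0: "(\<lambda>n. real (high n) / sqrt (real n) * iter_log l0 (real (high n))) \<longlonglongrightarrow> 0"
    using A4(3) by blast
  have "tendsto_in_L2 (env_measure_star \<nu>) (level_sum k lam) (tuple_limit k lam)"
    by (rule regular_law.level_sum_tendsto_in_L2[OF regular k refl])
  moreover have "tendsto_in_annealed_prob \<nu> Q
             (\<lambda>n \<omega> X. tuple_sum k (D_set low high n \<omega> X) (f_lambda k lam) /
                        (sqrt (real n) * (real (high n) - real (low n) + 1)) ^ k)
             (\<lambda>\<omega>. c_infty M S ^ k * tuple_limit k lam \<omega>)"
    by (rule regular_law.tuple_sum_converges_annealed[OF regular walk k S \<delta>0 A4(2) l0])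
  ultimately show ?thesis by blast
qed

end
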